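(* Let $n,l\in\mathbb{N}$ with $l>1$, let $\gamma\in A_1^{\rm loc}(\mathbb{R}^{n+1})$, and put $$\gamma_{k,m}:=2^{kl}\iint_{Q_{k,m}\times(0,2^{-k})}\gamma(x,t)\,dx\,dt,\qquad (k,m)\in\mathbb{Z}_+\times\mathbb{Z}^n .$$ Then the linear trace operator $\operatorname{Tr}:W^l_1(\mathbb{R}^{n+1},\gamma)\to\widetilde{B}^l(\mathbb{R}^n,\{\gamma_{k,m}\})$ is bounded. Moreover, there exists a bounded linear operator $\operatorname{Ext}:\widetilde{B}^l(\mathbb{R}^n,\{\gamma_{k,m}\})\to W^l_1(\mathbb{R}^{n+1},\gamma)$ such that $\operatorname{Tr}\circ\operatorname{Ext}=\operatorname{Id}$ on $\widetilde{B}^l(\mathbb{R}^n,\{\gamma_{k,m}\})$.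
   Context: Points of $\mathbb{R}^{n+1}$ are written $(x,t)$ with $x\in\mathbb{R}^n$, $t\in\mathbb{R}$; $\mathbb{R}^n$ is identified with $\mathbb{R}^n\times\{0\}\subset\mathbb{R}^{n+1}$. $\mathbb{Z}_+=\{0,1,2,\dots\}$. All cubes have sides parallel to the coordinate axes; $r(Q)$ is the side length of $Q$. For $k\in\mathbb{Z}_+$, $m\in\mathbb{Z}^n$, $Q_{k,m}:=\prod_{i=1}^n(\frac{m_i}{2^k},\frac{m_i+1}{2^k})$. $I:=(-1,1)^n$. A weight is a function $\gamma\in L_1^{\rm loc}(\mathbb{R}^{n+1})$ that is positive almost everywhere. $\gamma\in A_1^{\rm loc}(\mathbb{R}^{n+1})$ means that there is a constant $C_\gamma\ge 1$ with $\frac1{|Q|}\iint_Q\gamma\,dx\,dt\le C_\gamma\operatorname{ess\,inf}_{Q}\gamma$ for every cube $Q\subset\mathbb{R}^{n+1}$ with $r(Q)\le1$. $W^l_1(\mathbb{R}^{n+1},\gamma)$ is the space of locally integrable functions $f$ on $\mathbb{R}^{n+1}$, with Sobolev generalized derivatives up to order $l$, with finite norm $\sum_{|\alpha|\le l}\|\gamma D^\alpha f|L_1(\mathbb{R}^{n+1})\|$. For measurable $\varphi$ on $\mathbb{R}^n$, $\Delta^l(h)\varphi(x):=\sum_{i=0}^l(-1)^i\binom{l}{i}\varphi(x+ih)$, and for $\varphi\in L_1^{\rm loc}(\mathbb{R}^n)$ and a cube $Q\subset\mathbb{R}^n$, $\delta^l(Q)\varphi:=\frac1{|Q|^2}\int_{r(Q)I}\int_Q|\Delta^l(h)\varphi(x)|\,dx\,dh$.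 The space $\widetilde{B}^l(\mathbb{R}^n,\{\gamma_{k,m}\})$ consists of all $\varphi\in L_1^{\rm loc}(\mathbb{R}^n)$ with finite norm $$\|\varphi|\widetilde{B}^l(\mathbb{R}^n,\{\gamma_{k,m}\})\|:=\sum_{k=1}^\infty\sum_{m\in\mathbb{Z}^n}\gamma_{k,m}\,\delta^l(Q_{k,m})\varphi+\sum_{m\in\mathbb{Z}^n}\gamma_{0,m}\|\varphi|L_1(Q_{0,m})\|.$$ Trace: $\varphi\in L_1^{\rm loc}(\mathbb{R}^n)$ is the trace of $f\in L_1^{\rm loc}(\mathbb{R}^{n+1})$ on $\mathbb{R}^n$ if $\int_Q|\varphi(x)-f(x,t)|\,dx\to0$ as $t\to0$ for every open cube $Q\subset\mathbb{R}^n$; then $\operatorname{Tr}[f]:=\varphi$. $\operatorname{Tr}$ is the resulting linear operator on the linear space of all $f\in L_1^{\rm loc}(\mathbb{R}^{n+1})$ having a trace. *)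

theory Defs
  imports "HOL-Analysis.Analysis" "HOL-Probability.Essential_Supremum"
begin

text \<open>
  The space \<open>\<real>\<^sup>n\<close> is \<^typ>\<open>real^'n\<close> and \<open>\<real>\<^sup>n\<^sup>+\<^sup>1\<close> is \<^typ>\<open>(real^'n) \<times> real\<close>, with points \<open>(x, t)\<close>.
  Elements of function spaces are functions rather than classes modulo null sets; equality of
  elements is \<open>ae_eq\<close>, and norms take values in \<^typ>\<open>ennreal\<close>.
\<close>

definition ae_eq :: "('a::euclidean_space \<Rightarrow> real) \<Rightarrow> ('a \<Rightarrow> real) \<Rightarrow> bool" (infix "=\<^sub>a" 50)
  where "f =\<^sub>a g \<longleftrightarrow> (AE x in lebesgue. f x = g x)"

definition L1_loc :: "('a::euclidean_space \<Rightarrow> real) set"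
  where "L1_loc = {f. \<forall>K. compact K \<longrightarrow> f absolutely_integrable_on K}"


subsection \<open>Cubes and weights\<close>

text \<open>Only open cubes are used: adding boundary points changes neither integrals nor essential
  infima.\<close>

definition is_cube :: "'a::euclidean_space set \<Rightarrow> bool"
  where "is_cube Q \<longleftrightarrow> (\<exists>a r. r > 0 \<and> Q = box a (a + r *\<^sub>R One))"

definition side_length :: "'a::euclidean_space set \<Rightarrow> real"
  where "side_length Q = (THE r. r > 0 \<and> (\<exists>a. Q = box a (a + r *\<^sub>R One)))"

definition dyadic_cube :: "nat \<Rightarrow> int^'n \<Rightarrow> (real^'n) set"
  where "dyadic_cube k m =
    box (\<chi> i. of_int (m $ i) / 2 ^ k) (\<chi> i. (of_int (m $ i) + 1) / 2 ^ k)"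

definition weight :: "('a::euclidean_space \<Rightarrow> real) \<Rightarrow> bool"
  where "weight \<gamma> \<longleftrightarrow> \<gamma> \<in> L1_loc \<and> (AE z in lebesgue. \<gamma> z > 0)"

definition essinf_on :: "'a::euclidean_space set \<Rightarrow> ('a \<Rightarrow> real) \<Rightarrow> ereal"
  where "essinf_on Q f = - esssup (lebesgue_on Q) (\<lambda>z. - ereal (f z))"

definition A1_loc :: "('a::euclidean_space \<Rightarrow> real) set"
  where "A1_loc = {\<gamma>. weight \<gamma> \<and>
    (\<exists>C\<ge>1. \<forall>Q. is_cube Q \<and> side_length Q \<le> 1 \<longrightarrow>
      ereal ((LINT z:Q|lebesgue. \<gamma> z) / measure lebesgue Q) \<le> ereal C * essinf_on Q \<gamma>)}"


subsection \<open>Generalized derivatives and weighted Sobolev spaces\<close>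

definition pderiv_dir :: "'a::euclidean_space \<Rightarrow> ('a \<Rightarrow> real) \<Rightarrow> 'a \<Rightarrow> real"
  where "pderiv_dir b \<phi> x = deriv (\<lambda>s. \<phi> (x + s *\<^sub>R b)) 0"

definition smooth :: "('a::euclidean_space \<Rightarrow> real) \<Rightarrow> bool"
  where "smooth \<phi> \<longleftrightarrow> (\<forall>bs. set bs \<subseteq> Basis \<longrightarrow> foldr pderiv_dir bs \<phi> differentiable_on UNIV)"

definition test_functions :: "('a::euclidean_space \<Rightarrow> real) set"
  where "test_functions = {\<phi>. smooth \<phi> \<and> compact (closure {x. \<phi> x \<noteq> 0})}"

text \<open>A multi-index assigns to each basis vector the order of differentiation in its direction.\<close>

definition multi_indices :: "nat \<Rightarrow> ('a::euclidean_space \<Rightarrow> nat) set"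
  where "multi_indices l = {\<alpha>. (\<forall>b. b \<notin> Basis \<longrightarrow> \<alpha> b = 0) \<and> (\<Sum>b\<in>Basis. \<alpha> b) \<le> l}"

text \<open>The order in which the basis is enumerated is immaterial for \<open>classical_deriv\<close>, which is only
  applied to smooth functions.\<close>

definition basis_list :: "'a::euclidean_space list"
  where "basis_list = (SOME bs. distinct bs \<and> set bs = Basis)"

definition classical_deriv :: "('a::euclidean_space \<Rightarrow> nat) \<Rightarrow> ('a \<Rightarrow> real) \<Rightarrow> 'a \<Rightarrow> real"
  where "classical_deriv \<alpha> = foldr (\<lambda>b. pderiv_dir b ^^ \<alpha> b) basis_list"

definition is_weak_deriv ::
    "('a::euclidean_space \<Rightarrow> nat) \<Rightarrow> ('a \<Rightarrow> real) \<Rightarrow> ('a \<Rightarrow> real) \<Rightarrow> bool"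
  where "is_weak_deriv \<alpha> f g \<longleftrightarrow> f \<in> L1_loc \<and> g \<in> L1_loc \<and>
    (\<forall>\<phi>\<in>test_functions. (LINT z|lebesgue. f z * classical_deriv \<alpha> \<phi> z)
        = (-1) ^ (\<Sum>b\<in>Basis. \<alpha> b) * (LINT z|lebesgue. g z * \<phi> z))"

text \<open>Unique up to \<open>ae_eq\<close> whenever it exists.\<close>

definition weak_deriv :: "('a::euclidean_space \<Rightarrow> nat) \<Rightarrow> ('a \<Rightarrow> real) \<Rightarrow> 'a \<Rightarrow> real"
  where "weak_deriv \<alpha> f = (SOME g. is_weak_deriv \<alpha> f g)"

definition W_norm :: "nat \<Rightarrow> ('a::euclidean_space \<Rightarrow> real) \<Rightarrow> ('a \<Rightarrow> real) \<Rightarrow> ennreal"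
  where "W_norm l \<gamma> f =
    (\<Sum>\<alpha>\<in>multi_indices l. \<integral>\<^sup>+z. ennreal \<bar>\<gamma> z * weak_deriv \<alpha> f z\<bar> \<partial>lebesgue)"

definition W_space :: "nat \<Rightarrow> ('a::euclidean_space \<Rightarrow> real) \<Rightarrow> ('a \<Rightarrow> real) set"
  where "W_space l \<gamma> = {f \<in> L1_loc.
    (\<forall>\<alpha>\<in>multi_indices l. \<exists>g. is_weak_deriv \<alpha> f g) \<and> W_norm l \<gamma> f < \<infinity>}"


subsection \<open>Besov-type spaces of variable smoothness\<close>

definition fin_diff :: "nat \<Rightarrow> 'a::euclidean_space \<Rightarrow> ('a \<Rightarrow> real) \<Rightarrow> 'a \<Rightarrow> real"
  where "fin_diff l h \<phi> x = (\<Sum>i\<le>l. (-1) ^ i * real (l choose i) * \<phi> (x + real i *\<^sub>R h))"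

definition unit_I :: "'a::euclidean_space set"
  where "unit_I = box (- One) One"

definition oscillation :: "nat \<Rightarrow> 'a::euclidean_space set \<Rightarrow> ('a \<Rightarrow> real) \<Rightarrow> ennreal"
  where "oscillation l Q \<phi> = ennreal (1 / (measure lebesgue Q)\<^sup>2) *
    (\<integral>\<^sup>+h\<in>(*\<^sub>R) (side_length Q) ` unit_I.
      (\<integral>\<^sup>+x\<in>Q. ennreal \<bar>fin_diff l h \<phi> x\<bar> \<partial>lebesgue) \<partial>lebesgue)"

definition B_norm :: "nat \<Rightarrow> (nat \<Rightarrow> int^'n \<Rightarrow> real) \<Rightarrow> (real^'n \<Rightarrow> real) \<Rightarrow> ennreal"
  where "B_norm l w \<phi> =
    (\<Sum>\<^sub>\<infinity>k\<in>{1..}. \<Sum>\<^sub>\<infinity>m\<in>UNIV. ennreal (w k m) * oscillation l (dyadic_cube k m) \<phi>)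
    + (\<Sum>\<^sub>\<infinity>m\<in>UNIV. ennreal (w 0 m) * (\<integral>\<^sup>+x\<in>dyadic_cube 0 m. ennreal \<bar>\<phi> x\<bar> \<partial>lebesgue))"

definition B_space :: "nat \<Rightarrow> (nat \<Rightarrow> int^'n \<Rightarrow> real) \<Rightarrow> (real^'n \<Rightarrow> real) set"
  where "B_space l w = {\<phi> \<in> L1_loc. B_norm l w \<phi> < \<infinity>}"

definition weight_seq :: "nat \<Rightarrow> ((real^'n) \<times> real \<Rightarrow> real) \<Rightarrow> nat \<Rightarrow> int^'n \<Rightarrow> real"
  where "weight_seq l \<gamma> k m =
    2 ^ (k * l) * (LINT z:dyadic_cube k m \<times> {0<..<1 / 2 ^ k}|lebesgue. \<gamma> z)"


subsection \<open>Traces and operators\<close>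

text \<open>The slices \<open>f(\<cdot>, t)\<close> of a class modulo null sets are determined for almost every \<open>t\<close> only, so
  the limit is required of some representative \<open>f'\<close>. It is taken Borel measurable to make every
  slice measurable.\<close>

definition is_trace :: "((real^'n) \<times> real \<Rightarrow> real) \<Rightarrow> (real^'n \<Rightarrow> real) \<Rightarrow> bool"
  where "is_trace f \<phi> \<longleftrightarrow> f \<in> L1_loc \<and> \<phi> \<in> L1_loc \<and>
    (\<exists>f'\<in>borel_measurable borel. f' =\<^sub>a f \<and>
      (\<forall>Q. is_cube Q \<longrightarrow>
        ((\<lambda>t. \<integral>\<^sup>+x\<in>Q. ennreal \<bar>\<phi> x - f' (x, t)\<bar> \<partial>lebesgue) \<longlongrightarrow> 0) (at 0)))"

definition Tr_domain :: "((real^'n) \<times> real \<Rightarrow> real) set"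
  where "Tr_domain = {f. \<exists>\<phi>. is_trace f \<phi>}"

text \<open>Unique up to \<open>ae_eq\<close> on \<open>Tr_domain\<close>.\<close>

definition Tr :: "((real^'n) \<times> real \<Rightarrow> real) \<Rightarrow> real^'n \<Rightarrow> real"
  where "Tr f = (SOME \<phi>. is_trace f \<phi>)"

text \<open>Well-definedness on classes and linearity are modulo null sets.\<close>

definition bounded_linear_op ::
    "('a::euclidean_space \<Rightarrow> real) set \<Rightarrow> (('a \<Rightarrow> real) \<Rightarrow> ennreal) \<Rightarrow>
     ('b::euclidean_space \<Rightarrow> real) set \<Rightarrow> (('b \<Rightarrow> real) \<Rightarrow> ennreal) \<Rightarrow>
     (('a \<Rightarrow> real) \<Rightarrow> ('b \<Rightarrow> real)) \<Rightarrow> bool"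
  where "bounded_linear_op X normX Y normY T \<longleftrightarrow>
    T ` X \<subseteq> Y \<and>
    (\<forall>f\<in>X. \<forall>g\<in>X. f =\<^sub>a g \<longrightarrow> T f =\<^sub>a T g) \<and>
    (\<forall>f\<in>X. \<forall>g\<in>X. T (\<lambda>x. f x + g x) =\<^sub>a (\<lambda>y. T f y + T g y)) \<and>
    (\<forall>c. \<forall>f\<in>X. T (\<lambda>x. c * f x) =\<^sub>a (\<lambda>y. c * T f y)) \<and>
    (\<exists>C. \<forall>f\<in>X. normY (T f) \<le> ennreal C * normX f)"

end

theory Submission
  imports Defs
begin

text \<open>
  The weight enters through two consequences of the \<open>A\<^sub>1\<close> condition. Cubes of equal side length at most
  \<open>1\<close> whose distance is a bounded multiple of it carry comparable weights (\<open>cell_compare\<close>), and the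
  mean over such a cube bounds the weight from below almost everywhere nearby (\<open>cell_AE\<close>). In
  particular, convergence in the weighted norm implies local convergence in \<open>L\<^sub>1\<close>
  (\<open>weighted_locint\<close>), so that traces and generalized derivatives survive weighted limits.

  Boundedness of the trace. If \<open>f\<close> has a generalized derivative \<open>g = \<partial>\<^sub>t f\<close>, its trace is
  \<open>\<integral>\<^sub>0\<^sup>1 (f(x,t) - (1 - t) g(x,t)) dt\<close>; for smooth \<open>f\<close> this is the fundamental theorem of calculus, and
  the formula is continuous in local \<open>L\<^sub>1\<close> (\<open>trace_representation\<close>, \<open>is_traceI\<close>). The core is an
  unweighted local estimate (\<open>local_estimate\<close>): for \<open>h\<close> in \<open>2\<^sup>-\<^sup>k (-1,1)\<^sup>n\<close>, the \<open>L\<^sub>1\<close> norm of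
  \<open>\<Delta>\<^sup>l(h)\<close> of the trace over a dyadic cube of side \<open>2\<^sup>-\<^sup>k\<close> is at most a constant times
  the integral of \<open>t\<^sup>l\<^sup>-\<^sup>1 \<bar>D\<^sup>l f\<bar>\<close> over a box of comparable size standing on a neighbourhood of the
  cube. One lifts the difference to a height \<open>\<tau>\<close> of order \<open>2\<^sup>-\<^sup>k\<close>: the vertical differences
  between height \<open>0\<close> and height \<open>\<tau>\<close> are controlled by Taylor's formula with the kernel \<open>t\<^sup>l\<^sup>-\<^sup>1\<close>, and at
  height \<open>\<tau>\<close> the horizontal difference costs \<open>\<tau>\<^sup>l\<close> times \<open>D\<^sup>l f\<close>; averaging over \<open>\<tau>\<close> restores a solid
  integral. After multiplication with the weights \<open>\<gamma>\<^sub>k\<^sub>,\<^sub>m\<close> and summation over \<open>m\<close>, the scale \<open>k\<close>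
  contributes the integral of \<open>(2\<^sup>k t)\<^sup>l\<^sup>-\<^sup>1 \<gamma> \<bar>D\<^sup>l f\<bar>\<close> over \<open>0 < t < 2 l 2\<^sup>-\<^sup>k\<close>. For \<open>l > 1\<close> the factors
  \<open>(2\<^sup>k t)\<^sup>l\<^sup>-\<^sup>1\<close> form a geometric progression in \<open>k\<close> for fixed \<open>t\<close>, hence the sum over \<open>k\<close> is bounded
  (\<open>nn_integral_scales_le\<close>, \<open>trace_bounded\<close>).

  The extension. There is a mollifier \<open>\<Omega>\<close> for which \<open>\<phi> - \<phi> * \<Omega>\<^sub>j\<close> is an average of the differences
  \<open>\<Delta>\<^sup>l(h) \<phi>\<close> over \<open>h\<close> of size \<open>2\<^sup>-\<^sup>j\<close>, where \<open>\<Omega>\<^sub>j\<close> is the dilation of \<open>\<Omega>\<close> to that scale (\<open>conv_Om\<close>). Put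
  \<open>d\<^sub>j = (\<phi> * \<Omega>\<^sub>j\<^sub>+\<^sub>1 - \<phi> * \<Omega>\<^sub>j\<^sub>-\<^sub>1) * \<Omega>\<^sub>j\<close> and \<open>d\<^sub>0 = \<phi> * \<Omega>\<^sub>1 * \<Omega>\<^sub>0\<close>. The sums of the \<open>d\<^sub>j\<close> telescope to
  \<open>\<phi> * \<Omega>\<^sub>N\<^sub>+\<^sub>1 * \<Omega>\<^sub>N\<close>, which tends to \<open>\<phi>\<close>, and a derivative of order \<open>\<nu>\<close> of \<open>d\<^sub>j\<close> is bounded on a dyadic
  cube by \<open>2\<^sup>j\<^sup>\<nu>\<close> times the oscillations \<open>\<delta>\<^sup>l \<phi>\<close> of the neighbouring cubes for \<open>j \<ge> 1\<close>, and by the local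
  \<open>L\<^sub>1\<close> norms of \<open>\<phi>\<close> for \<open>j = 0\<close> (\<open>piece_bound\<close>). The
  extension is the sum of the layers \<open>d\<^sub>j(x) \<chi>(2\<^sup>j t)\<close> with a cutoff function \<open>\<chi>\<close> that equals \<open>1\<close> at
  \<open>0\<close>. The layer \<open>j\<close> lives in \<open>\<bar>t\<bar> \<le> 2\<^sup>-\<^sup>j\<close>, so the weighted norms of its derivatives of order at most
  \<open>l\<close> are bounded by the part of the Besov norm at scale \<open>j\<close> (\<open>layer_bound\<close>); these bounds sum to the
  full norm, and the layers may be differentiated termwise (\<open>smooth_series\<close>). The coefficients \<open>d\<^sub>j\<close>
  depend linearly on \<open>\<phi>\<close>.
\<close>

abbreviation borel_fun :: "('a::topological_space \<Rightarrow> 'b::topological_space) \<Rightarrow> bool"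
  where "borel_fun f \<equiv> f \<in> borel_measurable borel"

section \<open>Smooth functions\<close>

definition pderivs :: "'a::euclidean_space list \<Rightarrow> ('a \<Rightarrow> real) \<Rightarrow> 'a \<Rightarrow> real"
  where "pderivs = foldr pderiv_dir"

lemma pderivs_simps [simp]: "pderivs [] f = f" "pderivs (b # bs) f = pderiv_dir b (pderivs bs f)"
  by (auto simp: pderivs_def)

lemma pderivs_append: "pderivs (as @ bs) f = pderivs as (pderivs bs f)"
  by (simp add: pderivs_def)

lemma pderiv_dir_eq:
  fixes f :: "'a::euclidean_space \<Rightarrow> real"
  assumes "(f has_derivative f') (at x)"
  shows "pderiv_dir b f x = f' b"
    and "((\<lambda>s. f (x + s *\<^sub>R b)) has_real_derivative f' b) (at 0)"
proof -
  have a: "(f has_derivative f') (at (x + 0 *\<^sub>R b))"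
    using assms by simp
  have "((\<lambda>s. x + s *\<^sub>R b) has_derivative (\<lambda>s. s *\<^sub>R b)) (at 0)"
    by (auto intro!: derivative_eq_intros)
  from diff_chain_at[OF this a]
  have "((\<lambda>s. f (x + s *\<^sub>R b)) has_derivative (\<lambda>s. f' (s *\<^sub>R b))) (at 0)"
    by (simp add: o_def)
  moreover have "(\<lambda>s. f' (s *\<^sub>R b)) = (\<lambda>s. f' b * s)"
    using has_derivative_linear[OF assms] by (auto simp: linear_scale fun_eq_iff)
  ultimately show "((\<lambda>s. f (x + s *\<^sub>R b)) has_real_derivative f' b) (at 0)"
    by (simp add: has_field_derivative_def)
  then show "pderiv_dir b f x = f' b"
    unfolding pderiv_dir_def by (rule DERIV_imp_deriv)
qed

lemma has_derivative_pderiv_dir: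
  fixes f :: "'a::euclidean_space \<Rightarrow> real"
  assumes "f differentiable (at x)"
  shows "(f has_derivative (\<lambda>h. \<Sum>b\<in>Basis. (h \<bullet> b) * pderiv_dir b f x)) (at x)"
proof -
  obtain f' where f': "(f has_derivative f') (at x)"
    using assms by (auto simp: differentiable_def)
  have "f' h = (\<Sum>b\<in>Basis. (h \<bullet> b) * pderiv_dir b f x)" for h
  proof -
    have "f' h = f' (\<Sum>b\<in>Basis. (h \<bullet> b) *\<^sub>R b)"
      by (simp add: euclidean_representation)
    also have "\<dots> = (\<Sum>b\<in>Basis. (h \<bullet> b) * f' b)"
      using has_derivative_linear[OF f'] by (simp add: linear_sum linear_scale)
    finally show ?thesis
      by (simp add: pderiv_dir_eq[OF f'])
  qed
  then show ?thesis
    using f' by (metis (no_types, lifting) ext)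
qed

text \<open>The number of derivatives that are still required is a parameter, so that closure properties can be
  proved by induction on it.\<close>

primrec smooth_upto :: "nat \<Rightarrow> ('a::euclidean_space \<Rightarrow> real) \<Rightarrow> bool"
  where "smooth_upto 0 f \<longleftrightarrow> True"
  | "smooth_upto (Suc k) f \<longleftrightarrow>
      f differentiable_on UNIV \<and> (\<forall>b\<in>Basis. smooth_upto k (pderiv_dir b f))"

lemma smooth_upto_iff:
  "smooth_upto k f \<longleftrightarrow>
    (\<forall>bs. set bs \<subseteq> Basis \<and> length bs < k \<longrightarrow> pderivs bs f differentiable_on UNIV)"
proof (induction k arbitrary: f)
  case (Suc k)
  have "(\<forall>bs. set bs \<subseteq> Basis \<and> length bs < Suc k \<longrightarrow> pderivs bs f differentiable_on UNIV) \<longleftrightarrow>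
    f differentiable_on UNIV \<and>
    (\<forall>b\<in>Basis. \<forall>bs. set bs \<subseteq> Basis \<and> length bs < k \<longrightarrow>
      pderivs bs (pderiv_dir b f) differentiable_on UNIV)" (is "?L \<longleftrightarrow> ?R")
  proof
    assume L: ?L
    have "f differentiable_on UNIV"
      using L[rule_format, of "[]"] by simp
    moreover have "pderivs bs (pderiv_dir b f) differentiable_on UNIV"
      if "b \<in> Basis" "set bs \<subseteq> Basis" "length bs < k" for b bs
      using L[rule_format, of "bs @ [b]"] that by (simp add: pderivs_append)
    ultimately show ?R by blast
  next
    assume R: ?R
    show ?L
    proof (intro allI impI)
      fix bs :: "'a list" assume bs: "set bs \<subseteq> Basis \<and> length bs < Suc k"
      show "pderivs bs f differentiable_on UNIV"
      proof (cases bs rule: rev_cases)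
        case Nil then show ?thesis using R by simp
      next
        case (snoc cs c)
        then have "pderivs cs (pderiv_dir c f) differentiable_on UNIV"
          using R bs by auto
        then show ?thesis by (simp add: snoc pderivs_append)
      qed
    qed
  qed
  then show ?case using Suc.IH by simp
qed simp

lemma smooth_iff_upto: "smooth f \<longleftrightarrow> (\<forall>k. smooth_upto k f)"
  unfolding smooth_upto_iff smooth_def pderivs_def by auto

lemma smooth_upto_Suc_imp: "smooth_upto (Suc k) f \<Longrightarrow> smooth_upto k f"
  unfolding smooth_upto_iff by auto

lemma smooth_differentiable: "smooth f \<Longrightarrow> f differentiable (at x)"
  using smooth_iff_upto[of f] smooth_upto.simps(2)[of 0 f] by (auto simp: differentiable_on_def)

lemma smooth_upto_Suc_differentiable: "smooth_upto (Suc k) f \<Longrightarrow> f differentiable (at x)"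
  by (auto simp: differentiable_on_def)

lemma smooth_pderiv_dir: "smooth f \<Longrightarrow> b \<in> Basis \<Longrightarrow> smooth (pderiv_dir b f)"
  by (metis smooth_iff_upto smooth_upto.simps(2))

lemma smooth_pderivs: "smooth f \<Longrightarrow> set bs \<subseteq> Basis \<Longrightarrow> smooth (pderivs bs f)"
  by (induction bs) (auto intro: smooth_pderiv_dir)

lemma smooth_continuous: "smooth f \<Longrightarrow> continuous_on S f"
  by (meson continuous_at_imp_continuous_on differentiable_imp_continuous_within
      smooth_differentiable)

lemma smooth_borel: "smooth f \<Longrightarrow> f \<in> borel_measurable borel"
  by (intro borel_measurable_continuous_onI smooth_continuous)

lemma pderiv_dir_add:
  fixes f g :: "'a::euclidean_space \<Rightarrow> real"
  assumes "f differentiable (at x)" "g differentiable (at x)"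
  shows "pderiv_dir b (\<lambda>x. f x + g x) x = pderiv_dir b f x + pderiv_dir b g x"
proof -
  obtain f' g' where "(f has_derivative f') (at x)" "(g has_derivative g') (at x)"
    using assms by (auto simp: differentiable_def)
  then show ?thesis
    using pderiv_dir_eq(1) has_derivative_add by metis
qed

lemma pderiv_dir_mult:
  fixes f g :: "'a::euclidean_space \<Rightarrow> real"
  assumes "f differentiable (at x)" "g differentiable (at x)"
  shows "pderiv_dir b (\<lambda>x. f x * g x) x = f x * pderiv_dir b g x + pderiv_dir b f x * g x"
proof -
  obtain f' g' where d: "(f has_derivative f') (at x)" "(g has_derivative g') (at x)"
    using assms by (auto simp: differentiable_def)
  show ?thesis
    using pderiv_dir_eq(1)[OF has_derivative_mult[OF d]] pderiv_dir_eq(1)[OF d(1)]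
      pderiv_dir_eq(1)[OF d(2)] by simp
qed

lemma pderiv_dir_const: "pderiv_dir b (\<lambda>x::'a::euclidean_space. c) = (\<lambda>x. 0)"
  by (auto simp: pderiv_dir_def)

lemma smooth_upto_const: "smooth_upto k (\<lambda>x. c)"
  by (induction k arbitrary: c) (auto simp: pderiv_dir_const)

lemma smooth_upto_add:
  "smooth_upto k f \<Longrightarrow> smooth_upto k g \<Longrightarrow> smooth_upto k (\<lambda>x. f x + g x)"
proof (induction k arbitrary: f g)
  case (Suc k)
  have "pderiv_dir b (\<lambda>x. f x + g x) = (\<lambda>x. pderiv_dir b f x + pderiv_dir b g x)" for b
    using Suc.prems by (intro ext pderiv_dir_add) (auto simp: differentiable_on_def)
  then show ?case using Suc by (auto simp: differentiable_on_add)
qed simp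

lemma smooth_upto_mult:
  "smooth_upto k f \<Longrightarrow> smooth_upto k g \<Longrightarrow> smooth_upto k (\<lambda>x. f x * g x)"
proof (induction k arbitrary: f g)
  case (Suc k)
  have e: "pderiv_dir b (\<lambda>x. f x * g x) = (\<lambda>x. f x * pderiv_dir b g x + pderiv_dir b f x * g x)" for b
    using Suc.prems by (intro ext pderiv_dir_mult) (auto simp: differentiable_on_def)
  have "smooth_upto k (pderiv_dir b (\<lambda>x. f x * g x))" if "b \<in> Basis" for b
    unfolding e using Suc that smooth_upto_Suc_imp[of k f] smooth_upto_Suc_imp[of k g]
    by (intro smooth_upto_add Suc.IH) auto
  then show ?case using Suc.prems by (auto simp: differentiable_on_def)
qed simp

lemma smooth_const: "smooth (\<lambda>x. c)"
  by (simp add: smooth_iff_upto smooth_upto_const)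

lemma smooth_add: "smooth f \<Longrightarrow> smooth g \<Longrightarrow> smooth (\<lambda>x. f x + g x)"
  by (simp add: smooth_iff_upto smooth_upto_add)

lemma smooth_mult: "smooth f \<Longrightarrow> smooth g \<Longrightarrow> smooth (\<lambda>x. f x * g x)"
  by (simp add: smooth_iff_upto smooth_upto_mult)

lemma smooth_cmult: "smooth f \<Longrightarrow> smooth (\<lambda>x. c * f x)"
  by (rule smooth_mult[OF smooth_const])

lemma smooth_sum: "(\<And>i. i \<in> A \<Longrightarrow> smooth (f i)) \<Longrightarrow> smooth (\<lambda>x. \<Sum>i\<in>A. f i x)"
  by (induction A rule: infinite_finite_induct) (auto intro: smooth_const smooth_add)

lemma pderivs_add:
  "smooth f \<Longrightarrow> smooth g \<Longrightarrow> set bs \<subseteq> Basis \<Longrightarrow>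
    pderivs bs (\<lambda>x. f x + g x) = (\<lambda>x. pderivs bs f x + pderivs bs g x)"
proof (induction bs)
  case (Cons b bs)
  then show ?case
    by (auto intro!: ext pderiv_dir_add smooth_differentiable smooth_pderivs)
qed simp

lemma pderivs_cmult:
  "smooth f \<Longrightarrow> set bs \<subseteq> Basis \<Longrightarrow> pderivs bs (\<lambda>x. c * f x) = (\<lambda>x. c * pderivs bs f x)"
proof (induction bs)
  case (Cons b bs)
  have "pderiv_dir b (\<lambda>x. c * pderivs bs f x) x = c * pderiv_dir b (pderivs bs f) x" for x
    using pderiv_dir_mult[of "\<lambda>x. c" x "pderivs bs f" b] Cons.prems
    by (auto simp: pderiv_dir_const intro: smooth_differentiable smooth_pderivs)
  then show ?case using Cons by auto
qed simp

text \<open>The chain rule; the outer function lives on the line, where \<open>1\<close> is the only direction.\<close>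

lemma pderiv_dir_compose:
  fixes g :: "real \<Rightarrow> real" and q :: "'a::euclidean_space \<Rightarrow> real"
  assumes "g differentiable (at (q x))" "q differentiable (at x)"
  shows "pderiv_dir b (\<lambda>x. g (q x)) x = pderiv_dir 1 g (q x) * pderiv_dir b q x"
proof -
  obtain g' q' where d: "(g has_derivative g') (at (q x))" "(q has_derivative q') (at x)"
    using assms by (auto simp: differentiable_def)
  have "pderiv_dir b (\<lambda>x. g (q x)) x = g' (q' b)"
    using pderiv_dir_eq(1)[OF diff_chain_at[OF d(2,1)]] by (simp add: o_def)
  also have "\<dots> = g' 1 * q' b"
    using linear_scale[OF has_derivative_linear[OF d(1)], of "q' b" 1] by simp
  finally show ?thesis
    using pderiv_dir_eq(1)[OF d(1)] pderiv_dir_eq(1)[OF d(2)] by simp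
qed

lemma smooth_upto_compose:
  fixes g :: "real \<Rightarrow> real" and q :: "'a::euclidean_space \<Rightarrow> real"
  shows "smooth_upto k g \<Longrightarrow> smooth_upto k q \<Longrightarrow> smooth_upto k (\<lambda>x. g (q x))"
proof (induction k arbitrary: g q)
  case (Suc k)
  have dg: "g differentiable (at s)" for s
    using Suc.prems smooth_upto_Suc_differentiable by blast
  have dq: "q differentiable (at x)" for x
    using Suc.prems smooth_upto_Suc_differentiable by blast
  have e: "pderiv_dir b (\<lambda>x. g (q x)) = (\<lambda>x. pderiv_dir 1 g (q x) * pderiv_dir b q x)" for b
    by (intro ext pderiv_dir_compose dg dq)
  have "smooth_upto k (pderiv_dir b (\<lambda>x. g (q x)))" if "b \<in> Basis" for b
  proof -
    have "smooth_upto k (pderiv_dir 1 g)" "smooth_upto k (pderiv_dir b q)" "smooth_upto k q"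
      using Suc.prems that smooth_upto_Suc_imp[of k q] by auto
    then show ?thesis
      unfolding e by (intro smooth_upto_mult[OF Suc.IH[of "pderiv_dir 1 g" q]])
  qed
  moreover have "(\<lambda>x. g (q x)) differentiable (at x)" for x
    using differentiable_chain_at[OF dq dg] by (simp add: o_def)
  ultimately show ?case by (auto simp: differentiable_on_def)
qed simp

lemma smooth_compose:
  fixes g :: "real \<Rightarrow> real" and q :: "'a::euclidean_space \<Rightarrow> real"
  assumes "smooth g" "smooth q"
  shows "smooth (\<lambda>x. g (q x))"
  using assms smooth_upto_compose[of _ g q] unfolding smooth_iff_upto by blast

lemma smooth_inner: "smooth (\<lambda>x::'a::euclidean_space. x \<bullet> b)"
proof -
  have d: "((\<lambda>x. x \<bullet> b) has_derivative (\<lambda>h. h \<bullet> b)) (at x)" for x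
    by (auto intro!: derivative_eq_intros)
  have "pderiv_dir c (\<lambda>x. x \<bullet> b) = (\<lambda>x. c \<bullet> b)" for c
    using pderiv_dir_eq(1)[OF d] by auto
  then have "smooth_upto k (\<lambda>x. x \<bullet> b)" for k
    using d by (cases k) (auto simp: smooth_upto_const differentiable_on_def differentiable_def)
  then show ?thesis by (simp add: smooth_iff_upto)
qed

subsection \<open>Bump functions\<close>

text \<open>The family is closed under differentiation up to linear combinations, which is why the
  powers of \<open>1/s\<close> are included.\<close>

definition flat_exp :: "nat \<Rightarrow> real \<Rightarrow> real"
  where "flat_exp k s = (if s > 0 then (1/s) ^ k * exp (- (1/s)) else 0)"

lemma flat_exp_tendsto: "(flat_exp k \<longlongrightarrow> 0) (at_right 0)"
proof -
  have "((\<lambda>x. x ^ k / exp x) \<longlongrightarrow> 0) (at_top :: real filter)"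
    by (rule tendsto_power_div_exp_0)
  then have "((\<lambda>s. (inverse s) ^ k / exp (inverse s)) \<longlongrightarrow> 0) (at_right (0::real))"
    by (rule filterlim_compose) (rule filterlim_inverse_at_top_right)
  then show ?thesis
    by (rule Lim_transform_eventually)
      (auto simp: eventually_at_right_less flat_exp_def exp_minus field_simps
        intro!: eventually_mono[OF eventually_at_right_less])
qed

lemma flat_exp_deriv:
  "(flat_exp k has_real_derivative (flat_exp (k+2) s - k * flat_exp (k+1) s)) (at s)"
proof -
  consider "s > 0" | "s < 0" | "s = 0" by linarith
  then show ?thesis
  proof cases
    case 1
    have "((\<lambda>s. (1/s) ^ k * exp (- (1/s))) has_real_derivative
        (flat_exp (k+2) s - k * flat_exp (k+1) s)) (at s)"
    proof -
      have i: "((\<lambda>s. 1/s) has_real_derivative - ((1/s)^2)) (at s)"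
        using 1 by (auto intro!: derivative_eq_intros simp: power2_eq_square)
      have e: "((\<lambda>s. exp (- (1/s))) has_real_derivative (1/s)^2 * exp (- (1/s))) (at s)"
        using 1 by (auto intro!: derivative_eq_intros simp: power2_eq_square)
      have r: "real k * (- (x^2) * x ^ (k - Suc 0)) = - (real k * x ^ (k+1))" for x :: real
        by (cases k) (simp_all add: power2_eq_square)
      show ?thesis
        by (rule DERIV_cong[OF DERIV_mult[OF DERIV_power[OF i, of k] e]])
          (use 1 in \<open>simp only: r flat_exp_def if_True power_add\<close>, simp add: algebra_simps)
    qed
    then show ?thesis
      by (rule has_field_derivative_transform_within_open[where S="{0<..}"])
        (use 1 in \<open>auto simp: flat_exp_def\<close>)
  next
    case 2
    have "((\<lambda>s. 0) has_real_derivative (flat_exp (k+2) s - k * flat_exp (k+1) s)) (at s)"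
      using 2 by (auto simp: flat_exp_def)
    then show ?thesis
      by (rule has_field_derivative_transform_within_open[where S="{..<0}"])
        (use 2 in \<open>auto simp: flat_exp_def\<close>)
  next
    case 3
    have "((\<lambda>h. flat_exp k h / h) \<longlongrightarrow> 0) (at_right 0)"
      by (rule Lim_transform_eventually[OF flat_exp_tendsto[of "Suc k"]])
        (auto simp: flat_exp_def intro!: eventually_mono[OF eventually_at_right_less])
    moreover have "((\<lambda>h. flat_exp k h / h) \<longlongrightarrow> 0) (at_left 0)"
      by (rule Lim_transform_eventually[OF tendsto_const])
        (auto simp: flat_exp_def eventually_at_filter)
    ultimately have "((\<lambda>h. flat_exp k h / h) \<longlongrightarrow> 0) (at 0)"
      by (simp add: filterlim_at_split)
    then show ?thesis using 3
      by (simp add: DERIV_def flat_exp_def)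
  qed
qed

lemma smooth_flat_exp: "smooth (flat_exp k)"
proof -
  have "smooth_upto n (flat_exp k)" for n
  proof (induction n arbitrary: k)
    case (Suc n)
    have d: "(flat_exp k has_derivative (\<lambda>h. (flat_exp (k+2) s - k * flat_exp (k+1) s) * h)) (at s)" for s
      using flat_exp_deriv[of k s] by (simp add: has_field_derivative_def)
    have e: "pderiv_dir b (flat_exp k) = (\<lambda>s. b * flat_exp (k+2) s + (- real k * b) * flat_exp (k+1) s)"
      for b
      by (rule ext) (simp add: pderiv_dir_eq(1)[OF d] algebra_simps)
    have "smooth_upto n (pderiv_dir b (flat_exp k))" for b
      unfolding e by (intro smooth_upto_add smooth_upto_mult smooth_upto_const Suc)
    then show ?case
      using d by (auto simp: differentiable_on_def differentiable_def)
  qed simp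
  then show ?thesis by (simp add: smooth_iff_upto)
qed

text \<open>The function \<open>exp (- 1 / (1 - \<bar>x\<bar>\<^sup>2))\<close> on the open unit ball, extended by \<open>0\<close>.\<close>

definition bump :: "'a::euclidean_space \<Rightarrow> real"
  where "bump x = flat_exp 0 (1 - x \<bullet> x)"

lemma smooth_bump: "smooth bump"
proof -
  have e: "(\<lambda>x::'a. 1 - x \<bullet> x) = (\<lambda>x. 1 + (-1) * (\<Sum>b\<in>Basis. (x \<bullet> b) * (x \<bullet> b)))"
  proof
    fix x :: 'a
    have "x \<bullet> x = (\<Sum>b\<in>Basis. (x \<bullet> b) * (x \<bullet> b))" by (rule euclidean_inner)
    then show "1 - x \<bullet> x = 1 + (-1) * (\<Sum>b\<in>Basis. (x \<bullet> b) * (x \<bullet> b))" by linarith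
  qed
  have "smooth (\<lambda>x::'a. 1 - x \<bullet> x)"
    unfolding e by (intro smooth_add smooth_const smooth_cmult smooth_sum smooth_mult smooth_inner)
  then show ?thesis
    unfolding bump_def[abs_def] by (rule smooth_compose[OF smooth_flat_exp])
qed

lemma bump_nonneg: "0 \<le> bump x"
  by (simp add: bump_def flat_exp_def)

lemma bump_0: "bump 0 = exp (-1)"
  by (simp add: bump_def flat_exp_def)

lemma bump_pos_iff: "bump x > 0 \<longleftrightarrow> norm x < 1"
  by (auto simp: bump_def flat_exp_def norm_eq_sqrt_inner)

lemma bump_eq_0_iff: "bump x = 0 \<longleftrightarrow> norm x \<ge> 1"
  using bump_pos_iff[of x] bump_nonneg[of x] by linarith

subsection \<open>Symmetry of mixed derivatives\<close>

lemma has_real_derivative_along_line: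
  fixes f :: "'a::euclidean_space \<Rightarrow> real"
  assumes "f differentiable (at (x + s *\<^sub>R b))"
  shows "((\<lambda>s. f (x + s *\<^sub>R b)) has_real_derivative pderiv_dir b f (x + s *\<^sub>R b)) (at s)"
proof -
  obtain f' where f': "(f has_derivative f') (at (x + s *\<^sub>R b))"
    using assms by (auto simp: differentiable_def)
  have "((\<lambda>h. f (x + s *\<^sub>R b + h *\<^sub>R b)) has_real_derivative pderiv_dir b f (x + s *\<^sub>R b)) (at 0)"
    using pderiv_dir_eq[OF f', of b] by simp
  then show ?thesis
    using DERIV_shift[of "\<lambda>s. f (x + s *\<^sub>R b)" "pderiv_dir b f (x + s *\<^sub>R b)" 0 s]
    by (simp add: algebra_simps)
qed

text \<open>The second difference quotient does not depend on the order of the two directions, and by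
  two applications of the mean value theorem it converges to the mixed derivative.\<close>

lemma second_difference_tendsto:
  fixes f :: "'a::euclidean_space \<Rightarrow> real" and x :: 'a
  assumes f: "smooth f" and b: "b \<in> Basis" and c: "c \<in> Basis"
  defines "D \<equiv> \<lambda>h::real. f (x + h *\<^sub>R b + h *\<^sub>R c) - f (x + h *\<^sub>R b) - f (x + h *\<^sub>R c) + f x"
  shows "(\<lambda>n. D (1 / Suc n) / (1 / Suc n)^2) \<longlonglongrightarrow> pderiv_dir c (pderiv_dir b f) x"
proof -
  define F where "F = pderiv_dir c (pderiv_dir b f)"
  have sb: "smooth (pderiv_dir b f)" and sF: "smooth F"
    using f b c by (auto simp: F_def intro: smooth_pderiv_dir)
  have ex: "\<exists>p. dist p x \<le> 2 * h \<and> D h = h^2 * F p" if h: "h > 0" for h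
  proof -
    have "\<exists>z. 0 < z \<and> z < h \<and>
        (f (x + h *\<^sub>R c + h *\<^sub>R b) - f (x + h *\<^sub>R b)) - (f (x + h *\<^sub>R c + 0 *\<^sub>R b) - f (x + 0 *\<^sub>R b)) =
        (h - 0) * (pderiv_dir b f (x + h *\<^sub>R c + z *\<^sub>R b) - pderiv_dir b f (x + z *\<^sub>R b))"
      by (rule MVT2[OF h, of "\<lambda>s. f (x + h *\<^sub>R c + s *\<^sub>R b) - f (x + s *\<^sub>R b)"])
        (intro DERIV_diff has_real_derivative_along_line smooth_differentiable[OF f])
    then obtain z where z: "0 < z" "z < h" and
      Dz: "D h = h * (pderiv_dir b f (x + h *\<^sub>R c + z *\<^sub>R b) - pderiv_dir b f (x + z *\<^sub>R b))"
      unfolding D_def by (auto simp: algebra_simps)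
    have "\<exists>w. 0 < w \<and> w < h \<and>
        pderiv_dir b f (x + z *\<^sub>R b + h *\<^sub>R c) - pderiv_dir b f (x + z *\<^sub>R b + 0 *\<^sub>R c) =
        (h - 0) * F (x + z *\<^sub>R b + w *\<^sub>R c)"
      unfolding F_def
      by (rule MVT2[OF h, of "\<lambda>s. pderiv_dir b f (x + z *\<^sub>R b + s *\<^sub>R c)"])
        (intro has_real_derivative_along_line smooth_differentiable[OF sb])
    then obtain w where w: "0 < w" "w < h" and
      Dw: "pderiv_dir b f (x + z *\<^sub>R b + h *\<^sub>R c) - pderiv_dir b f (x + z *\<^sub>R b)
        = h * F (x + z *\<^sub>R b + w *\<^sub>R c)"
      by auto
    have "D h = h^2 * F (x + z *\<^sub>R b + w *\<^sub>R c)"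
      using Dz Dw by (simp add: algebra_simps power2_eq_square)
    moreover have "dist (x + z *\<^sub>R b + w *\<^sub>R c) x \<le> 2 * h"
    proof -
      have "norm (z *\<^sub>R b + w *\<^sub>R c) \<le> norm (z *\<^sub>R b) + norm (w *\<^sub>R c)"
        by (rule norm_triangle_ineq)
      also have "\<dots> \<le> 2 * h" using z w b c by simp
      finally show ?thesis by (simp add: dist_norm add.assoc)
    qed
    ultimately show ?thesis by blast
  qed
  then obtain p where p: "\<And>h. h > 0 \<Longrightarrow> dist (p h) x \<le> 2 * h \<and> D h = h^2 * F (p h)"
    by metis
  have "(\<lambda>n. p (1 / Suc n)) \<longlonglongrightarrow> x"
  proof (rule metric_tendsto_imp_tendsto[where f="\<lambda>n. 2 * (1 / real (Suc n))" and a=0])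
    show "(\<lambda>n. 2 * (1 / real (Suc n))) \<longlonglongrightarrow> 0"
      using tendsto_mult_right_zero[OF LIMSEQ_Suc[OF lim_1_over_n], of 2] by simp
    show "\<forall>\<^sub>F n in sequentially. dist (p (1 / Suc n)) x \<le> dist (2 * (1 / real (Suc n))) 0"
    proof (intro always_eventually allI)
      fix n
      show "dist (p (1 / Suc n)) x \<le> dist (2 * (1 / real (Suc n))) 0"
        using p[of "1 / Suc n"] by simp
    qed
  qed
  then have "(\<lambda>n. F (p (1 / Suc n))) \<longlonglongrightarrow> F x"
    using sF smooth_continuous[of F UNIV] by (auto intro: continuous_on_tendsto_compose)
  moreover have "D (1 / Suc n) / (1 / Suc n)^2 = F (p (1 / Suc n))" for n
    using p[of "1 / Suc n"] by (simp add: field_simps)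
  ultimately show ?thesis by (simp add: F_def)
qed

lemma pderiv_dir_commute:
  assumes "smooth f" "b \<in> Basis" "c \<in> Basis"
  shows "pderiv_dir c (pderiv_dir b f) = pderiv_dir b (pderiv_dir c f)"
proof
  fix x
  show "pderiv_dir c (pderiv_dir b f) x = pderiv_dir b (pderiv_dir c f) x"
    using second_difference_tendsto[OF assms, of x]
      second_difference_tendsto[OF assms(1,3,2), of x]
    by (intro LIMSEQ_unique) (simp_all add: algebra_simps)
qed

lemma pderivs_rotate:
  "smooth f \<Longrightarrow> set (b # bs) \<subseteq> Basis \<Longrightarrow> pderivs bs (pderiv_dir b f) = pderiv_dir b (pderivs bs f)"
proof (induction bs)
  case (Cons c bs)
  then show ?case
    using pderiv_dir_commute[of "pderivs bs f" b c] smooth_pderivs[of f bs] by auto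
qed simp

text \<open>Schwarz's theorem for words of directions.\<close>

lemma pderivs_mset_cong:
  "smooth f \<Longrightarrow> set bs \<subseteq> Basis \<Longrightarrow> mset bs = mset cs \<Longrightarrow> pderivs bs f = pderivs cs f"
proof (induction bs arbitrary: cs)
  case (Cons b bs)
  then have "b \<in> set cs"
    by (metis list.set_intros(1) set_mset_mset)
  then obtain us vs where cs: "cs = us @ b # vs"
    by (meson split_list)
  have st: "set us \<subseteq> Basis" "set vs \<subseteq> Basis" "b \<in> Basis"
    using Cons.prems(2) mset_eq_setD[OF Cons.prems(3)] cs by auto
  have "pderivs cs f = pderivs us (pderiv_dir b (pderivs vs f))"
    by (simp add: cs pderivs_append)
  also have "\<dots> = pderiv_dir b (pderivs us (pderivs vs f))"
    using st Cons.prems by (intro pderivs_rotate smooth_pderivs) auto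
  also have "\<dots> = pderiv_dir b (pderivs bs f)"
    using Cons.IH[of "us @ vs"] Cons.prems cs by (simp add: pderivs_append)
  finally show ?case by simp
qed simp

subsection \<open>Multi-indices and words\<close>

text \<open>Iterated derivatives are indexed by words of basis vectors: words compose by concatenation, which
  suits induction, and on smooth functions two words with the same letters give the same derivative.\<close>

definition word_of :: "('a::euclidean_space \<Rightarrow> nat) \<Rightarrow> 'a list"
  where "word_of \<alpha> = concat (map (\<lambda>b. replicate (\<alpha> b) b) basis_list)"

lemma basis_list: "distinct (basis_list :: 'a::euclidean_space list)"
    "set basis_list = (Basis :: 'a set)"
proof -
  have "\<exists>bs::'a list. distinct bs \<and> set bs = Basis"
    using finite_distinct_list[of "Basis :: 'a set"] by auto
  then have "distinct (basis_list :: 'a list) \<and> set basis_list = (Basis :: 'a set)"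
    unfolding basis_list_def by (rule someI_ex)
  then show "distinct (basis_list :: 'a list)" "set basis_list = (Basis :: 'a set)" by auto
qed

lemma pderivs_replicate: "pderivs (replicate n b) f = (pderiv_dir b ^^ n) f"
  by (induction n) auto

lemma classical_deriv_word_of: "classical_deriv \<alpha> f = pderivs (word_of \<alpha>) f"
proof -
  have "foldr (\<lambda>b. pderiv_dir b ^^ \<alpha> b) bs f
      = pderivs (concat (map (\<lambda>b. replicate (\<alpha> b) b) bs)) f" for bs :: "'a list"
  proof (induction bs)
    case (Cons b bs)
    then show ?case
      by (simp only: list.map concat.simps pderivs_append pderivs_replicate foldr.simps o_apply)
  qed (simp only: list.map concat.simps pderivs_simps foldr.simps id_apply)
  from this[of basis_list] show ?thesis
    by (simp only: classical_deriv_def word_of_def)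
qed

lemma set_word_of: "set (word_of \<alpha>) \<subseteq> Basis"
  unfolding word_of_def by (auto simp: basis_list(2))

lemma length_word_of: "length (word_of \<alpha>) = (\<Sum>b\<in>Basis. \<alpha> b)"
  unfolding word_of_def length_concat
  by (simp add: sum_list_distinct_conv_sum_set basis_list o_def)

lemma count_word_of: "count (mset (word_of \<alpha>)) b = (if b \<in> Basis then \<alpha> b else 0)"
proof -
  have "count (mset (concat (map (\<lambda>b. replicate (\<alpha> b) b) bs))) b = (if b \<in> set bs then \<alpha> b else 0)"
    if "distinct bs" for bs :: "'a list"
    using that by (induction bs) auto
  then show ?thesis by (simp add: word_of_def basis_list)
qed

definition index_of :: "'a::euclidean_space list \<Rightarrow> 'a \<Rightarrow> nat"
  where "index_of w b = count (mset w) b"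

lemma mset_word_of_index_of: "set w \<subseteq> Basis \<Longrightarrow> mset (word_of (index_of w)) = mset w"
proof (rule multiset_eqI)
  fix b
  assume w: "set w \<subseteq> Basis"
  show "count (mset (word_of (index_of w))) b = count (mset w) b"
  proof (cases "b \<in> Basis")
    case False
    then have "b \<notin># mset w" using w by auto
    then have "count (mset w) b = 0" by (rule count_eq_zero_iff[THEN iffD2])
    then show ?thesis using False by (simp add: count_word_of)
  qed (simp add: count_word_of index_of_def)
qed

lemma length_word_of_index_of: "set w \<subseteq> Basis \<Longrightarrow> (\<Sum>b\<in>Basis. index_of w b) = length w"
  using length_word_of[of "index_of w"] arg_cong[OF mset_word_of_index_of, of w size] by simp

lemma index_of_in_multi_indices: 
  assumes w: "set w \<subseteq> Basis" "length w \<le> l" shows "index_of w \<in> multi_indices l"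
proof -
  have "index_of w b = 0" if "b \<notin> Basis" for b
  proof -
    have "b \<notin># mset w" using that w(1) by auto
    then show ?thesis unfolding index_of_def by (rule count_eq_zero_iff[THEN iffD2])
  qed
  moreover have "(\<Sum>b\<in>Basis. index_of w b) \<le> l"
    unfolding length_word_of_index_of[OF w(1)] by (rule w(2))
  ultimately show ?thesis
    by (simp add: multi_indices_def)
qed

lemma finite_multi_indices: "finite (multi_indices l :: ('a::euclidean_space \<Rightarrow> nat) set)"
proof (rule finite_subset)
  let ?S = "{\<alpha>::'a \<Rightarrow> nat. \<forall>b. (b \<in> Basis \<longrightarrow> \<alpha> b \<in> {..l}) \<and> (b \<notin> Basis \<longrightarrow> \<alpha> b = 0)}"
  show "multi_indices l \<subseteq> ?S"
  proof
    fix \<alpha> :: "'a \<Rightarrow> nat" assume a: "\<alpha> \<in> multi_indices l"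
    have a1: "(\<Sum>b\<in>Basis. \<alpha> b) \<le> l" and a2: "\<forall>b. b \<notin> Basis \<longrightarrow> \<alpha> b = 0"
      using a unfolding multi_indices_def by blast+
    have "\<alpha> b \<le> l" if "b \<in> Basis" for b
      using order_trans[OF member_le_sum[of b Basis \<alpha>] a1] that by simp
    then show "\<alpha> \<in> ?S"
      using a2 by blast
  qed
  show "finite ?S"
    by (rule finite_set_of_finite_funs) simp_all
qed

subsection \<open>Affine substitutions and tensor products\<close>

lemma pderivs_affine:
  fixes f :: "'a::euclidean_space \<Rightarrow> real"
  assumes "smooth f" "set bs \<subseteq> Basis"
  shows "pderivs bs (\<lambda>x. f (a + c *\<^sub>R x)) = (\<lambda>x. c ^ length bs * pderivs bs f (a + c *\<^sub>R x))"
  using assms(2)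
proof (induction bs)
  case (Cons b bs)
  let ?g = "pderivs bs f"
  have "((\<lambda>x. c ^ length bs * ?g (a + c *\<^sub>R x)) has_derivative
      (\<lambda>h. c ^ length bs * (\<Sum>b\<in>Basis. ((c *\<^sub>R h) \<bullet> b) * pderiv_dir b ?g (a + c *\<^sub>R x)))) (at x)" for x
  proof -
    have "((\<lambda>x. a + c *\<^sub>R x) has_derivative (\<lambda>h. c *\<^sub>R h)) (at x)"
      by (auto intro!: derivative_eq_intros)
    moreover have "(?g has_derivative (\<lambda>h. \<Sum>b\<in>Basis. (h \<bullet> b) * pderiv_dir b ?g (a + c *\<^sub>R x)))
        (at (a + c *\<^sub>R x))"
      using Cons.prems assms(1)
      by (intro has_derivative_pderiv_dir smooth_differentiable smooth_pderivs) auto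
    ultimately show ?thesis
      using diff_chain_at by (intro has_derivative_mult_right) (fastforce simp: o_def)
  qed
  from pderiv_dir_eq(1)[OF this, of b]
  have "pderiv_dir b (\<lambda>x. c ^ length bs * ?g (a + c *\<^sub>R x)) x
      = c ^ length bs * (\<Sum>b'\<in>Basis. ((c *\<^sub>R b) \<bullet> b') * pderiv_dir b' ?g (a + c *\<^sub>R x))" for x .
  moreover have "(\<Sum>b'\<in>Basis. ((c *\<^sub>R b) \<bullet> b') * pderiv_dir b' ?g y) = c * pderiv_dir b ?g y" for y
  proof -
    have "(\<Sum>b'\<in>Basis. ((c *\<^sub>R b) \<bullet> b') * pderiv_dir b' ?g y)
        = (\<Sum>b'\<in>Basis. if b' = b then c * pderiv_dir b ?g y else 0)"
      using Cons.prems by (intro sum.cong) (auto simp: inner_Basis)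
    then show ?thesis using Cons.prems by simp
  qed
  ultimately have "pderiv_dir b (\<lambda>x. c ^ length bs * ?g (a + c *\<^sub>R x))
      = (\<lambda>x. c ^ length (b # bs) * pderivs (b # bs) f (a + c *\<^sub>R x))"
    by (simp add: fun_eq_iff)
  moreover have "pderivs bs (\<lambda>x. f (a + c *\<^sub>R x)) = (\<lambda>x. c ^ length bs * ?g (a + c *\<^sub>R x))"
    using Cons by simp
  ultimately show ?case by simp
qed simp

lemma smooth_affine:
  fixes f :: "'a::euclidean_space \<Rightarrow> real"
  assumes "smooth f"
  shows "smooth (\<lambda>x. f (a + c *\<^sub>R x))"
  unfolding smooth_def pderivs_def[symmetric]
proof (intro allI impI)
  fix bs :: "'a list" assume bs: "set bs \<subseteq> Basis"
  have "(\<lambda>x. a + c *\<^sub>R x) differentiable (at x)" for x by simp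
  then have "(\<lambda>x. pderivs bs f (a + c *\<^sub>R x)) differentiable (at x)" for x
    using differentiable_chain_at[of "\<lambda>x. a + c *\<^sub>R x" x "pderivs bs f"]
      smooth_differentiable[OF smooth_pderivs[OF assms bs]] by (simp add: o_def)
  then show "pderivs bs (\<lambda>x. f (a + c *\<^sub>R x)) differentiable_on UNIV"
    unfolding pderivs_affine[OF assms bs] by (auto simp: differentiable_on_def)
qed

text \<open>A basis vector of a product lies in one of the two factors; a word of directions splits
  accordingly.\<close>

definition fst_part :: "('a::euclidean_space \<times> 'b::euclidean_space) list \<Rightarrow> 'a list"
  where "fst_part w = map fst (filter (\<lambda>b. snd b = 0) w)"

definition snd_part :: "('a::euclidean_space \<times> 'b::euclidean_space) list \<Rightarrow> 'b list"
  where "snd_part w = map snd (filter (\<lambda>b. snd b \<noteq> 0) w)"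

lemma fst_snd_part_Basis:
  assumes "set w \<subseteq> Basis"
  shows "set (fst_part w) \<subseteq> Basis" "set (snd_part w) \<subseteq> Basis"
    "length (fst_part w) + length (snd_part w) = length w"
proof -
  show "set (fst_part w) \<subseteq> Basis" "set (snd_part w) \<subseteq> Basis"
    using assms by (auto simp: fst_part_def snd_part_def Basis_prod_def)
  show "length (fst_part w) + length (snd_part w) = length w"
    by (simp add: fst_part_def snd_part_def sum_length_filter_compl)
qed

lemma tensor_has_derivative:
  fixes d :: "'a::euclidean_space \<Rightarrow> real" and c :: "'b::euclidean_space \<Rightarrow> real"
  assumes "d differentiable (at (fst z))" "c differentiable (at (snd z))"
  shows "(\<lambda>z. d (fst z) * c (snd z)) differentiable (at z)"
    and "pderiv_dir (u, 0) (\<lambda>z. d (fst z) * c (snd z)) z = pderiv_dir u d (fst z) * c (snd z)"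
    and "pderiv_dir (0, v) (\<lambda>z. d (fst z) * c (snd z)) z = d (fst z) * pderiv_dir v c (snd z)"
proof -
  obtain d' c' where D: "(d has_derivative d') (at (fst z))" "(c has_derivative c') (at (snd z))"
    using assms by (auto simp: differentiable_def)
  have f: "(fst has_derivative fst) (at z)" "(snd has_derivative snd) (at z)"
    by (auto intro!: derivative_eq_intros)
  have 1: "((\<lambda>z. d (fst z)) has_derivative (\<lambda>h. d' (fst h))) (at z)"
    using diff_chain_at[OF f(1) D(1)] by (simp add: o_def)
  have 2: "((\<lambda>z. c (snd z)) has_derivative (\<lambda>h. c' (snd h))) (at z)"
    using diff_chain_at[OF f(2) D(2)] by (simp add: o_def)
  note 3 = has_derivative_mult[OF 1 2]
  show "(\<lambda>z. d (fst z) * c (snd z)) differentiable (at z)"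
    using 3 by (auto simp: differentiable_def)
  have "d' 0 = 0" "c' 0 = 0"
    using linear_0[OF has_derivative_linear[OF D(1)]] linear_0[OF has_derivative_linear[OF D(2)]]
    by blast+
  then show "pderiv_dir (u, 0) (\<lambda>z. d (fst z) * c (snd z)) z = pderiv_dir u d (fst z) * c (snd z)"
    "pderiv_dir (0, v) (\<lambda>z. d (fst z) * c (snd z)) z = d (fst z) * pderiv_dir v c (snd z)"
    using pderiv_dir_eq(1)[OF 3] pderiv_dir_eq(1)[OF D(1)] pderiv_dir_eq(1)[OF D(2)] by simp_all
qed

lemma pderivs_tensor:
  fixes d :: "'a::euclidean_space \<Rightarrow> real" and c :: "'b::euclidean_space \<Rightarrow> real"
  assumes "smooth d" "smooth c" "set w \<subseteq> Basis"
  shows "pderivs w (\<lambda>z. d (fst z) * c (snd z))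
    = (\<lambda>z. pderivs (fst_part w) d (fst z) * pderivs (snd_part w) c (snd z))"
  using assms(3)
proof (induction w)
  case Nil then show ?case by (simp add: fst_part_def snd_part_def)
next
  case (Cons b w)
  have s: "smooth (pderivs (fst_part w) d)" "smooth (pderivs (snd_part w) c)"
    using Cons.prems assms fst_snd_part_Basis[of w] by (auto intro!: smooth_pderivs)
  note T = tensor_has_derivative(2,3)[OF smooth_differentiable[OF s(1)] smooth_differentiable[OF s(2)]]
  have IH: "pderivs w (\<lambda>z. d (fst z) * c (snd z))
    = (\<lambda>z. pderivs (fst_part w) d (fst z) * pderivs (snd_part w) c (snd z))"
    using Cons.prems by (intro Cons.IH) simp
  have "b \<in> Basis" using Cons.prems by simp
  then consider u where "b = (u, 0)" | v where "b = (0, v)" "v \<noteq> 0"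
    by (auto simp: Basis_prod_def)
  then show ?case
  proof cases
    case 1
    then have "fst_part (b # w) = u # fst_part w" "snd_part (b # w) = snd_part w"
      by (simp_all add: fst_part_def snd_part_def)
    then show ?thesis
      unfolding pderivs_simps(2) IH by (simp only: 1 pderivs_simps T(1))
  next
    case 2
    then have "fst_part (b # w) = fst_part w" "snd_part (b # w) = v # snd_part w"
      by (simp_all add: fst_part_def snd_part_def)
    then show ?thesis
      unfolding pderivs_simps(2) IH by (simp only: 2 pderivs_simps T(2))
  qed
qed

lemma smooth_tensor:
  fixes d :: "'a::euclidean_space \<Rightarrow> real" and c :: "'b::euclidean_space \<Rightarrow> real"
  assumes "smooth d" "smooth c"
  shows "smooth (\<lambda>z. d (fst z) * c (snd z))"
  unfolding smooth_def pderivs_def[symmetric]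
proof (intro allI impI)
  fix w :: "('a \<times> 'b) list" assume w: "set w \<subseteq> Basis"
  have s: "smooth (pderivs (fst_part w) d)" "smooth (pderivs (snd_part w) c)"
    using assms fst_snd_part_Basis[OF w] by (auto intro!: smooth_pderivs)
  show "pderivs w (\<lambda>z. d (fst z) * c (snd z)) differentiable_on UNIV"
    unfolding pderivs_tensor[OF assms w] differentiable_on_def
    using tensor_has_derivative(1)[OF smooth_differentiable[OF s(1)] smooth_differentiable[OF s(2)]]
    by simp
qed

section \<open>Integration preliminaries\<close>

lemma nn_integral_affine:
  fixes f :: "'a::euclidean_space \<Rightarrow> ennreal"
  assumes [measurable]: "borel_fun f" and c: "c \<noteq> 0"
  shows "(\<integral>\<^sup>+x. f x \<partial>lborel) = ennreal (\<bar>c\<bar> ^ DIM('a)) * (\<integral>\<^sup>+x. f (t + c *\<^sub>R x) \<partial>lborel)"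
  by (subst lborel_affine[OF c, of t])
    (simp add: nn_integral_density nn_integral_distr nn_integral_cmult)

lemma integrable_affine:
  fixes f :: "'a::euclidean_space \<Rightarrow> real"
  assumes "borel_fun f" and c: "c \<noteq> 0"
  shows "integrable lborel (\<lambda>x. f (t + c *\<^sub>R x)) \<longleftrightarrow> integrable lborel f"
proof -
  have [measurable]: "borel_fun f" by fact
  have "(\<integral>\<^sup>+x. ennreal (norm (f x)) \<partial>lborel)
      = ennreal (\<bar>c\<bar> ^ DIM('a)) * (\<integral>\<^sup>+x. ennreal (norm (f (t + c *\<^sub>R x))) \<partial>lborel)"
    by (rule nn_integral_affine[OF _ c]) measurable
  moreover have "ennreal (\<bar>c\<bar> ^ DIM('a)) \<noteq> 0" using c by simp
  ultimately have "(\<integral>\<^sup>+x. ennreal (norm (f x)) \<partial>lborel) < \<infinity> \<longleftrightarrow>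
      (\<integral>\<^sup>+x. ennreal (norm (f (t + c *\<^sub>R x))) \<partial>lborel) < \<infinity>"
    by (auto simp: ennreal_mult_less_top)
  then show ?thesis
    unfolding integrable_iff_bounded by simp
qed

lemma integral_affine:
  fixes f :: "'a::euclidean_space \<Rightarrow> real"
  assumes [measurable]: "borel_fun f" and c: "c \<noteq> 0"
  shows "(LINT x|lborel. f x) = \<bar>c\<bar> ^ DIM('a) * (LINT x|lborel. f (t + c *\<^sub>R x))"
proof -
  have "(LINT x|lborel. f x) = (LINT x|density (distr lborel borel (\<lambda>x. t + c *\<^sub>R x)) (\<lambda>_. \<bar>c\<bar> ^ DIM('a)). f x)"
    by (subst lborel_affine[OF c, of t]) (rule refl)
  also have "\<dots> = (LINT x|distr lborel borel (\<lambda>x. t + c *\<^sub>R x). \<bar>c\<bar> ^ DIM('a) * f x)"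
    by (subst integral_density) auto
  also have "\<dots> = (LINT x|lborel. \<bar>c\<bar> ^ DIM('a) * f (t + c *\<^sub>R x))"
    by (subst integral_distr) auto
  finally show ?thesis by simp
qed

lemma nn_integral_translate:
  fixes f :: "'a::euclidean_space \<Rightarrow> ennreal"
  assumes "borel_fun f"
  shows "(\<integral>\<^sup>+x. f (x + t) \<partial>lborel) = (\<integral>\<^sup>+x. f x \<partial>lborel)"
  using nn_integral_affine[OF assms, of 1 t] by (simp add: add.commute)

lemma integral_translate:
  fixes f :: "'a::euclidean_space \<Rightarrow> real"
  assumes "borel_fun f"
  shows "(LINT x|lborel. f (x + t)) = (LINT x|lborel. f x)"
  using integral_affine[OF assms, of 1 t] by (simp add: add.commute)

lemma integrable_translate:
  fixes f :: "'a::euclidean_space \<Rightarrow> real"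
  assumes "borel_fun f"
  shows "integrable lborel (\<lambda>x. f (x + t)) \<longleftrightarrow> integrable lborel f"
  using integrable_affine[OF assms, of 1 t] by (simp add: add.commute)

lemma integral_reflect:
  fixes f :: "'a::euclidean_space \<Rightarrow> real"
  assumes "borel_fun f"
  shows "(LINT x|lborel. f (t - x)) = (LINT x|lborel. f x)"
  using integral_affine[OF assms, of "-1" t] by simp

lemma integrable_reflect:
  fixes f :: "'a::euclidean_space \<Rightarrow> real"
  assumes "borel_fun f"
  shows "integrable lborel (\<lambda>x. f (t - x)) \<longleftrightarrow> integrable lborel f"
  using integrable_affine[OF assms, of "-1" t] by simp

definition L1n :: "'a::euclidean_space set \<Rightarrow> ('a \<Rightarrow> real) \<Rightarrow> ennreal"
  where "L1n S f = (\<integral>\<^sup>+x\<in>S. ennreal \<bar>f x\<bar> \<partial>lborel)"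

abbreviation wnorm :: "('a::euclidean_space \<Rightarrow> real) \<Rightarrow> ('a \<Rightarrow> real) \<Rightarrow> ennreal"
  where "wnorm \<gamma> u \<equiv> (\<integral>\<^sup>+z. ennreal \<bar>\<gamma> z * u z\<bar> \<partial>lborel)"

lemma L1n_mono_set: "S \<subseteq> T \<Longrightarrow> L1n S f \<le> L1n T f"
  unfolding L1n_def by (intro nn_integral_mono) (auto simp: indicator_def)

lemma L1n_triangle:
  assumes [measurable]: "borel_fun f" "borel_fun g" "S \<in> sets borel"
  shows "L1n S (\<lambda>x. f x + g x) \<le> L1n S f + L1n S g"
proof -
  have "L1n S (\<lambda>x. f x + g x)
      \<le> (\<integral>\<^sup>+x. ennreal \<bar>f x\<bar> * indicator S x + ennreal \<bar>g x\<bar> * indicator S x \<partial>lborel)"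
    unfolding L1n_def
    by (intro nn_integral_mono)
      (auto simp: indicator_def ennreal_plus[symmetric] simp del: ennreal_plus intro!: ennreal_leI)
  also have "\<dots> = L1n S f + L1n S g"
    unfolding L1n_def by (subst nn_integral_add) auto
  finally show ?thesis .
qed

lemma L1n_cmult:
  assumes [measurable]: "borel_fun f" "S \<in> sets borel"
  shows "L1n S (\<lambda>x. c * f x) = ennreal \<bar>c\<bar> * L1n S f"
  unfolding L1n_def
  by (subst nn_integral_cmult[symmetric]) (auto simp: abs_mult ennreal_mult mult.assoc)

lemma L1n_cong_AE: "AE x in lborel. x \<in> S \<longrightarrow> f x = g x \<Longrightarrow> L1n S f = L1n S g"
  unfolding L1n_def by (intro nn_integral_cong_AE) (auto elim!: eventually_mono simp: indicator_def)

lemma L1n_eq_0: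
  assumes [measurable]: "borel_fun f" "S \<in> sets borel"
  shows "L1n S f = 0 \<longleftrightarrow> (AE x in lborel. x \<in> S \<longrightarrow> f x = 0)"
  unfolding L1n_def
  by (subst nn_integral_0_iff_AE) (auto simp: indicator_def intro!: AE_cong)

lemma integrable_L1n:
  fixes f :: "'a::euclidean_space \<Rightarrow> real"
  assumes [measurable]: "borel_fun f" "S \<in> sets borel"
  shows "integrable lborel (\<lambda>x. indicator S x * f x) \<longleftrightarrow> L1n S f < \<infinity>"
proof -
  have "(\<integral>\<^sup>+x. ennreal (norm (indicator S x * f x)) \<partial>lborel) = L1n S f"
    unfolding L1n_def by (intro nn_integral_cong) (auto simp: indicator_def)
  then show ?thesis unfolding integrable_iff_bounded by simp
qed

subsection \<open>Locally integrable Borel functions\<close>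

text \<open>Local integrability of a Borel function. A Borel representative has measurable slices, and
  products of Lebesgue--Borel measures are again Lebesgue--Borel measures, so that Fubini's theorem
  applies directly.\<close>

definition locint :: "('a::euclidean_space \<Rightarrow> real) \<Rightarrow> bool"
  where "locint f \<longleftrightarrow> f \<in> borel_measurable borel \<and> (\<forall>R. L1n (cball 0 R) f < \<infinity>)"

lemma locint_borel: "locint f \<Longrightarrow> f \<in> borel_measurable borel"
  by (simp add: locint_def)

lemma locint_bounded:
  assumes "locint f" "bounded S"
  shows "L1n S f < \<infinity>"
proof -
  obtain R where "\<forall>x\<in>S. norm x \<le> R" using assms(2) unfolding bounded_iff by blast
  then have "S \<subseteq> cball 0 R" by auto
  then have "L1n S f \<le> L1n (cball 0 R) f" by (rule L1n_mono_set)
  also have "\<dots> < \<infinity>" using assms(1) by (simp add: locint_def)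
  finally show ?thesis .
qed

lemma locint_integrable:
  assumes "locint f" "bounded S" "S \<in> sets borel"
  shows "integrable lborel (\<lambda>x. indicator S x * f x)"
  using integrable_L1n[OF locint_borel[OF assms(1)] assms(3)] locint_bounded[OF assms(1,2)] by simp

lemma locint_add:
  assumes "locint f" "locint g" shows "locint (\<lambda>x. f x + g x)"
proof -
  have [measurable]: "borel_fun f" "borel_fun g"
    using assms by (auto simp: locint_def)
  have "L1n (cball 0 R) (\<lambda>x. f x + g x) < \<infinity>" for R
  proof -
    have "L1n (cball 0 R) (\<lambda>x. f x + g x) \<le> L1n (cball 0 R) f + L1n (cball 0 R) g"
      by (rule L1n_triangle) auto
    also have "\<dots> < \<infinity>" using assms by (simp add: locint_def)
    finally show ?thesis .
  qed
  then show ?thesis by (auto simp: locint_def)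
qed

lemma locint_cmult:
  assumes "locint f" shows "locint (\<lambda>x. c * f x)"
  using assms by (auto simp: locint_def L1n_cmult ennreal_mult_less_top)

lemma locint_diff:
  assumes "locint f" "locint g" shows "locint (\<lambda>x. f x - g x)"
  using locint_add[OF assms(1) locint_cmult[OF assms(2), of "-1"]] by simp

lemma locint_continuous:
  fixes f :: "'a::euclidean_space \<Rightarrow> real"
  assumes "continuous_on UNIV f" shows "locint f"
proof -
  have [measurable]: "borel_fun f"
    using assms by (rule borel_measurable_continuous_onI)
  have "L1n (cball 0 R) f < \<infinity>" for R
  proof -
    have "set_integrable lborel (cball 0 R) f"
      using borel_integrable_compact[of "cball 0 R" f] assms
      by (auto simp: set_integrable_def intro: continuous_on_subset)
    then show ?thesis
      using integrable_L1n[of f "cball 0 R"] by (auto simp: set_integrable_def)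
  qed
  then show ?thesis by (auto simp: locint_def)
qed

lemma AE_lebesgue_iff: "(AE x in lebesgue. P x) \<longleftrightarrow> (AE x in lborel. P x)"
  by (rule AE_completion_iff)

lemma set_nn_integral_lebesgue: "(\<integral>\<^sup>+x\<in>S. ennreal \<bar>f x\<bar> \<partial>lebesgue) = L1n S f"
  unfolding L1n_def by (rule nn_integral_completion)

lemma locint_imp_L1_loc:
  fixes f :: "'a::euclidean_space \<Rightarrow> real"
  assumes "locint f" shows "f \<in> L1_loc"
proof -
  have "f absolutely_integrable_on K" if "compact K" for K
  proof -
    have "set_integrable lborel K f"
      using locint_integrable[OF assms, of K] that
      by (auto simp: set_integrable_def compact_imp_bounded compact_imp_closed borel_closed)
    then show ?thesis
      using integrable_completion[of "\<lambda>x. indicator K x *\<^sub>R f x" lborel]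
        borel_measurable_integrable
      by (auto simp: set_integrable_def)
  qed
  then show ?thesis by (auto simp: L1_loc_def)
qed

lemma L1_loc_lebesgue_measurable:
  fixes f :: "'a::euclidean_space \<Rightarrow> real"
  assumes "f \<in> L1_loc" shows "f \<in> borel_measurable lebesgue"
proof (rule borel_measurable_LIMSEQ_real)
  show "(\<lambda>x. indicator (cball 0 (real n)) x * f x) \<in> borel_measurable lebesgue" for n
  proof -
    have "integrable lebesgue (\<lambda>x. indicator (cball 0 (real n)) x *\<^sub>R f x)"
      using assms by (auto simp: L1_loc_def set_integrable_def)
    then show ?thesis
      using borel_measurable_integrable by auto
  qed
  show "(\<lambda>n. indicator (cball 0 (real n)) x * f x) \<longlonglongrightarrow> f x" for x
  proof (rule tendsto_eventually)
    show "\<forall>\<^sub>F n in sequentially. indicator (cball 0 (real n)) x * f x = f x"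
      using eventually_ge_at_top[of "nat \<lceil>norm x\<rceil>"]
      by eventually_elim (auto simp: indicator_def)
  qed
qed

lemma L1_loc_cong_AE:
  fixes f :: "'a::euclidean_space \<Rightarrow> real"
  assumes "f \<in> L1_loc" "g =\<^sub>a f" shows "g \<in> L1_loc"
proof -
  have fm: "f \<in> borel_measurable lebesgue" by (rule L1_loc_lebesgue_measurable[OF assms(1)])
  have gm: "g \<in> borel_measurable lebesgue"
    by (rule borel_measurable_AE[OF fm])
      (use assms(2) in \<open>auto simp: ae_eq_def elim: eventually_mono\<close>)
  have "g absolutely_integrable_on K" if K: "compact K" for K
  proof -
    have [measurable]: "K \<in> sets lebesgue" using K by (simp add: lmeasurable_compact fmeasurableD)
    have "integrable lebesgue (\<lambda>x. indicator K x *\<^sub>R g x) \<longleftrightarrow> integrable lebesgue (\<lambda>x. indicator K x *\<^sub>R f x)"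
      by (intro integrable_cong_AE borel_measurable_scaleR borel_measurable_indicator gm fm)
        (use assms(2) in \<open>auto simp: ae_eq_def elim!: eventually_mono\<close>)
    then show ?thesis using assms(1) K by (auto simp: L1_loc_def set_integrable_def)
  qed
  then show ?thesis by (auto simp: L1_loc_def)
qed

lemma L1_loc_imp_locint:
  fixes f :: "'a::euclidean_space \<Rightarrow> real"
  assumes "f \<in> L1_loc" "g =\<^sub>a f" "borel_fun g"
  shows "locint g"
proof -
  have "L1n (cball 0 R) g < \<infinity>" for R
  proof -
    have "set_integrable lebesgue (cball 0 R) g"
      using L1_loc_cong_AE[OF assms(1,2)] by (auto simp: L1_loc_def)
    then have "integrable lborel (\<lambda>x. indicator (cball 0 R) x *\<^sub>R g x)"
      unfolding set_integrable_def
      by (subst (asm) integrable_completion)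
        (auto intro!: borel_measurable_times borel_measurable_indicator assms(3))
    then show ?thesis using integrable_L1n[OF assms(3), of "cball 0 R"] by simp
  qed
  then show ?thesis using assms(3) by (auto simp: locint_def)
qed

definition rep :: "('a::euclidean_space \<Rightarrow> real) \<Rightarrow> 'a \<Rightarrow> real"
  where "rep f = (SOME g. g \<in> borel_measurable borel \<and> g =\<^sub>a f)"

lemma rep:
  fixes f :: "'a::euclidean_space \<Rightarrow> real"
  assumes "f \<in> L1_loc" shows "locint (rep f)" "rep f =\<^sub>a f"
proof -
  obtain g where "g \<in> borel_measurable lborel" "AE x in lborel. f x = g x"
    using completion_ex_borel_measurable_real[OF L1_loc_lebesgue_measurable[OF assms]] by auto
  then have "\<exists>g. g \<in> borel_measurable borel \<and> g =\<^sub>a f"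
    by (auto simp: ae_eq_def AE_lebesgue_iff eq_commute)
  then have "rep f \<in> borel_measurable borel \<and> rep f =\<^sub>a f"
    unfolding rep_def by (rule someI_ex)
  then show "locint (rep f)" "rep f =\<^sub>a f"
    using L1_loc_imp_locint[OF assms] by auto
qed

lemma ae_eq_sym: "f =\<^sub>a g \<Longrightarrow> g =\<^sub>a f"
  by (auto simp: ae_eq_def elim: eventually_mono)

lemma ae_eq_refl: "f =\<^sub>a f"
  by (simp add: ae_eq_def)

lemma ae_eq_trans: "f =\<^sub>a g \<Longrightarrow> g =\<^sub>a h \<Longrightarrow> f =\<^sub>a h"
  unfolding ae_eq_def by (auto elim: eventually_elim2)

section \<open>Convolution\<close>

definition kern :: "('a::euclidean_space \<Rightarrow> real) \<Rightarrow> bool"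
  where "kern k \<longleftrightarrow> continuous_on UNIV k \<and> (\<exists>R. \<forall>x. norm x > R \<longrightarrow> k x = 0)"

definition conv :: "('a::euclidean_space \<Rightarrow> real) \<Rightarrow> ('a \<Rightarrow> real) \<Rightarrow> 'a \<Rightarrow> real"
  where "conv f k x = (LINT y|lborel. f (x - y) * k y)"

lemma kernE:
  assumes "kern k"
  obtains R M where "R > 0" "M > 0" "\<And>x. norm x > R \<Longrightarrow> k x = 0" "\<And>x. \<bar>k x\<bar> \<le> M"
proof -
  obtain R where R: "\<And>x. norm x > R \<Longrightarrow> k x = 0" and c: "continuous_on UNIV k"
    using assms by (auto simp: kern_def)
  have "bounded (k ` cball 0 R)"
    by (intro compact_imp_bounded compact_continuous_image continuous_on_subset[OF c]) auto
  then obtain M where "\<forall>y\<in>k ` cball 0 R. norm y \<le> M"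
    unfolding bounded_iff by blast
  then have M: "\<And>x. norm x \<le> R \<Longrightarrow> \<bar>k x\<bar> \<le> M"
    by auto
  have "\<bar>k x\<bar> \<le> max M 1" for x
    using M[of x] R[of x] by (cases "norm x \<le> R") auto
  then show ?thesis
    using that[of "max R 1" "max M 1"] R by auto
qed

lemma kern_borel: "kern k \<Longrightarrow> k \<in> borel_measurable borel"
  by (auto simp: kern_def intro: borel_measurable_continuous_onI)

lemma kern_integrable_right:
  assumes f: "locint f" and k: "kern k"
  shows "integrable lborel (\<lambda>y. f y * k (x - y))"
proof -
  obtain R M where RM: "R > 0" "M > 0" "\<And>x. norm x > R \<Longrightarrow> k x = 0" "\<And>x. \<bar>k x\<bar> \<le> M"
    using kernE[OF k] by blast
  have [measurable]: "borel_fun f" "borel_fun k"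
    using f k by (auto intro: locint_borel kern_borel)
  have "integrable lborel (\<lambda>y. M * (indicator (cball 0 (norm x + R)) y * f y))"
    by (intro integrable_mult_right locint_integrable f) auto
  then show ?thesis
  proof (rule Bochner_Integration.integrable_bound)
    show "AE y in lborel. norm (f y * k (x - y))
        \<le> norm (M * (indicator (cball 0 (norm x + R)) y * f y))"
    proof (intro AE_I2)
      fix y
      show "norm (f y * k (x - y)) \<le> norm (M * (indicator (cball 0 (norm x + R)) y * f y))"
      proof (cases "norm (x - y) > R")
        case True then show ?thesis by (simp add: RM)
      next
        case False
        then have "norm y \<le> norm x + R"
          using norm_triangle_ineq4[of x "x - y"] by simp
        moreover have "\<bar>f y\<bar> * \<bar>k (x - y)\<bar> \<le> \<bar>f y\<bar> * M"
          by (intro mult_left_mono RM) auto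
        ultimately show ?thesis using RM(2) by (simp add: abs_mult mult.commute)
      qed
    qed
  qed auto
qed

lemma kern_integrable_left:
  assumes f: "locint f" and k: "kern k"
  shows "integrable lborel (\<lambda>y. f (x - y) * k y)"
proof -
  have [measurable]: "borel_fun f" "borel_fun k"
    using f k by (auto intro: locint_borel kern_borel)
  show ?thesis
    using kern_integrable_right[OF assms, of x] integrable_reflect[of "\<lambda>y. f (x - y) * k y" x]
    by simp
qed

lemma conv_alt:
  assumes f: "borel_fun f" and k: "borel_fun k"
  shows "conv f k x = (LINT y|lborel. f y * k (x - y))"
proof -
  have [measurable]: "borel_fun f" "borel_fun k"
    using f k by auto
  show ?thesis
    unfolding conv_def
    using integral_reflect[of "\<lambda>y. f (x - y) * k y" x] by simp
qed

lemma conv_cong_AE: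
  assumes "borel_fun f" "borel_fun g" "borel_fun k"
    and "AE x in lborel. f x = g x"
  shows "conv f k = conv g k"
proof
  fix x
  have [measurable]: "borel_fun f" "borel_fun g" "borel_fun k"
    using assms by auto
  show "conv f k x = conv g k x"
    unfolding conv_alt[OF assms(1,3)] conv_alt[OF assms(2,3)]
    using assms(4) by (intro integral_cong_AE) (auto elim!: eventually_mono)
qed

lemma conv_add:
  assumes "locint f" "locint g" "kern k"
  shows "conv (\<lambda>x. f x + g x) k x = conv f k x + conv g k x"
  unfolding conv_def using assms
  by (simp add: ring_distribs kern_integrable_left)

lemma conv_cmult: "conv (\<lambda>x. c * f x) k x = c * conv f k x"
  unfolding conv_def by (simp add: mult.assoc)

lemma conv_diff:
  assumes "locint f" "locint g" "kern k"
  shows "conv (\<lambda>x. f x - g x) k x = conv f k x - conv g k x"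
  unfolding conv_def using assms
  by (simp add: left_diff_distrib kern_integrable_left)

lemma kern_abs: "kern k \<Longrightarrow> kern (\<lambda>y. \<bar>k y\<bar>)"
  by (auto simp: kern_def intro!: continuous_intros)

lemma kern_integrable: "kern k \<Longrightarrow> integrable lborel k"
  using kern_integrable_left[of "\<lambda>_. 1" k 0] locint_continuous[of "\<lambda>_. 1"] by simp

lemma locint_abs: "locint f \<Longrightarrow> locint (\<lambda>x. \<bar>f x\<bar>)"
  by (auto simp: locint_def L1n_def)

lemma continuous_on_conv:
  assumes f: "locint f" and k: "kern k"
  shows "continuous_on UNIV (conv f k)"
proof (rule continuous_on_sequentiallyI)
  fix u :: "nat \<Rightarrow> 'a" and a assume u: "u \<longlonglongrightarrow> a"
  obtain R M where RM: "R > 0" "M > 0" "\<And>x. norm x > R \<Longrightarrow> k x = 0" "\<And>x. \<bar>k x\<bar> \<le> M"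
    using kernE[OF k] by blast
  have [measurable]: "borel_fun f" "borel_fun k"
    using f k by (auto intro: locint_borel kern_borel)
  obtain B where B: "\<And>n. norm (u n) \<le> B"
    using convergent_imp_Bseq[OF convergentI[OF u]] by (auto simp: Bseq_def)
  have "(\<lambda>n. LINT y|lborel. f y * k (u n - y)) \<longlonglongrightarrow> (LINT y|lborel. f y * k (a - y))"
  proof (rule integral_dominated_convergence)
    show "integrable lborel (\<lambda>y. norm (M * (indicator (cball 0 (B + R)) y * f y)))"
      by (intro integrable_norm integrable_mult_right locint_integrable f) auto
    show "AE y in lborel. (\<lambda>n. f y * k (u n - y)) \<longlonglongrightarrow> f y * k (a - y)"
    proof (intro AE_I2 tendsto_mult_left)
      fix y
      have "(\<lambda>n. u n - y) \<longlonglongrightarrow> a - y" using u by (intro tendsto_intros)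
      then show "(\<lambda>n. k (u n - y)) \<longlonglongrightarrow> k (a - y)"
        using k by (auto simp: kern_def intro: continuous_on_tendsto_compose)
    qed
    show "AE y in lborel. norm (f y * k (u n - y)) \<le> norm (M * (indicator (cball 0 (B + R)) y * f y))" for n
    proof (intro AE_I2)
      fix y
      show "norm (f y * k (u n - y)) \<le> norm (M * (indicator (cball 0 (B + R)) y * f y))"
      proof (cases "norm (u n - y) > R")
        case True then show ?thesis by (simp add: RM)
      next
        case False
        then have "norm y \<le> B + R"
          using norm_triangle_ineq4[of "u n" "u n - y"] B[of n] by simp
        moreover have "\<bar>f y\<bar> * \<bar>k (u n - y)\<bar> \<le> \<bar>f y\<bar> * M"
          by (intro mult_left_mono RM) auto
        ultimately show ?thesis using RM(2) by (simp add: abs_mult mult.commute)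
      qed
    qed
  qed auto
  then show "(\<lambda>n. conv f k (u n)) \<longlonglongrightarrow> conv f k a"
    using f k by (simp add: conv_alt locint_borel kern_borel)
qed

lemma locint_conv: "locint f \<Longrightarrow> kern k \<Longrightarrow> locint (conv f k)"
  by (rule locint_continuous[OF continuous_on_conv])

lemma conv_commute:
  assumes f: "locint f" and j: "kern j" and k: "kern k"
  shows "conv (conv f j) k = conv (conv f k) j"
proof
  fix x
  have [measurable]: "borel_fun f" "borel_fun k"
    "borel_fun j"
    using f j k by (auto intro: locint_borel kern_borel)

  define F where "F = (\<lambda>y z. f (x - y - z) * j z * k y)"
  have "integrable (lborel \<Otimes>\<^sub>M lborel) (\<lambda>(y,z). F y z)"
  proof (rule lborel_pair.Fubini_integrable)
    show "(\<lambda>(y, z). F y z) \<in> borel_measurable (lborel \<Otimes>\<^sub>M lborel)"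
      unfolding F_def by measurable
    have "(LINT z|lborel. norm (F y z)) = conv (\<lambda>x. \<bar>f x\<bar>) (\<lambda>z. \<bar>j z\<bar>) (x - y) * \<bar>k y\<bar>" for y
      unfolding F_def conv_def by (simp add: abs_mult)
    moreover have "integrable lborel (\<lambda>y. conv (\<lambda>x. \<bar>f x\<bar>) (\<lambda>z. \<bar>j z\<bar>) (x - y) * \<bar>k y\<bar>)"
      by (intro kern_integrable_left locint_conv locint_abs kern_abs f j k)
    ultimately show "integrable lborel (\<lambda>y. LINT z|lborel. norm (case (y, z) of (y, z) \<Rightarrow> F y z))"
      by simp
    show "AE y in lborel. integrable lborel (\<lambda>z. case (y, z) of (y, z) \<Rightarrow> F y z)"
      using kern_integrable_left[OF f j] by (auto simp: F_def)
  qed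
  then have "(LINT y|lborel. LINT z|lborel. F z y) = (LINT y|lborel. LINT z|lborel. F y z)"
    by (rule lborel_pair.Fubini_integral)
  moreover have "(LINT z|lborel. F y z) = conv f j (x - y) * k y" for y
    unfolding F_def conv_def by simp
  moreover have "(LINT z|lborel. F z y) = conv f k (x - y) * j y" for y
  proof -
    have "(LINT z|lborel. F z y) = (LINT z|lborel. (f (x - y - z) * k z) * j y)"
      unfolding F_def by (intro Bochner_Integration.integral_cong) (auto simp: algebra_simps)
    then show ?thesis unfolding conv_def by simp
  qed
  ultimately show "conv (conv f j) k x = conv (conv f k) j x"
    unfolding conv_def[of "conv f j"] conv_def[of "conv f k"] by simp
qed

subsection \<open>Differentiation of convolutions\<close>

definition tfun :: "('a::euclidean_space \<Rightarrow> real) \<Rightarrow> bool"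
  where "tfun k \<longleftrightarrow> smooth k \<and> (\<exists>R. \<forall>x. norm x > R \<longrightarrow> k x = 0)"

lemma tfun_iff: "k \<in> test_functions \<longleftrightarrow> tfun k"
proof
  assume k: "k \<in> test_functions"
  then have "compact (closure {x. k x \<noteq> 0})"
    by (simp add: test_functions_def)
  then have "bounded {x. k x \<noteq> 0}"
    by (rule bounded_subset[OF compact_imp_bounded closure_subset])
  then obtain R where "\<forall>x\<in>{x. k x \<noteq> 0}. norm x \<le> R" unfolding bounded_iff by blast
  then have "\<forall>x. norm x > R \<longrightarrow> k x = 0" by force
  then show "tfun k" using k by (auto simp: tfun_def test_functions_def)
next
  assume k: "tfun k"
  then obtain R where "\<forall>x. norm x > R \<longrightarrow> k x = 0" by (auto simp: tfun_def)
  then have "{x. k x \<noteq> 0} \<subseteq> cball 0 R" by force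
  then have "compact (closure {x. k x \<noteq> 0})"
    using bounded_subset[OF bounded_cball] by (simp add: compact_closure)
  then show "k \<in> test_functions" using k by (auto simp: tfun_def test_functions_def)
qed

lemma tfun_kern: "tfun k \<Longrightarrow> kern k"
  by (auto simp: tfun_def kern_def intro: smooth_continuous)

lemma pderiv_dir_zero_outside:
  fixes k :: "'a::euclidean_space \<Rightarrow> real"
  assumes "\<And>x. norm x > R \<Longrightarrow> k x = 0" "norm x > R"
  shows "pderiv_dir b k x = 0"
proof -
  have "(k has_derivative (\<lambda>h. 0)) (at x)"
  proof (rule has_derivative_transform_within_open[where s="- cball 0 R" and f="\<lambda>_. 0"])
    show "open (- cball 0 R :: 'a set)" by (simp add: open_Compl)
  qed (use assms in auto)
  then show ?thesis by (rule pderiv_dir_eq(1))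
qed

lemma pderivs_zero_outside:
  fixes k :: "'a::euclidean_space \<Rightarrow> real"
  assumes "\<And>x. norm x > R \<Longrightarrow> k x = 0"
  shows "norm x > R \<Longrightarrow> pderivs bs k x = 0"
  using assms
proof (induction bs arbitrary: x)
  case (Cons b bs)
  then show ?case using pderiv_dir_zero_outside[of R "pderivs bs k" x b] by simp
qed simp

lemma tfun_pderivs: "tfun k \<Longrightarrow> set bs \<subseteq> Basis \<Longrightarrow> tfun (pderivs bs k)"
  unfolding tfun_def using smooth_pderivs pderivs_zero_outside by meson

lemma tfun_pderiv_dir: "tfun k \<Longrightarrow> b \<in> Basis \<Longrightarrow> tfun (pderiv_dir b k)"
  using tfun_pderivs[of k "[b]"] by simp

lemma smooth_mvt:
  fixes k :: "'a::euclidean_space \<Rightarrow> real"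
  assumes "smooth k"
  shows "\<exists>s. 0 < s \<and> s < 1 \<and> k (z + h) - k z = (\<Sum>b\<in>Basis. (h \<bullet> b) * pderiv_dir b k (z + s *\<^sub>R h))"
proof -
  have d: "((\<lambda>s. k (z + s *\<^sub>R h)) has_real_derivative
      (\<Sum>b\<in>Basis. (h \<bullet> b) * pderiv_dir b k (z + s *\<^sub>R h))) (at s)" for s
  proof -
    have "pderiv_dir h k x = (\<Sum>b\<in>Basis. (h \<bullet> b) * pderiv_dir b k x)" for x
      by (rule pderiv_dir_eq(1)[OF has_derivative_pderiv_dir[OF smooth_differentiable[OF assms]]])
    then show ?thesis
      using has_real_derivative_along_line[OF smooth_differentiable[OF assms], of z h s] by simp
  qed
  have "\<exists>s>0. s < 1 \<and> k (z + 1 *\<^sub>R h) - k (z + 0 *\<^sub>R h)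
      = (1 - 0) * (\<Sum>b\<in>Basis. (h \<bullet> b) * pderiv_dir b k (z + s *\<^sub>R h))"
    using d by (intro MVT2) auto
  then show ?thesis by auto
qed

lemma tfun_Lipschitz:
  fixes k :: "'a::euclidean_space \<Rightarrow> real"
  assumes "tfun k"
  shows "\<exists>L\<ge>0. \<forall>z h. \<bar>k (z + h) - k z\<bar> \<le> L * norm h"
proof -
  have "\<exists>M>0. \<forall>x. \<bar>pderiv_dir b k x\<bar> \<le> M" if "b \<in> Basis" for b
    using kernE[OF tfun_kern[OF tfun_pderiv_dir[OF assms that]]] by metis
  then obtain M where M: "\<And>b x. b \<in> Basis \<Longrightarrow> M b > 0 \<and> \<bar>pderiv_dir b k x\<bar> \<le> M b"
    by metis
  have "\<bar>k (z + h) - k z\<bar> \<le> (\<Sum>b\<in>Basis. M b) * norm h" for z h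
  proof -
    obtain s where "k (z + h) - k z = (\<Sum>b\<in>Basis. (h \<bullet> b) * pderiv_dir b k (z + s *\<^sub>R h))"
      using smooth_mvt[of k z h] assms by (auto simp: tfun_def)
    also have "\<bar>\<dots>\<bar> \<le> (\<Sum>b\<in>Basis. norm h * M b)"
    proof (intro order_trans[OF sum_abs] sum_mono)
      fix b :: 'a assume b: "b \<in> Basis"
      show "\<bar>(h \<bullet> b) * pderiv_dir b k (z + s *\<^sub>R h)\<bar> \<le> norm h * M b"
        unfolding abs_mult using M[OF b] Basis_le_norm[OF b, of h] by (intro mult_mono) auto
    qed
    also have "\<dots> = (\<Sum>b\<in>Basis. M b) * norm h"
      by (simp add: sum_distrib_left mult.commute)
    finally show ?thesis .
  qed
  moreover have "0 \<le> (\<Sum>b\<in>Basis. M b)" using M by (intro sum_nonneg) (auto simp: less_imp_le)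
  ultimately show ?thesis by blast
qed

lemma tfun_taylor:
  fixes k :: "'a::euclidean_space \<Rightarrow> real"
  assumes "tfun k"
  shows "\<exists>C\<ge>0. \<forall>z h. \<bar>k (z + h) - k z - (\<Sum>b\<in>Basis. (h \<bullet> b) * pderiv_dir b k z)\<bar> \<le> C * norm h ^ 2"
proof -
  have "\<exists>L\<ge>0. \<forall>z h. \<bar>pderiv_dir b k (z + h) - pderiv_dir b k z\<bar> \<le> L * norm h" if "b \<in> Basis" for b
    by (rule tfun_Lipschitz[OF tfun_pderiv_dir[OF assms that]])
  then obtain L where L: "\<And>b z h. b \<in> Basis \<Longrightarrow>
      L b \<ge> 0 \<and> \<bar>pderiv_dir b k (z + h) - pderiv_dir b k z\<bar> \<le> L b * norm h"
    by metis
  have "\<bar>k (z + h) - k z - (\<Sum>b\<in>Basis. (h \<bullet> b) * pderiv_dir b k z)\<bar>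
      \<le> (\<Sum>b\<in>Basis. L b) * norm h ^ 2" for z h
  proof -
    obtain s where s: "0 < s" "s < 1"
      "k (z + h) - k z = (\<Sum>b\<in>Basis. (h \<bullet> b) * pderiv_dir b k (z + s *\<^sub>R h))"
      using smooth_mvt[of k z h] assms by (auto simp: tfun_def)
    have "k (z + h) - k z - (\<Sum>b\<in>Basis. (h \<bullet> b) * pderiv_dir b k z)
        = (\<Sum>b\<in>Basis. (h \<bullet> b) * (pderiv_dir b k (z + s *\<^sub>R h) - pderiv_dir b k z))"
      unfolding s(3) by (simp add: sum_subtractf right_diff_distrib)
    also have "\<bar>\<dots>\<bar> \<le> (\<Sum>b\<in>Basis. norm h * (L b * norm h))"
    proof (intro order_trans[OF sum_abs] sum_mono)
      fix b :: 'a assume b: "b \<in> Basis"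
      have "\<bar>pderiv_dir b k (z + s *\<^sub>R h) - pderiv_dir b k z\<bar> \<le> L b * norm (s *\<^sub>R h)"
        using L[OF b] by blast
      also have "\<dots> \<le> L b * norm h"
        using L[OF b] s mult_right_mono[of s 1 "norm h"] by (intro mult_left_mono) auto
      finally show "\<bar>(h \<bullet> b) * (pderiv_dir b k (z + s *\<^sub>R h) - pderiv_dir b k z)\<bar> \<le> norm h * (L b * norm h)"
        unfolding abs_mult using Basis_le_norm[OF b, of h] by (intro mult_mono) auto
    qed
    also have "\<dots> = (\<Sum>b\<in>Basis. L b) * norm h ^ 2"
      by (simp add: sum_distrib_left mult_ac power2_eq_square)
    finally show ?thesis .
  qed
  moreover have "0 \<le> (\<Sum>b\<in>Basis. L b)" using L by (intro sum_nonneg) auto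
  ultimately show ?thesis by blast
qed

text \<open>Differentiation under the integral sign: by Taylor's formula the kernel differs from its linear
  approximation by a quadratic error, uniformly in the base point.\<close>

lemma conv_has_derivative:
  fixes f :: "'a::euclidean_space \<Rightarrow> real"
  assumes f: "locint f" and k: "tfun k"
  shows "(conv f k has_derivative (\<lambda>h. \<Sum>b\<in>Basis. (h \<bullet> b) * conv f (pderiv_dir b k) x)) (at x)"
proof -
  obtain C where C: "C \<ge> 0"
    "\<And>z h. \<bar>k (z + h) - k z - (\<Sum>b\<in>Basis. (h \<bullet> b) * pderiv_dir b k z)\<bar> \<le> C * norm h ^ 2"
    using tfun_taylor[OF k] by blast
  obtain R where R: "\<And>x. norm x > R \<Longrightarrow> k x = 0" using k by (auto simp: tfun_def)
  have kk: "kern k" "\<And>b. b \<in> Basis \<Longrightarrow> kern (pderiv_dir b k)"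
    using k by (auto intro: tfun_kern tfun_pderiv_dir)
  have fm [measurable]: "borel_fun f" using f by (rule locint_borel)
  note ca = conv_alt[OF fm kern_borel]
  define I where "I = (LINT y|lborel. indicator (cball 0 (norm x + 1 + R)) y * \<bar>f y\<bar>)"
  have Ii: "integrable lborel (\<lambda>y. indicator (cball 0 (norm x + 1 + R)) y * \<bar>f y\<bar>)"
    by (intro locint_integrable locint_abs f) auto
  have I0: "I \<ge> 0" unfolding I_def by (intro integral_nonneg_AE) auto
  have bd: "\<bar>conv f k (x + h) - conv f k x - (\<Sum>b\<in>Basis. (h \<bullet> b) * conv f (pderiv_dir b k) x)\<bar>
      \<le> C * norm h ^ 2 * I" if h: "norm h \<le> 1" for h
  proof -
    define r where "r y = k (x + h - y) - k (x - y) - (\<Sum>b\<in>Basis. (h \<bullet> b) * pderiv_dir b k (x - y))" for y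
    have ri: "integrable lborel (\<lambda>y. f y * r y)"
      "(LINT y|lborel. f y * r y) =
        conv f k (x + h) - conv f k x - (\<Sum>b\<in>Basis. (h \<bullet> b) * conv f (pderiv_dir b k) x)"
    proof -
      have i: "integrable lborel (\<lambda>y. f y * k (x + h - y))" "integrable lborel (\<lambda>y. f y * k (x - y))"
        "\<And>b. b \<in> Basis \<Longrightarrow> integrable lborel (\<lambda>y. (h \<bullet> b) * (f y * pderiv_dir b k (x - y)))"
        by (auto intro!: kern_integrable_right f kk integrable_mult_right)
      have e: "(\<lambda>y. f y * r y) = (\<lambda>y. f y * k (x + h - y) - f y * k (x - y)
          - (\<Sum>b\<in>Basis. (h \<bullet> b) * (f y * pderiv_dir b k (x - y))))"
        by (auto simp: r_def fun_eq_iff algebra_simps sum_distrib_left)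
      show "integrable lborel (\<lambda>y. f y * r y)"
        unfolding e by (intro Bochner_Integration.integrable_diff Bochner_Integration.integrable_sum i)
      show "(LINT y|lborel. f y * r y) =
        conv f k (x + h) - conv f k x - (\<Sum>b\<in>Basis. (h \<bullet> b) * conv f (pderiv_dir b k) x)"
        unfolding e using i kk
        by (simp add: Bochner_Integration.integral_sum ca)
    qed
    have "\<bar>LINT y|lborel. f y * r y\<bar>
        \<le> (LINT y|lborel. C * norm h ^ 2 * (indicator (cball 0 (norm x + 1 + R)) y * \<bar>f y\<bar>))"
    proof (rule order_trans[OF integral_abs_bound], rule integral_mono)
      show "integrable lborel (\<lambda>y. \<bar>f y * r y\<bar>)" using ri(1) by simp
      show "integrable lborel (\<lambda>y. C * norm h ^ 2 * (indicator (cball 0 (norm x + 1 + R)) y * \<bar>f y\<bar>))"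
        using Ii by simp
      fix y
      show "\<bar>f y * r y\<bar> \<le> C * norm h ^ 2 * (indicator (cball 0 (norm x + 1 + R)) y * \<bar>f y\<bar>)"
      proof (cases "norm y \<le> norm x + 1 + R")
        case True
        have "\<bar>r y\<bar> \<le> C * norm h ^ 2"
          using C(2)[of "x - y" h] by (simp add: r_def algebra_simps)
        then have "\<bar>r y\<bar> * \<bar>f y\<bar> \<le> C * norm h ^ 2 * \<bar>f y\<bar>"
          by (rule mult_right_mono) simp
        then show ?thesis using True by (simp add: abs_mult mult.commute)
      next
        case False
        have n: "norm (x - y) > R" "norm (x + h - y) > R"
          using False h norm_triangle_ineq2[of y x] norm_triangle_ineq2[of y "x + h"]
            norm_triangle_ineq[of x h] by (auto simp: norm_minus_commute)
        have z: "pderiv_dir b k (x - y) = 0" for b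
          using pderiv_dir_zero_outside[of R k "x - y" b] R n by blast
        have "r y = 0"
          unfolding r_def using R n by (simp add: z)
        then show ?thesis using C(1) by simp
      qed
    qed
    then show ?thesis unfolding ri(2) I_def by simp
  qed
  show ?thesis
    unfolding has_derivative_at_alt
  proof (intro conjI allI impI)
    show "bounded_linear (\<lambda>h. \<Sum>b\<in>Basis. (h \<bullet> b) * conv f (pderiv_dir b k) x)"
      by (intro bounded_linear_sum bounded_linear_mult_const bounded_linear_inner_left)
    fix e :: real assume e: "e > 0"
    define d where "d = min 1 (e / (C * I + 1))"
    have CI: "C * I + 1 > 0" using C(1) I0 by (simp add: add_nonneg_pos)
    have d: "d > 0" using e CI by (simp add: d_def)
    show "\<exists>d>0. \<forall>y. norm (y - x) < d \<longrightarrow>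
      norm (conv f k y - conv f k x - (\<Sum>b\<in>Basis. ((y - x) \<bullet> b) * conv f (pderiv_dir b k) x)) \<le> e * norm (y - x)"
    proof (intro exI[of _ d] conjI d allI impI)
      fix y assume y: "norm (y - x) < d"
      have "norm (conv f k y - conv f k x - (\<Sum>b\<in>Basis. ((y - x) \<bullet> b) * conv f (pderiv_dir b k) x))
          \<le> C * norm (y - x) ^ 2 * I"
        using bd[of "y - x"] y by (simp add: d_def)
      also have "\<dots> = (C * I * norm (y - x)) * norm (y - x)" by (simp add: power2_eq_square)
      also have "\<dots> \<le> e * norm (y - x)"
      proof (rule mult_right_mono)
        have "C * I * norm (y - x) \<le> (C * I + 1) * (e / (C * I + 1))"
          using y CI C(1) I0 by (intro mult_mono) (auto simp: d_def)
        then show "C * I * norm (y - x) \<le> e" using CI by simp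
      qed simp
      finally show "norm (conv f k y - conv f k x - (\<Sum>b\<in>Basis. ((y - x) \<bullet> b) * conv f (pderiv_dir b k) x))
          \<le> e * norm (y - x)" .
    qed
  qed
qed

lemma pderiv_dir_conv:
  assumes f: "locint f" and k: "tfun k" and c: "c \<in> Basis"
  shows "pderiv_dir c (conv f k) = conv f (pderiv_dir c k)"
proof
  fix x
  have "pderiv_dir c (conv f k) x = (\<Sum>b\<in>Basis. (c \<bullet> b) * conv f (pderiv_dir b k) x)"
    by (rule pderiv_dir_eq(1)[OF conv_has_derivative[OF f k]])
  also have "\<dots> = (\<Sum>b\<in>Basis. if b = c then conv f (pderiv_dir c k) x else 0)"
    using c by (intro sum.cong) (auto simp: inner_Basis)
  finally show "pderiv_dir c (conv f k) x = conv f (pderiv_dir c k) x" using c by simp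
qed

lemma pderivs_conv:
  assumes f: "locint f" and k: "tfun k"
  shows "set bs \<subseteq> Basis \<Longrightarrow> pderivs bs (conv f k) = conv f (pderivs bs k)"
proof (induction bs)
  case (Cons b bs)
  then show ?case using pderiv_dir_conv[OF f tfun_pderivs[OF k, of bs], of b] by simp
qed simp

lemma smooth_conv:
  assumes f: "locint f" and k: "tfun k"
  shows "smooth (conv f k)"
  unfolding smooth_def pderivs_def[symmetric]
proof (intro allI impI)
  fix bs :: "'a list" assume bs: "set bs \<subseteq> Basis"
  show "pderivs bs (conv f k) differentiable_on UNIV"
    unfolding pderivs_conv[OF f k bs] differentiable_on_def
    using conv_has_derivative[OF f tfun_pderivs[OF k bs]] by (auto simp: differentiable_def)
qed

section \<open>Approximation by convolution\<close>

lemma L1_translation_open: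
  fixes U :: "'a::euclidean_space set"
  assumes U: "open U" and fin: "emeasure lborel U < \<infinity>" and y: "y \<longlonglongrightarrow> 0"
  shows "(\<lambda>n. LINT x|lborel. \<bar>indicator U (x - y n) - indicator U x\<bar> :: real) \<longlonglongrightarrow> 0"
proof -
  have [measurable]: "U \<in> sets borel" using U by simp
  define p :: "nat \<Rightarrow> 'a \<Rightarrow> real" where "p n x = indicator U x * (1 - indicator U (x - y n))" for n x
  have iU: "integrable lborel (indicator U :: 'a \<Rightarrow> real)" using fin by simp
  have iU': "integrable lborel (\<lambda>x. indicator U (x - y n) :: real)" for n
    using integrable_translate[of "indicator U :: 'a \<Rightarrow> real" "- y n"] iU by simp
  have [measurable]: "borel_fun (p n)" for n
    unfolding p_def[abs_def] by measurable
  have ip: "integrable lborel (p n)" for n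
    by (rule Bochner_Integration.integrable_bound[OF iU]) (auto simp: p_def indicator_def)
  have "(\<lambda>n. LINT x|lborel. p n x) \<longlonglongrightarrow> (LINT x|(lborel::'a measure). (0::real))"
  proof (rule integral_dominated_convergence[where w="\<lambda>x. indicator U x :: real" and s=p])
    show "AE x in lborel. (\<lambda>n. p n x) \<longlonglongrightarrow> 0"
    proof (intro AE_I2)
      fix x :: 'a
      show "(\<lambda>n. p n x) \<longlonglongrightarrow> 0"
      proof (cases "x \<in> U")
        case True
        have "(\<lambda>n. x - y n) \<longlonglongrightarrow> x - 0" using y by (intro tendsto_intros)
        then have "\<forall>\<^sub>F n in sequentially. x - y n \<in> U"
          using topological_tendstoD[OF _ U] True by simp
        then have "\<forall>\<^sub>F n in sequentially. p n x = 0"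
          by eventually_elim (simp add: p_def)
        then show ?thesis by (rule tendsto_eventually)
      qed (simp add: p_def)
    qed
    show "integrable lborel (\<lambda>x. indicator U x :: real)" by (rule iU)
  qed (auto simp: p_def indicator_def)
  then have "(\<lambda>n. 2 * (LINT x|lborel. p n x)) \<longlonglongrightarrow> 0" by (simp add: tendsto_mult_right_zero)
  moreover have "(LINT x|lborel. \<bar>indicator U (x - y n) - indicator U x\<bar> :: real) = 2 * (LINT x|lborel. p n x)" for n
  proof -
    have "(LINT x|lborel. \<bar>indicator U (x - y n) - indicator U x\<bar> :: real)
        = (LINT x|lborel. 2 * p n x + (indicator U (x - y n) - indicator U x))"
      by (intro Bochner_Integration.integral_cong) (auto simp: p_def indicator_def)
    also have "\<dots> = 2 * (LINT x|lborel. p n x)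
        + ((LINT x|lborel. indicator U (x - y n)) - (LINT x|lborel. indicator U x))"
      using ip iU iU' by simp
    also have "(LINT x|lborel. indicator U (x - y n) :: real) = (LINT x|lborel. indicator U x)"
      using integral_translate[of "indicator U :: 'a \<Rightarrow> real" "- y n"] by simp
    finally show ?thesis by simp
  qed
  ultimately show ?thesis by simp
qed

lemma L1_translation_approx:
  fixes f :: "'a::euclidean_space \<Rightarrow> real"
  assumes f: "integrable lborel f"
    and g: "\<And>e. e > 0 \<Longrightarrow> \<exists>g. integrable lborel g \<and> (LINT x|lborel. \<bar>f x - g x\<bar>) \<le> e \<and>
      (\<lambda>n. LINT x|lborel. \<bar>g (x - y n) - g x\<bar>) \<longlonglongrightarrow> 0"
  shows "(\<lambda>n. LINT x|lborel. \<bar>f (x - y n) - f x\<bar>) \<longlonglongrightarrow> 0"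
proof (rule LIMSEQ_I)
  fix r :: real assume r: "r > 0"
  obtain g where g: "integrable lborel g" "(LINT x|lborel. \<bar>f x - g x\<bar>) \<le> r / 4"
    "(\<lambda>n. LINT x|lborel. \<bar>g (x - y n) - g x\<bar>) \<longlonglongrightarrow> 0"
    using g[of "r/4"] r by auto
  obtain N where N: "\<And>n. n \<ge> N \<Longrightarrow> \<bar>LINT x|lborel. \<bar>g (x - y n) - g x\<bar>\<bar> < r / 4"
    using LIMSEQ_D[OF g(3), of "r/4"] r by auto
  have [measurable]: "borel_fun f" "borel_fun g"
    using f g(1) borel_measurable_integrable by auto
  have tr: "integrable lborel (\<lambda>x. h (x - t))" "(LINT x|lborel. h (x - t)) = (LINT x|lborel. h x)"
    if "integrable lborel h" for h :: "'a \<Rightarrow> real" and t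
    using integrable_translate[of h "- t"] integral_translate[of h "- t"] that
      borel_measurable_integrable[OF that] by auto
  have "norm ((LINT x|lborel. \<bar>f (x - y n) - f x\<bar>) - 0) < r" if "n \<ge> N" for n
  proof -
    have i: "integrable lborel (\<lambda>x. \<bar>f x - g x\<bar>)" using f g by simp
    have "(LINT x|lborel. \<bar>f (x - y n) - f x\<bar>) \<le>
      (LINT x|lborel. \<bar>f (x - y n) - g (x - y n)\<bar> + \<bar>g (x - y n) - g x\<bar> + \<bar>f x - g x\<bar>)"
      using f g(1) tr(1) by (intro integral_mono) auto
    also have "\<dots> = (LINT x|lborel. \<bar>f (x - y n) - g (x - y n)\<bar>) + (LINT x|lborel. \<bar>g (x - y n) - g x\<bar>)
        + (LINT x|lborel. \<bar>f x - g x\<bar>)"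
      using f g(1) tr(1) by simp
    also have "(LINT x|lborel. \<bar>f (x - y n) - g (x - y n)\<bar>) = (LINT x|lborel. \<bar>f x - g x\<bar>)"
      using tr(2)[OF i, of "y n"] by simp
    also have "(LINT x|lborel. \<bar>f x - g x\<bar>) + (LINT x|lborel. \<bar>g (x - y n) - g x\<bar>)
        + (LINT x|lborel. \<bar>f x - g x\<bar>) < r"
      using g(2) N[OF that] r by linarith
    finally show ?thesis by simp
  qed
  then show "\<exists>N. \<forall>n\<ge>N. norm ((LINT x|lborel. \<bar>f (x - y n) - f x\<bar>) - 0) < r" by blast
qed

text \<open>Translation is continuous in \<open>L\<^sub>1\<close>. For the indicator of an open set this is dominated
  convergence; outer regularity and linear combinations reduce the general case to it.\<close>

lemma L1_translation:
  fixes f :: "'a::euclidean_space \<Rightarrow> real"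
  assumes "integrable lborel f" and y: "y \<longlonglongrightarrow> 0"
  shows "(\<lambda>n. LINT x|lborel. \<bar>f (x - y n) - f x\<bar>) \<longlonglongrightarrow> 0"
  using assms(1)
proof (induction f rule: integrable_induct)
  case (base A c)
  have [measurable]: "A \<in> sets borel" using base by simp
  have iA: "integrable lborel (indicator A :: 'a \<Rightarrow> real)" using base by simp
  have "(\<lambda>n. LINT x|lborel. \<bar>indicator A (x - y n) - indicator A x\<bar> :: real) \<longlonglongrightarrow> 0"
  proof (rule L1_translation_approx[OF iA])
    fix e :: real assume e: "e > 0"
    obtain U where U: "open U" "A \<subseteq> U" "emeasure lborel (U - A) < ennreal e"
      using outer_regular_lborel[of A e] e by auto
    have [measurable]: "U \<in> sets borel" using U by simp
    have fU: "emeasure lborel U < \<infinity>"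
    proof -
      have "emeasure lborel U \<le> emeasure lborel A + emeasure lborel (U - A)"
        using emeasure_subadditive[of A lborel "U - A"] U(2) by (simp add: Un_absorb1)
      also have "\<dots> < \<infinity>" using base U(3) by (simp add: less_top order_less_trans[of _ "ennreal e"])
      finally show ?thesis .
    qed
    have "(LINT x|lborel. \<bar>indicator A x - indicator U x\<bar> :: real) = (LINT x|lborel. indicator (U - A) x)"
      using U(2) by (intro Bochner_Integration.integral_cong) (auto simp: indicator_def)
    also have "\<dots> = measure lborel (U - A)" by simp
    also have "\<dots> \<le> e"
      using U(3) e unfolding measure_def by (intro enn2real_leI) auto
    finally have "(LINT x|lborel. \<bar>indicator A x - indicator U x\<bar> :: real) \<le> e" .
    moreover have "integrable lborel (indicator U :: 'a \<Rightarrow> real)" using fU by simp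
    ultimately show "\<exists>g. integrable lborel g \<and> (LINT x|lborel. \<bar>indicator A x - g x\<bar> :: real) \<le> e \<and>
      (\<lambda>n. LINT x|lborel. \<bar>g (x - y n) - g x\<bar>) \<longlonglongrightarrow> 0"
      using L1_translation_open[OF U(1) fU y] by blast
  qed
  then have "(\<lambda>n. \<bar>c\<bar> * (LINT x|lborel. \<bar>indicator A (x - y n) - indicator A x\<bar> :: real)) \<longlonglongrightarrow> 0"
    by (rule tendsto_mult_right_zero)
  moreover have "\<bar>indicator A (x - y n) *\<^sub>R c - indicator A x *\<^sub>R c\<bar>
      = \<bar>c\<bar> * \<bar>indicator A (x - y n) - indicator A x\<bar>" for x n
    by (simp add: abs_mult[symmetric] algebra_simps)
  ultimately show ?case by simp
next
  case (add f g)
  have [measurable]: "borel_fun f" "borel_fun g"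
    using add borel_measurable_integrable by auto
  have i: "integrable lborel (\<lambda>x. \<bar>h (x - t) - h x\<bar>)" if "integrable lborel h" for h :: "'a \<Rightarrow> real" and t
    using integrable_translate[of h "- t"] that borel_measurable_integrable[OF that] by auto
  have ia: "integrable lborel (\<lambda>x. f x + g x)" using add by simp
  show ?case
  proof (rule tendsto_sandwich[OF _ _ tendsto_const])
    show "\<forall>\<^sub>F n in sequentially. 0 \<le> (LINT x|lborel. \<bar>(f (x - y n) + g (x - y n)) - (f x + g x)\<bar>)"
      by (intro always_eventually allI integral_nonneg_AE) auto
    show "\<forall>\<^sub>F n in sequentially. (LINT x|lborel. \<bar>(f (x - y n) + g (x - y n)) - (f x + g x)\<bar>)
      \<le> (LINT x|lborel. \<bar>f (x - y n) - f x\<bar>) + (LINT x|lborel. \<bar>g (x - y n) - g x\<bar>)"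
    proof (intro always_eventually allI)
      fix n
      have "(LINT x|lborel. \<bar>(f (x - y n) + g (x - y n)) - (f x + g x)\<bar>)
        \<le> (LINT x|lborel. \<bar>f (x - y n) - f x\<bar> + \<bar>g (x - y n) - g x\<bar>)"
        using i[OF add(1)] i[OF add(2)] i[OF ia] by (intro integral_mono) auto
      then show "(LINT x|lborel. \<bar>(f (x - y n) + g (x - y n)) - (f x + g x)\<bar>)
        \<le> (LINT x|lborel. \<bar>f (x - y n) - f x\<bar>) + (LINT x|lborel. \<bar>g (x - y n) - g x\<bar>)"
        using i[OF add(1)] i[OF add(2)] by simp
    qed
    show "(\<lambda>n. (LINT x|lborel. \<bar>f (x - y n) - f x\<bar>) + (LINT x|lborel. \<bar>g (x - y n) - g x\<bar>)) \<longlonglongrightarrow> 0"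
      using tendsto_add[OF add(3,4)] by simp
  qed
next
  case (lim f s)
  have [measurable]: "borel_fun f" "\<And>i. borel_fun (s i)"
    using borel_measurable_integrable[OF lim(4)] borel_measurable_integrable[OF lim(1)] by simp_all
  have "(\<lambda>i. LINT x|lborel. \<bar>f x - s i x\<bar>) \<longlonglongrightarrow> (LINT x|(lborel::'a measure). (0::real))"
  proof (rule integral_dominated_convergence[where w="\<lambda>x. 3 * \<bar>f x\<bar>"])
    show "AE x in lborel. (\<lambda>i. \<bar>f x - s i x\<bar>) \<longlonglongrightarrow> 0"
    proof (intro AE_I2)
      fix x
      have "(\<lambda>i. \<bar>f x - s i x\<bar>) \<longlonglongrightarrow> \<bar>f x - f x\<bar>"
        using lim(2)[of x] by (intro tendsto_intros) auto
      then show "(\<lambda>i. \<bar>f x - s i x\<bar>) \<longlonglongrightarrow> 0" by simp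
    qed
    show "AE x in lborel. norm \<bar>f x - s i x\<bar> \<le> 3 * \<bar>f x\<bar>" for i
    proof (intro AE_I2)
      fix x
      show "norm \<bar>f x - s i x\<bar> \<le> 3 * \<bar>f x\<bar>" using lim(3)[of x i] by simp
    qed
  qed (use lim in auto)
  then have L: "(\<lambda>i. LINT x|lborel. \<bar>f x - s i x\<bar>) \<longlonglongrightarrow> 0" by simp
  show ?case
  proof (rule L1_translation_approx[OF lim(4)])
    fix e :: real assume "e > 0"
    then obtain i where "\<bar>LINT x|lborel. \<bar>f x - s i x\<bar>\<bar> < e"
      using LIMSEQ_D[OF L, of e] by auto
    then show "\<exists>g. integrable lborel g \<and> (LINT x|lborel. \<bar>f x - g x\<bar>) \<le> e \<and>
      (\<lambda>n. LINT x|lborel. \<bar>g (x - y n) - g x\<bar>) \<longlonglongrightarrow> 0"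
      using lim(1)[of i] lim(5)[of i] by (intro exI[of _ "s i"]) auto
  qed
qed

text \<open>Continuity of translations, localised by truncating the function to a larger ball.\<close>

lemma locint_translation:
  fixes f :: "'a::euclidean_space \<Rightarrow> real"
  assumes f: "locint f" and e: "e > 0"
  shows "\<exists>d>0. \<forall>y. norm y < d \<longrightarrow> L1n (cball 0 R) (\<lambda>x. f (x - y) - f x) \<le> ennreal e"
proof (rule ccontr)
  assume "\<not> ?thesis"
  then have "\<forall>n. \<exists>y. norm y < 1 / real (Suc n) \<and> \<not> L1n (cball 0 R) (\<lambda>x. f (x - y) - f x) \<le> ennreal e"
    by auto
  then obtain y where y: "\<And>n. norm (y n) < 1 / real (Suc n)"
    "\<And>n. \<not> L1n (cball 0 R) (\<lambda>x. f (x - y n) - f x) \<le> ennreal e"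
    by metis
  have y0: "y \<longlonglongrightarrow> 0"
  proof (rule tendsto_norm_zero_cancel, rule tendsto_sandwich[OF _ _ tendsto_const])
    show "(\<lambda>n. 1 / real (Suc n)) \<longlonglongrightarrow> 0" by (rule LIMSEQ_Suc[OF lim_1_over_n])
    show "\<forall>\<^sub>F n in sequentially. norm (y n) \<le> 1 / real (Suc n)"
      using y(1) by (intro always_eventually allI) (rule less_imp_le)
  qed simp
  define g where "g x = indicator (cball 0 (R+1)) x * f x" for x
  have fm [measurable]: "borel_fun f" using f by (rule locint_borel)
  have gi: "integrable lborel g"
    unfolding g_def by (intro locint_integrable f) auto
  have [measurable]: "borel_fun g" using gi borel_measurable_integrable by auto
  have "(\<lambda>n. LINT x|lborel. \<bar>g (x - y n) - g x\<bar>) \<longlonglongrightarrow> 0"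
    by (rule L1_translation[OF gi y0])
  from LIMSEQ_D[OF this e] obtain N where N: "\<bar>LINT x|lborel. \<bar>g (x - y N) - g x\<bar>\<bar> < e" by auto
  have yN: "norm (y N) \<le> 1" by (rule order_trans[OF less_imp_le[OF y(1)]]) simp
  have "integrable lborel (\<lambda>x. g (x - y N))"
    using gi integrable_translate[of g "- y N"] by simp
  then have gi': "integrable lborel (\<lambda>x. \<bar>g (x - y N) - g x\<bar>)" using gi by auto
  have "L1n (cball 0 R) (\<lambda>x. f (x - y N) - f x) \<le> (\<integral>\<^sup>+x. ennreal \<bar>g (x - y N) - g x\<bar> \<partial>lborel)"
    unfolding L1n_def
  proof (intro nn_integral_mono)
    fix x :: 'a
    have "norm x \<le> R \<Longrightarrow> norm (x - y N) \<le> R + 1"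
      using yN norm_triangle_ineq4[of x "y N"] by linarith
    then show "ennreal \<bar>f (x - y N) - f x\<bar> * indicator (cball 0 R) x \<le> ennreal \<bar>g (x - y N) - g x\<bar>"
      by (auto simp: g_def indicator_def)
  qed
  also have "\<dots> = ennreal (LINT x|lborel. \<bar>g (x - y N) - g x\<bar>)"
    using gi' by (intro nn_integral_eq_integral) auto
  also have "\<dots> \<le> ennreal e" using N by (intro ennreal_leI) linarith
  finally show False using y(2)[of N] by simp
qed

lemma L1n_conv_diff_le:
  fixes f :: "'a::euclidean_space \<Rightarrow> real"
  assumes f: "locint f" and k: "kern k" and r: "\<And>z. norm z > r \<Longrightarrow> k z = 0"
    and k1: "(LINT z|lborel. k z) = 1"
    and e: "\<And>y. norm y \<le> r \<Longrightarrow> L1n (cball 0 R) (\<lambda>x. f (x - y) - f x) \<le> ennreal e"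
  shows "L1n (cball 0 R) (\<lambda>x. conv f k x - f x) \<le> ennreal (LINT z|lborel. \<bar>k z\<bar>) * ennreal e"
proof -
  have [measurable]: "cball (0::'a) R \<in> sets borel" by simp
  have [measurable]: "borel_fun f" "borel_fun k"
    using f k by (auto intro: locint_borel kern_borel)
  have *: "ennreal \<bar>conv f k x - f x\<bar> \<le> (\<integral>\<^sup>+y. ennreal \<bar>f (x - y) - f x\<bar> * ennreal \<bar>k y\<bar> \<partial>lborel)" for x
  proof -
    have i: "integrable lborel (\<lambda>y. (f (x - y) - f x) * k y)"
      using kern_integrable_left[OF f k, of x] kern_integrable[OF k] by (simp add: left_diff_distrib)
    have "(LINT y|lborel. (f (x - y) - f x) * k y) = conv f k x - f x"
      using kern_integrable_left[OF f k, of x] kern_integrable[OF k] k1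
      by (simp add: left_diff_distrib conv_def)
    then have "ennreal \<bar>conv f k x - f x\<bar> \<le> (\<integral>\<^sup>+y. ennreal (norm ((f (x - y) - f x) * k y)) \<partial>lborel)"
      using integral_norm_bound_ennreal[OF i] by simp
    also have "\<dots> = (\<integral>\<^sup>+y. ennreal \<bar>f (x - y) - f x\<bar> * ennreal \<bar>k y\<bar> \<partial>lborel)"
      by (simp add: abs_mult ennreal_mult)
    finally show ?thesis .
  qed
  have "L1n (cball 0 R) (\<lambda>x. conv f k x - f x) \<le>
      (\<integral>\<^sup>+x. (\<integral>\<^sup>+y. ennreal \<bar>f (x - y) - f x\<bar> * ennreal \<bar>k y\<bar> * indicator (cball 0 R) x \<partial>lborel) \<partial>lborel)"
    unfolding L1n_def
    using * by (intro nn_integral_mono) (auto simp: indicator_def)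
  also have "\<dots> = (\<integral>\<^sup>+y. (\<integral>\<^sup>+x. ennreal \<bar>f (x - y) - f x\<bar> * ennreal \<bar>k y\<bar> * indicator (cball 0 R) x \<partial>lborel) \<partial>lborel)"
    by (rule lborel_pair.Fubini') measurable
  also have "\<dots> = (\<integral>\<^sup>+y. ennreal \<bar>k y\<bar> * L1n (cball 0 R) (\<lambda>x. f (x - y) - f x) \<partial>lborel)"
    unfolding L1n_def
    by (intro nn_integral_cong, subst nn_integral_cmult[symmetric]) (auto simp: mult_ac)
  also have "\<dots> \<le> (\<integral>\<^sup>+y. ennreal \<bar>k y\<bar> * ennreal e \<partial>lborel)"
  proof (intro nn_integral_mono)
    fix y
    show "ennreal \<bar>k y\<bar> * L1n (cball 0 R) (\<lambda>x. f (x - y) - f x) \<le> ennreal \<bar>k y\<bar> * ennreal e"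
      using e[of y] r[of y] by (cases "norm y \<le> r") (auto intro: mult_left_mono)
  qed
  also have "\<dots> = (\<integral>\<^sup>+y. ennreal \<bar>k y\<bar> \<partial>lborel) * ennreal e"
    by (rule nn_integral_multc) measurable
  also have "(\<integral>\<^sup>+y. ennreal \<bar>k y\<bar> \<partial>lborel) = ennreal (LINT z|lborel. \<bar>k z\<bar>)"
    using kern_integrable[OF k] by (intro nn_integral_eq_integral) auto
  finally show ?thesis .
qed

text \<open>Young's inequality; the ball grows by the radius of the support of the kernel.\<close>

lemma L1n_conv_le:
  fixes f :: "'a::euclidean_space \<Rightarrow> real"
  assumes f: "locint f" and k: "kern k" and r: "\<And>z. norm z > r \<Longrightarrow> k z = 0"
  shows "L1n (cball 0 R) (conv f k) \<le> ennreal (LINT z|lborel. \<bar>k z\<bar>) * L1n (cball 0 (R + r)) f"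
proof -
  have [measurable]: "cball (0::'a) R \<in> sets borel" by simp
  have [measurable]: "borel_fun f" "borel_fun k"
    using f k by (auto intro: locint_borel kern_borel)
  have [measurable]: "cball (0::'a) (R + r) \<in> sets borel" by simp
  have *: "ennreal \<bar>conv f k x\<bar> \<le> (\<integral>\<^sup>+y. ennreal \<bar>f (x - y)\<bar> * ennreal \<bar>k y\<bar> \<partial>lborel)" for x
    using integral_norm_bound_ennreal[OF kern_integrable_left[OF f k, of x]]
    by (simp add: conv_def abs_mult ennreal_mult)
  have "L1n (cball 0 R) (conv f k) \<le>
      (\<integral>\<^sup>+x. (\<integral>\<^sup>+y. ennreal \<bar>f (x - y)\<bar> * ennreal \<bar>k y\<bar> * indicator (cball 0 R) x \<partial>lborel) \<partial>lborel)"
    unfolding L1n_def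
    using * by (intro nn_integral_mono) (auto simp: indicator_def)
  also have "\<dots> = (\<integral>\<^sup>+y. (\<integral>\<^sup>+x. ennreal \<bar>f (x - y)\<bar> * ennreal \<bar>k y\<bar> * indicator (cball 0 R) x \<partial>lborel) \<partial>lborel)"
    by (rule lborel_pair.Fubini') measurable
  also have "\<dots> \<le> (\<integral>\<^sup>+y. ennreal \<bar>k y\<bar> * L1n (cball 0 (R + r)) f \<partial>lborel)"
  proof (intro nn_integral_mono)
    fix y :: 'a
    show "(\<integral>\<^sup>+x. ennreal \<bar>f (x - y)\<bar> * ennreal \<bar>k y\<bar> * indicator (cball 0 R) x \<partial>lborel)
        \<le> ennreal \<bar>k y\<bar> * L1n (cball 0 (R + r)) f"
    proof (cases "norm y \<le> r")
      case True
      have "(\<integral>\<^sup>+x. ennreal \<bar>f (x - y)\<bar> * ennreal \<bar>k y\<bar> * indicator (cball 0 R) x \<partial>lborel)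
        \<le> (\<integral>\<^sup>+x. ennreal \<bar>k y\<bar> * (ennreal \<bar>f (x - y)\<bar> * indicator (cball 0 (R + r)) (x - y)) \<partial>lborel)"
      proof (intro nn_integral_mono)
        fix x :: 'a
        have "norm x \<le> R \<Longrightarrow> norm (x - y) \<le> R + r"
          using True norm_triangle_ineq4[of x y] by linarith
        then show "ennreal \<bar>f (x - y)\<bar> * ennreal \<bar>k y\<bar> * indicator (cball 0 R) x
          \<le> ennreal \<bar>k y\<bar> * (ennreal \<bar>f (x - y)\<bar> * indicator (cball 0 (R + r)) (x - y))"
          by (auto simp: indicator_def mult.commute)
      qed
      also have "\<dots> = ennreal \<bar>k y\<bar> * (\<integral>\<^sup>+x. ennreal \<bar>f (x - y)\<bar> * indicator (cball 0 (R + r)) (x - y) \<partial>lborel)"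
        by (rule nn_integral_cmult) measurable
      also have "(\<integral>\<^sup>+x. ennreal \<bar>f (x - y)\<bar> * indicator (cball 0 (R + r)) (x - y) \<partial>lborel) = L1n (cball 0 (R + r)) f"
        using nn_integral_translate[of "\<lambda>x. ennreal \<bar>f x\<bar> * indicator (cball 0 (R + r)) x" "- y"]
        by (simp add: L1n_def)
      finally show ?thesis .
    qed (simp add: r)
  qed
  also have "\<dots> = (\<integral>\<^sup>+y. ennreal \<bar>k y\<bar> \<partial>lborel) * L1n (cball 0 (R + r)) f"
    by (rule nn_integral_multc) measurable
  also have "(\<integral>\<^sup>+y. ennreal \<bar>k y\<bar> \<partial>lborel) = ennreal (LINT z|lborel. \<bar>k z\<bar>)"
    using kern_integrable[OF k] by (intro nn_integral_eq_integral) auto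
  finally show ?thesis .
qed

subsection \<open>Dilated kernels\<close>

text \<open>Dilation to the scale \<open>2\<^sup>-\<^sup>j\<close>, normalised to preserve the integral.\<close>

definition dil :: "nat \<Rightarrow> ('a::euclidean_space \<Rightarrow> real) \<Rightarrow> 'a \<Rightarrow> real"
  where "dil j k x = 2 ^ (j * DIM('a)) * k (2 ^ j *\<^sub>R x)"

lemma dil_zero_outside:
  assumes "\<And>z. norm z > r \<Longrightarrow> k z = 0" "norm z > r / 2 ^ j"
  shows "dil j k z = 0"
  using assms(1)[of "2 ^ j *\<^sub>R z"] assms(2) by (simp add: dil_def field_simps)

lemma smooth_dil: "smooth k \<Longrightarrow> smooth (dil j k)"
  unfolding dil_def[abs_def] using smooth_affine[of k 0 "2 ^ j"] by (intro smooth_cmult) simp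

lemma pderivs_dil:
  fixes k :: "'a::euclidean_space \<Rightarrow> real"
  assumes k: "smooth k" and bs: "set bs \<subseteq> Basis"
  shows "pderivs bs (dil j k) x = 2 ^ (j * length bs) * dil j (pderivs bs k) x"
proof -
  have s: "smooth (\<lambda>x. k (2 ^ j *\<^sub>R x))" using smooth_affine[OF k, of 0 "2 ^ j"] by simp
  have e: "dil j k = (\<lambda>x. 2 ^ (j * DIM('a)) * k (2 ^ j *\<^sub>R x))" by (simp add: dil_def fun_eq_iff)
  have a: "pderivs bs (\<lambda>x. k (2 ^ j *\<^sub>R x)) = (\<lambda>x. (2 ^ j) ^ length bs * pderivs bs k (2 ^ j *\<^sub>R x))"
    using pderivs_affine[OF k bs, of 0 "2 ^ j"] by simp
  show ?thesis
    unfolding e pderivs_cmult[OF s bs] a by (simp add: dil_def power_mult)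
qed

lemma kern_dil:
  assumes "kern k" shows "kern (dil j k)"
proof -
  obtain R where R: "\<And>x. norm x > R \<Longrightarrow> k x = 0" and c: "continuous_on UNIV k"
    using assms by (auto simp: kern_def)
  have "continuous_on UNIV (\<lambda>x. k (2 ^ j *\<^sub>R x))"
    by (rule continuous_on_compose2[OF c]) (auto intro!: continuous_intros)
  then have "continuous_on UNIV (dil j k)"
    unfolding dil_def[abs_def] by (intro continuous_intros)
  then show ?thesis using dil_zero_outside[where r=R and k=k and j=j] R unfolding kern_def by blast
qed

lemma tfun_dil: "tfun k \<Longrightarrow> tfun (dil j k)"
  using kern_dil[OF tfun_kern, of k j] smooth_dil[of k j] by (auto simp: tfun_def kern_def)

lemma integral_dil:
  fixes k :: "'a::euclidean_space \<Rightarrow> real"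
  assumes "borel_fun k"
  shows "(LINT x|lborel. dil j k x) = (LINT x|lborel. k x)"
  unfolding dil_def using integral_affine[OF assms, of "2 ^ j" 0] by (simp add: power_mult)

lemma integral_abs_dil:
  fixes k :: "'a::euclidean_space \<Rightarrow> real"
  assumes [measurable]: "borel_fun k"
  shows "(LINT x|lborel. \<bar>dil j k x\<bar>) = (LINT x|lborel. \<bar>k x\<bar>)"
proof -
  have "(\<lambda>x. \<bar>dil j k x\<bar>) = dil j (\<lambda>x. \<bar>k x\<bar>)" by (auto simp: dil_def abs_mult)
  then show ?thesis using integral_dil[of "\<lambda>x. \<bar>k x\<bar>" j] by simp
qed

lemma ennreal_tendsto_0I:
  fixes a :: "nat \<Rightarrow> ennreal"
  assumes "\<And>e. e > 0 \<Longrightarrow> \<forall>\<^sub>F n in sequentially. a n \<le> ennreal e"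
  shows "a \<longlonglongrightarrow> 0"
proof (rule order_tendstoI)
  fix b :: ennreal assume "0 < b"
  then obtain e where e: "0 < e" "ennreal e < b"
  proof (cases b)
    case (real r)
    then show ?thesis using that[of "r/2"] \<open>0 < b\<close> by (auto simp: ennreal_less_iff)
  next
    case top
    then show ?thesis using that[of 1] by simp
  qed
  show "\<forall>\<^sub>F n in sequentially. a n < b"
    using assms[OF e(1)] by eventually_elim (use e(2) in order)
qed simp

text \<open>At scale \<open>2\<^sup>-\<^sup>j\<close> the error is an average of translation errors over vectors of that size.\<close>

lemma mollify_tendsto:
  fixes f :: "'a::euclidean_space \<Rightarrow> real"
  assumes f: "locint f" and k: "kern k" and k1: "(LINT z|lborel. k z) = 1"
  shows "(\<lambda>j. L1n (cball 0 R) (\<lambda>x. conv f (dil j k) x - f x)) \<longlonglongrightarrow> 0"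
proof (rule ennreal_tendsto_0I)
  fix e :: real assume e: "e > 0"
  obtain r M where r: "r > 0" "\<And>z. norm z > r \<Longrightarrow> k z = 0" using kernE[OF k] by metis
  define I where "I = (LINT z|lborel. \<bar>k z\<bar>)"
  have I0: "I \<ge> 0" unfolding I_def by (intro integral_nonneg_AE) auto
  define e' where "e' = e / (I + 1)"
  have e': "e' > 0" using e I0 by (simp add: e'_def)
  obtain d where d: "d > 0" "\<And>y. norm y < d \<Longrightarrow> L1n (cball 0 R) (\<lambda>x. f (x - y) - f x) \<le> ennreal e'"
    using locint_translation[OF f e', of R] by blast
  have "(\<lambda>j. r * (1/2) ^ j) \<longlonglongrightarrow> 0"
    by (intro tendsto_mult_right_zero LIMSEQ_power_zero) simp
  then have "\<forall>\<^sub>F j in sequentially. r * (1/2) ^ j < d"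
    using order_tendstoD(2)[of _ 0] d(1) by blast
  then show "\<forall>\<^sub>F j in sequentially. L1n (cball 0 R) (\<lambda>x. conv f (dil j k) x - f x) \<le> ennreal e"
  proof eventually_elim
    case (elim j)
    have "L1n (cball 0 R) (\<lambda>x. conv f (dil j k) x - f x)
        \<le> ennreal (LINT z|lborel. \<bar>dil j k z\<bar>) * ennreal e'"
    proof (rule L1n_conv_diff_le[OF f kern_dil[OF k]])
      show "\<And>z. norm z > r / 2 ^ j \<Longrightarrow> dil j k z = 0"
        using dil_zero_outside[of r k] r(2) by blast
      show "(LINT z|lborel. dil j k z) = 1" using k1 integral_dil[OF kern_borel[OF k], of j] by simp
      show "L1n (cball 0 R) (\<lambda>x. f (x - y) - f x) \<le> ennreal e'" if "norm y \<le> r / 2 ^ j" for y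
        using that elim by (intro d(2)) (simp add: power_divide)
    qed
    also have "\<dots> = ennreal (I * e')"
      using I0 e' integral_abs_dil[OF kern_borel[OF k], of j] by (simp add: I_def ennreal_mult)
    also have "\<dots> \<le> ennreal e"
      using I0 e by (intro ennreal_leI) (simp add: e'_def field_simps)
    finally show ?case .
  qed
qed

definition moll :: "'a::euclidean_space \<Rightarrow> real"
  where "moll x = bump x / (LINT z|lborel. bump (z::'a))"

lemma bump_facts:
  "tfun (bump :: 'a::euclidean_space \<Rightarrow> real)" "(LINT z|lborel. (bump (z::'a))) > 0"
proof -
  show t: "tfun (bump :: 'a \<Rightarrow> real)"
    unfolding tfun_def using smooth_bump bump_eq_0_iff
    by (metis less_imp_le)
  have i: "integrable lborel (bump :: 'a \<Rightarrow> real)" by (rule kern_integrable[OF tfun_kern[OF t]])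
  have "(LINT z|lborel. (bump (z::'a))) \<noteq> 0"
  proof
    assume "(LINT z|lborel. (bump (z::'a))) = 0"
    then have "AE z::'a in lborel. bump z = 0"
      using integral_nonneg_eq_0_iff_AE[OF i] bump_nonneg by auto
    then have "AE z::'a in lborel. z \<notin> ball 0 1"
      by eventually_elim (auto simp: bump_eq_0_iff)
    then have "emeasure lborel (ball (0::'a) 1) = 0"
      by (subst (asm) AE_iff_measurable[of "ball 0 1"]) auto
    then show False
      using emeasure_lborel_ball_finite[of "0::'a" 1] open_not_negligible[of "ball (0::'a) 1"]
      by (simp add: negligible_iff_null_sets null_sets_def)
  qed
  moreover have "(LINT z|lborel. (bump (z::'a))) \<ge> 0"
    by (intro integral_nonneg_AE) (auto simp: bump_nonneg)
  ultimately show "(LINT z|lborel. (bump (z::'a))) > 0" by simp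
qed

lemma moll_facts:
  "tfun (moll :: 'a::euclidean_space \<Rightarrow> real)" "kern (moll :: 'a \<Rightarrow> real)"
  "(LINT z|lborel. (moll (z::'a))) = 1" "moll (x::'a) \<ge> 0" "norm (x::'a) \<ge> 1 \<Longrightarrow> moll x = 0"
proof -
  have e: "moll = (\<lambda>x::'a. (1 / (LINT z|lborel. (bump (z::'a)))) * bump x)"
    by (auto simp: moll_def)
  show t: "tfun (moll :: 'a \<Rightarrow> real)"
    using bump_facts(1)[where 'a='a] unfolding tfun_def e by (intro conjI smooth_cmult) auto
  then show "kern (moll :: 'a \<Rightarrow> real)" by (rule tfun_kern)
  show "(LINT z|lborel. (moll (z::'a))) = 1" unfolding e using bump_facts(2)[where 'a='a] by simp
  show "moll x \<ge> 0" using bump_facts(2)[where 'a='a] bump_nonneg[of x] by (simp add: moll_def)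
  show "norm (x::'a) \<ge> 1 \<Longrightarrow> moll x = 0" by (simp add: moll_def bump_eq_0_iff)
qed

lemma AE_cballI:
  assumes "\<And>n. AE x in lborel. x \<in> cball 0 (real n) \<longrightarrow> P x"
  shows "AE x in lborel. P (x::'a::euclidean_space)"
proof -
  have "AE x in lborel. \<forall>n. x \<in> cball 0 (real n) \<longrightarrow> P x"
    by (subst AE_all_countable) (blast intro: assms)
  then show ?thesis
  proof eventually_elim
    case (elim x)
    then show ?case using real_arch_simple[of "norm x"] by auto
  qed
qed

lemma L1n_zero_imp_AE:
  fixes f g :: "'a::euclidean_space \<Rightarrow> real"
  assumes [measurable]: "borel_fun f" "borel_fun g"
    and "\<And>n. L1n (cball 0 (real n)) (\<lambda>x. f x - g x) = 0"
  shows "AE x in lborel. f x = g x"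
proof (rule AE_cballI)
  fix n
  show "AE x in lborel. x \<in> cball 0 (real n) \<longrightarrow> f x = g x"
    using assms(3)[of n] by (subst (asm) L1n_eq_0) auto
qed

lemma L1n_minus_commute: "L1n S (\<lambda>x. f x - g x) = L1n S (\<lambda>x. g x - f x)"
  unfolding L1n_def by (simp add: abs_minus_commute)

lemma L1n_diff_triangle:
  assumes [measurable]: "borel_fun f" "borel_fun g"
    "borel_fun h" "S \<in> sets borel"
  shows "L1n S (\<lambda>x. f x - h x) \<le> L1n S (\<lambda>x. f x - g x) + L1n S (\<lambda>x. g x - h x)"
  using L1n_triangle[of "\<lambda>x. f x - g x" "\<lambda>x. g x - h x" S] by simp

lemma L1_limit_unique:
  fixes f g :: "'a::euclidean_space \<Rightarrow> real"
  assumes [measurable]: "borel_fun f" "borel_fun g"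
    "\<And>n. borel_fun (u n)" "S \<in> sets borel"
    and f: "(\<lambda>n. L1n S (\<lambda>x. u n x - f x)) \<longlonglongrightarrow> 0" and g: "(\<lambda>n. L1n S (\<lambda>x. u n x - g x)) \<longlonglongrightarrow> 0"
  shows "L1n S (\<lambda>x. f x - g x) = 0"
proof -
  have "(\<lambda>n. L1n S (\<lambda>x. u n x - f x) + L1n S (\<lambda>x. u n x - g x)) \<longlonglongrightarrow> 0 + 0"
    by (intro tendsto_add f g)
  moreover have "L1n S (\<lambda>x. f x - g x) \<le> L1n S (\<lambda>x. u n x - f x) + L1n S (\<lambda>x. u n x - g x)" for n
    using L1n_diff_triangle[of f "u n" g S] L1n_minus_commute[of S f "u n"] by simp
  ultimately have "L1n S (\<lambda>x. f x - g x) \<le> 0"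
    by (intro tendsto_lowerbound[of _ 0 sequentially]) (auto simp: always_eventually)
  then show ?thesis by simp
qed

section \<open>Weak derivatives\<close>

text \<open>Words of directions replace multi-indices and Borel functions replace Lebesgue measurable ones;
  up to null sets this is the notion of generalized derivative from the definitions.\<close>

definition wderiv :: "'a::euclidean_space list \<Rightarrow> ('a \<Rightarrow> real) \<Rightarrow> ('a \<Rightarrow> real) \<Rightarrow> bool"
  where "wderiv w f g \<longleftrightarrow> locint f \<and> locint g \<and>
    (\<forall>\<psi>. tfun \<psi> \<longrightarrow> (LINT z|lborel. f z * pderivs w \<psi> z) = (-1) ^ length w * (LINT z|lborel. g z * \<psi> z))"

lemma integral_lebesgue_rep:
  fixes f g :: "'a::euclidean_space \<Rightarrow> real"
  assumes "f \<in> L1_loc" "g =\<^sub>a f" "borel_fun g" "borel_fun h"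
  shows "(LINT z|lebesgue. f z * h z) = (LINT z|lborel. g z * h z)"
proof -
  have [measurable]: "f \<in> borel_measurable lebesgue" using assms(1) by (rule L1_loc_lebesgue_measurable)
  have [measurable]: "g \<in> borel_measurable lebesgue" "h \<in> borel_measurable lebesgue"
    using assms(3,4) by (auto intro: measurable_completion)
  have "(LINT z|lebesgue. f z * h z) = (LINT z|lebesgue. g z * h z)"
    using assms(2) by (intro integral_cong_AE) (auto simp: ae_eq_def elim!: eventually_mono)
  also have "\<dots> = (LINT z|lborel. g z * h z)"
    by (intro integral_completion) (use assms(3,4) in auto)
  finally show ?thesis .
qed

lemma is_weak_deriv_iff_wderiv:
  fixes f g :: "'a::euclidean_space \<Rightarrow> real"
  assumes f: "f' =\<^sub>a f" "borel_fun f'" and g: "g' =\<^sub>a g" "borel_fun g'"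
  shows "is_weak_deriv \<alpha> f g \<longleftrightarrow> f \<in> L1_loc \<and> g \<in> L1_loc \<and> wderiv (word_of \<alpha>) f' g'"
proof -
  have "f \<in> L1_loc \<Longrightarrow> locint f'" "g \<in> L1_loc \<Longrightarrow> locint g'"
    using L1_loc_imp_locint f g by auto
  moreover have "(LINT z|lebesgue. f z * classical_deriv \<alpha> \<phi> z) = (LINT z|lborel. f' z * pderivs (word_of \<alpha>) \<phi> z)"
    "(LINT z|lebesgue. g z * \<phi> z) = (LINT z|lborel. g' z * \<phi> z)"
    if "f \<in> L1_loc" "g \<in> L1_loc" "tfun \<phi>" for \<phi>
    using that f g tfun_pderivs[OF that(3) set_word_of, of \<alpha>]
    by (auto simp: classical_deriv_word_of tfun_def intro!: integral_lebesgue_rep smooth_borel)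
  ultimately show ?thesis
    unfolding is_weak_deriv_def wderiv_def by (auto simp: tfun_iff length_word_of)
qed

lemma wderiv_mset:
  assumes "wderiv w f g" "set w \<subseteq> Basis" "mset w = mset v"
  shows "wderiv v f g"
  using assms pderivs_mset_cong[OF _ assms(2,3)] mset_eq_length[OF assms(3)]
  by (auto simp: wderiv_def tfun_def)

lemma tfun_reflect:
  assumes "tfun k" shows "tfun (\<lambda>y. k (x - y))"
proof -
  obtain R where R: "\<And>x. norm x > R \<Longrightarrow> k x = 0" using assms by (auto simp: tfun_def)
  have "k (x - y) = 0" if "norm y > R + norm x" for y
    using that norm_triangle_ineq2[of y x] by (intro R) (simp add: norm_minus_commute)
  moreover have "smooth (\<lambda>y. k (x - y))"
    using smooth_affine[of k x "-1"] assms by (simp add: tfun_def)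
  ultimately show ?thesis unfolding tfun_def by blast
qed

text \<open>Mollification turns weak derivatives into classical ones.\<close>

lemma wderiv_conv:
  assumes w: "wderiv w f g" "set w \<subseteq> Basis" and k: "tfun k"
  shows "pderivs w (conv f k) = conv g k"
proof
  fix x
  have l: "locint f" "locint g" using w by (auto simp: wderiv_def)
  have kb: "borel_fun k" "borel_fun (pderivs w k)"
    using k tfun_pderivs[OF k w(2)] by (auto simp: tfun_def intro: smooth_borel)
  have p: "pderivs w (\<lambda>y. k (x - y)) = (\<lambda>y. (-1) ^ length w * pderivs w k (x - y))"
    using pderivs_affine[OF _ w(2), of k x "-1"] k by (simp add: tfun_def)
  have "pderivs w (conv f k) x = (LINT y|lborel. f y * pderivs w k (x - y))"
    unfolding pderivs_conv[OF l(1) k w(2)] by (rule conv_alt[OF locint_borel[OF l(1)] kb(2)])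
  also have "\<dots> = (LINT y|lborel. (-1) ^ length w * (f y * pderivs w (\<lambda>y. k (x - y)) y))"
    unfolding p by (intro Bochner_Integration.integral_cong) (auto simp: algebra_simps simp flip: power_add power_mult_distrib)
  also have "\<dots> = (-1) ^ length w * (LINT y|lborel. f y * pderivs w (\<lambda>y. k (x - y)) y)" by simp
  also have "\<dots> = (-1) ^ length w * ((-1) ^ length w * (LINT y|lborel. g y * k (x - y)))"
    using w(1) tfun_reflect[OF k, of x] by (simp add: wderiv_def)
  also have "\<dots> = conv g k x"
    unfolding conv_alt[OF locint_borel[OF l(2)] kb(1)] by (simp flip: mult.assoc power_mult_distrib)
  finally show "pderivs w (conv f k) x = conv g k x" .
qed

text \<open>Both sides are limits of the common mollifications.\<close>

lemma conv_determines:
  fixes f g :: "'a::euclidean_space \<Rightarrow> real"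
  assumes f: "locint f" and g: "locint g" and eq: "\<And>j. conv f (dil j moll) = conv g (dil j moll)"
  shows "AE x in lborel. f x = g x"
proof (rule L1n_zero_imp_AE)
  show fm: "borel_fun f" and gm: "borel_fun g"
    using f g by (auto intro: locint_borel)
  note m = moll_facts(2,3)[where 'a='a]
  have "borel_fun (conv f (dil j moll))" for j
    by (intro locint_borel locint_conv f kern_dil m)
  moreover have "(\<lambda>j. L1n (cball 0 R) (\<lambda>x. conv f (dil j moll) x - f x)) \<longlonglongrightarrow> 0" for R
    by (rule mollify_tendsto[OF f m])
  moreover have "(\<lambda>j. L1n (cball 0 R) (\<lambda>x. conv f (dil j moll) x - g x)) \<longlonglongrightarrow> 0" for R
    unfolding eq by (rule mollify_tendsto[OF g m])
  ultimately show "L1n (cball 0 (real n)) (\<lambda>x. f x - g x) = 0" for n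
    using fm gm by (intro L1_limit_unique[where u="\<lambda>j. conv f (dil j moll)"]) auto
qed

text \<open>The mollifications of two generalized derivatives are the same classical derivative.\<close>

lemma wderiv_unique:
  assumes "wderiv w f g" "wderiv w f h" "set w \<subseteq> Basis"
  shows "AE x in lborel. g x = h x"
proof (rule conv_determines)
  show "locint g" "locint h" using assms by (auto simp: wderiv_def)
  show "conv g (dil j moll) = conv h (dil j moll)" for j
    using wderiv_conv[OF assms(1,3)] wderiv_conv[OF assms(2,3)] tfun_dil moll_facts(1) by metis
qed

text \<open>Convolving the constant \<open>1\<close> gives a constant, whose derivative is the integral of the
  derivative of the kernel.\<close>

lemma integral_pderiv_dir_zero:
  fixes k :: "'a::euclidean_space \<Rightarrow> real"
  assumes k: "tfun k" and b: "b \<in> Basis"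
  shows "(LINT z|lborel. pderiv_dir b k z) = 0"
proof -
  have l: "locint (\<lambda>_::'a. 1)" by (intro locint_continuous) simp
  have c: "conv (\<lambda>_. 1) h = (\<lambda>x. LINT z|lborel. h z)" for h :: "'a \<Rightarrow> real"
    by (simp add: conv_def fun_eq_iff)
  have "pderiv_dir b (conv (\<lambda>_. 1) k) 0 = conv (\<lambda>_. 1) (pderiv_dir b k) 0"
    by (simp add: pderiv_dir_conv[OF l k b])
  then show ?thesis unfolding c pderiv_dir_const by simp
qed

lemma tfun_mult:
  assumes "smooth f" "tfun k" shows "tfun (\<lambda>x. f x * k x)"
  using assms by (auto simp: tfun_def intro: smooth_mult)

lemma integration_by_parts:
  assumes f: "smooth f" and k: "tfun k" and b: "b \<in> Basis"
  shows "(LINT z|lborel. f z * pderiv_dir b k z) = - (LINT z|lborel. pderiv_dir b f z * k z)"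
proof -
  have e: "pderiv_dir b (\<lambda>x. f x * k x) = (\<lambda>x. f x * pderiv_dir b k x + pderiv_dir b f x * k x)"
    using f k by (intro ext pderiv_dir_mult) (auto simp: tfun_def smooth_differentiable)
  have i: "integrable lborel (\<lambda>x. f x * pderiv_dir b k x)" "integrable lborel (\<lambda>x. pderiv_dir b f x * k x)"
    by (intro kern_integrable tfun_kern tfun_mult f k tfun_pderiv_dir smooth_pderiv_dir b)+
  show ?thesis
    using integral_pderiv_dir_zero[OF tfun_mult[OF f k] b] i unfolding e by simp
qed

lemma wderiv_smooth:
  assumes f: "smooth f" and w: "set w \<subseteq> Basis"
  shows "wderiv w f (pderivs w f)"
proof -
  have "(LINT z|lborel. f z * pderivs w \<psi> z) = (-1) ^ length w * (LINT z|lborel. pderivs w f z * \<psi> z)"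
    if "tfun \<psi>" for \<psi>
    using f w
  proof (induction w arbitrary: f)
    case (Cons b w)
    have "(LINT z|lborel. f z * pderivs (b # w) \<psi> z) = - (LINT z|lborel. pderiv_dir b f z * pderivs w \<psi> z)"
      using integration_by_parts[OF Cons.prems(1) tfun_pderivs[OF that]] Cons.prems by simp
    also have "(LINT z|lborel. pderiv_dir b f z * pderivs w \<psi> z)
      = (-1) ^ length w * (LINT z|lborel. pderivs w (pderiv_dir b f) z * \<psi> z)"
      using Cons.prems by (intro Cons.IH smooth_pderiv_dir) auto
    also have "pderivs w (pderiv_dir b f) = pderivs (b # w) f"
      using pderivs_rotate[OF Cons.prems] by simp
    finally show ?case by simp
  qed simp
  then show ?thesis
    unfolding wderiv_def using f smooth_pderivs[OF f w] by (auto intro: locint_continuous smooth_continuous)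
qed

lemma locint_kern_integrable:
  fixes f :: "'a::euclidean_space \<Rightarrow> real"
  assumes f: "locint f" and k: "kern k"
  shows "integrable lborel (\<lambda>z. f z * k z)"
proof -
  have "kern (\<lambda>z. k (- z))"
    unfolding kern_def
  proof
    show "continuous_on UNIV (\<lambda>z. k (- z))"
      by (rule continuous_on_compose2[where g=k and t=UNIV])
        (use k in \<open>auto simp: kern_def intro!: continuous_intros\<close>)
    show "\<exists>R. \<forall>x. norm x > R \<longrightarrow> k (- x) = 0"
      using k unfolding kern_def by (metis norm_minus_cancel)
  qed
  from kern_integrable_right[OF f this, of 0] show ?thesis by simp
qed

lemma integral_kern_tendsto:
  fixes f :: "'a::euclidean_space \<Rightarrow> real"
  assumes f: "locint f" "\<And>n. locint (u n)" and k: "kern k"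
    and lim: "\<And>R. (\<lambda>n. L1n (cball 0 R) (\<lambda>x. u n x - f x)) \<longlonglongrightarrow> 0"
  shows "(\<lambda>n. LINT z|lborel. u n z * k z) \<longlonglongrightarrow> (LINT z|lborel. f z * k z)"
proof -
  obtain R M where RM: "R > 0" "M > 0" "\<And>x. norm x > R \<Longrightarrow> k x = 0" "\<And>x. \<bar>k x\<bar> \<le> M"
    using kernE[OF k] by blast
  have [measurable]: "cball (0::'a) R \<in> sets borel" by simp
  have [measurable]: "borel_fun f" "\<And>n. borel_fun (u n)" "borel_fun k"
    using f k by (auto intro: locint_borel kern_borel)
  note i = locint_kern_integrable[OF _ k]
  have bd: "ennreal \<bar>(LINT z|lborel. u n z * k z) - (LINT z|lborel. f z * k z)\<bar>
      \<le> ennreal M * L1n (cball 0 R) (\<lambda>x. u n x - f x)" for n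
  proof -
    have ii: "integrable lborel (\<lambda>z. (u n z - f z) * k z)"
      by (intro i locint_diff f)
    have "(LINT z|lborel. u n z * k z) - (LINT z|lborel. f z * k z) = (LINT z|lborel. (u n z - f z) * k z)"
      using i[OF f(1)] i[OF f(2)[of n]] by (simp add: left_diff_distrib)
    then have "ennreal \<bar>(LINT z|lborel. u n z * k z) - (LINT z|lborel. f z * k z)\<bar>
      \<le> (\<integral>\<^sup>+z. ennreal (norm ((u n z - f z) * k z)) \<partial>lborel)"
      using integral_norm_bound_ennreal[OF ii] by simp
    also have "\<dots> \<le> (\<integral>\<^sup>+z. ennreal M * (ennreal \<bar>u n z - f z\<bar> * indicator (cball 0 R) z) \<partial>lborel)"
    proof (intro nn_integral_mono)
      fix z
      show "ennreal (norm ((u n z - f z) * k z)) \<le> ennreal M * (ennreal \<bar>u n z - f z\<bar> * indicator (cball 0 R) z)"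
      proof (cases "norm z \<le> R")
        case True
        have "\<bar>u n z - f z\<bar> * \<bar>k z\<bar> \<le> \<bar>u n z - f z\<bar> * M" by (intro mult_left_mono RM) auto
        then show ?thesis using True RM(2)
          by (auto simp: abs_mult ennreal_mult'[symmetric] mult.commute intro: ennreal_leI)
      qed (simp add: RM)
    qed
    also have "\<dots> = ennreal M * L1n (cball 0 R) (\<lambda>x. u n x - f x)"
      unfolding L1n_def by (rule nn_integral_cmult) measurable
    finally show ?thesis .
  qed
  have "(\<lambda>n. ennreal M * L1n (cball 0 R) (\<lambda>x. u n x - f x)) \<longlonglongrightarrow> ennreal M * 0"
    by (intro ennreal_tendsto_cmult lim) simp
  then have L: "(\<lambda>n. ennreal M * L1n (cball 0 R) (\<lambda>x. u n x - f x)) \<longlonglongrightarrow> 0" by simp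
  have "(\<lambda>n. ennreal \<bar>(LINT z|lborel. u n z * k z) - (LINT z|lborel. f z * k z)\<bar>) \<longlonglongrightarrow> 0"
    by (rule tendsto_sandwich[OF _ _ tendsto_const L]) (simp_all add: bd)
  then have "(\<lambda>n. ennreal \<bar>(LINT z|lborel. u n z * k z) - (LINT z|lborel. f z * k z)\<bar>) \<longlonglongrightarrow> ennreal 0"
    by simp
  then have "(\<lambda>n. \<bar>(LINT z|lborel. u n z * k z) - (LINT z|lborel. f z * k z)\<bar>) \<longlonglongrightarrow> 0"
    by (subst (asm) tendsto_ennreal_iff) auto
  then show ?thesis
    by (subst Lim_null) (rule tendsto_rabs_zero_cancel)
qed

text \<open>The defining identity is continuous with respect to local convergence in \<open>L\<^sub>1\<close>.\<close>

lemma wderiv_limit: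
  assumes "locint f" "locint g" "\<And>n. wderiv w (u n) (v n)" "set w \<subseteq> Basis"
    and "\<And>R. (\<lambda>n. L1n (cball 0 R) (\<lambda>x. u n x - f x)) \<longlonglongrightarrow> 0"
    and "\<And>R. (\<lambda>n. L1n (cball 0 R) (\<lambda>x. v n x - g x)) \<longlonglongrightarrow> 0"
  shows "wderiv w f g"
  unfolding wderiv_def
proof (intro conjI assms(1,2) allI impI)
  fix \<psi> :: "'a \<Rightarrow> real" assume t: "tfun \<psi>"
  have l: "\<And>n. locint (u n)" "\<And>n. locint (v n)" using assms(3) by (auto simp: wderiv_def)
  have "(\<lambda>n. LINT z|lborel. u n z * pderivs w \<psi> z) \<longlonglongrightarrow> (LINT z|lborel. f z * pderivs w \<psi> z)"
    by (intro integral_kern_tendsto assms l tfun_kern tfun_pderivs t)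
  moreover have "(\<lambda>n. (-1) ^ length w * (LINT z|lborel. v n z * \<psi> z)) \<longlonglongrightarrow> (-1) ^ length w * (LINT z|lborel. g z * \<psi> z)"
    by (intro tendsto_mult_left integral_kern_tendsto assms l tfun_kern t)
  moreover have "(LINT z|lborel. u n z * pderivs w \<psi> z) = (-1) ^ length w * (LINT z|lborel. v n z * \<psi> z)" for n
    using assms(3)[of n] t by (auto simp: wderiv_def)
  ultimately show "(LINT z|lborel. f z * pderivs w \<psi> z) = (-1) ^ length w * (LINT z|lborel. g z * \<psi> z)"
    by (simp add: LIMSEQ_unique)
qed

subsection \<open>Weighted Sobolev spaces\<close>

lemma wderiv_lincomb:
  assumes "wderiv w f g" "wderiv w f' g'" "set w \<subseteq> Basis"
  shows "wderiv w (\<lambda>z. a * f z + b * f' z) (\<lambda>z. a * g z + b * g' z)"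
  unfolding wderiv_def
proof (intro conjI allI impI)
  have l: "locint f" "locint g" "locint f'" "locint g'" using assms by (auto simp: wderiv_def)
  show "locint (\<lambda>z. a * f z + b * f' z)" "locint (\<lambda>z. a * g z + b * g' z)"
    by (intro locint_add locint_cmult l)+
  fix \<psi> :: "'a \<Rightarrow> real" assume t: "tfun \<psi>"
  have e: "(LINT z|lborel. (a * u z + b * v z) * k z) = a * (LINT z|lborel. u z * k z) + b * (LINT z|lborel. v z * k z)"
    if "locint u" "locint v" "tfun k" for u v k :: "'a \<Rightarrow> real"
  proof -
    have "integrable lborel (\<lambda>z. h z * k z)" if "locint h" for h
      using locint_kern_integrable[OF that tfun_kern[OF \<open>tfun k\<close>]] .
    from this[OF that(1)] this[OF that(2)] show ?thesis
      by (simp add: distrib_right mult.assoc)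
  qed
  have "(LINT z|lborel. h z * pderivs w \<psi> z) = (-1) ^ length w * (LINT z|lborel. h' z * \<psi> z)" if "wderiv w h h'" for h h'
    using that t by (auto simp: wderiv_def)
  from this[OF assms(1)] this[OF assms(2)]
  show "(LINT z|lborel. (a * f z + b * f' z) * pderivs w \<psi> z) = (-1) ^ length w * (LINT z|lborel. (a * g z + b * g' z) * \<psi> z)"
    unfolding e[OF l(1,3) tfun_pderivs[OF t assms(3)]] e[OF l(2,4) t] by (simp add: algebra_simps)
qed

definition Dw :: "'a::euclidean_space list \<Rightarrow> ('a \<Rightarrow> real) \<Rightarrow> 'a \<Rightarrow> real"
  where "Dw w f = rep (weak_deriv (index_of w) f)"

lemma weak_deriv_works:
  assumes "\<exists>g. is_weak_deriv \<alpha> f g"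
  shows "is_weak_deriv \<alpha> f (weak_deriv \<alpha> f)"
  unfolding weak_deriv_def by (rule someI_ex[OF assms])

lemma is_weak_deriv_L1_loc: "is_weak_deriv \<alpha> f g \<Longrightarrow> f \<in> L1_loc \<and> g \<in> L1_loc"
  by (simp add: is_weak_deriv_def)

lemma W_space_wderiv:
  assumes f: "f \<in> W_space l \<gamma>" and w: "set w \<subseteq> Basis" "length w \<le> l"
  shows "wderiv w (rep f) (Dw w f)"
    and "wnorm \<gamma> (Dw w f) \<le> W_norm l \<gamma> f"
proof -
  have i: "index_of w \<in> multi_indices l" using index_of_in_multi_indices[OF w] .
  have wd: "is_weak_deriv (index_of w) f (weak_deriv (index_of w) f)"
    using f i by (intro weak_deriv_works) (auto simp: W_space_def)
  note L = conjunct1[OF is_weak_deriv_L1_loc[OF wd]] conjunct2[OF is_weak_deriv_L1_loc[OF wd]]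
  have "wderiv (word_of (index_of w)) (rep f) (Dw w f)"
    using is_weak_deriv_iff_wderiv[OF rep(2)[OF L(1)] locint_borel[OF rep(1)[OF L(1)]]
        rep(2)[OF L(2)] locint_borel[OF rep(1)[OF L(2)]]] wd
    unfolding Dw_def by blast
  then show "wderiv w (rep f) (Dw w f)"
    by (rule wderiv_mset[OF _ set_word_of mset_word_of_index_of[OF w(1)]])
  have "wnorm \<gamma> (Dw w f) = (\<integral>\<^sup>+z. ennreal \<bar>\<gamma> z * Dw w f z\<bar> \<partial>lebesgue)"
    by (rule nn_integral_completion[symmetric])
  also have "\<dots> = (\<integral>\<^sup>+z. ennreal \<bar>\<gamma> z * weak_deriv (index_of w) f z\<bar> \<partial>lebesgue)"
    using rep(2)[OF L(2)] unfolding Dw_def ae_eq_def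
    by (intro nn_integral_cong_AE) (auto elim!: eventually_mono)
  also have "\<dots> \<le> W_norm l \<gamma> f"
    unfolding W_norm_def
    by (rule member_le_sum[OF i, where f="\<lambda>\<alpha>. \<integral>\<^sup>+z. ennreal \<bar>\<gamma> z * weak_deriv \<alpha> f z\<bar> \<partial>lebesgue"])
      (auto simp: finite_multi_indices)
  finally show "wnorm \<gamma> (Dw w f) \<le> W_norm l \<gamma> f" .
qed

text \<open>It suffices to exhibit candidates for the derivatives; the norm uses the chosen weak derivatives,
  which agree with the candidates almost everywhere.\<close>

lemma W_spaceI:
  fixes F :: "'a::euclidean_space \<Rightarrow> real"
  assumes F: "\<And>\<alpha>. \<alpha> \<in> multi_indices l \<Longrightarrow> wderiv (word_of \<alpha>) F (G \<alpha>)"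
    and C: "\<And>\<alpha>. \<alpha> \<in> multi_indices l \<Longrightarrow> wnorm \<gamma> (G \<alpha>) \<le> C" "C < \<infinity>"
  shows "F \<in> W_space l \<gamma>"
    and "W_norm l \<gamma> F \<le> of_nat (card (multi_indices l :: ('a \<Rightarrow> nat) set)) * C"
proof -
  have wd: "is_weak_deriv \<alpha> F (G \<alpha>)" if "\<alpha> \<in> multi_indices l" for \<alpha>
  proof -
    have "locint F" "locint (G \<alpha>)" using F[OF that] by (auto simp: wderiv_def)
    then show ?thesis
      using is_weak_deriv_iff_wderiv[of F F "G \<alpha>" "G \<alpha>" \<alpha>] F[OF that]
      by (auto simp: ae_eq_refl locint_imp_L1_loc locint_borel)
  qed
  have "(\<lambda>b::'a. 0) \<in> multi_indices l" by (simp add: multi_indices_def)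
  from wd[OF this] have FL: "F \<in> L1_loc" by (simp add: is_weak_deriv_def)
  have e: "(\<integral>\<^sup>+z. ennreal \<bar>\<gamma> z * weak_deriv \<alpha> F z\<bar> \<partial>lebesgue) \<le> C" if a: "\<alpha> \<in> multi_indices l" for \<alpha>
  proof -
    have w2: "is_weak_deriv \<alpha> F (weak_deriv \<alpha> F)" using wd[OF a] by (intro weak_deriv_works) auto
    then have L: "weak_deriv \<alpha> F \<in> L1_loc" by (simp add: is_weak_deriv_def)
    have Fb: "borel_fun F" using F[OF a] by (auto simp: wderiv_def locint_borel)
    have "wderiv (word_of \<alpha>) F (rep (weak_deriv \<alpha> F))"
      using is_weak_deriv_iff_wderiv[OF ae_eq_refl Fb rep(2)[OF L] locint_borel[OF rep(1)[OF L]]] w2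
      by blast
    then have "AE x in lborel. rep (weak_deriv \<alpha> F) x = G \<alpha> x"
      by (rule wderiv_unique[OF _ F[OF a] set_word_of])
    then have "AE x in lebesgue. weak_deriv \<alpha> F x = G \<alpha> x"
      using rep(2)[OF L] unfolding ae_eq_def AE_lebesgue_iff by eventually_elim simp
    then have "(\<integral>\<^sup>+z. ennreal \<bar>\<gamma> z * weak_deriv \<alpha> F z\<bar> \<partial>lebesgue) = (\<integral>\<^sup>+z. ennreal \<bar>\<gamma> z * G \<alpha> z\<bar> \<partial>lebesgue)"
      by (intro nn_integral_cong_AE) (auto elim!: eventually_mono)
    also have "\<dots> \<le> C" using C(1)[OF a] by (subst nn_integral_completion)
    finally show ?thesis .
  qed
  show "W_norm l \<gamma> F \<le> of_nat (card (multi_indices l :: ('a \<Rightarrow> nat) set)) * C"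
    unfolding W_norm_def by (rule order_trans[OF sum_mono[OF e]]) auto
  also have "\<dots> < \<infinity>" using C(2) by (simp add: ennreal_mult_less_top ennreal_of_nat_eq_real_of_nat)
  finally show "F \<in> W_space l \<gamma>"
    using FL wd by (auto simp: W_space_def)
qed

section \<open>Weights\<close>

subsection \<open>Cubes\<close>

abbreviation cube :: "'a::euclidean_space \<Rightarrow> real \<Rightarrow> 'a set"
  where "cube a r \<equiv> box a (a + r *\<^sub>R One)"

lemma mem_cube: "x \<in> cube a r \<longleftrightarrow> (\<forall>i\<in>Basis. a \<bullet> i < x \<bullet> i \<and> x \<bullet> i < a \<bullet> i + r)"
  by (simp add: mem_box inner_add_left inner_sum_left inner_Basis)

lemma emeasure_cube:
  fixes a :: "'a::euclidean_space"
  assumes "r \<ge> 0"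
  shows "emeasure lborel (cube a r) = ennreal (r ^ DIM('a))"
proof -
  have "emeasure lborel (cube a r) = (\<Prod>b\<in>(Basis::'a set). (a + r *\<^sub>R One - a) \<bullet> b)"
    using assms by (intro emeasure_lborel_box) (simp add: inner_add_left)
  also have "(\<Prod>b\<in>(Basis::'a set). (a + r *\<^sub>R One - a) \<bullet> b) = r ^ DIM('a)" by simp
  finally show ?thesis .
qed

lemma measure_cube:
  fixes a :: "'a::euclidean_space"
  assumes "r \<ge> 0"
  shows "measure lebesgue (cube a r) = r ^ DIM('a)"
  using emeasure_cube[OF assms, of a] assms by (simp add: measure_def)

lemma side_length_cube:
  fixes a :: "'a::euclidean_space"
  assumes r: "r > 0"
  shows "side_length (cube a r) = r"
  unfolding side_length_def
proof (rule the_equality)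
  fix s assume "s > 0 \<and> (\<exists>b. cube a r = cube b s)"
  then obtain b where s: "s > 0" and e: "cube a r = cube b s" by blast
  have "r ^ DIM('a) = s ^ DIM('a)"
    using measure_cube[of r a] measure_cube[of s b] r s e by simp
  then show "s = r" using r s by (simp add: power_eq_iff_eq_base)
qed (use r in auto)

lemma is_cube_cube: "r > 0 \<Longrightarrow> is_cube (cube a r)"
  by (auto simp: is_cube_def)

subsection \<open>The Muckenhoupt condition\<close>

text \<open>The absolute value makes the Borel representative of a weight nonnegative everywhere.\<close>

definition wrep :: "('a::euclidean_space \<Rightarrow> real) \<Rightarrow> 'a \<Rightarrow> real"
  where "wrep \<gamma> z = \<bar>rep \<gamma> z\<bar>"

lemma wrep:
  fixes \<gamma> :: "'a::euclidean_space \<Rightarrow> real"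
  assumes "\<gamma> \<in> A1_loc"
  shows "locint (wrep \<gamma>)" "wrep \<gamma> =\<^sub>a \<gamma>" "wrep \<gamma> z \<ge> 0" "AE z in lborel. wrep \<gamma> z > 0"
    "borel_fun (wrep \<gamma>)" "\<gamma> \<in> L1_loc"
proof -
  have L: "\<gamma> \<in> L1_loc" and p: "AE z in lebesgue. \<gamma> z > 0"
    using assms by (auto simp: A1_loc_def weight_def)
  then show "\<gamma> \<in> L1_loc" by simp
  show l: "locint (wrep \<gamma>)" unfolding wrep_def[abs_def] by (intro locint_abs rep L)
  then show "borel_fun (wrep \<gamma>)" by (rule locint_borel)
  show "wrep \<gamma> z \<ge> 0" by (simp add: wrep_def)
  show e: "wrep \<gamma> =\<^sub>a \<gamma>"
    using rep(2)[OF L] p unfolding ae_eq_def wrep_def by eventually_elim simp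
  show "AE z in lborel. wrep \<gamma> z > 0"
    using e p unfolding ae_eq_def AE_lebesgue_iff by eventually_elim simp
qed

text \<open>The essential infimum is only ever used through this pointwise bound.\<close>

lemma A1_pointwise:
  fixes \<gamma> :: "'a::euclidean_space \<Rightarrow> real"
  assumes "\<gamma> \<in> A1_loc"
  shows "\<exists>C\<ge>1. \<forall>a r. 0 < r \<and> r \<le> 1 \<longrightarrow> (AE z in lborel. z \<in> cube a r \<longrightarrow>
    L1n (cube a r) (wrep \<gamma>) \<le> ennreal (C * r ^ DIM('a)) * ennreal (wrep \<gamma> z))"
proof -
  obtain C where C: "C \<ge> 1" "\<And>Q. is_cube Q \<Longrightarrow> side_length Q \<le> 1 \<Longrightarrow>
      ereal ((LINT z:Q|lebesgue. \<gamma> z) / measure lebesgue Q) \<le> ereal C * essinf_on Q \<gamma>"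
    using assms unfolding A1_loc_def by blast
  note W = wrep[OF assms]
  have wm [measurable]: "borel_fun (wrep \<gamma>)" by (rule W(5))
  have "AE z in lborel. z \<in> cube a r \<longrightarrow>
    L1n (cube a r) (wrep \<gamma>) \<le> ennreal (C * r ^ DIM('a)) * ennreal (wrep \<gamma> z)" if r: "0 < r" "r \<le> 1" for a r
  proof -
    let ?Q = "cube a r"
    have Qb: "bounded ?Q" by (rule bounded_box)
    have "(LINT z:?Q|lebesgue. \<gamma> z) = (LINT z|lebesgue. \<gamma> z * indicator ?Q z)"
      unfolding set_lebesgue_integral_def by (simp add: mult.commute)
    also have "\<dots> = (LINT z|lborel. wrep \<gamma> z * indicator ?Q z)"
      by (rule integral_lebesgue_rep[OF W(6) W(2) W(5)]) simp
    finally have I: "(LINT z:?Q|lebesgue. \<gamma> z) = (LINT z|lborel. indicator ?Q z * wrep \<gamma> z)"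
      by (simp add: mult.commute)
    have L: "L1n ?Q (wrep \<gamma>) = ennreal (LINT z|lborel. indicator ?Q z * wrep \<gamma> z)"
    proof -
      have "L1n ?Q (wrep \<gamma>) = (\<integral>\<^sup>+z. ennreal (indicator ?Q z * wrep \<gamma> z) \<partial>lborel)"
        unfolding L1n_def using W(3) by (intro nn_integral_cong) (auto simp: indicator_def)
      also have "\<dots> = ennreal (LINT z|lborel. indicator ?Q z * wrep \<gamma> z)"
        using W(3) by (intro nn_integral_eq_integral locint_integrable W(1) Qb) auto
      finally show ?thesis .
    qed
    have "AE z in lebesgue_on ?Q. - ereal (\<gamma> z) \<le> esssup (lebesgue_on ?Q) (\<lambda>z. - ereal (\<gamma> z))"
      by (rule esssup_AE)
    then have "AE z in lebesgue. z \<in> ?Q \<longrightarrow> essinf_on ?Q \<gamma> \<le> ereal (\<gamma> z)"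
      by (subst (asm) AE_restrict_space_iff)
        (auto simp: essinf_on_def ereal_uminus_le_reorder elim!: eventually_mono)
    moreover have "AE z in lebesgue. wrep \<gamma> z = \<gamma> z" using W(2) by (simp add: ae_eq_def)
    ultimately have "AE z in lebesgue. z \<in> ?Q \<longrightarrow>
      L1n ?Q (wrep \<gamma>) \<le> ennreal (C * r ^ DIM('a)) * ennreal (wrep \<gamma> z)"
    proof eventually_elim
      case (elim z)
      show ?case
      proof
        assume z: "z \<in> ?Q"
        have "ereal ((LINT z:?Q|lebesgue. \<gamma> z) / measure lebesgue ?Q) \<le> ereal C * essinf_on ?Q \<gamma>"
          by (rule C(2)[OF is_cube_cube]) (use r in \<open>auto simp: side_length_cube\<close>)
        also have "\<dots> \<le> ereal C * ereal (\<gamma> z)"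
          using elim z C(1) by (intro ereal_mult_left_mono) auto
        finally have "(LINT z:?Q|lebesgue. \<gamma> z) / r ^ DIM('a) \<le> C * wrep \<gamma> z"
          using elim z measure_cube[of r a] r by simp
        then have "(LINT z|lborel. indicator ?Q z * wrep \<gamma> z) \<le> C * r ^ DIM('a) * wrep \<gamma> z"
          unfolding I using r by (simp add: divide_le_eq mult_ac)
        then show "L1n ?Q (wrep \<gamma>) \<le> ennreal (C * r ^ DIM('a)) * ennreal (wrep \<gamma> z)"
          unfolding L using C(1) r W(3) by (simp add: ennreal_mult[symmetric] ennreal_leI)
      qed
    qed
    then show ?thesis by (simp add: AE_lebesgue_iff)
  qed
  then show ?thesis using C(1) by blast
qed

text \<open>Two cubes of the same side whose corners differ by at most half a side in each coordinate share a
  cube of half the side, and both carry a weight comparable to that of the common part; chains of such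
  cubes compare any two cubes of equal side.\<close>

lemma cube_doubling:
  fixes \<gamma> :: "'a::euclidean_space \<Rightarrow> real"
  assumes "\<gamma> \<in> A1_loc"
  shows "\<exists>C\<ge>1. \<forall>M a b r. 0 < r \<and> r \<le> 1 \<and> (\<forall>i\<in>Basis. \<bar>(a - b) \<bullet> i\<bar> \<le> real M * (r / 2)) \<longrightarrow>
    L1n (cube a r) (wrep \<gamma>) \<le> ennreal (C ^ M) * L1n (cube b r) (wrep \<gamma>)"
proof -
  obtain C where C: "C \<ge> 1" "\<And>a r. 0 < r \<Longrightarrow> r \<le> 1 \<Longrightarrow> AE z in lborel. z \<in> cube a r \<longrightarrow>
    L1n (cube a r) (wrep \<gamma>) \<le> ennreal (C * r ^ DIM('a)) * ennreal (wrep \<gamma> z)"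
    using A1_pointwise[OF assms] by blast
  note W = wrep[OF assms]
  have [measurable]: "borel_fun (wrep \<gamma>)" by (rule W(5))
  define D where "D = C * 2 ^ DIM('a)"
  have D1: "D \<ge> 1" unfolding D_def using C(1) mult_mono[of 1 C 1 "2 ^ DIM('a)"] by simp
  have one: "L1n (cube a r) (wrep \<gamma>) \<le> ennreal D * L1n (cube b r) (wrep \<gamma>)"
    if r: "0 < r" "r \<le> 1" and ab: "\<forall>i\<in>Basis. \<bar>(a - b) \<bullet> i\<bar> \<le> r / 2" for a b r
  proof -
    define c where "c = (\<Sum>i\<in>Basis. max (a \<bullet> i) (b \<bullet> i) *\<^sub>R i)"
    have ci: "c \<bullet> i = max (a \<bullet> i) (b \<bullet> i)" if "i \<in> Basis" for i
      using that by (simp add: c_def)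
    have V: "cube c (r/2) \<subseteq> cube a r" "cube c (r/2) \<subseteq> cube b r"
    proof -
      have "a \<bullet> i \<le> c \<bullet> i \<and> b \<bullet> i \<le> c \<bullet> i \<and> c \<bullet> i \<le> a \<bullet> i + r/2 \<and> c \<bullet> i \<le> b \<bullet> i + r/2"
        if "i \<in> Basis" for i
      proof -
        have "\<bar>a \<bullet> i - b \<bullet> i\<bar> \<le> r / 2" using ab that by (simp add: inner_diff_left)
        then show ?thesis using r unfolding ci[OF that] by (auto simp: abs_le_iff max_def)
      qed
      then show "cube c (r/2) \<subseteq> cube a r" "cube c (r/2) \<subseteq> cube b r"
        unfolding subset_iff mem_cube by fastforce+
    qed
    have "L1n (cube a r) (wrep \<gamma>) * ennreal ((r/2) ^ DIM('a))
        = (\<integral>\<^sup>+z. L1n (cube a r) (wrep \<gamma>) * indicator (cube c (r/2)) z \<partial>lborel)"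
      using r by (subst nn_integral_cmult_indicator) (auto simp: emeasure_cube)
    also have "\<dots> \<le> (\<integral>\<^sup>+z. ennreal (C * r ^ DIM('a)) * (ennreal \<bar>wrep \<gamma> z\<bar> * indicator (cube c (r/2)) z) \<partial>lborel)"
      using C(2)[OF r, of a]
      by (intro nn_integral_mono_AE) (use V(1) W(3) in \<open>auto elim!: eventually_mono simp: indicator_def\<close>)
    also have "\<dots> = ennreal (C * r ^ DIM('a)) * L1n (cube c (r/2)) (wrep \<gamma>)"
      unfolding L1n_def by (rule nn_integral_cmult) measurable
    also have "\<dots> \<le> ennreal (C * r ^ DIM('a)) * L1n (cube b r) (wrep \<gamma>)"
      by (intro mult_left_mono L1n_mono_set V) simp
    also have "C * r ^ DIM('a) = D * (r/2) ^ DIM('a)" by (simp add: D_def power_divide)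
    also have "ennreal (D * (r/2) ^ DIM('a)) = ennreal D * ennreal ((r/2) ^ DIM('a))"
      using D1 r by (simp add: ennreal_mult)
    finally have *: "L1n (cube a r) (wrep \<gamma>) * ennreal ((r/2) ^ DIM('a))
        \<le> (ennreal D * L1n (cube b r) (wrep \<gamma>)) * ennreal ((r/2) ^ DIM('a))" by (simp add: mult_ac)
    show ?thesis
    proof -
      have p: "(r/2) ^ DIM('a) > 0" using r by simp
      have "L1n (cube a r) (wrep \<gamma>) * ennreal ((r/2) ^ DIM('a)) * ennreal (1 / (r/2) ^ DIM('a))
        \<le> (ennreal D * L1n (cube b r) (wrep \<gamma>)) * ennreal ((r/2) ^ DIM('a)) * ennreal (1 / (r/2) ^ DIM('a))"
        by (rule mult_right_mono[OF *]) simp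
      moreover have "ennreal ((r/2) ^ DIM('a)) * ennreal (1 / (r/2) ^ DIM('a)) = 1"
        using p r by (simp add: ennreal_mult[symmetric])
      ultimately show ?thesis by (simp add: mult.assoc)
    qed
  qed
  have "L1n (cube a r) (wrep \<gamma>) \<le> ennreal (D ^ M) * L1n (cube b r) (wrep \<gamma>)"
    if r: "0 < r" "r \<le> 1" and "\<forall>i\<in>Basis. \<bar>(a - b) \<bullet> i\<bar> \<le> real M * (r / 2)" for M a b r
    using that(3)
  proof (induction M arbitrary: a)
    case 0
    then have "a = b" by (auto simp: inner_diff_left intro: euclidean_eqI)
    then show ?case by simp
  next
    case (Suc M)
    define a' where "a' = a + (1 / real (Suc M)) *\<^sub>R (b - a)"
    have "L1n (cube a r) (wrep \<gamma>) \<le> ennreal D * L1n (cube a' r) (wrep \<gamma>)"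
    proof (rule one[OF r], rule ballI)
      fix i :: 'a assume i: "i \<in> Basis"
      have "(a - a') \<bullet> i = (1 / real (Suc M)) * ((a - b) \<bullet> i)"
        by (simp add: a'_def algebra_simps inner_diff_left)
      then have "\<bar>(a - a') \<bullet> i\<bar> = (1 / real (Suc M)) * \<bar>(a - b) \<bullet> i\<bar>" by (simp add: abs_mult)
      also have "\<dots> \<le> (1 / real (Suc M)) * (real (Suc M) * (r / 2))"
        using Suc.prems i by (intro mult_left_mono) auto
      finally show "\<bar>(a - a') \<bullet> i\<bar> \<le> r / 2" by simp
    qed
    also have "\<dots> \<le> ennreal D * (ennreal (D ^ M) * L1n (cube b r) (wrep \<gamma>))"
    proof (intro mult_left_mono Suc.IH ballI)
      fix i :: 'a assume i: "i \<in> Basis"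
      have "(a' - b) \<bullet> i = (real M / real (Suc M)) * ((a - b) \<bullet> i)"
      proof -
        have "a' - b = (1 - 1 / real (Suc M)) *\<^sub>R (a - b)"
          by (simp add: a'_def algebra_simps)
        moreover have "1 - 1 / real (Suc M) = real M / real (Suc M)" by (simp add: field_simps)
        ultimately show ?thesis by (metis inner_scaleR_left)
      qed
      then have "\<bar>(a' - b) \<bullet> i\<bar> = (real M / real (Suc M)) * \<bar>(a - b) \<bullet> i\<bar>" by (simp add: abs_mult)
      also have "\<dots> \<le> (real M / real (Suc M)) * (real (Suc M) * (r / 2))"
        using Suc.prems i by (intro mult_left_mono) auto
      also have "\<dots> = real M * (r / 2)" by simp
      finally show "\<bar>(a' - b) \<bullet> i\<bar> \<le> real M * (r / 2)" .
    qed simp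
    also have "\<dots> = ennreal (D ^ Suc M) * L1n (cube b r) (wrep \<gamma>)"
      using D1 by (simp add: ennreal_mult mult.assoc)
    finally show ?case .
  qed
  then show ?thesis using D1 by blast
qed

subsection \<open>Dyadic cells\<close>

definition cell :: "nat \<Rightarrow> int^'n \<Rightarrow> int \<Rightarrow> ((real^'n) \<times> real) set"
  where "cell k m i = dyadic_cube k m \<times> {real_of_int i / 2 ^ k <..< (real_of_int i + 1) / 2 ^ k}"

definition corner :: "nat \<Rightarrow> int^'n \<Rightarrow> real^'n"
  where "corner k m = (\<chi> i. of_int (m $ i) / 2 ^ k)"

lemma One_cart: "(One :: real^'n) $ i = 1"
proof -
  have "(One :: real^'n) \<bullet> axis i 1 = 1"
    by (simp add: inner_sum_left inner_Basis axis_in_Basis_iff)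
  then show ?thesis by (simp add: inner_axis)
qed

lemma One_cart': "(\<Sum>x\<in>(Basis :: (real^'n) set). x $ i) = 1"
  using One_cart[of i] by simp

lemma dyadic_cube_eq: "dyadic_cube k m = cube (corner k m) (1 / 2 ^ k)"
proof -
  have "corner k m + (1 / 2 ^ k) *\<^sub>R One = (\<chi> i. (of_int (m $ i) + 1) / 2 ^ k)"
    by (simp add: vec_eq_iff corner_def One_cart' add_divide_distrib)
  then show ?thesis by (simp add: dyadic_cube_def corner_def)
qed

lemma mem_dyadic_cube:
  "x \<in> dyadic_cube k m \<longleftrightarrow> (\<forall>i. of_int (m $ i) / 2 ^ k < x $ i \<and> x $ i < (of_int (m $ i) + 1) / 2 ^ k)"
  by (simp add: dyadic_cube_def mem_box_cart)

lemma One_prod: "(One :: 'a::euclidean_space \<times> 'b::euclidean_space) = (One, One)"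
  by (rule euclidean_eqI) (auto simp: Basis_prod_def inner_sum_left inner_Basis)

lemma cell_eq: "cell k m i = cube (corner k m, real_of_int i / 2 ^ k) (1 / 2 ^ k)"
  by (auto simp: cell_def dyadic_cube_eq box_prod One_prod box_real add_divide_distrib)

lemma cell_sets [measurable]: "cell k m i \<in> sets borel"
  unfolding cell_eq by simp

lemma dyadic_cube_sets [measurable]: "dyadic_cube k m \<in> sets borel"
  unfolding dyadic_cube_eq by simp

text \<open>The corners of the two cells differ by at most \<open>2 L\<close> sides in each coordinate, that is by \<open>4 L\<close> half
  sides.\<close>

lemma cell_compare:
  fixes \<gamma> :: "(real^'n) \<times> real \<Rightarrow> real"
  assumes "\<gamma> \<in> A1_loc"
  shows "\<exists>C\<ge>1. \<forall>k m p i j. (\<forall>a. \<bar>p $ a\<bar> \<le> int L) \<and> \<bar>i\<bar> \<le> int L \<and> \<bar>j\<bar> \<le> int L \<longrightarrow>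
    L1n (cell k m i) (wrep \<gamma>) \<le> ennreal C * L1n (cell k (m + p) j) (wrep \<gamma>)"
proof -
  obtain C where C: "C \<ge> 1" "\<And>M a b r. 0 < r \<Longrightarrow> r \<le> 1 \<Longrightarrow> \<forall>i\<in>Basis. \<bar>(a - b) \<bullet> i\<bar> \<le> real M * (r / 2) \<Longrightarrow>
    L1n (cube a r) (wrep \<gamma>) \<le> ennreal (C ^ M) * L1n (cube b r) (wrep \<gamma>)"
    using cube_doubling[OF assms] by blast
  have "L1n (cell k m i) (wrep \<gamma>) \<le> ennreal (C ^ (4 * L)) * L1n (cell k (m + p) j) (wrep \<gamma>)"
    if p: "\<forall>a. \<bar>p $ a\<bar> \<le> int L" and ij: "\<bar>i\<bar> \<le> int L" "\<bar>j\<bar> \<le> int L" for k m p i j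
    unfolding cell_eq
  proof (rule C(2))
    show "\<forall>b\<in>Basis. \<bar>((corner k m, real_of_int i / 2 ^ k) - (corner k (m + p), real_of_int j / 2 ^ k)) \<bullet> b\<bar>
        \<le> real (4 * L) * (1 / 2 ^ k / 2)"
    proof
      fix b :: "(real^'n) \<times> real" assume "b \<in> Basis"
      then consider u where "b = (axis u 1, 0)" | "b = (0, 1)"
        by (auto simp: Basis_prod_def Basis_vec_def)
      then show "\<bar>((corner k m, real_of_int i / 2 ^ k) - (corner k (m + p), real_of_int j / 2 ^ k)) \<bullet> b\<bar>
        \<le> real (4 * L) * (1 / 2 ^ k / 2)"
      proof cases
        case 1
        have "\<bar>p $ u\<bar> \<le> int L" using p by blast
        then have "\<bar>real_of_int (p $ u)\<bar> \<le> real L" by linarith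
        moreover have "((corner k m, real_of_int i / 2 ^ k) - (corner k (m + p), real_of_int j / 2 ^ k)) \<bullet> b
            = - (real_of_int (p $ u) / 2 ^ k)"
          by (simp add: 1 inner_axis corner_def add_divide_distrib)
        ultimately show ?thesis by (simp add: field_simps)
      next
        case 2
        have "\<bar>real_of_int i - real_of_int j\<bar> \<le> 2 * real L" using ij by linarith
        moreover have "((corner k m, real_of_int i / 2 ^ k) - (corner k (m + p), real_of_int j / 2 ^ k)) \<bullet> b
            = (real_of_int i - real_of_int j) / 2 ^ k"
          by (simp add: 2 diff_divide_distrib)
        ultimately show ?thesis by (simp add: field_simps)
      qed
    qed
  qed auto
  moreover have "C ^ (4 * L) \<ge> 1" using C(1) by (rule one_le_power)
  ultimately show ?thesis by blast
qed

text \<open>The \<open>A\<^sub>1\<close> condition on the cell of \<open>z\<close>, transferred to the cell \<open>m\<close> by comparability.\<close>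

lemma cell_AE:
  fixes \<gamma> :: "(real^'n) \<times> real \<Rightarrow> real"
  assumes "\<gamma> \<in> A1_loc"
  shows "\<exists>C\<ge>1. \<forall>k m p j. (\<forall>a. \<bar>p $ a\<bar> \<le> int L) \<and> \<bar>j\<bar> \<le> int L \<longrightarrow>
    (AE z in lborel. z \<in> cell k (m + p) j \<longrightarrow>
      L1n (cell k m 0) (wrep \<gamma>) \<le> ennreal (C / 2 ^ (k * (CARD('n) + 1))) * ennreal (wrep \<gamma> z))"
proof -
  obtain A where A: "A \<ge> 1" "\<And>a r. 0 < r \<Longrightarrow> r \<le> 1 \<Longrightarrow> AE z in lborel. z \<in> cube a r \<longrightarrow>
    L1n (cube a r) (wrep \<gamma>) \<le> ennreal (A * r ^ DIM((real^'n) \<times> real)) * ennreal (wrep \<gamma> z)"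
    using A1_pointwise[OF assms] by blast
  obtain B where B: "B \<ge> 1" "\<And>k m p i j. \<forall>a. \<bar>p $ a\<bar> \<le> int L \<Longrightarrow> \<bar>i\<bar> \<le> int L \<Longrightarrow> \<bar>j\<bar> \<le> int L \<Longrightarrow>
    L1n (cell k m i) (wrep \<gamma>) \<le> ennreal B * L1n (cell k (m + p) j) (wrep \<gamma>)"
    using cell_compare[OF assms, of L] by blast
  have "AE z in lborel. z \<in> cell k (m + p) j \<longrightarrow>
      L1n (cell k m 0) (wrep \<gamma>) \<le> ennreal (B * A / 2 ^ (k * (CARD('n) + 1))) * ennreal (wrep \<gamma> z)"
    if p: "\<forall>a. \<bar>p $ a\<bar> \<le> int L" "\<bar>j\<bar> \<le> int L" for k m p j
  proof -
    have "AE z in lborel. z \<in> cell k (m + p) j \<longrightarrow>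
      L1n (cell k (m + p) j) (wrep \<gamma>) \<le> ennreal (A * (1 / 2 ^ k) ^ (CARD('n) + 1)) * ennreal (wrep \<gamma> z)"
      unfolding cell_eq using A(2)[of "1 / 2 ^ k"] by simp
    then show ?thesis
    proof eventually_elim
      case (elim z)
      show ?case
      proof
        assume z: "z \<in> cell k (m + p) j"
        have "L1n (cell k m 0) (wrep \<gamma>) \<le> ennreal B * L1n (cell k (m + p) j) (wrep \<gamma>)"
          using p by (intro B(2)) auto
        also have "\<dots> \<le> ennreal B * (ennreal (A * (1 / 2 ^ k) ^ (CARD('n) + 1)) * ennreal (wrep \<gamma> z))"
          using elim z by (intro mult_left_mono) auto
        also have "\<dots> = ennreal (B * A / 2 ^ (k * (CARD('n) + 1))) * ennreal (wrep \<gamma> z)"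
          using A(1) B(1) by (simp add: ennreal_mult mult.assoc[symmetric] power_divide power_mult
            power_add ennreal_mult[symmetric])
        finally show "L1n (cell k m 0) (wrep \<gamma>)
          \<le> ennreal (B * A / 2 ^ (k * (CARD('n) + 1))) * ennreal (wrep \<gamma> z)" .
      qed
    qed
  qed
  moreover have "B * A \<ge> 1" using A(1) B(1) mult_mono[of 1 B 1 A] by simp
  ultimately show ?thesis by blast
qed

text \<open>On bounded sets a weight is bounded below, so weighted integrability implies local
  integrability.\<close>

lemma weight_lower_bound:
  fixes \<gamma> :: "'a::euclidean_space \<Rightarrow> real"
  assumes "\<gamma> \<in> A1_loc"
  shows "\<exists>c>0. AE z in lborel. z \<in> cball 0 R \<longrightarrow> wrep \<gamma> z \<ge> c"
proof -
  obtain A where A: "A \<ge> 1" "\<And>a r. 0 < r \<Longrightarrow> r \<le> 1 \<Longrightarrow> AE z in lborel. z \<in> cube a r \<longrightarrow>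
    L1n (cube a r) (wrep \<gamma>) \<le> ennreal (A * r ^ DIM('a)) * ennreal (wrep \<gamma> z)"
    using A1_pointwise[OF assms] by blast
  note W = wrep[OF assms]
  have "\<exists>c>0. AE z in lborel. z \<in> cube a 1 \<longrightarrow> wrep \<gamma> z \<ge> c" for a :: 'a
  proof -
    have "L1n (cube a 1) (wrep \<gamma>) \<noteq> 0"
    proof
      assume "L1n (cube a 1) (wrep \<gamma>) = 0"
      then have "AE z in lborel. z \<in> cube a 1 \<longrightarrow> wrep \<gamma> z = 0"
        by (subst (asm) L1n_eq_0) (use W(5) in auto)
      with W(4) have "AE z in lborel. z \<notin> cube a 1" by eventually_elim auto
      then have "emeasure lborel (cube a 1) = 0"
        by (subst (asm) AE_iff_measurable[of "cube a 1"]) auto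
      then show False using emeasure_cube[of 1 a] by simp
    qed
    moreover have "L1n (cube a 1) (wrep \<gamma>) < \<infinity>" by (intro locint_bounded W bounded_box)
    ultimately obtain q where q: "L1n (cube a 1) (wrep \<gamma>) = ennreal q" "q > 0"
      by (cases "L1n (cube a 1) (wrep \<gamma>)") (auto simp: less_le)
    have "AE z in lborel. z \<in> cube a 1 \<longrightarrow> wrep \<gamma> z \<ge> q / A"
    proof -
      have "AE z in lborel. z \<in> cube a 1 \<longrightarrow> ennreal q \<le> ennreal A * ennreal (wrep \<gamma> z)"
        using A(2)[of 1 a] q(1) by simp
      then show ?thesis
      proof eventually_elim
        case (elim z)
        then show ?case
          using A(1) W(3)[of z] q(2)
          by (auto simp: ennreal_mult[symmetric] field_simps)
      qed
    qed
    then show ?thesis using q(2) A(1) by (intro exI[of _ "q / A"]) auto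
  qed
  then obtain c where c: "\<And>a::'a. c a > 0 \<and> (AE z in lborel. z \<in> cube a 1 \<longrightarrow> wrep \<gamma> z \<ge> c a)"
    by metis
  have "cball (0::'a) R \<subseteq> (\<Union>a\<in>UNIV. cube a 1)"
  proof
    fix x :: 'a
    have "x \<in> cube (x - (1/2) *\<^sub>R One) 1"
      unfolding mem_cube by (simp add: inner_diff_left)
    then show "x \<in> (\<Union>a\<in>UNIV. cube a 1)" by blast
  qed
  then obtain T where T: "finite T" "cball (0::'a) R \<subseteq> (\<Union>a\<in>T. cube a 1)"
    using compactE_image[of "cball (0::'a) R" UNIV "\<lambda>a. cube a 1"] compact_cball open_box by metis
  define d where "d = Min (insert 1 (c ` T))"
  have "d > 0" unfolding d_def using T(1) c by (subst Min_gr_iff) auto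
  moreover have "AE z in lborel. \<forall>a\<in>T. z \<in> cube a 1 \<longrightarrow> wrep \<gamma> z \<ge> c a"
    using c T(1) by (intro AE_finite_allI) auto
  then have "AE z in lborel. z \<in> cball 0 R \<longrightarrow> wrep \<gamma> z \<ge> d"
  proof eventually_elim
    case (elim z)
    show ?case
    proof
      assume "z \<in> cball 0 R"
      then obtain a where a: "a \<in> T" "z \<in> cube a 1" using T(2) by blast
      then have "c a \<le> wrep \<gamma> z" using elim by blast
      moreover have "d \<le> c a" unfolding d_def using T(1) a by (intro Min_le) auto
      ultimately show "d \<le> wrep \<gamma> z" by simp
    qed
  qed
  ultimately show ?thesis by blast
qed

lemma weighted_locint:
  fixes \<gamma> :: "'a::euclidean_space \<Rightarrow> real"
  assumes "\<gamma> \<in> A1_loc"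
  shows "\<exists>C. \<forall>h\<in>borel_measurable borel. L1n (cball 0 R) h \<le> ennreal C * wnorm (wrep \<gamma>) h"
proof -
  obtain c where c: "c > 0" "AE z in lborel. z \<in> cball 0 R \<longrightarrow> wrep \<gamma> z \<ge> c"
    using weight_lower_bound[OF assms] by blast
  have "L1n (cball 0 R) h \<le> ennreal (1 / c) * wnorm (wrep \<gamma>) h"
    if [measurable]: "borel_fun h" for h :: "'a \<Rightarrow> real"
  proof -
    have [measurable]: "cball (0::'a) R \<in> sets borel" by simp
    have "ennreal c * L1n (cball 0 R) h \<le> wnorm (wrep \<gamma>) h"
      unfolding L1n_def
    proof -
      have "ennreal c * (\<integral>\<^sup>+x\<in>cball 0 R. ennreal \<bar>h x\<bar> \<partial>lborel)
          = (\<integral>\<^sup>+x. ennreal c * (ennreal \<bar>h x\<bar> * indicator (cball 0 R) x) \<partial>lborel)"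
        by (rule nn_integral_cmult[symmetric]) measurable
      also have "\<dots> \<le> wnorm (wrep \<gamma>) h"
        using c(2)
      proof (intro nn_integral_mono_AE, eventually_elim)
        case (elim z)
        show ?case
        proof (cases "z \<in> cball 0 R")
          case True
          have "c * \<bar>h z\<bar> \<le> wrep \<gamma> z * \<bar>h z\<bar>" using elim True by (intro mult_right_mono) auto
          also have "\<dots> = \<bar>wrep \<gamma> z * h z\<bar>" using wrep(3)[OF assms, of z] by (simp add: abs_mult)
          finally show ?thesis using True c(1)
            by (simp add: ennreal_mult[symmetric] ennreal_leI)
        qed simp
      qed
      finally show "ennreal c * (\<integral>\<^sup>+x\<in>cball 0 R. ennreal \<bar>h x\<bar> \<partial>lborel)
        \<le> wnorm (wrep \<gamma>) h" .
    qed
    then have "ennreal (1 / c) * (ennreal c * L1n (cball 0 R) h)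
      \<le> ennreal (1 / c) * wnorm (wrep \<gamma>) h"
      by (rule mult_left_mono) simp
    then show ?thesis using c(1) by (simp add: mult.assoc[symmetric] ennreal_mult[symmetric])
  qed
  then show ?thesis by blast
qed

lemma ennreal_weight_seq:
  fixes \<gamma> :: "(real^'n) \<times> real \<Rightarrow> real"
  assumes "\<gamma> \<in> A1_loc"
  shows "ennreal (weight_seq l \<gamma> k m) = ennreal (2 ^ (k * l)) * L1n (cell k m 0) (wrep \<gamma>)"
proof -
  note W = wrep[OF assms]
  let ?Q = "cell k m 0"
  have Qb: "bounded ?Q" unfolding cell_eq by (rule bounded_box)
  have "(LINT z:dyadic_cube k m \<times> {0<..<1 / 2 ^ k}|lebesgue. \<gamma> z) = (LINT z|lebesgue. \<gamma> z * indicator ?Q z)"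
    unfolding set_lebesgue_integral_def cell_def by (simp add: mult.commute)
  also have "\<dots> = (LINT z|lborel. wrep \<gamma> z * indicator ?Q z)"
    by (rule integral_lebesgue_rep[OF W(6) W(2) W(5)]) simp
  finally have I: "(LINT z:dyadic_cube k m \<times> {0<..<1 / 2 ^ k}|lebesgue. \<gamma> z) = (LINT z|lborel. indicator ?Q z * wrep \<gamma> z)"
    by (simp add: mult.commute)
  have L: "L1n ?Q (wrep \<gamma>) = ennreal (LINT z|lborel. indicator ?Q z * wrep \<gamma> z)"
  proof -
    have "L1n ?Q (wrep \<gamma>) = (\<integral>\<^sup>+z. ennreal (indicator ?Q z * wrep \<gamma> z) \<partial>lborel)"
      unfolding L1n_def using W(3) by (intro nn_integral_cong) (auto simp: indicator_def)
    also have "\<dots> = ennreal (LINT z|lborel. indicator ?Q z * wrep \<gamma> z)"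
      using W(3) by (intro nn_integral_eq_integral locint_integrable W(1) Qb) auto
    finally show ?thesis .
  qed
  have "(LINT z|lborel. indicator ?Q z * wrep \<gamma> z) \<ge> 0"
    using W(3) by (intro integral_nonneg_AE) auto
  then show ?thesis unfolding weight_seq_def I L by (simp add: ennreal_mult)
qed

section \<open>Sums over dyadic cubes\<close>

lemma infsum_eq_nn_integral:
  fixes f :: "'i \<Rightarrow> ennreal"
  assumes "countable I"
  shows "(\<Sum>\<^sub>\<infinity>i\<in>I. f i) = (\<integral>\<^sup>+i. f i \<partial>count_space I)"
proof (cases "finite I")
  case True
  then show ?thesis by (simp add: nn_integral_count_space_finite)
next
  case False
  have n: "(\<Sum>\<^sub>\<infinity>i\<in>UNIV. g i) = (\<integral>\<^sup>+i. g i \<partial>count_space UNIV)" for g :: "nat \<Rightarrow> ennreal"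
  proof -
    have "g summable_on UNIV" by (rule nonneg_summable_on_complete) simp
    then have "(g has_sum (\<Sum>\<^sub>\<infinity>i\<in>UNIV. g i)) UNIV" by (rule has_sum_infsum)
    then have "g sums (\<Sum>\<^sub>\<infinity>i\<in>UNIV. g i)" by (rule has_sum_imp_sums)
    then show ?thesis by (simp add: nn_integral_count_space_nat sums_iff)
  qed
  have b: "bij_betw (from_nat_into I) UNIV I" by (rule bij_betw_from_nat_into[OF assms False])
  show ?thesis
    using infsum_reindex_bij_betw[OF b, of f] nn_integral_bij_count_space[OF b, of f] n by simp
qed

text \<open>The index of the dyadic cube that contains \<open>x\<close>, unless \<open>x\<close> lies on a dyadic hyperplane.\<close>

definition idx :: "nat \<Rightarrow> real^'n \<Rightarrow> int^'n"
  where "idx k x = (\<chi> i. \<lfloor>2 ^ k * x $ i\<rfloor>)"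

lemma dyadic_cube_unique: "x \<in> dyadic_cube k m \<Longrightarrow> m = idx k x"
proof -
  assume x: "x \<in> dyadic_cube k m"
  have "m $ i = \<lfloor>2 ^ k * x $ i\<rfloor>" for i
    using x by (intro floor_unique[symmetric]) (auto simp: mem_dyadic_cube field_simps less_imp_le)
  then show ?thesis by (simp add: idx_def vec_eq_iff)
qed

lemma AE_hyperplane:
  fixes b :: "'a::euclidean_space"
  assumes "b \<in> Basis"
  shows "AE z in lborel. z \<bullet> b \<noteq> c"
proof -
  have "{z. z \<bullet> b = c} \<in> null_sets lebesgue"
    using negligible_standard_hyperplane[OF assms, of c] by (simp add: negligible_iff_null_sets)
  then have "AE z in lebesgue. z \<notin> {z. z \<bullet> b = c}" by (rule AE_not_in)
  then show ?thesis by (simp add: AE_lebesgue_iff)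
qed

lemma dyadic_cubeI:
  assumes "\<And>i c. x $ i \<noteq> real_of_int c / 2 ^ k"
  shows "x \<in> dyadic_cube k (idx k x)"
  unfolding mem_dyadic_cube
proof
  fix i
  define q where "q = \<lfloor>2 ^ k * x $ i\<rfloor>"
  have q: "real_of_int q \<le> 2 ^ k * x $ i" "2 ^ k * x $ i < real_of_int q + 1"
    unfolding q_def by linarith+
  have "real_of_int q \<noteq> 2 ^ k * x $ i"
    using assms[of i q] by (auto simp: field_simps)
  then have "real_of_int q < 2 ^ k * x $ i" using q(1) by simp
  moreover have "idx k x $ i = q" by (simp add: idx_def q_def)
  ultimately show "of_int (idx k x $ i) / 2 ^ k < x $ i \<and> x $ i < (of_int (idx k x $ i) + 1) / 2 ^ k"
    using q(2) by (simp add: field_simps)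
qed

lemma AE_dyadic_cube: "AE x in lborel. x \<in> dyadic_cube k (idx k x)"
proof -
  have "AE x in lborel. \<forall>i. \<forall>c. (x::real^'n) \<bullet> axis i 1 \<noteq> real_of_int c / 2 ^ k"
    unfolding AE_all_countable by (intro allI AE_hyperplane) (simp add: axis_in_Basis_iff)
  then show ?thesis
    by eventually_elim (rule dyadic_cubeI, simp add: inner_axis)
qed

lemma AE_fst_dyadic_cube: "AE z in lborel. fst (z :: (real^'n) \<times> real) \<in> dyadic_cube k (idx k (fst z))"
proof -
  have "AE z in lborel. \<forall>i. \<forall>c. (z :: (real^'n) \<times> real) \<bullet> (axis i 1, 0) \<noteq> real_of_int c / 2 ^ k"
    unfolding AE_all_countable
    by (intro allI AE_hyperplane) (simp add: axis_in_Basis_iff Basis_prod_def)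
  then show ?thesis
    by eventually_elim (rule dyadic_cubeI, simp add: inner_axis inner_prod_def)
qed

lemma AE_snd_neq: "AE z in lborel. snd (z :: 'a::euclidean_space \<times> real) \<noteq> c"
proof -
  have "AE z in lborel. (z :: 'a \<times> real) \<bullet> (0, 1) \<noteq> c"
    by (rule AE_hyperplane) (simp add: Basis_prod_def)
  then show ?thesis by eventually_elim (simp add: inner_prod_def)
qed

lemma nn_integral_count_space_single:
  fixes f :: "'i \<Rightarrow> ennreal"
  assumes "\<And>j. j \<noteq> i \<Longrightarrow> f j = 0"
  shows "(\<integral>\<^sup>+j. f j \<partial>count_space UNIV) = f i"
  using nn_integral_count_space'[of "{i}" UNIV f] assms by simp

lemma nn_integral_cells:
  fixes h :: "(real^'n) \<times> real \<Rightarrow> ennreal"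
  assumes [measurable]: "borel_fun h"
  shows "(\<integral>\<^sup>+m. (\<integral>\<^sup>+z\<in>cell k m i. h z \<partial>lborel) \<partial>count_space UNIV)
    = (\<integral>\<^sup>+z\<in>UNIV \<times> {real_of_int i / 2 ^ k <..< (real_of_int i + 1) / 2 ^ k}. h z \<partial>lborel)"
proof -
  have "(\<integral>\<^sup>+m. (\<integral>\<^sup>+z\<in>cell k m i. h z \<partial>lborel) \<partial>count_space UNIV)
      = (\<integral>\<^sup>+z. (\<integral>\<^sup>+m. h z * indicator (cell k m i) z \<partial>count_space UNIV) \<partial>lborel)"
    by (rule nn_integral_count_space_nn_integral[symmetric]) auto
  also have "\<dots> = (\<integral>\<^sup>+z\<in>UNIV \<times> {real_of_int i / 2 ^ k <..< (real_of_int i + 1) / 2 ^ k}. h z \<partial>lborel)"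
  proof (rule nn_integral_cong_AE)
    show "AE z in lborel. (\<integral>\<^sup>+m. h z * indicator (cell k m i) z \<partial>count_space UNIV)
      = h z * indicator (UNIV \<times> {real_of_int i / 2 ^ k <..< (real_of_int i + 1) / 2 ^ k}) z"
      using AE_fst_dyadic_cube[of k]
    proof eventually_elim
      case (elim z)
      have "(\<integral>\<^sup>+m. h z * indicator (cell k m i) z \<partial>count_space UNIV)
          = h z * indicator (cell k (idx k (fst z)) i) z"
        by (rule nn_integral_count_space_single)
          (auto simp: indicator_def cell_def dest: dyadic_cube_unique)
      also have "\<dots> = h z * indicator (UNIV \<times> {real_of_int i / 2 ^ k <..< (real_of_int i + 1) / 2 ^ k}) z"
        using elim by (cases z) (auto simp: cell_def indicator_def)
      finally show ?case .
    qed
  qed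
  finally show ?thesis .
qed

lemma nn_integral_count_space_shift:
  fixes f :: "int^'n \<Rightarrow> ennreal"
  shows "(\<integral>\<^sup>+m. f (m + p) \<partial>count_space UNIV) = (\<integral>\<^sup>+m. f m \<partial>count_space UNIV)"
proof (rule nn_integral_bij_count_space)
  show "bij_betw (\<lambda>m. m + p) UNIV UNIV"
    by (rule bij_betwI[of _ _ _ "\<lambda>m. m - p"]) auto
qed

lemma nn_integral_cover:
  fixes h :: "'a::euclidean_space \<Rightarrow> ennreal"
  assumes [measurable]: "borel_fun h" "\<And>p. p \<in> F \<Longrightarrow> A p \<in> sets borel"
    and "finite F" "AE x in lborel. x \<in> S \<longrightarrow> (\<exists>p\<in>F. x \<in> A p)"
  shows "(\<integral>\<^sup>+x\<in>S. h x \<partial>lborel) \<le> (\<Sum>p\<in>F. \<integral>\<^sup>+x\<in>A p. h x \<partial>lborel)"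
proof -
  have "(\<integral>\<^sup>+x\<in>S. h x \<partial>lborel) \<le> (\<integral>\<^sup>+x. (\<Sum>p\<in>F. h x * indicator (A p) x) \<partial>lborel)"
  proof (rule nn_integral_mono_AE)
    show "AE x in lborel. h x * indicator S x \<le> (\<Sum>p\<in>F. h x * indicator (A p) x)"
      using assms(4)
    proof eventually_elim
      case (elim x)
      show ?case
      proof (cases "x \<in> S")
        case True
        then obtain p where p: "p \<in> F" "x \<in> A p" using elim by blast
        have "h x * indicator (A p) x \<le> (\<Sum>p\<in>F. h x * indicator (A p) x)"
          by (rule member_le_sum) (use p assms(3) in auto)
        then show ?thesis using p True by simp
      qed simp
    qed
  qed
  also have "\<dots> = (\<Sum>p\<in>F. \<integral>\<^sup>+x\<in>A p. h x \<partial>lborel)"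
    by (rule nn_integral_sum) auto
  finally show ?thesis .
qed

definition nbrs :: "nat \<Rightarrow> (int^'n) set"
  where "nbrs L = {p. \<forall>a. \<bar>p $ a\<bar> \<le> int L}"

lemma finite_nbrs: "finite (nbrs L :: (int^'n) set)"
proof (rule finite_imageD)
  have "vec_nth ` (nbrs L :: (int^'n) set) \<subseteq> PiE UNIV (\<lambda>_. {- int L..int L})"
    by (auto simp: nbrs_def abs_le_iff) (metis minus_le_iff)
  then show "finite (vec_nth ` (nbrs L :: (int^'n) set))"
    by (rule finite_subset) (intro finite_PiE, auto)
  show "inj_on vec_nth (nbrs L :: (int^'n) set)" by (auto intro!: inj_onI simp: vec_eq_iff)
qed

lemma nbr_dyadic:
  assumes x: "x \<in> dyadic_cube k m" and y: "\<And>i. \<bar>y $ i - x $ i\<bar> < real L / 2 ^ k"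
  shows "idx k y - m \<in> nbrs L"
  unfolding nbrs_def mem_Collect_eq
proof
  fix i
  have m: "m $ i = \<lfloor>2 ^ k * x $ i\<rfloor>" using dyadic_cube_unique[OF x] by (simp add: idx_def)
  have "\<bar>2 ^ k * y $ i - 2 ^ k * x $ i\<bar> < real L"
  proof -
    have "\<bar>2 ^ k * y $ i - 2 ^ k * x $ i\<bar> = 2 ^ k * \<bar>y $ i - x $ i\<bar>"
      unfolding right_diff_distrib[symmetric] abs_mult by simp
    then show ?thesis using y[of i] by (simp add: field_simps)
  qed
  then have "\<bar>\<lfloor>2 ^ k * y $ i\<rfloor> - \<lfloor>2 ^ k * x $ i\<rfloor>\<bar> \<le> int L" by linarith
  then show "\<bar>(idx k y - m) $ i\<bar> \<le> int L" by (simp add: m idx_def)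
qed

section \<open>Iterated integrals over products\<close>

lemma nn_integral_prod_fst:
  fixes h :: "'a::euclidean_space \<times> 'b::euclidean_space \<Rightarrow> ennreal"
  assumes [measurable]: "borel_fun h"
  shows "(\<integral>\<^sup>+z. h z \<partial>lborel) = (\<integral>\<^sup>+x. (\<integral>\<^sup>+t. h (x, t) \<partial>lborel) \<partial>lborel)"
proof -
  have "h \<in> borel_measurable (lborel \<Otimes>\<^sub>M lborel)" unfolding lborel_prod by simp
  from lborel.nn_integral_fst[OF this] show ?thesis unfolding lborel_prod by simp
qed

lemma nn_integral_prod_snd:
  fixes h :: "'a::euclidean_space \<times> 'b::euclidean_space \<Rightarrow> ennreal"
  assumes [measurable]: "borel_fun h"
  shows "(\<integral>\<^sup>+z. h z \<partial>lborel) = (\<integral>\<^sup>+t. (\<integral>\<^sup>+x. h (x, t) \<partial>lborel) \<partial>lborel)"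
proof -
  have "h \<in> borel_measurable (lborel \<Otimes>\<^sub>M lborel)" unfolding lborel_prod by simp
  from lborel_pair.nn_integral_snd[OF this] show ?thesis unfolding lborel_prod by simp
qed

lemma Times_sets [measurable]:
  "S \<in> sets borel \<Longrightarrow> T \<in> sets borel \<Longrightarrow> S \<times> T \<in> sets (borel :: ('a::euclidean_space \<times> 'b::euclidean_space) measure)"
  by (metis borel_prod pair_measureI)

lemma L1n_prod_fst:
  fixes h :: "'a::euclidean_space \<times> 'b::euclidean_space \<Rightarrow> real"
  assumes [measurable]: "borel_fun h" "S \<in> sets borel" "T \<in> sets borel"
  shows "L1n (S \<times> T) h = (\<integral>\<^sup>+x\<in>S. L1n T (\<lambda>t. h (x, t)) \<partial>lborel)"
proof -
  have "L1n (S \<times> T) h = (\<integral>\<^sup>+x. (\<integral>\<^sup>+t. ennreal \<bar>h (x, t)\<bar> * indicator (S \<times> T) (x, t) \<partial>lborel) \<partial>lborel)"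
    unfolding L1n_def by (rule nn_integral_prod_fst) measurable
  also have "\<dots> = (\<integral>\<^sup>+x\<in>S. L1n T (\<lambda>t. h (x, t)) \<partial>lborel)"
    unfolding L1n_def by (intro nn_integral_cong) (auto simp: indicator_def)
  finally show ?thesis .
qed

lemma L1n_prod_snd:
  fixes h :: "'a::euclidean_space \<times> 'b::euclidean_space \<Rightarrow> real"
  assumes [measurable]: "borel_fun h" "S \<in> sets borel" "T \<in> sets borel"
  shows "L1n (S \<times> T) h = (\<integral>\<^sup>+t\<in>T. L1n S (\<lambda>x. h (x, t)) \<partial>lborel)"
proof -
  have "L1n (S \<times> T) h = (\<integral>\<^sup>+t. (\<integral>\<^sup>+x. ennreal \<bar>h (x, t)\<bar> * indicator (S \<times> T) (x, t) \<partial>lborel) \<partial>lborel)"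
    unfolding L1n_def by (rule nn_integral_prod_snd) measurable
  also have "\<dots> = (\<integral>\<^sup>+t\<in>T. L1n S (\<lambda>x. h (x, t)) \<partial>lborel)"
    unfolding L1n_def by (intro nn_integral_cong) (auto simp: indicator_def)
  finally show ?thesis .
qed

lemma Pair_borel:
  fixes h :: "'a::euclidean_space \<times> 'b::euclidean_space \<Rightarrow> real"
  assumes [measurable]: "borel_fun h"
  shows "borel_fun (\<lambda>x. h (x, t))" "borel_fun (\<lambda>t. h (x, t))"
  by measurable

section \<open>Traces\<close>

text \<open>For smooth \<open>f\<close> with \<open>g = \<partial>\<^sub>t f\<close> one has
  \<open>f(x,0) = \<integral>\<^sub>0\<^sup>1 (f(x,t) - (1-t) g(x,t)) dt\<close>. The right-hand side is continuous with respect to local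
  \<open>L\<^sub>1\<close> convergence of \<open>f\<close> and \<open>g\<close>, and therefore serves as the trace in general.\<close>

definition trc :: "('a::euclidean_space \<times> real \<Rightarrow> real) \<Rightarrow> ('a \<times> real \<Rightarrow> real) \<Rightarrow> 'a \<Rightarrow> real"
  where "trc f g x = (LINT t|lborel. indicator {0<..<1} t * (f (x, t) - (1 - t) * g (x, t)))"

definition kap :: "real \<Rightarrow> real \<Rightarrow> real"
  where "kap t s = (if 0 < s \<and> s < t then 1 else if t < s \<and> s < 0 then -1 else 0)"

text \<open>The primitive \<open>\<integral>\<^sub>0\<^sup>t g(x,s) ds\<close>, written with a signed kernel to treat both signs of \<open>t\<close> at
  once.\<close>

definition prim :: "('a::euclidean_space \<times> real \<Rightarrow> real) \<Rightarrow> 'a \<times> real \<Rightarrow> real"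
  where "prim g z = (LINT s|lborel. kap (snd z) s * g (fst z, s))"

lemma trc_borel:
  assumes [measurable]: "borel_fun f" "borel_fun g"
  shows "borel_fun (trc f g)"
  unfolding trc_def[abs_def] by measurable

lemma prim_borel:
  assumes [measurable]: "borel_fun g"
  shows "borel_fun (prim g)"
proof -
  have [measurable]: "(\<lambda>z. kap (snd (fst z)) (snd z) :: real) \<in> borel_measurable ((borel :: ('a \<times> real) measure) \<Otimes>\<^sub>M borel)"
    unfolding kap_def borel_prod[symmetric] by measurable
  have [measurable]: "(\<lambda>z. g (fst (fst z), snd z)) \<in> borel_measurable ((borel :: ('a \<times> real) measure) \<Otimes>\<^sub>M borel)"
  proof -
    have "borel_fun (\<lambda>z::('a \<times> real) \<times> real. (fst (fst z), snd z))"
      by (intro borel_measurable_continuous_onI continuous_intros)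
    from measurable_compose[OF this assms] show ?thesis unfolding borel_prod by simp
  qed
  show ?thesis unfolding prim_def[abs_def] by measurable
qed

lemma L1n_slice_borel:
  fixes h :: "'a::euclidean_space \<times> real \<Rightarrow> real"
  assumes [measurable]: "borel_fun h" "T \<in> sets borel"
  shows "borel_fun (\<lambda>x. L1n T (\<lambda>t. h (x, t)))"
  unfolding L1n_def by measurable

lemma AE_slice_integrable:
  fixes h :: "'a::euclidean_space \<times> real \<Rightarrow> real"
  assumes h: "locint h"
  shows "AE x in lborel. \<forall>n::nat. integrable lborel (\<lambda>t. indicator (cball 0 n) t * h (x, t))"
  unfolding AE_all_countable
proof
  fix n
  have [measurable]: "borel_fun h" using h by (rule locint_borel)
  have [measurable]: "cball (0::real) r \<in> sets borel" "cball (0::'a) r \<in> sets borel" for r by simp_all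
  have "AE x in lborel. x \<in> cball 0 (real N) \<longrightarrow> L1n (cball 0 (real n)) (\<lambda>t. h (x, t)) \<noteq> \<infinity>" for N
  proof -
    have "(\<integral>\<^sup>+x\<in>cball 0 (real N). L1n (cball 0 (real n)) (\<lambda>t. h (x, t)) \<partial>lborel) < \<infinity>"
      using locint_bounded[OF h bounded_Times, of "cball 0 (real N)" "cball 0 (real n)"]
        L1n_prod_fst[of h "cball 0 (real N)" "cball 0 (real n)"] by simp
    then have "AE x in lborel. L1n (cball 0 (real n)) (\<lambda>t. h (x, t)) * indicator (cball 0 (real N)) x \<noteq> \<infinity>"
      by (intro nn_integral_PInf_AE borel_measurable_times_ennreal)
        (auto intro!: L1n_slice_borel borel_measurable_indicator simp: less_top)
    then show ?thesis by eventually_elim (auto simp: indicator_def)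
  qed
  then have "AE x in lborel. L1n (cball 0 (real n)) (\<lambda>t. h (x, t)) \<noteq> \<infinity>" by (rule AE_cballI)
  then show "AE x in lborel. integrable lborel (\<lambda>t. indicator (cball 0 (real n)) t * h (x, t))"
  proof eventually_elim
    case (elim x)
    then show ?case
      by (subst integrable_L1n) (auto simp: Pair_borel less_top)
  qed
qed

lemma kap_bound: "\<bar>kap t s\<bar> \<le> indicator {-\<bar>t\<bar>..\<bar>t\<bar>} s"
  by (auto simp: kap_def indicator_def)

lemma kap_borel [measurable]: "borel_fun (kap t)"
  unfolding kap_def[abs_def] by measurable

lemma slice_integrable:
  fixes h :: "real \<Rightarrow> real"
  assumes "\<forall>n::nat. integrable lborel (\<lambda>t. indicator (cball 0 n) t * h t)"
    and [measurable]: "borel_fun h" "borel_fun k"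
    and k: "\<And>s. \<bar>k s\<bar> \<le> indicator {-T..T} s"
  shows "integrable lborel (\<lambda>s. k s * h s)"
proof -
  obtain n :: nat where n: "T \<le> real n" using real_arch_simple by blast
  show ?thesis
  proof (rule Bochner_Integration.integrable_bound[OF spec[OF assms(1), of n]])
    show "AE s in lborel. norm (k s * h s) \<le> norm (indicator (cball 0 (real n)) s * h s)"
    proof (intro AE_I2)
      fix s
      have "\<bar>k s\<bar> * \<bar>h s\<bar> \<le> indicator (cball 0 (real n)) s * \<bar>h s\<bar>"
        using n by (intro mult_right_mono order_trans[OF k[of s]]) (auto simp: indicator_def)
      then show "norm (k s * h s) \<le> norm (indicator (cball 0 (real n)) s * h s)"
        by (simp add: abs_mult)
    qed
  qed measurable
qed

lemma trc_lincomb_AE: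
  assumes l: "locint f" "locint g" "locint f'" "locint g'"
  shows "AE x in lborel. trc (\<lambda>z. a * f z + b * f' z) (\<lambda>z. a * g z + b * g' z) x = a * trc f g x + b * trc f' g' x"
  using AE_slice_integrable[OF l(1)] AE_slice_integrable[OF l(2)]
    AE_slice_integrable[OF l(3)] AE_slice_integrable[OF l(4)]
proof eventually_elim
  case (elim x)
  note m = locint_borel[OF l(1)] locint_borel[OF l(2)] locint_borel[OF l(3)] locint_borel[OF l(4)]
  have 1: "integrable lborel (\<lambda>s. indicator {0<..<1} s * h (x, s))"
    and 2: "integrable lborel (\<lambda>s. (indicator {0<..<1} s * (1 - s)) * h (x, s))"
    if "\<forall>n::nat. integrable lborel (\<lambda>t. indicator (cball 0 n) t * h (x, t))" "borel_fun h"
    for h :: "'a \<times> real \<Rightarrow> real"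
    by (rule slice_integrable[OF that(1), of _ 1]; (auto intro: Pair_borel that simp: indicator_def)[])+
  have e: "integrable lborel (\<lambda>s. indicator {0<..<1} s * (f (x, s) - (1 - s) * g (x, s)))"
    "integrable lborel (\<lambda>s. indicator {0<..<1} s * (f' (x, s) - (1 - s) * g' (x, s)))"
    using Bochner_Integration.integrable_diff[OF 1[OF elim(1) m(1)] 2[OF elim(2) m(2)]]
      Bochner_Integration.integrable_diff[OF 1[OF elim(3) m(3)] 2[OF elim(4) m(4)]]
    by (simp_all add: algebra_simps)
  have "trc (\<lambda>z. a * f z + b * f' z) (\<lambda>z. a * g z + b * g' z) x
    = (LINT s|lborel. a * (indicator {0<..<1} s * (f (x, s) - (1 - s) * g (x, s)))
      + b * (indicator {0<..<1} s * (f' (x, s) - (1 - s) * g' (x, s))))"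
    unfolding trc_def by (intro Bochner_Integration.integral_cong refl) (simp add: algebra_simps)
  also have "\<dots> = a * trc f g x + b * trc f' g' x"
    unfolding trc_def using e by (subst Bochner_Integration.integral_add) auto
  finally show ?case .
qed

lemma trc_diff_AE:
  assumes "locint f" "locint g" "locint f'" "locint g'"
  shows "AE x in lborel. trc f g x - trc f' g' x = trc (\<lambda>z. f z - f' z) (\<lambda>z. g z - g' z) x"
  using trc_lincomb_AE[OF assms, of 1 "-1"] by (auto elim!: eventually_mono)

lemma prim_diff_AE:
  assumes l: "locint g" "locint g'"
  shows "AE x in lborel. \<forall>t. prim g (x, t) - prim g' (x, t) = prim (\<lambda>z. g z - g' z) (x, t)"
  using AE_slice_integrable[OF l(1)] AE_slice_integrable[OF l(2)]
proof eventually_elim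
  case (elim x)
  show ?case
  proof
    fix t
    have "integrable lborel (\<lambda>s. kap t s * g (x, s))" "integrable lborel (\<lambda>s. kap t s * g' (x, s))"
      by (rule slice_integrable[OF elim(1) _ _ kap_bound] slice_integrable[OF elim(2) _ _ kap_bound];
        (auto intro: Pair_borel locint_borel l))+
    then show "prim g (x, t) - prim g' (x, t) = prim (\<lambda>z. g z - g' z) (x, t)"
      by (simp add: prim_def right_diff_distrib)
  qed
qed

lemma norm_integral_le_nn:
  fixes h :: "'a \<Rightarrow> real"
  shows "ennreal \<bar>LINT x|M. h x\<bar> \<le> (\<integral>\<^sup>+x. ennreal \<bar>h x\<bar> \<partial>M)"
  using integral_norm_bound_ennreal[of M h] by (cases "integrable M h") (auto simp: not_integrable_integral_eq)

lemma L1n_trc: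
  assumes [measurable]: "borel_fun f" "borel_fun g" "S \<in> sets borel"
  shows "L1n S (trc f g) \<le> L1n (S \<times> {0<..<1}) f + L1n (S \<times> {0<..<1}) g"
proof -
  have "ennreal \<bar>trc f g x\<bar> \<le> L1n {0<..<1} (\<lambda>t. f (x, t)) + L1n {0<..<1} (\<lambda>t. g (x, t))" for x
  proof -
    have "ennreal \<bar>trc f g x\<bar> \<le> (\<integral>\<^sup>+t. ennreal \<bar>indicator {0<..<1} t * (f (x, t) - (1 - t) * g (x, t))\<bar> \<partial>lborel)"
      unfolding trc_def by (rule norm_integral_le_nn)
    also have "\<dots> \<le> (\<integral>\<^sup>+t. ennreal \<bar>f (x, t)\<bar> * indicator {0<..<1} t + ennreal \<bar>g (x, t)\<bar> * indicator {0<..<1} t \<partial>lborel)"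
    proof (rule nn_integral_mono)
      fix t :: real
      have "\<bar>f (x, t) - (1 - t) * g (x, t)\<bar> \<le> \<bar>f (x, t)\<bar> + \<bar>g (x, t)\<bar>" if "0 < t" "t < 1"
      proof -
        have "\<bar>(1 - t) * g (x, t)\<bar> \<le> 1 * \<bar>g (x, t)\<bar>"
          unfolding abs_mult using that by (intro mult_right_mono) auto
        then show ?thesis by linarith
      qed
      then show "ennreal \<bar>indicator {0<..<1} t * (f (x, t) - (1 - t) * g (x, t))\<bar>
        \<le> ennreal \<bar>f (x, t)\<bar> * indicator {0<..<1} t + ennreal \<bar>g (x, t)\<bar> * indicator {0<..<1} t"
        by (auto simp: indicator_def ennreal_plus[symmetric] simp del: ennreal_plus intro!: ennreal_leI)
    qed
    also have "\<dots> = L1n {0<..<1} (\<lambda>t. f (x, t)) + L1n {0<..<1} (\<lambda>t. g (x, t))"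
      unfolding L1n_def by (rule nn_integral_add) measurable
    finally show ?thesis .
  qed
  then have "L1n S (trc f g) \<le> (\<integral>\<^sup>+x. L1n {0<..<1} (\<lambda>t. f (x, t)) * indicator S x + L1n {0<..<1} (\<lambda>t. g (x, t)) * indicator S x \<partial>lborel)"
    unfolding L1n_def[of S] by (intro nn_integral_mono) (auto simp: indicator_def)
  also have "\<dots> = (\<integral>\<^sup>+x\<in>S. L1n {0<..<1} (\<lambda>t. f (x, t)) \<partial>lborel) + (\<integral>\<^sup>+x\<in>S. L1n {0<..<1} (\<lambda>t. g (x, t)) \<partial>lborel)"
    unfolding L1n_def by (rule nn_integral_add) measurable
  finally show ?thesis by (simp add: L1n_prod_fst)
qed

lemma L1n_prim_slice:
  assumes [measurable]: "borel_fun g" "S \<in> sets borel"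
  shows "L1n S (\<lambda>x. prim g (x, t)) \<le> L1n (S \<times> {-\<bar>t\<bar>..\<bar>t\<bar>}) g"
proof -
  have "ennreal \<bar>prim g (x, t)\<bar> \<le> L1n {-\<bar>t\<bar>..\<bar>t\<bar>} (\<lambda>s. g (x, s))" for x
  proof -
    have "ennreal \<bar>prim g (x, t)\<bar> \<le> (\<integral>\<^sup>+s. ennreal \<bar>kap t s * g (x, s)\<bar> \<partial>lborel)"
      unfolding prim_def fst_conv snd_conv by (rule norm_integral_le_nn)
    also have "\<dots> \<le> L1n {-\<bar>t\<bar>..\<bar>t\<bar>} (\<lambda>s. g (x, s))"
      unfolding L1n_def by (intro nn_integral_mono) (auto simp: kap_def indicator_def)
    finally show ?thesis .
  qed
  then show ?thesis
    by (subst L1n_prod_fst) (auto simp: L1n_def[of S] intro!: nn_integral_mono mult_right_mono)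
qed

abbreviation et :: "'a::euclidean_space \<times> real"
  where "et \<equiv> (0, 1)"

lemma et_Basis: "et \<in> Basis"
  by (simp add: Basis_prod_def)

lemma DERIV_et:
  fixes F :: "'a::euclidean_space \<times> real \<Rightarrow> real"
  assumes "smooth F"
  shows "((\<lambda>t. F (x, t)) has_real_derivative pderiv_dir et F (x, t)) (at t)"
  using has_real_derivative_along_line[OF smooth_differentiable[OF assms], of "(x, 0)" et t] by simp

lemma isCont_slice:
  fixes F :: "'a::euclidean_space \<times> real \<Rightarrow> real"
  assumes "smooth F" shows "isCont (\<lambda>t. F (x, t)) t"
  by (rule DERIV_isCont[OF DERIV_et[OF assms]])

lemma integral_FTC_open:
  assumes "a \<le> b" "\<And>t. DERIV H t :> h t" "\<And>t. isCont h t"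
  shows "(LINT t|lborel. indicator {a<..<b} t * h t) = H b - H (a::real)"
proof -
  have [measurable]: "borel_fun h"
    using assms(3) by (intro borel_measurable_continuous_onI continuous_at_imp_continuous_on) auto
  have "(LINT t|lborel. indicator {a<..<b} t * h t) = (LINT t|lborel. h t * indicator {a..b} t)"
    by (rule integral_cong_AE, measurable, use AE_lborel_singleton[of a] AE_lborel_singleton[of b] in eventually_elim)
      (auto simp: indicator_def)
  also have "\<dots> = H b - H a"
    by (rule integral_FTC_Icc_real) (use assms in auto)
  finally show ?thesis .
qed

lemma trc_smooth:
  fixes F :: "'a::euclidean_space \<times> real \<Rightarrow> real"
  assumes F: "smooth F"
  shows "trc F (pderiv_dir et F) x = F (x, 0)"
    and "prim (pderiv_dir et F) (x, t) = F (x, t) - F (x, 0)"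
proof -
  let ?G = "pderiv_dir et F"
  have G: "smooth ?G" by (rule smooth_pderiv_dir[OF F et_Basis])
  have "trc F ?G x = (\<lambda>t. - (1 - t) * F (x, t)) 1 - (\<lambda>t. - (1 - t) * F (x, t)) 0"
    unfolding trc_def
  proof (rule integral_FTC_open)
    show "((\<lambda>t. - (1 - t) * F (x, t)) has_real_derivative (F (x, t) - (1 - t) * ?G (x, t))) (at t)" for t
      by (auto intro!: derivative_eq_intros DERIV_et[OF F] simp: algebra_simps)
    show "isCont (\<lambda>t. F (x, t) - (1 - t) * ?G (x, t)) t" for t
      by (intro continuous_intros isCont_slice F G)
  qed simp
  then show "trc F ?G x = F (x, 0)" by simp
  have c: "(LINT s|lborel. indicator {a<..<b} s * ?G (x, s)) = F (x, b) - F (x, a)" if "a \<le> b" for a b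
    by (rule integral_FTC_open[OF that DERIV_et[OF F] isCont_slice[OF G]])
  show "prim ?G (x, t) = F (x, t) - F (x, 0)"
  proof (cases "t \<ge> 0")
    case True
    have "prim ?G (x, t) = (LINT s|lborel. indicator {0<..<t} s * ?G (x, s))"
      unfolding prim_def using True by (intro Bochner_Integration.integral_cong) (auto simp: kap_def indicator_def)
    then show ?thesis using c[OF True] by simp
  next
    case False
    have "prim ?G (x, t) = (LINT s|lborel. - (indicator {t<..<0} s * ?G (x, s)))"
      unfolding prim_def using False by (intro Bochner_Integration.integral_cong) (auto simp: kap_def indicator_def)
    then show ?thesis using c[of t 0] False by simp
  qed
qed

lemma AE_fst:
  assumes "AE x in (lborel :: 'a::euclidean_space measure). P x"
  shows "AE z in (lborel :: ('a \<times> 'b::euclidean_space) measure). P (fst z)"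
proof -
  obtain N where N: "N \<in> null_sets lborel" "{x. \<not> P x} \<subseteq> N"
    using AE_E[OF assms] by (auto simp: null_sets_def)
  have "emeasure (lborel \<Otimes>\<^sub>M lborel) (N \<times> (UNIV :: 'b set)) = emeasure lborel N * emeasure lborel (UNIV :: 'b set)"
    using N by (intro lborel.emeasure_pair_measure_Times) auto
  then have "emeasure lborel (N \<times> (UNIV :: 'b set)) = 0"
    using N unfolding lborel_prod by (simp add: null_sets_def)
  moreover have "N \<times> (UNIV :: 'b set) \<in> sets borel" using N by (intro Times_sets) auto
  ultimately have "N \<times> (UNIV :: 'b set) \<in> null_sets lborel" by (simp add: null_sets_def)
  then show ?thesis
    by (rule AE_I') (use N(2) in auto)
qed

lemma fst_borel: "borel_fun (fst :: 'a::euclidean_space \<times> 'b::euclidean_space \<Rightarrow> 'a)"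
  by (rule borel_measurable_continuous_onI) (rule continuous_on_fst[OF continuous_on_id])

lemma L1n_trc_prim:
  assumes [measurable]: "borel_fun a" "borel_fun b" "S \<in> sets borel" and T: "T \<ge> 0"
  shows "L1n (S \<times> {-T..T}) (\<lambda>z. trc a b (fst z) + prim b z)
    \<le> ennreal (2 * T) * (L1n (S \<times> {0<..<1}) a + L1n (S \<times> {0<..<1}) b + L1n (S \<times> {-T..T}) b)"
proof -
  have m [measurable]: "borel_fun (trc a b)" "borel_fun (prim b)"
    "borel_fun (fst :: 'a \<times> real \<Rightarrow> 'a)"
    by (auto intro: trc_borel prim_borel fst_borel)
  have m2 [measurable]: "borel_fun (\<lambda>z::'a \<times> real. trc a b (fst z))"
    by (rule measurable_compose[OF m(3) m(1)])
  have "L1n (S \<times> {-T..T}) (\<lambda>z. trc a b (fst z) + prim b z)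
      \<le> L1n (S \<times> {-T..T}) (\<lambda>z. trc a b (fst z)) + L1n (S \<times> {-T..T}) (prim b)"
    by (rule L1n_triangle) auto
  also have "L1n (S \<times> {-T..T}) (\<lambda>z. trc a b (fst z)) = (\<integral>\<^sup>+t\<in>{-T..T}. L1n S (trc a b) \<partial>lborel)"
    by (subst L1n_prod_snd) auto
  also have "\<dots> = L1n S (trc a b) * ennreal (2 * T)"
    using T by (subst nn_integral_cmult_indicator) auto
  also have "L1n (S \<times> {-T..T}) (prim b) = (\<integral>\<^sup>+t\<in>{-T..T}. L1n S (\<lambda>x. prim b (x, t)) \<partial>lborel)"
    by (subst L1n_prod_snd) auto
  also have "\<dots> \<le> (\<integral>\<^sup>+t\<in>{-T..T}. L1n (S \<times> {-T..T}) b \<partial>lborel)"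
  proof (rule nn_integral_mono)
    fix t :: real
    have "L1n S (\<lambda>x. prim b (x, t)) \<le> L1n (S \<times> {-T..T}) b" if "t \<in> {-T..T}"
      using that by (intro order_trans[OF L1n_prim_slice] L1n_mono_set) auto
    then show "L1n S (\<lambda>x. prim b (x, t)) * indicator {-T..T} t \<le> L1n (S \<times> {-T..T}) b * indicator {-T..T} t"
      by (auto simp: indicator_def)
  qed
  also have "\<dots> = L1n (S \<times> {-T..T}) b * ennreal (2 * T)"
    using T by (subst nn_integral_cmult_indicator) auto
  also have "L1n S (trc a b) * ennreal (2 * T) + L1n (S \<times> {-T..T}) b * ennreal (2 * T)
      = ennreal (2 * T) * (L1n S (trc a b) + L1n (S \<times> {-T..T}) b)" by (simp add: algebra_simps)
  also have "\<dots> \<le> ennreal (2 * T) * (L1n (S \<times> {0<..<1}) a + L1n (S \<times> {0<..<1}) b + L1n (S \<times> {-T..T}) b)"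
    by (intro mult_left_mono add_right_mono L1n_trc) auto
  finally show ?thesis by (simp add: add_left_mono)
qed

lemma tendsto_L1n_subset:
  assumes "\<And>R. (\<lambda>j. L1n (cball 0 R) (u j)) \<longlonglongrightarrow> 0" "bounded S"
  shows "(\<lambda>j. L1n S (u j)) \<longlonglongrightarrow> 0"
proof -
  obtain R where "\<forall>x\<in>S. norm x \<le> R" using assms(2) unfolding bounded_iff by blast
  then have S: "S \<subseteq> cball 0 R" by auto
  show ?thesis
    by (rule tendsto_sandwich[OF _ _ tendsto_const assms(1)[of R]])
      (simp_all add: always_eventually L1n_mono_set[OF S])
qed

text \<open>The identity is elementary for smooth functions; both sides are continuous in local \<open>L\<^sub>1\<close>.\<close>

lemma trace_representation:
  fixes f g :: "'a::euclidean_space \<times> real \<Rightarrow> real"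
  assumes w: "wderiv [et] f g"
  shows "AE z in lborel. f z = trc f g (fst z) + prim g z"
proof (rule L1n_zero_imp_AE)
  have l: "locint f" "locint g" using w by (auto simp: wderiv_def)
  have [measurable]: "borel_fun f" "borel_fun g"
    using l by (auto intro: locint_borel)
  show "borel_fun f" by simp
  have m2: "borel_fun (\<lambda>z. trc a b (fst z) + prim b z)"
    if "borel_fun a" "borel_fun b" for a b :: "'a \<times> real \<Rightarrow> real"
    by (intro borel_measurable_add measurable_compose[OF fst_borel trc_borel] prim_borel that)
  then show "borel_fun (\<lambda>z. trc f g (fst z) + prim g z)" by simp
  fix n :: nat
  define S where "S = cball (0::'a) n"
  define T where "T = real n"
  have T: "T \<ge> 0" and Sb: "bounded S" and [measurable]: "S \<in> sets borel" by (auto simp: T_def S_def)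
  define F where "F j = conv f (dil j moll)" for j
  define G where "G j = conv g (dil j moll)" for j
  note mt = tfun_dil[OF moll_facts(1)[where 'a="'a \<times> real"]]
  have sF: "smooth (F j)" for j unfolding F_def by (rule smooth_conv[OF l(1) mt])
  have G: "pderiv_dir et (F j) = G j" for j
    unfolding F_def G_def using wderiv_conv[OF w _ mt] et_Basis by simp
  have lF: "locint (F j)" "locint (G j)" for j
    unfolding F_def G_def by (intro locint_conv l tfun_kern mt)+
  have [measurable]: "borel_fun (F j)" "borel_fun (G j)" for j
    using lF by (auto intro: locint_borel)
  have R: "F j z = trc (F j) (G j) (fst z) + prim (G j) z" for j z
    using trc_smooth[OF sF, of j "fst z"] trc_smooth(2)[OF sF, of j "fst z" "snd z"] unfolding G by simp
  have conv: "(\<lambda>j. L1n A (\<lambda>z. F j z - f z)) \<longlonglongrightarrow> 0" "(\<lambda>j. L1n A (\<lambda>z. G j z - g z)) \<longlonglongrightarrow> 0" if "bounded A" for A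
    unfolding F_def G_def
    by (intro tendsto_L1n_subset[OF _ that] mollify_tendsto l moll_facts)+
  have "(\<lambda>j. ennreal (2 * T) * (L1n (S \<times> {0<..<1}) (\<lambda>z. F j z - f z) + L1n (S \<times> {0<..<1}) (\<lambda>z. G j z - g z)
      + L1n (S \<times> {-T..T}) (\<lambda>z. G j z - g z))) \<longlonglongrightarrow> ennreal (2 * T) * (0 + 0 + 0)"
    by (intro ennreal_tendsto_cmult tendsto_add conv bounded_Times Sb) auto
  then have lim: "(\<lambda>j. ennreal (2 * T) * (L1n (S \<times> {0<..<1}) (\<lambda>z. F j z - f z) + L1n (S \<times> {0<..<1}) (\<lambda>z. G j z - g z)
      + L1n (S \<times> {-T..T}) (\<lambda>z. G j z - g z))) \<longlonglongrightarrow> 0" by simp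
  have bd: "L1n (S \<times> {-T..T}) (\<lambda>z. F j z - (trc f g (fst z) + prim g z)) \<le>
      ennreal (2 * T) * (L1n (S \<times> {0<..<1}) (\<lambda>z. F j z - f z) + L1n (S \<times> {0<..<1}) (\<lambda>z. G j z - g z)
      + L1n (S \<times> {-T..T}) (\<lambda>z. G j z - g z))" for j
  proof -
    have "AE z in lborel. F j z - (trc f g (fst z) + prim g z)
      = trc (\<lambda>z. F j z - f z) (\<lambda>z. G j z - g z) (fst z) + prim (\<lambda>z. G j z - g z) z"
      using AE_fst[OF trc_diff_AE[OF lF l], where 'b=real, of j j] AE_fst[OF prim_diff_AE[OF lF(2) l(2)], where 'b=real, of j]
    proof eventually_elim
      case (elim z)
      from spec[OF elim(2), of "snd z"] elim(1) show ?case unfolding R[of j z] by simp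
    qed
    then have "L1n (S \<times> {-T..T}) (\<lambda>z. F j z - (trc f g (fst z) + prim g z))
      = L1n (S \<times> {-T..T}) (\<lambda>z. trc (\<lambda>z. F j z - f z) (\<lambda>z. G j z - g z) (fst z) + prim (\<lambda>z. G j z - g z) z)"
      by (intro L1n_cong_AE) (auto elim!: eventually_mono)
    also have "\<dots> \<le> ennreal (2 * T) * (L1n (S \<times> {0<..<1}) (\<lambda>z. F j z - f z) + L1n (S \<times> {0<..<1}) (\<lambda>z. G j z - g z)
      + L1n (S \<times> {-T..T}) (\<lambda>z. G j z - g z))"
      by (rule L1n_trc_prim) (auto simp: T)
    finally show ?thesis .
  qed
  have z0: "L1n (S \<times> {-T..T}) (\<lambda>z. f z - (trc f g (fst z) + prim g z)) = 0"
  proof (rule L1_limit_unique[where u=F])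
    show "(\<lambda>j. L1n (S \<times> {-T..T}) (\<lambda>z. F j z - f z)) \<longlonglongrightarrow> 0"
      by (intro conv bounded_Times Sb) auto
    show "(\<lambda>j. L1n (S \<times> {-T..T}) (\<lambda>z. F j z - (trc f g (fst z) + prim g z))) \<longlonglongrightarrow> 0"
      by (rule tendsto_sandwich[OF _ _ tendsto_const lim]) (auto simp: bd)
  qed (auto intro: m2)
  have "cball (0 :: 'a \<times> real) (real n) \<subseteq> S \<times> {-T..T}"
  proof
    fix z :: "'a \<times> real" assume "z \<in> cball 0 (real n)"
    then have "norm z \<le> real n" by simp
    then have "norm (fst z) \<le> real n" "norm (snd z) \<le> real n"
      using norm_fst_le[of "fst z" "snd z"] norm_snd_le[of "snd z" "fst z"] by simp_all
    then show "z \<in> S \<times> {-T..T}" by (cases z) (auto simp: S_def T_def abs_le_iff)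
  qed
  from L1n_mono_set[OF this, of "\<lambda>z. f z - (trc f g (fst z) + prim g z)"]
  show "L1n (cball 0 (real n)) (\<lambda>z. f z - (trc f g (fst z) + prim g z)) = 0"
    using z0 by simp
qed

lemma L1n_thin_slab:
  fixes g :: "'a::euclidean_space \<times> real \<Rightarrow> real"
  assumes g: "locint g" and Q: "bounded Q" "Q \<in> sets borel"
  shows "((\<lambda>t. L1n (Q \<times> {-\<bar>t\<bar>..\<bar>t\<bar>}) g) \<longlongrightarrow> 0) (at 0)"
  unfolding tendsto_at_iff_sequentially
proof (intro allI impI)
  fix X :: "nat \<Rightarrow> real" assume X: "\<forall>i. X i \<in> UNIV - {0}" "X \<longlonglongrightarrow> 0"
  have [measurable]: "borel_fun g" "Q \<in> sets borel" using g Q by (auto intro: locint_borel)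
  obtain B where B: "\<And>n. \<bar>X n\<bar> \<le> B"
    using convergent_imp_Bseq[OF convergentI[OF X(2)]] by (auto simp: Bseq_def)
  have "(\<lambda>n. \<integral>\<^sup>+z. ennreal \<bar>g z\<bar> * indicator (Q \<times> {-\<bar>X n\<bar>..\<bar>X n\<bar>}) z \<partial>lborel) \<longlonglongrightarrow> (\<integral>\<^sup>+z. 0 \<partial>(lborel :: ('a \<times> real) measure))"
  proof (rule nn_integral_dominated_convergence[where w="\<lambda>z. ennreal \<bar>g z\<bar> * indicator (Q \<times> {-B..B}) z"])
    show "(\<integral>\<^sup>+z. ennreal \<bar>g z\<bar> * indicator (Q \<times> {-B..B}) z \<partial>lborel) < \<infinity>"
      using locint_bounded[OF g bounded_Times[OF Q(1)], of "{-B..B}"] by (simp add: L1n_def)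
    show "AE z in lborel. ennreal \<bar>g z\<bar> * indicator (Q \<times> {-\<bar>X n\<bar>..\<bar>X n\<bar>}) z
        \<le> ennreal \<bar>g z\<bar> * indicator (Q \<times> {-B..B}) z" for n
    proof (intro AE_I2 mult_left_mono)
      fix z :: "'a \<times> real"
      have "Q \<times> {-\<bar>X n\<bar>..\<bar>X n\<bar>} \<subseteq> Q \<times> {-B..B}" using B[of n] by auto
      then show "indicator (Q \<times> {-\<bar>X n\<bar>..\<bar>X n\<bar>}) z \<le> (indicator (Q \<times> {-B..B}) z :: ennreal)"
        by (auto simp: indicator_def)
    qed simp
    show "AE z in lborel. (\<lambda>n. ennreal \<bar>g z\<bar> * indicator (Q \<times> {-\<bar>X n\<bar>..\<bar>X n\<bar>}) z) \<longlonglongrightarrow> 0"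
      using AE_snd_neq[of 0]
    proof eventually_elim
      case (elim z)
      have "(\<lambda>n. \<bar>X n\<bar>) \<longlonglongrightarrow> 0" using X(2) by (rule tendsto_rabs_zero)
      then have "\<forall>\<^sub>F n in sequentially. \<bar>X n\<bar> < \<bar>snd z\<bar>"
        using elim by (intro order_tendstoD(2)) auto
      then have "\<forall>\<^sub>F n in sequentially. ennreal \<bar>g z\<bar> * indicator (Q \<times> {-\<bar>X n\<bar>..\<bar>X n\<bar>}) z = 0"
        by eventually_elim (auto simp: indicator_def)
      then show ?case by (rule tendsto_eventually)
    qed
  qed auto
  then show "((\<lambda>t. L1n (Q \<times> {-\<bar>t\<bar>..\<bar>t\<bar>}) g) \<circ> X) \<longlonglongrightarrow> 0"
    by (simp add: L1n_def o_def)
qed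

lemma cubeE:
  assumes "is_cube Q" shows "bounded Q" "Q \<in> sets borel"
  using assms by (auto simp: is_cube_def bounded_box)

lemma locint_trc:
  assumes "locint f" "locint g" shows "locint (trc f g)"
proof -
  have [measurable]: "borel_fun f" "borel_fun g"
    using assms by (auto intro: locint_borel)
  have "L1n (cball 0 R) (trc f g) < \<infinity>" for R
  proof -
    have "L1n (cball 0 R) (trc f g) \<le> L1n (cball 0 R \<times> {0<..<1}) f + L1n (cball 0 R \<times> {0<..<1}) g"
      by (rule L1n_trc) auto
    also have "\<dots> < \<infinity>"
      using locint_bounded[OF assms(1), of "cball 0 R \<times> {0<..<1}"] locint_bounded[OF assms(2), of "cball 0 R \<times> {0<..<1}"]
      by (simp add: bounded_Times)
    finally show ?thesis .
  qed
  then show ?thesis by (simp add: locint_def trc_borel)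
qed

text \<open>The representative \<open>trc f g x + \<integral>\<^sub>0\<^sup>t g(x,s) ds\<close> of \<open>f\<close> deviates from \<open>trc f g\<close> by at most the
  integral of \<open>\<bar>g\<bar>\<close> over a thin slab.\<close>

lemma is_traceI:
  fixes f g :: "(real^'n) \<times> real \<Rightarrow> real"
  assumes w: "wderiv [et] f g" and f: "f0 \<in> L1_loc" "f =\<^sub>a f0"
  shows "is_trace f0 (trc f g)"
  unfolding is_trace_def
proof (intro conjI bexI allI impI)
  have l: "locint f" "locint g" using w by (auto simp: wderiv_def)
  note b = locint_borel[OF l(1)] locint_borel[OF l(2)]
  show "f0 \<in> L1_loc" by fact
  show "trc f g \<in> L1_loc" by (intro locint_imp_L1_loc locint_trc l)
  let ?f = "\<lambda>z. trc f g (fst z) + prim g z"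
  have m: "borel_fun (fst :: (real^'n) \<times> real \<Rightarrow> real^'n)"
    by (rule fst_borel)
  show "borel_fun ?f"
    by (intro borel_measurable_add measurable_compose[OF m trc_borel] prim_borel b)
  show "?f =\<^sub>a f0"
  proof -
    have "?f =\<^sub>a f" using trace_representation[OF w] unfolding ae_eq_def AE_lebesgue_iff by eventually_elim simp
    then show ?thesis using f(2) ae_eq_trans by blast
  qed
  fix Q :: "(real^'n) set" assume Q: "is_cube Q"
  note Qb = cubeE[OF Q]
  have "(\<integral>\<^sup>+x\<in>Q. ennreal \<bar>trc f g x - ?f (x, t)\<bar> \<partial>lebesgue) = L1n Q (\<lambda>x. prim g (x, t))" for t
    unfolding set_nn_integral_lebesgue by (simp add: L1n_def)
  moreover have "((\<lambda>t. L1n Q (\<lambda>x. prim g (x, t))) \<longlongrightarrow> 0) (at 0)"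
    by (rule tendsto_sandwich[OF _ _ tendsto_const L1n_thin_slab[OF l(2) Qb]])
      (simp_all add: always_eventually L1n_prim_slice b Qb)
  ultimately show "((\<lambda>t. \<integral>\<^sup>+x\<in>Q. ennreal \<bar>trc f g x - ?f (x, t)\<bar> \<partial>lebesgue) \<longlongrightarrow> 0) (at 0)"
    by simp
qed

lemma L1n_rep:
  fixes \<phi> :: "'a::euclidean_space \<Rightarrow> real"
  assumes "\<phi> \<in> L1_loc"
  shows "L1n Q (\<lambda>x. \<phi> x - h x) = L1n Q (\<lambda>x. rep \<phi> x - h x)"
  using rep(2)[OF assms] unfolding ae_eq_def AE_lebesgue_iff
  by (intro L1n_cong_AE) (auto elim!: eventually_mono)

text \<open>Two representatives of \<open>f\<close> agree on almost every slice. On such slices at small heights both are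
  close to their limits, which therefore coincide.\<close>

lemma is_trace_unique:
  fixes f :: "(real^'n) \<times> real \<Rightarrow> real"
  assumes "is_trace f \<phi>" "is_trace f \<psi>"
  shows "\<phi> =\<^sub>a \<psi>"
proof -
  obtain f1 where f1: "borel_fun f1" "f1 =\<^sub>a f"
    "\<And>Q. is_cube Q \<Longrightarrow> ((\<lambda>t. \<integral>\<^sup>+x\<in>Q. ennreal \<bar>\<phi> x - f1 (x, t)\<bar> \<partial>lebesgue) \<longlongrightarrow> 0) (at 0)"
    using assms(1) by (auto simp: is_trace_def)
  obtain f2 where f2: "borel_fun f2" "f2 =\<^sub>a f"
    "\<And>Q. is_cube Q \<Longrightarrow> ((\<lambda>t. \<integral>\<^sup>+x\<in>Q. ennreal \<bar>\<psi> x - f2 (x, t)\<bar> \<partial>lebesgue) \<longlongrightarrow> 0) (at 0)"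
    using assms(2) by (auto simp: is_trace_def)
  have L: "\<phi> \<in> L1_loc" "\<psi> \<in> L1_loc" using assms by (auto simp: is_trace_def)
  have [measurable]: "borel_fun f1" "borel_fun f2"
    "borel_fun (rep \<phi>)" "borel_fun (rep \<psi>)"
    using f1 f2 rep(1)[OF L(1)] rep(1)[OF L(2)] by (auto intro: locint_borel)
  have f12: "AE z in lborel. f1 z = f2 z"
    using f1(2) f2(2) unfolding ae_eq_def AE_lebesgue_iff by eventually_elim simp
  have z: "L1n Q (\<lambda>x. rep \<phi> x - rep \<psi> x) = 0" if Q: "is_cube Q" for Q
  proof (rule ccontr)
    have [measurable]: "Q \<in> sets borel" using cubeE[OF Q] by simp
    define a where "a t = L1n Q (\<lambda>x. rep \<phi> x - f1 (x, t))" for t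
    define b where "b t = L1n Q (\<lambda>x. rep \<psi> x - f2 (x, t))" for t
    define c where "c t = L1n Q (\<lambda>x. f1 (x, t) - f2 (x, t))" for t
    define q where "q = L1n Q (\<lambda>x. rep \<phi> x - rep \<psi> x)"
    assume "\<not> L1n Q (\<lambda>x. rep \<phi> x - rep \<psi> x) = 0"
    then have q: "q > 0" by (simp add: q_def zero_less_iff_neq_zero)
    have "(a \<longlongrightarrow> 0) (at 0)" "(b \<longlongrightarrow> 0) (at 0)"
      using f1(3)[OF Q] f2(3)[OF Q] unfolding set_nn_integral_lebesgue a_def b_def
      by (simp_all add: L1n_rep[OF L(1)] L1n_rep[OF L(2)])
    then have "((\<lambda>t. a t + b t) \<longlongrightarrow> 0 + 0) (at 0)" by (intro tendsto_add)
    then have "\<forall>\<^sub>F t in at 0. a t + b t < q" using q by (intro order_tendstoD(2)) auto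
    then obtain d where d: "d > 0" "\<And>t. 0 < t \<Longrightarrow> t < d \<Longrightarrow> a t + b t < q"
      by (auto simp: eventually_at dist_real_def)
    have "L1n (Q \<times> UNIV) (\<lambda>z. f1 z - f2 z) = 0"
      by (subst L1n_eq_0) (use f12 in \<open>auto elim!: eventually_mono\<close>)
    then have "(\<integral>\<^sup>+t. c t \<partial>lborel) = 0"
      unfolding c_def by (subst (asm) L1n_prod_snd) auto
    moreover have "borel_fun c" unfolding c_def[abs_def] L1n_def by measurable
    ultimately have "AE t in lborel. c t = 0" by (subst (asm) nn_integral_0_iff_AE) auto
    then have "\<exists>t\<in>{0<..<d}. c t = 0"
    proof (rule contrapos_pp)
      assume n: "\<not> (\<exists>t\<in>{0<..<d}. c t = 0)"
      show "\<not> (AE t in lborel. c t = 0)"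
      proof
        assume "AE t in lborel. c t = 0"
        then have "AE t in lborel. t \<notin> {0<..<d}" by eventually_elim (use n in auto)
        then have "emeasure lborel {0<..<d} = 0"
          by (subst (asm) AE_iff_measurable[of "{0<..<d}"]) auto
        then show False using d(1) by simp
      qed
    qed
    then obtain t where t: "0 < t" "t < d" "c t = 0" by auto
    have "q \<le> a t + L1n Q (\<lambda>x. f1 (x, t) - rep \<psi> x)"
      unfolding q_def a_def by (rule L1n_diff_triangle) auto
    also have "L1n Q (\<lambda>x. f1 (x, t) - rep \<psi> x) \<le> c t + L1n Q (\<lambda>x. f2 (x, t) - rep \<psi> x)"
      unfolding c_def by (rule L1n_diff_triangle) auto
    also have "L1n Q (\<lambda>x. f2 (x, t) - rep \<psi> x) = b t" unfolding b_def by (rule L1n_minus_commute)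
    finally have "q \<le> a t + b t" using t(3) by (simp add: add_left_mono)
    then show False using d(2)[OF t(1,2)] by simp
  qed
  have "AE x in lborel. rep \<phi> x = rep \<psi> x"
  proof (rule L1n_zero_imp_AE)
    fix n :: nat
    have "cball (0 :: real^'n) (real n) \<subseteq> cube (- (real n + 1) *\<^sub>R One) (2 * (real n + 1))"
    proof
      fix x :: "real^'n" assume "x \<in> cball 0 (real n)"
      then have "\<bar>x \<bullet> i\<bar> \<le> real n" if "i \<in> Basis" for i using Basis_le_norm[OF that, of x] by simp
      then show "x \<in> cube (- (real n + 1) *\<^sub>R One) (2 * (real n + 1))"
        unfolding mem_cube by (force simp: abs_le_iff)
    qed
    from L1n_mono_set[OF this, of "\<lambda>x. rep \<phi> x - rep \<psi> x"]
    show "L1n (cball 0 (real n)) (\<lambda>x. rep \<phi> x - rep \<psi> x) = 0"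
      using z[OF is_cube_cube, of "2 * (real n + 1)"] by simp
  qed auto
  then have "rep \<phi> =\<^sub>a rep \<psi>" by (simp add: ae_eq_def AE_lebesgue_iff)
  from ae_eq_trans[OF ae_eq_sym[OF rep(2)[OF L(1)]] ae_eq_trans[OF this rep(2)[OF L(2)]]]
  show ?thesis .
qed

lemma Tr_eq:
  fixes f :: "(real^'n) \<times> real \<Rightarrow> real"
  assumes "is_trace f \<phi>"
  shows "Tr f =\<^sub>a \<phi>" "is_trace f (Tr f)"
proof -
  show "is_trace f (Tr f)" unfolding Tr_def by (rule someI[of "is_trace f", OF assms])
  then show "Tr f =\<^sub>a \<phi>" using is_trace_unique assms by blast
qed

lemma L1_loc_add:
  assumes "f \<in> L1_loc" "g \<in> L1_loc" shows "(\<lambda>x. f x + g x) \<in> L1_loc"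
  using assms by (auto simp: L1_loc_def intro: set_integral_add)

lemma L1_loc_cmult:
  assumes "f \<in> L1_loc" shows "(\<lambda>x. c * f x) \<in> L1_loc"
  using assms by (auto simp: L1_loc_def)

section \<open>Finite differences\<close>

definition fd :: "nat \<Rightarrow> nat \<Rightarrow> real"
  where "fd l j = (-1) ^ j * real (l choose j)"

lemma fin_diff_fd: "fin_diff l h \<phi> x = (\<Sum>i\<le>l. fd l i * \<phi> (x + real i *\<^sub>R h))"
  by (simp add: fin_diff_def fd_def)

lemma fd_0 [simp]: "fd l 0 = 1"
  by (simp add: fd_def)

text \<open>Pascal's rule.\<close>

lemma fd_Suc: "(\<Sum>j\<le>Suc l. fd (Suc l) j * a j) = (\<Sum>j\<le>l. fd l j * (a j - a (Suc j)))"
proof -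
  have "(\<Sum>j\<le>Suc l. fd (Suc l) j * a j) = a 0 + (\<Sum>j\<le>l. fd (Suc l) (Suc j) * a (Suc j))"
    by (subst sum.atMost_Suc_shift) simp
  also have "(\<Sum>j\<le>l. fd (Suc l) (Suc j) * a (Suc j))
      = (\<Sum>j\<le>l. fd l (Suc j) * a (Suc j)) - (\<Sum>j\<le>l. fd l j * a (Suc j))"
    unfolding sum_subtractf[symmetric]
    by (intro sum.cong refl) (simp add: fd_def algebra_simps)
  also have "a 0 + ((\<Sum>j\<le>l. fd l (Suc j) * a (Suc j)) - (\<Sum>j\<le>l. fd l j * a (Suc j)))
      = (\<Sum>j\<le>Suc l. fd l j * a j) - (\<Sum>j\<le>l. fd l j * a (Suc j))"
    by (subst sum.atMost_Suc_shift) simp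
  also have "(\<Sum>j\<le>Suc l. fd l j * a j) = (\<Sum>j\<le>l. fd l j * a j)"
    by (simp add: fd_def)
  finally show ?thesis by (simp add: sum_subtractf right_diff_distrib)
qed

lemma abs_fd: "\<bar>fd l j\<bar> = real (l choose j)"
  by (simp add: fd_def abs_mult power_abs)

lemma sum_abs_fd: "(\<Sum>j\<le>l. \<bar>fd l j\<bar>) = 2 ^ l"
  unfolding abs_fd using choose_row_sum[of l] by (metis of_nat_numeral of_nat_power of_nat_sum)

text \<open>A difference of order \<open>l + 1\<close> is an average of the derivative of that order against a spline that
  vanishes to order \<open>l\<close> at \<open>0\<close>. The factor \<open>s\<^sup>l\<close> is what makes the trace estimate summable over scales.\<close>

lemma fin_diff_1d:
  fixes D :: "nat \<Rightarrow> real \<Rightarrow> real"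
  assumes "\<And>k s. k < Suc l \<Longrightarrow> DERIV (D k) s :> D (Suc k) s" "\<And>s. isCont (D (Suc l)) s" "\<tau> > 0"
  shows "ennreal \<bar>\<Sum>j\<le>Suc l. fd (Suc l) j * D 0 (real j * \<tau>)\<bar>
    \<le> (\<integral>\<^sup>+s\<in>{0<..<real (Suc l) * \<tau>}. ennreal (s ^ l * \<bar>D (Suc l) s\<bar>) \<partial>lborel)"
  using assms(1,2)
proof (induction l arbitrary: D)
  case 0
  have "D 0 \<tau> - D 0 0 = (LINT s|lborel. indicator {0<..<\<tau>} s * D 1 s)"
    by (rule integral_FTC_open[symmetric]) (use 0 assms(3) in auto)
  then have "ennreal \<bar>D 0 \<tau> - D 0 0\<bar> \<le> (\<integral>\<^sup>+s. ennreal \<bar>indicator {0<..<\<tau>} s * D 1 s\<bar> \<partial>lborel)"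
    using norm_integral_le_nn by simp
  also have "\<dots> = (\<integral>\<^sup>+s\<in>{0<..<\<tau>}. ennreal \<bar>D 1 s\<bar> \<partial>lborel)"
    by (intro nn_integral_cong) (auto simp: indicator_def)
  finally show ?case by (simp add: fd_def abs_minus_commute)
next
  case (Suc l)
  define E where "E k s = D k (s + \<tau>) - D k s" for k s
  have cD: "isCont (D (Suc (Suc l))) s" for s by (rule Suc.prems(2))
  have m [measurable]: "borel_fun (D (Suc (Suc l)))"
    using cD by (intro borel_measurable_continuous_onI continuous_at_imp_continuous_on) auto
  have dE: "DERIV (E k) s :> E (Suc k) s" if "k < Suc (Suc l)" for k s
    unfolding E_def
    by (intro DERIV_diff DERIV_shift[THEN iffD1, OF Suc.prems(1)[OF that]] Suc.prems(1)[OF that])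
  have "(\<Sum>j\<le>Suc (Suc l). fd (Suc (Suc l)) j * D 0 (real j * \<tau>)) = - (\<Sum>j\<le>Suc l. fd (Suc l) j * E 0 (real j * \<tau>))"
  proof -
    have e: "D 0 (real j * \<tau>) - D 0 (real (Suc j) * \<tau>) = - E 0 (real j * \<tau>)" for j
      by (simp add: E_def algebra_simps)
    show ?thesis unfolding fd_Suc[of "Suc l"] e by (simp add: sum_negf)
  qed
  then have "ennreal \<bar>\<Sum>j\<le>Suc (Suc l). fd (Suc (Suc l)) j * D 0 (real j * \<tau>)\<bar>
      = ennreal \<bar>\<Sum>j\<le>Suc l. fd (Suc l) j * E 0 (real j * \<tau>)\<bar>" by simp
  also have "\<dots> \<le> (\<integral>\<^sup>+s\<in>{0<..<real (Suc l) * \<tau>}. ennreal (s ^ l * \<bar>E (Suc l) s\<bar>) \<partial>lborel)"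
  proof (rule Suc.IH)
    show "isCont (E (Suc l)) s" for s by (rule DERIV_isCont[OF dE]) simp
  qed (use dE in auto)
  also have "\<dots> \<le> (\<integral>\<^sup>+s. (\<integral>\<^sup>+u. ennreal \<bar>D (Suc (Suc l)) u\<bar> * ennreal (s ^ l) *
      indicator {0<..<real (Suc l) * \<tau>} s * indicator {s<..<s + \<tau>} u \<partial>lborel) \<partial>lborel)"
  proof (rule nn_integral_mono)
    fix s :: real
    show "ennreal (s ^ l * \<bar>E (Suc l) s\<bar>) * indicator {0<..<real (Suc l) * \<tau>} s
      \<le> (\<integral>\<^sup>+u. ennreal \<bar>D (Suc (Suc l)) u\<bar> * ennreal (s ^ l) *
      indicator {0<..<real (Suc l) * \<tau>} s * indicator {s<..<s + \<tau>} u \<partial>lborel)"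
    proof (cases "s \<in> {0<..<real (Suc l) * \<tau>}")
      case True
      have "E (Suc l) s = (LINT u|lborel. indicator {s<..<s + \<tau>} u * D (Suc (Suc l)) u)"
        unfolding E_def by (rule integral_FTC_open[symmetric]) (use Suc.prems assms(3) in auto)
      then have "ennreal \<bar>E (Suc l) s\<bar> \<le> (\<integral>\<^sup>+u. ennreal \<bar>indicator {s<..<s + \<tau>} u * D (Suc (Suc l)) u\<bar> \<partial>lborel)"
        using norm_integral_le_nn by simp
      then have "ennreal (s ^ l) * ennreal \<bar>E (Suc l) s\<bar>
        \<le> ennreal (s ^ l) * (\<integral>\<^sup>+u. ennreal \<bar>indicator {s<..<s + \<tau>} u * D (Suc (Suc l)) u\<bar> \<partial>lborel)"
        by (rule mult_left_mono) simp
      also have "\<dots> = (\<integral>\<^sup>+u. ennreal (s ^ l) * ennreal \<bar>indicator {s<..<s + \<tau>} u * D (Suc (Suc l)) u\<bar> \<partial>lborel)"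
        by (rule nn_integral_cmult[symmetric]) measurable
      also have "\<dots> = (\<integral>\<^sup>+u. ennreal \<bar>D (Suc (Suc l)) u\<bar> * ennreal (s ^ l) *
        indicator {0<..<real (Suc l) * \<tau>} s * indicator {s<..<s + \<tau>} u \<partial>lborel)"
        using True by (intro nn_integral_cong) (auto simp: indicator_def mult.commute)
      finally show ?thesis using True by (simp add: ennreal_mult)
    qed simp
  qed
  also have "\<dots> = (\<integral>\<^sup>+u. (\<integral>\<^sup>+s. ennreal \<bar>D (Suc (Suc l)) u\<bar> * ennreal (s ^ l) *
      indicator {0<..<real (Suc l) * \<tau>} s * indicator {s<..<s + \<tau>} u \<partial>lborel) \<partial>lborel)"
  proof (rule lborel_pair.Fubini'[symmetric])
    have e: "(\<lambda>(s, u). indicator {s<..<s + \<tau>} u :: ennreal) = (\<lambda>z. indicator {z. fst z < snd z \<and> snd z < fst z + \<tau>} z)"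
      by (auto simp: indicator_def fun_eq_iff)
    have i: "(\<lambda>(s, u). indicator {s<..<s + \<tau>} u :: ennreal) \<in> borel_measurable (lborel \<Otimes>\<^sub>M lborel)"
      unfolding e by measurable
    show "(\<lambda>(s, u). ennreal \<bar>D (Suc (Suc l)) u\<bar> * ennreal (s ^ l) *
      indicator {0<..<real (Suc l) * \<tau>} s * indicator {s<..<s + \<tau>} u) \<in> borel_measurable (lborel \<Otimes>\<^sub>M lborel)"
    proof -
      have "(\<lambda>(s, u). ennreal \<bar>D (Suc (Suc l)) u\<bar> * ennreal (s ^ l) *
        indicator {0<..<real (Suc l) * \<tau>} s) \<in> borel_measurable (lborel \<Otimes>\<^sub>M lborel)"
        by measurable
      from borel_measurable_times_ennreal[OF this i] show ?thesis by (simp add: split_beta')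
    qed
  qed
  also have "\<dots> \<le> (\<integral>\<^sup>+u\<in>{0<..<real (Suc (Suc l)) * \<tau>}. ennreal (u ^ Suc l * \<bar>D (Suc (Suc l)) u\<bar>) \<partial>lborel)"
  proof (rule nn_integral_mono)
    fix u :: real
    show "(\<integral>\<^sup>+s. ennreal \<bar>D (Suc (Suc l)) u\<bar> * ennreal (s ^ l) *
      indicator {0<..<real (Suc l) * \<tau>} s * indicator {s<..<s + \<tau>} u \<partial>lborel)
      \<le> ennreal (u ^ Suc l * \<bar>D (Suc (Suc l)) u\<bar>) * indicator {0<..<real (Suc (Suc l)) * \<tau>} u"
    proof (cases "u \<in> {0<..<real (Suc (Suc l)) * \<tau>}")
      case False
      have "ennreal \<bar>D (Suc (Suc l)) u\<bar> * ennreal (s ^ l) *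
        indicator {0<..<real (Suc l) * \<tau>} s * indicator {s<..<s + \<tau>} u = 0" for s
        using False by (auto simp: indicator_def algebra_simps)
      then show ?thesis by (simp only: nn_integral_const mult_zero_left zero_le)
    next
      case True
      have "(\<integral>\<^sup>+s. ennreal \<bar>D (Suc (Suc l)) u\<bar> * ennreal (s ^ l) *
        indicator {0<..<real (Suc l) * \<tau>} s * indicator {s<..<s + \<tau>} u \<partial>lborel)
        \<le> (\<integral>\<^sup>+s. ennreal (\<bar>D (Suc (Suc l)) u\<bar> * u ^ l) * indicator {0..u} s \<partial>lborel)"
      proof (rule nn_integral_mono)
        fix s :: real
        have "ennreal \<bar>D (Suc (Suc l)) u\<bar> * ennreal (s ^ l) \<le> ennreal (\<bar>D (Suc (Suc l)) u\<bar> * u ^ l)" if "0 < s" "s < u"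
          using that by (subst ennreal_mult[symmetric]) (auto intro!: ennreal_leI mult_left_mono power_mono)
        then show "ennreal \<bar>D (Suc (Suc l)) u\<bar> * ennreal (s ^ l) *
          indicator {0<..<real (Suc l) * \<tau>} s * indicator {s<..<s + \<tau>} u
          \<le> ennreal (\<bar>D (Suc (Suc l)) u\<bar> * u ^ l) * indicator {0..u} s"
          by (auto simp: indicator_def)
      qed
      also have "\<dots> = ennreal (\<bar>D (Suc (Suc l)) u\<bar> * u ^ l) * ennreal u"
        using True by (subst nn_integral_cmult_indicator) auto
      also have "\<dots> = ennreal (u ^ Suc l * \<bar>D (Suc (Suc l)) u\<bar>)"
        using True by (subst ennreal_mult[symmetric]) (auto simp: mult_ac)
      finally show ?thesis using True by simp
    qed
  qed
  finally show ?case .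
qed

subsection \<open>Directional derivatives\<close>

lemma pderiv_dir_expand:
  assumes "smooth f"
  shows "pderiv_dir v f = (\<lambda>x. \<Sum>b\<in>Basis. (v \<bullet> b) * pderiv_dir b f x)"
  by (rule ext, rule pderiv_dir_eq(1)[OF has_derivative_pderiv_dir[OF smooth_differentiable[OF assms]]])

lemma smooth_pderiv_dir_any: "smooth f \<Longrightarrow> smooth (pderiv_dir v f)"
  by (subst pderiv_dir_expand) (auto intro!: smooth_sum smooth_cmult smooth_pderiv_dir)

lemma smooth_funpow_pderiv: "smooth f \<Longrightarrow> smooth ((pderiv_dir v ^^ k) f)"
  by (induction k) (auto intro: smooth_pderiv_dir_any)

definition words :: "nat \<Rightarrow> 'a::euclidean_space list set"
  where "words k = {w. set w \<subseteq> Basis \<and> length w = k}"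

lemma finite_words: "finite (words k)"
  unfolding words_def by (rule finite_lists_length_eq) simp

lemma words_Suc: "words (Suc k) = (\<lambda>(b, w). b # w) ` (Basis \<times> words k)"
  by (auto simp: words_def length_Suc_conv image_def)

lemma sum_words_Suc: "(\<Sum>w\<in>words (Suc k). f w) = (\<Sum>b\<in>Basis. \<Sum>w\<in>words k. f (b # w))"
  unfolding words_Suc
  by (subst sum.reindex) (auto simp: inj_on_def sum.cartesian_product intro!: sum.cong)

lemma pderiv_dir_sum:
  assumes "finite A" "\<And>i. i \<in> A \<Longrightarrow> smooth (f i)"
  shows "pderiv_dir v (\<lambda>x. \<Sum>i\<in>A. c i * f i x) = (\<lambda>x. \<Sum>i\<in>A. c i * pderiv_dir v (f i) x)"
  using assms
proof (induction A rule: finite_induct)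
  case empty then show ?case by (simp add: pderiv_dir_const)
next
  case (insert a A)
  have s: "smooth (\<lambda>x. c a * f a x)" "smooth (\<lambda>x. \<Sum>i\<in>A. c i * f i x)"
    using insert by (auto intro!: smooth_sum smooth_cmult)
  have "pderiv_dir v (\<lambda>x. c a * f a x + (\<Sum>i\<in>A. c i * f i x)) x
      = pderiv_dir v (\<lambda>x. c a * f a x) x + pderiv_dir v (\<lambda>x. \<Sum>i\<in>A. c i * f i x) x" for x
    by (intro pderiv_dir_add smooth_differentiable s)
  moreover have "pderiv_dir v (\<lambda>x. c a * f a x) x = c a * pderiv_dir v (f a) x" for x
    using pderiv_dir_mult[of "\<lambda>x. c a" x "f a" v] insert by (simp add: pderiv_dir_const smooth_differentiable)
  ultimately show ?case using insert by simp
qed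

lemma funpow_pderiv_dir_expand:
  assumes f: "smooth f"
  shows "(pderiv_dir v ^^ k) f = (\<lambda>x. \<Sum>w\<in>words k. prod_list (map (\<lambda>b. v \<bullet> b) w) * pderivs w f x)"
proof (induction k)
  case 0
  have "(words 0 :: 'a list set) = {[]}" by (auto simp: words_def)
  then show ?case by simp
next
  case (Suc k)
  have s: "smooth (pderivs w f)" if "w \<in> words k" for w
    using that f by (auto simp: words_def intro: smooth_pderivs)
  have "(pderiv_dir v ^^ Suc k) f = (\<lambda>x. \<Sum>w\<in>words k. prod_list (map (\<lambda>b. v \<bullet> b) w) * pderiv_dir v (pderivs w f) x)"
    using Suc by (simp add: pderiv_dir_sum[OF finite_words s])
  also have "\<dots> = (\<lambda>x. \<Sum>w\<in>words k. \<Sum>b\<in>Basis. prod_list (map (\<lambda>b. v \<bullet> b) (b # w)) * pderivs (b # w) f x)"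
    using s by (intro ext sum.cong) (auto simp: pderiv_dir_expand sum_distrib_left mult_ac)
  also have "\<dots> = (\<lambda>x. \<Sum>w\<in>words (Suc k). prod_list (map (\<lambda>b. v \<bullet> b) w) * pderivs w f x)"
    unfolding sum_words_Suc by (subst sum.swap) simp
  finally show ?case .
qed

lemma funpow_pderiv_dir_bound:
  assumes f: "smooth f" and v: "\<And>b. b \<in> Basis \<Longrightarrow> \<bar>v \<bullet> b\<bar> \<le> r"
  shows "\<bar>(pderiv_dir v ^^ k) f x\<bar> \<le> r ^ k * (\<Sum>w\<in>words k. \<bar>pderivs w f x\<bar>)"
proof -
  have p: "\<bar>prod_list (map (\<lambda>b. v \<bullet> b) w)\<bar> \<le> r ^ length w" if "set w \<subseteq> Basis" for w
    using that
  proof (induction w)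
    case (Cons b w)
    have "\<bar>v \<bullet> b\<bar> \<le> r" using Cons.prems v by simp
    then have "\<bar>v \<bullet> b\<bar> * \<bar>prod_list (map (\<lambda>b. v \<bullet> b) w)\<bar> \<le> r * r ^ length w"
      using Cons by (intro mult_mono) auto
    then show ?case by (simp add: abs_mult)
  qed simp
  have "\<bar>(pderiv_dir v ^^ k) f x\<bar> \<le> (\<Sum>w\<in>words k. \<bar>prod_list (map (\<lambda>b. v \<bullet> b) w) * pderivs w f x\<bar>)"
    unfolding funpow_pderiv_dir_expand[OF f] by (rule sum_abs)
  also have "\<dots> \<le> (\<Sum>w\<in>words k. r ^ k * \<bar>pderivs w f x\<bar>)"
  proof (rule sum_mono)
    fix w :: "'a list" assume "w \<in> words k"
    then show "\<bar>prod_list (map (\<lambda>b. v \<bullet> b) w) * pderivs w f x\<bar> \<le> r ^ k * \<bar>pderivs w f x\<bar>"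
      using p[of w] unfolding abs_mult by (intro mult_right_mono) (auto simp: words_def)
  qed
  finally show ?thesis by (simp add: sum_distrib_left)
qed

lemma DERIV_funpow_line:
  assumes "smooth f"
  shows "DERIV (\<lambda>s. (pderiv_dir v ^^ k) f (z + s *\<^sub>R v)) s :> (pderiv_dir v ^^ Suc k) f (z + s *\<^sub>R v)"
  using has_real_derivative_along_line[OF smooth_differentiable[OF smooth_funpow_pderiv[OF assms,
        where k=k and v=v]], of z v s]
  by simp

lemma fin_diff_line:
  assumes f: "smooth f" and t: "\<tau> > 0"
  shows "ennreal \<bar>\<Sum>j\<le>Suc l. fd (Suc l) j * f (z + (real j * \<tau>) *\<^sub>R v)\<bar>
    \<le> (\<integral>\<^sup>+s\<in>{0<..<real (Suc l) * \<tau>}. ennreal (s ^ l * \<bar>(pderiv_dir v ^^ Suc l) f (z + s *\<^sub>R v)\<bar>) \<partial>lborel)"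
proof -
  define D where "D k s = (pderiv_dir v ^^ k) f (z + s *\<^sub>R v)" for k s
  have d: "DERIV (D k) s :> D (Suc k) s" for k s
    unfolding D_def by (rule DERIV_funpow_line[OF f])
  have "ennreal \<bar>\<Sum>j\<le>Suc l. fd (Suc l) j * D 0 (real j * \<tau>)\<bar>
    \<le> (\<integral>\<^sup>+s\<in>{0<..<real (Suc l) * \<tau>}. ennreal (s ^ l * \<bar>D (Suc l) s\<bar>) \<partial>lborel)"
    by (rule fin_diff_1d[where D=D]; rule d DERIV_isCont[OF d] t)
  then show ?thesis by (simp add: D_def)
qed

section \<open>Local estimate of finite differences of the trace\<close>

lemma nn_integral_shift_le:
  fixes u :: "'a::euclidean_space \<Rightarrow> real"
  assumes [measurable]: "borel_fun u" "N \<in> sets borel" and "\<And>x. x \<in> Q \<Longrightarrow> x + h \<in> N"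
  shows "(\<integral>\<^sup>+x\<in>Q. ennreal \<bar>u (x + h)\<bar> \<partial>lborel) \<le> L1n N u"
proof -
  have "(\<integral>\<^sup>+x\<in>Q. ennreal \<bar>u (x + h)\<bar> \<partial>lborel)
      \<le> (\<integral>\<^sup>+x. ennreal \<bar>u (x + h)\<bar> * indicator N (x + h) \<partial>lborel)"
    using assms(3) by (intro nn_integral_mono) (auto simp: indicator_def)
  also have "\<dots> = L1n N u"
    unfolding L1n_def by (rule nn_integral_translate) measurable
  finally show ?thesis .
qed

lemma L1n_slice_borel':
  fixes h :: "'a::euclidean_space \<times> real \<Rightarrow> real"
  assumes [measurable]: "borel_fun h" "S \<in> sets borel"
  shows "borel_fun (\<lambda>t. L1n S (\<lambda>x. h (x, t)))"
  unfolding L1n_def by measurable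

lemma slice_fin_diff_x:
  fixes f :: "'a::euclidean_space \<times> real \<Rightarrow> real"
  assumes f: "smooth f" and h: "\<And>b. b \<in> Basis \<Longrightarrow> \<bar>h \<bullet> b\<bar> \<le> r" and r: "r \<ge> 0"
    and [measurable]: "Q \<in> sets borel" "N \<in> sets borel"
    and N: "\<And>x s. x \<in> Q \<Longrightarrow> 0 < s \<Longrightarrow> s < real (Suc l) \<Longrightarrow> x + s *\<^sub>R h \<in> N"
  shows "(\<integral>\<^sup>+x\<in>Q. ennreal \<bar>\<Sum>i\<le>Suc l. fd (Suc l) i * f (x + real i *\<^sub>R h, y)\<bar> \<partial>lborel)
    \<le> ennreal (real (Suc l) ^ Suc l * r ^ Suc l) * (\<Sum>w\<in>words (Suc l). L1n N (\<lambda>x. pderivs w f (x, y)))"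
proof -
  let ?v = "(h, 0) :: 'a \<times> real"
  let ?L = "real (Suc l)"
  let ?S = "\<Sum>w\<in>words (Suc l). L1n N (\<lambda>x. pderivs w f (x, y))"
  define K where "K = ?L ^ l * r ^ Suc l"
  have K: "K \<ge> 0" using r by (simp add: K_def)
  have sm: "smooth (pderivs w f)" if "w \<in> words (Suc l)" for w
    using that f by (auto simp: words_def intro: smooth_pderivs)
  have [measurable]: "borel_fun (pderivs w f)" if "w \<in> words (Suc l)" for w
    using sm[OF that] by (rule smooth_borel)
  have v: "\<bar>?v \<bullet> b\<bar> \<le> r" if "b \<in> Basis" for b
    using that h r by (auto simp: Basis_prod_def)
  define G where "G x s = (\<Sum>w\<in>words (Suc l). ennreal \<bar>pderivs w f (x + s *\<^sub>R h, y)\<bar>)" for x s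
  have pt: "ennreal \<bar>\<Sum>i\<le>Suc l. fd (Suc l) i * f (x + real i *\<^sub>R h, y)\<bar>
      \<le> (\<integral>\<^sup>+s. ennreal K * (G x s * indicator {0<..<?L} s) \<partial>lborel)" for x
  proof -
    have "ennreal \<bar>\<Sum>i\<le>Suc l. fd (Suc l) i * f (x + real i *\<^sub>R h, y)\<bar>
      \<le> (\<integral>\<^sup>+s\<in>{0<..<?L}. ennreal (s ^ l * \<bar>(pderiv_dir ?v ^^ Suc l) f ((x, y) + s *\<^sub>R ?v)\<bar>) \<partial>lborel)"
      using fin_diff_line[OF f, of 1 l "(x, y)" ?v] by simp
    also have "\<dots> \<le> (\<integral>\<^sup>+s. ennreal K * (G x s * indicator {0<..<?L} s) \<partial>lborel)"
    proof (rule nn_integral_mono)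
      fix s :: real
      show "ennreal (s ^ l * \<bar>(pderiv_dir ?v ^^ Suc l) f ((x, y) + s *\<^sub>R ?v)\<bar>) * indicator {0<..<?L} s
        \<le> ennreal K * (G x s * indicator {0<..<?L} s)"
      proof (cases "s \<in> {0<..<?L}")
        case True
        have "s ^ l * \<bar>(pderiv_dir ?v ^^ Suc l) f ((x, y) + s *\<^sub>R ?v)\<bar>
          \<le> ?L ^ l * (r ^ Suc l * (\<Sum>w\<in>words (Suc l). \<bar>pderivs w f ((x, y) + s *\<^sub>R ?v)\<bar>))"
          using True by (intro mult_mono power_mono funpow_pderiv_dir_bound[OF f v]) auto
        also have "\<dots> = K * (\<Sum>w\<in>words (Suc l). \<bar>pderivs w f (x + s *\<^sub>R h, y)\<bar>)"
          by (simp add: K_def mult_ac)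
        finally have "ennreal (s ^ l * \<bar>(pderiv_dir ?v ^^ Suc l) f ((x, y) + s *\<^sub>R ?v)\<bar>)
          \<le> ennreal K * ennreal (\<Sum>w\<in>words (Suc l). \<bar>pderivs w f (x + s *\<^sub>R h, y)\<bar>)"
          using K by (subst ennreal_mult[symmetric]) (auto intro!: ennreal_leI sum_nonneg)
        then show ?thesis using True by (simp add: G_def)
      qed simp
    qed
    finally show ?thesis .
  qed
  have Gm: "(\<lambda>(x, s). G x s) \<in> borel_measurable (lborel \<Otimes>\<^sub>M lborel)"
    unfolding G_def split_beta'
  proof (intro borel_measurable_sum)
    fix w :: "('a \<times> real) list" assume w: "w \<in> words (Suc l)"
    have "continuous_on UNIV (\<lambda>z::'a \<times> real. (fst z + snd z *\<^sub>R h, y))" by (intro continuous_intros)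
    then have "borel_fun (\<lambda>z::'a \<times> real. (fst z + snd z *\<^sub>R h, y))"
      by (rule borel_measurable_continuous_onI)
    from measurable_compose[OF this smooth_borel[OF sm[OF w]]]
    have "(\<lambda>z::'a \<times> real. pderivs w f (fst z + snd z *\<^sub>R h, y)) \<in> borel_measurable (lborel \<Otimes>\<^sub>M lborel)"
      unfolding lborel_prod by simp
    then show "(\<lambda>z::'a \<times> real. ennreal \<bar>pderivs w f (fst z + snd z *\<^sub>R h, y)\<bar>) \<in> borel_measurable (lborel \<Otimes>\<^sub>M lborel)"
      by measurable
  qed
  have "(\<integral>\<^sup>+x\<in>Q. ennreal \<bar>\<Sum>i\<le>Suc l. fd (Suc l) i * f (x + real i *\<^sub>R h, y)\<bar> \<partial>lborel)
      \<le> (\<integral>\<^sup>+x. (\<integral>\<^sup>+s. ennreal K * (G x s * indicator {0<..<?L} s * indicator Q x) \<partial>lborel) \<partial>lborel)"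
    using pt by (intro nn_integral_mono) (auto simp: indicator_def)
  also have "\<dots> = (\<integral>\<^sup>+s. (\<integral>\<^sup>+x. ennreal K * (G x s * indicator {0<..<?L} s * indicator Q x) \<partial>lborel) \<partial>lborel)"
  proof (rule lborel_pair.Fubini'[symmetric])
    have "(\<lambda>(x, s). ennreal K * (indicator {0<..<?L} s * indicator Q x)) \<in> borel_measurable ((lborel :: 'a measure) \<Otimes>\<^sub>M lborel)"
      by measurable
    from borel_measurable_times_ennreal[OF this Gm]
    show "(\<lambda>(x, s). ennreal K * (G x s * indicator {0<..<?L} s * indicator Q x)) \<in> borel_measurable (lborel \<Otimes>\<^sub>M lborel)"
      by (simp add: split_beta' mult_ac)
  qed
  also have "\<dots> \<le> (\<integral>\<^sup>+s. ennreal K * ?S * indicator {0<..<?L} s \<partial>lborel)"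
  proof (rule nn_integral_mono)
    fix s :: real
    show "(\<integral>\<^sup>+x. ennreal K * (G x s * indicator {0<..<?L} s * indicator Q x) \<partial>lborel)
      \<le> ennreal K * ?S * indicator {0<..<?L} s"
    proof (cases "s \<in> {0<..<?L}")
      case True
      have m: "borel_fun (\<lambda>x. pderivs w f (x + s *\<^sub>R h, y))" if "w \<in> words (Suc l)" for w
        using that by measurable
      have "(\<integral>\<^sup>+x. ennreal K * (G x s * indicator {0<..<?L} s * indicator Q x) \<partial>lborel)
        = (\<integral>\<^sup>+x. ennreal K * (\<Sum>w\<in>words (Suc l). ennreal \<bar>pderivs w f (x + s *\<^sub>R h, y)\<bar> * indicator Q x) \<partial>lborel)"
        using True by (simp add: G_def sum_distrib_right del: sum_ennreal)
      also have "\<dots> = ennreal K * (\<Sum>w\<in>words (Suc l). \<integral>\<^sup>+x\<in>Q. ennreal \<bar>pderivs w f (x + s *\<^sub>R h, y)\<bar> \<partial>lborel)"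
        using m by (subst nn_integral_cmult; (subst nn_integral_sum)?) auto
      also have "\<dots> \<le> ennreal K * ?S"
      proof (intro mult_left_mono sum_mono)
        fix w :: "('a \<times> real) list" assume "w \<in> words (Suc l)"
        then have [measurable]: "borel_fun (pderivs w f)" by measurable
        show "(\<integral>\<^sup>+x\<in>Q. ennreal \<bar>pderivs w f (x + s *\<^sub>R h, y)\<bar> \<partial>lborel) \<le> L1n N (\<lambda>x. pderivs w f (x, y))"
          using True N by (intro nn_integral_shift_le[of "\<lambda>x. pderivs w f (x, y)"]) auto
      qed simp
      finally show ?thesis using True by simp
    qed simp
  qed
  also have "\<dots> = ennreal K * ?S * ennreal ?L"
    by (subst nn_integral_cmult_indicator) auto
  also have "\<dots> = ennreal (?L ^ Suc l * r ^ Suc l) * ?S"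
  proof -
    have "K * ?L = ?L ^ Suc l * r ^ Suc l" by (simp only: K_def power_Suc mult_ac)
    then have e: "ennreal (?L ^ Suc l * r ^ Suc l) = ennreal K * ennreal ?L"
      using ennreal_mult[OF K, of ?L] by (simp del: of_nat_Suc power_Suc)
    have "a * b * c = a * c * b" for a b c :: ennreal by (simp only: mult_ac)
    then show ?thesis unfolding e .
  qed
  finally show ?thesis .
qed

lemma slice_fin_diff_t:
  fixes f :: "'a::euclidean_space \<times> real \<Rightarrow> real"
  assumes f: "smooth f" and t: "\<tau> > 0"
    and [measurable]: "Q \<in> sets borel" "N \<in> sets borel" and N: "\<And>x. x \<in> Q \<Longrightarrow> x + h \<in> N"
  shows "(\<integral>\<^sup>+x\<in>Q. ennreal \<bar>\<Sum>j\<le>Suc l. fd (Suc l) j * f (x + h, real j * \<tau>)\<bar> \<partial>lborel)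
    \<le> L1n (N \<times> {0<..<real (Suc l) * \<tau>}) (\<lambda>z. snd z ^ l * pderivs (replicate (Suc l) et) f z)"
proof -
  let ?w = "replicate (Suc l) (et :: 'a \<times> real)"
  let ?T = "{0<..<real (Suc l) * \<tau>}"
  have "set ?w \<subseteq> Basis" using et_Basis by auto
  then have [measurable]: "borel_fun (pderivs ?w f)"
    using f by (intro smooth_borel smooth_pderivs)
  have [measurable]: "borel_fun (snd :: 'a \<times> real \<Rightarrow> real)"
    by (rule borel_measurable_continuous_onI) (rule continuous_on_snd[OF continuous_on_id])
  have m [measurable]: "borel_fun (\<lambda>z. snd z ^ l * pderivs ?w f z)" by measurable
  have pt: "ennreal \<bar>\<Sum>j\<le>Suc l. fd (Suc l) j * f (x, real j * \<tau>)\<bar>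
      \<le> L1n ?T (\<lambda>s. s ^ l * pderivs ?w f (x, s))" for x
  proof -
    have "ennreal \<bar>\<Sum>j\<le>Suc l. fd (Suc l) j * f (x, real j * \<tau>)\<bar>
      \<le> (\<integral>\<^sup>+s\<in>?T. ennreal (s ^ l * \<bar>pderivs ?w f (x, s)\<bar>) \<partial>lborel)"
      using fin_diff_line[OF f t, of l "(x, 0)" et] unfolding pderivs_replicate by simp
    also have "\<dots> = L1n ?T (\<lambda>s. s ^ l * pderivs ?w f (x, s))"
      unfolding L1n_def by (intro nn_integral_cong) (auto simp: abs_mult indicator_def)
    finally show ?thesis .
  qed
  have "(\<integral>\<^sup>+x\<in>Q. ennreal \<bar>\<Sum>j\<le>Suc l. fd (Suc l) j * f (x + h, real j * \<tau>)\<bar> \<partial>lborel)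
    \<le> (\<integral>\<^sup>+x. (\<lambda>x. L1n ?T (\<lambda>s. s ^ l * pderivs ?w f (x, s)) * indicator N x) (x + h) \<partial>lborel)"
    using pt N by (intro nn_integral_mono) (auto simp: indicator_def)
  also have "\<dots> = (\<integral>\<^sup>+x\<in>N. L1n ?T (\<lambda>s. s ^ l * pderivs ?w f (x, s)) \<partial>lborel)"
    using L1n_slice_borel[OF m, of ?T] by (intro nn_integral_translate) simp
  also have "\<dots> = L1n (N \<times> ?T) (\<lambda>z. snd z ^ l * pderivs ?w f z)"
    using m by (subst L1n_prod_fst) (simp_all del: replicate.simps)
  finally show ?thesis .
qed

text \<open>Put \<open>q = l + 1\<close>, and let \<open>T\<^sub>h\<close> and \<open>S\<^sub>\<tau>\<close> be the translations by \<open>h\<close> in space and by \<open>\<tau>\<close> in \<open>t\<close>. Then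
  \<open>(1 - T\<^sub>h)\<^sup>q = (1 - T\<^sub>h)\<^sup>q (1 - S\<^sub>\<tau>)\<^sup>q + (1 - T\<^sub>h)\<^sup>q (1 - (1 - S\<^sub>\<tau>)\<^sup>q)\<close>. At height \<open>0\<close> the first term is a
  difference in \<open>t\<close>, controlled down to \<open>t = 0\<close> by the factor \<open>s\<^sup>l\<close>; the second only involves heights
  between \<open>\<tau>\<close> and \<open>q \<tau>\<close>, and averaging over \<open>r < \<tau> < 2 r\<close> turns the slices into solid integrals.\<close>

lemma local_estimate_smooth:
  fixes f :: "'a::euclidean_space \<times> real \<Rightarrow> real"
  assumes f: "smooth f" and h: "\<And>b. b \<in> Basis \<Longrightarrow> \<bar>h \<bullet> b\<bar> \<le> r" and r: "r > 0"
    and [measurable]: "Q \<in> sets borel" "N \<in> sets borel"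
    and N: "\<And>x s. x \<in> Q \<Longrightarrow> 0 \<le> s \<Longrightarrow> s \<le> real (Suc l) \<Longrightarrow> x + s *\<^sub>R h \<in> N"
  shows "L1n Q (fin_diff (Suc l) h (\<lambda>x. f (x, 0))) \<le> ennreal (2 ^ Suc l + 2 ^ Suc l * real (Suc l) ^ Suc l) *
    (\<Sum>w\<in>words (Suc l). L1n (N \<times> {0<..<2 * real (Suc l) * r}) (\<lambda>z. snd z ^ l * pderivs w f z))"
proof -
  let ?L = "real (Suc l)"
  let ?q = "Suc l"
  let ?R = "2 * ?L * r"
  define K where "K w = L1n (N \<times> {0<..<?R}) (\<lambda>z. snd z ^ l * pderivs w f z)" for w
  define KK where "KK = (\<Sum>w\<in>words ?q. K w)"
  have sm: "smooth (pderivs w f)" if "w \<in> words ?q" for w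
    using that f by (auto simp: words_def intro: smooth_pderivs)
  have [measurable]: "borel_fun (pderivs w f)" if "w \<in> words ?q" for w
    using sm[OF that] by (rule smooth_borel)
  have [measurable]: "borel_fun (snd :: 'a \<times> real \<Rightarrow> real)"
    by (rule borel_measurable_continuous_onI) (rule continuous_on_snd[OF continuous_on_id])
  have [measurable]: "borel_fun f" using f by (rule smooth_borel)
  have wt: "replicate ?q et \<in> words ?q" using et_Basis by (auto simp: words_def)
  have Kt: "K (replicate ?q et) \<le> KK" unfolding KK_def by (rule member_le_sum[OF wt]) (auto simp: finite_words)
  define A where "A s = (\<Sum>w\<in>words ?q. L1n N (\<lambda>x. pderivs w f (x, s)))" for s
  have Am [measurable]: "borel_fun A"
    unfolding A_def[abs_def] by (intro borel_measurable_sum L1n_slice_borel') auto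
  let ?I = "\<integral>\<^sup>+s\<in>{r<..<?R}. A s \<partial>lborel"
  let ?J = "\<lambda>j. \<integral>\<^sup>+\<tau>. A (0 + real j * \<tau>) * indicator {r<..<?R} (0 + real j * \<tau>) \<partial>lborel"
  let ?H = "\<lambda>j. \<integral>\<^sup>+\<tau>\<in>{r<..<2*r}. A (real j * \<tau>) \<partial>lborel"
  let ?d = "\<lambda>j. real (?q choose j) * (?L ^ ?q * r ^ ?q)"
  let ?c = "\<lambda>j. real (?q choose j) * (?L ^ ?q * r)"
  define L0 where "L0 = L1n Q (fin_diff ?q h (\<lambda>x. f (x, 0)))"
  have step: "L0 \<le> ennreal (2 ^ ?q) * KK + (\<Sum>j\<in>{1..?q}. ennreal (real (?q choose j)) * (ennreal (?L ^ ?q * r ^ ?q) * A (real j * \<tau>)))"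
    if tau: "r < \<tau>" "\<tau> < 2 * r" for \<tau>
  proof -
    define B where "B z = (\<Sum>j\<le>?q. fd ?q j * f (z, real j * \<tau>))" for z
    define E where "E j x = (\<Sum>i\<le>?q. fd ?q i * f (x + real i *\<^sub>R h, real j * \<tau>))" for j x
    have [measurable]: "borel_fun B" "borel_fun (E j)" for j
      unfolding B_def[abs_def] E_def[abs_def] by measurable
    have id: "fin_diff ?q h (\<lambda>x. f (x, 0)) x = (\<Sum>i\<le>?q. fd ?q i * B (x + real i *\<^sub>R h)) - (\<Sum>j\<in>{1..?q}. fd ?q j * E j x)" for x
    proof -
      have s: "{..?q} = insert 0 {1..?q}" by auto
      have "B z = f (z, 0) + (\<Sum>j\<in>{1..?q}. fd ?q j * f (z, real j * \<tau>))" for z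
        unfolding B_def s by (subst sum.insert) auto
      then have "f (z, 0) = B z - (\<Sum>j\<in>{1..?q}. fd ?q j * f (z, real j * \<tau>))" for z by simp
      then have "fin_diff ?q h (\<lambda>x. f (x, 0)) x = (\<Sum>i\<le>?q. fd ?q i * (B (x + real i *\<^sub>R h)
          - (\<Sum>j\<in>{1..?q}. fd ?q j * f (x + real i *\<^sub>R h, real j * \<tau>))))"
        unfolding fin_diff_fd by simp
      also have "\<dots> = (\<Sum>i\<le>?q. fd ?q i * B (x + real i *\<^sub>R h))
          - (\<Sum>i\<le>?q. \<Sum>j\<in>{1..?q}. fd ?q i * (fd ?q j * f (x + real i *\<^sub>R h, real j * \<tau>)))"
        by (simp add: right_diff_distrib sum_subtractf sum_distrib_left del: sum.atMost_Suc sum.cl_ivl_Suc)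
      also have "(\<Sum>i\<le>?q. \<Sum>j\<in>{1..?q}. fd ?q i * (fd ?q j * f (x + real i *\<^sub>R h, real j * \<tau>)))
          = (\<Sum>j\<in>{1..?q}. \<Sum>i\<le>?q. fd ?q i * (fd ?q j * f (x + real i *\<^sub>R h, real j * \<tau>)))"
        by (rule sum.swap)
      also have "\<dots> = (\<Sum>j\<in>{1..?q}. fd ?q j * E j x)"
        unfolding E_def sum_distrib_left by (intro sum.cong refl) (simp add: mult_ac)
      finally show ?thesis .
    qed
    have "ennreal \<bar>fin_diff ?q h (\<lambda>x. f (x, 0)) x\<bar>
        \<le> (\<Sum>i\<le>?q. ennreal \<bar>fd ?q i\<bar> * ennreal \<bar>B (x + real i *\<^sub>R h)\<bar>) + (\<Sum>j\<in>{1..?q}. ennreal \<bar>fd ?q j\<bar> * ennreal \<bar>E j x\<bar>)" for x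
    proof -
      have "\<bar>fin_diff ?q h (\<lambda>x. f (x, 0)) x\<bar> \<le> \<bar>\<Sum>i\<le>?q. fd ?q i * B (x + real i *\<^sub>R h)\<bar> + \<bar>\<Sum>j\<in>{1..?q}. fd ?q j * E j x\<bar>"
        unfolding id by (rule abs_triangle_ineq4)
      also have "\<dots> \<le> (\<Sum>i\<le>?q. \<bar>fd ?q i\<bar> * \<bar>B (x + real i *\<^sub>R h)\<bar>) + (\<Sum>j\<in>{1..?q}. \<bar>fd ?q j\<bar> * \<bar>E j x\<bar>)"
        unfolding abs_mult[symmetric] by (intro add_mono sum_abs)
      finally show ?thesis
        by (simp add: ennreal_mult[symmetric] sum_ennreal ennreal_plus[symmetric] sum_nonneg ennreal_leI del: ennreal_plus sum.atMost_Suc)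
    qed
    then have "L0 \<le> (\<integral>\<^sup>+x. (\<Sum>i\<le>?q. ennreal \<bar>fd ?q i\<bar> * (ennreal \<bar>B (x + real i *\<^sub>R h)\<bar> * indicator Q x))
        + (\<Sum>j\<in>{1..?q}. ennreal \<bar>fd ?q j\<bar> * (ennreal \<bar>E j x\<bar> * indicator Q x)) \<partial>lborel)"
      unfolding L0_def L1n_def by (intro nn_integral_mono) (auto simp: indicator_def simp del: sum.atMost_Suc)
    also have "\<dots> = (\<Sum>i\<le>?q. ennreal \<bar>fd ?q i\<bar> * (\<integral>\<^sup>+x\<in>Q. ennreal \<bar>B (x + real i *\<^sub>R h)\<bar> \<partial>lborel))
        + (\<Sum>j\<in>{1..?q}. ennreal \<bar>fd ?q j\<bar> * (\<integral>\<^sup>+x\<in>Q. ennreal \<bar>E j x\<bar> \<partial>lborel))"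
      by (subst nn_integral_add; (subst nn_integral_sum)?) (auto simp: nn_integral_cmult nn_integral_sum simp del: sum.atMost_Suc)
    also have "\<dots> \<le> (\<Sum>i\<le>?q. ennreal \<bar>fd ?q i\<bar> * KK)
        + (\<Sum>j\<in>{1..?q}. ennreal \<bar>fd ?q j\<bar> * (ennreal (?L ^ ?q * r ^ ?q) * A (real j * \<tau>)))"
    proof (intro add_mono sum_mono mult_left_mono)
      fix i assume i: "i \<in> {..?q}"
      have "(\<integral>\<^sup>+x\<in>Q. ennreal \<bar>B (x + real i *\<^sub>R h)\<bar> \<partial>lborel)
          \<le> L1n (N \<times> {0<..<?L * \<tau>}) (\<lambda>z. snd z ^ l * pderivs (replicate ?q et) f z)"
        unfolding B_def by (rule slice_fin_diff_t[OF f]) (use tau r N i in auto)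
      also have "\<dots> \<le> K (replicate ?q et)"
      proof -
        have "?L * \<tau> \<le> ?L * (2 * r)" using tau by (intro mult_left_mono) auto
        then show ?thesis unfolding K_def by (intro L1n_mono_set) (auto simp: mult_ac)
      qed
      finally show "(\<integral>\<^sup>+x\<in>Q. ennreal \<bar>B (x + real i *\<^sub>R h)\<bar> \<partial>lborel) \<le> KK" using Kt by simp
    next
      fix j assume "j \<in> {1..?q}"
      show "(\<integral>\<^sup>+x\<in>Q. ennreal \<bar>E j x\<bar> \<partial>lborel) \<le> ennreal (?L ^ ?q * r ^ ?q) * A (real j * \<tau>)"
        unfolding E_def A_def by (rule slice_fin_diff_x[OF f h]) (use r N in auto)
    qed auto
    also have "(\<Sum>i\<le>?q. ennreal \<bar>fd ?q i\<bar> * KK) = ennreal (2 ^ ?q) * KK"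
      unfolding sum_distrib_right[symmetric] by (subst sum_ennreal) (auto simp: sum_abs_fd simp del: sum.atMost_Suc)
    finally show ?thesis by (simp add: abs_fd)
  qed
  have Aj: "?H j \<le> ?I" if j: "j \<in> {1..?q}" for j
  proof -
    have "?H j \<le> ?J j"
    proof (rule nn_integral_mono)
      fix \<tau> :: real
      have "r < real j * \<tau> \<and> real j * \<tau> < ?R" if "r < \<tau>" "\<tau> < 2 * r"
      proof
        have "1 * \<tau> \<le> real j * \<tau>" using j that r by (intro mult_right_mono) auto
        then show "r < real j * \<tau>" using that(1) by linarith
        have "real j * \<tau> \<le> ?L * \<tau>" using j that r by (intro mult_right_mono) auto
        also have "\<dots> < ?L * (2 * r)" using that by (intro mult_strict_left_mono) auto
        finally show "real j * \<tau> < ?R" by (simp add: mult_ac)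
      qed
      then show "A (real j * \<tau>) * indicator {r<..<2*r} \<tau> \<le> A (0 + real j * \<tau>) * indicator {r<..<?R} (0 + real j * \<tau>)"
        by (auto simp: indicator_def)
    qed
    also have "\<dots> \<le> ennreal \<bar>real j\<bar> * ?J j"
    proof -
      have "1 * (?J j)
        \<le> ennreal \<bar>real j\<bar> * ?J j"
        using j by (intro mult_right_mono) auto
      then show ?thesis by simp
    qed
    also have "\<dots> = ?I"
      using j by (intro nn_integral_real_affine[symmetric]) auto
    finally show ?thesis .
  qed
  \<comment> \<open>For \<open>s > r\<close> the factor \<open>s\<^sup>l\<close> dominates \<open>r\<^sup>l\<close>.\<close>
  have rA: "ennreal (r ^ l) * ?I \<le> KK"
  proof -
    have "ennreal (r ^ l) * ?I = (\<integral>\<^sup>+s. ennreal (r ^ l) * (A s * indicator {r<..<?R} s) \<partial>lborel)"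
      by (rule nn_integral_cmult[symmetric]) measurable
    also have "\<dots> \<le> (\<integral>\<^sup>+s. (\<Sum>w\<in>words ?q. L1n N (\<lambda>x. s ^ l * pderivs w f (x, s)) * indicator {0<..<?R} s) \<partial>lborel)"
    proof (rule nn_integral_mono)
      fix s :: real
      show "ennreal (r ^ l) * (A s * indicator {r<..<?R} s)
        \<le> (\<Sum>w\<in>words ?q. L1n N (\<lambda>x. s ^ l * pderivs w f (x, s)) * indicator {0<..<?R} s)"
      proof (cases "s \<in> {r<..<?R}")
        case True
        have "ennreal (r ^ l) * A s \<le> ennreal (s ^ l) * A s"
          using True r by (intro mult_right_mono ennreal_leI power_mono) auto
        also have "\<dots> = (\<Sum>w\<in>words ?q. L1n N (\<lambda>x. s ^ l * pderivs w f (x, s)))"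
          unfolding A_def sum_distrib_left
        proof (intro sum.cong refl)
          fix w :: "('a \<times> real) list" assume "w \<in> words ?q"
          then have [measurable]: "borel_fun (pderivs w f)" by measurable
          show "ennreal (s ^ l) * L1n N (\<lambda>x. pderivs w f (x, s)) = L1n N (\<lambda>x. s ^ l * pderivs w f (x, s))"
            using True r by (subst L1n_cmult) auto
        qed
        finally show ?thesis using True r by simp
      qed simp
    qed
    also have "\<dots> = (\<Sum>w\<in>words ?q. \<integral>\<^sup>+s\<in>{0<..<?R}. L1n N (\<lambda>x. s ^ l * pderivs w f (x, s)) \<partial>lborel)"
    proof (rule nn_integral_sum)
      fix w :: "('a \<times> real) list" assume "w \<in> words ?q"
      then have [measurable]: "borel_fun (pderivs w f)" by measurable
      have "borel_fun (\<lambda>s. L1n N (\<lambda>x. (\<lambda>z. snd z ^ l * pderivs w f z) (x, s)))"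
        by (rule L1n_slice_borel') measurable
      then show "(\<lambda>s. L1n N (\<lambda>x. s ^ l * pderivs w f (x, s)) * indicator {0<..<?R} s) \<in> borel_measurable lborel"
        by simp
    qed
    also have "\<dots> = KK"
      unfolding KK_def
    proof (intro sum.cong refl)
      fix w :: "('a \<times> real) list" assume "w \<in> words ?q"
      then have [measurable]: "borel_fun (pderivs w f)" by measurable
      show "(\<integral>\<^sup>+s\<in>{0<..<?R}. L1n N (\<lambda>x. s ^ l * pderivs w f (x, s)) \<partial>lborel) = K w"
        unfolding K_def by (subst L1n_prod_snd) auto
    qed
    finally show ?thesis .
  qed
  \<comment> \<open>The interval of the admissible heights \<open>\<tau>\<close> has length \<open>r\<close>.\<close>
  have "L0 * ennreal r = (\<integral>\<^sup>+\<tau>\<in>{r<..<2*r}. L0 \<partial>lborel)"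
    using r by (subst nn_integral_cmult_indicator) auto
  also have "\<dots> \<le> (\<integral>\<^sup>+\<tau>. ennreal (2 ^ ?q) * KK * indicator {r<..<2*r} \<tau>
      + (\<Sum>j\<in>{1..?q}. ennreal (?d j) * (A (real j * \<tau>) * indicator {r<..<2*r} \<tau>)) \<partial>lborel)"
    using step r by (intro nn_integral_mono) (auto simp: indicator_def ennreal_mult mult.assoc)
  also have "\<dots> = ennreal (2 ^ ?q) * KK * ennreal r
      + (\<Sum>j\<in>{1..?q}. ennreal (?d j) * ?H j)"
    using r by (subst nn_integral_add, measurable, subst nn_integral_cmult_indicator, measurable, subst nn_integral_sum, measurable)
      (simp add: nn_integral_cmult)
  also have "\<dots> \<le> ennreal (2 ^ ?q) * KK * ennreal r
      + (\<Sum>j\<in>{1..?q}. ennreal (?c j) * KK)"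
  proof (intro add_left_mono sum_mono)
    fix j assume j: "j \<in> {1..?q}"
    have "ennreal (?d j) * (?H j)
      \<le> ennreal (?d j) * ?I"
      by (intro mult_left_mono Aj j) simp
    also have "\<dots> = ennreal (?c j) * (ennreal (r ^ l) * ?I)"
    proof -
      have "real (?q choose j) * (?L ^ ?q * r ^ ?q) = ?c j * r ^ l"
        by (simp add: mult_ac del: of_nat_Suc)
      then have "ennreal (?d j) = ennreal (?c j) * ennreal (r ^ l)"
        using r by (simp only: ennreal_mult mult_nonneg_nonneg of_nat_0_le_iff zero_le_power less_imp_le)
      then show ?thesis by (simp only: mult.assoc)
    qed
    also have "\<dots> \<le> ennreal (?c j) * KK"
      by (intro mult_left_mono rA) simp
    finally show "ennreal (?d j) * (?H j)
      \<le> ennreal (?c j) * KK" .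
  qed
  also have "(\<Sum>j\<in>{1..?q}. ennreal (?c j) * KK)
      \<le> ennreal (2 ^ ?q * (?L ^ ?q * r)) * KK"
  proof -
    have "(\<Sum>j\<in>{1..?q}. real (?q choose j) * (?L ^ ?q * r)) \<le> 2 ^ ?q * (?L ^ ?q * r)"
    proof -
      have "(\<Sum>j\<in>{1..?q}. real (?q choose j)) \<le> (\<Sum>j\<le>?q. real (?q choose j))"
        by (intro sum_mono2) auto
      also have "\<dots> = 2 ^ ?q" using sum_abs_fd[of ?q] by (simp add: abs_fd del: sum.atMost_Suc)
      finally have "(\<Sum>j\<in>{1..?q}. real (?q choose j)) * (?L ^ ?q * r) \<le> 2 ^ ?q * (?L ^ ?q * r)"
        by (rule mult_right_mono) (use r in simp)
      then show ?thesis by (simp only: sum_distrib_right)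
    qed
    then have le: "ennreal (\<Sum>j\<in>{1..?q}. real (?q choose j) * (?L ^ ?q * r)) * KK \<le> ennreal (2 ^ ?q * (?L ^ ?q * r)) * KK"
      by (intro mult_right_mono ennreal_leI) simp_all
    have "(\<Sum>j\<in>{1..?q}. ennreal (?c j))
        = ennreal (\<Sum>j\<in>{1..?q}. real (?q choose j) * (?L ^ ?q * r))"
      using r by (intro sum_ennreal mult_nonneg_nonneg zero_le_power) simp_all
    with le show ?thesis
      unfolding sum_distrib_right[symmetric] by (simp only:)
  qed
  finally have "L0 * ennreal r \<le> ennreal (2 ^ ?q) * KK * ennreal r + ennreal (2 ^ ?q * (?L ^ ?q * r)) * KK"
    by (simp add: add_left_mono)
  also have "\<dots> = (ennreal (2 ^ ?q + 2 ^ ?q * ?L ^ ?q) * KK) * ennreal r"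
  proof -
    have e1: "ennreal (2 ^ ?q * (?L ^ ?q * r)) = ennreal (2 ^ ?q * ?L ^ ?q) * ennreal r"
      using r by (subst ennreal_mult[symmetric]) (simp_all add: mult.assoc del: of_nat_Suc power_Suc)
    have e2: "ennreal (2 ^ ?q + 2 ^ ?q * ?L ^ ?q) = ennreal (2 ^ ?q) + ennreal (2 ^ ?q * ?L ^ ?q)"
      by (rule ennreal_plus) simp_all
    show ?thesis unfolding e1 e2 distrib_right by (simp only: mult_ac)
  qed
  finally have "L0 * ennreal r * ennreal (1 / r) \<le> (ennreal (2 ^ ?q + 2 ^ ?q * ?L ^ ?q) * KK) * ennreal r * ennreal (1 / r)"
    by (rule mult_right_mono) simp
  moreover have "ennreal r * ennreal (1 / r) = 1" using r by (simp add: ennreal_mult[symmetric])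
  ultimately show ?thesis unfolding L0_def KK_def K_def by (simp add: mult.assoc del: of_nat_Suc power_Suc)
qed

lemma AE_translate:
  assumes "AE x in (lborel :: 'a::euclidean_space measure). P x"
  shows "AE x in lborel. P (x + t)"
proof -
  obtain N where N: "N \<in> null_sets lborel" "{x. \<not> P x} \<subseteq> N"
    using AE_E[OF assms] by (auto simp: null_sets_def)
  have [measurable]: "N \<in> sets borel" using N by (auto simp: null_sets_def)
  have "(\<integral>\<^sup>+x. indicator N (x + t) \<partial>lborel) = (\<integral>\<^sup>+x. indicator N x \<partial>lborel)"
    by (rule nn_integral_translate) measurable
  also have "\<dots> = 0" using N by (simp add: null_sets_def)
  finally have "AE x in lborel. (indicator N (x + t) :: ennreal) = 0"
    by (subst (asm) nn_integral_0_iff_AE) auto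
  then show ?thesis
    by eventually_elim (use N(2) in \<open>auto simp: indicator_def split: if_splits\<close>)
qed

lemma fin_diff_cong_AE:
  assumes "AE x in lborel. \<phi> x = \<psi> x"
  shows "AE x in lborel. fin_diff l h \<phi> x = fin_diff l h \<psi> x"
proof -
  have "AE x in lborel. \<forall>i\<in>{..l}. \<phi> (x + real i *\<^sub>R h) = \<psi> (x + real i *\<^sub>R h)"
    by (intro AE_finite_allI) (auto intro: AE_translate[OF assms])
  then show ?thesis by eventually_elim (simp add: fin_diff_def)
qed

lemma L1n_fin_diff_le:
  fixes \<psi> :: "'a::euclidean_space \<Rightarrow> real"
  assumes [measurable]: "borel_fun \<psi>" "Q \<in> sets borel" "N \<in> sets borel"
    and N: "\<And>x i. x \<in> Q \<Longrightarrow> i \<le> l \<Longrightarrow> x + real i *\<^sub>R h \<in> N"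
  shows "L1n Q (fin_diff l h \<psi>) \<le> ennreal (2 ^ l) * L1n N \<psi>"
proof -
  have "ennreal \<bar>fin_diff l h \<psi> x\<bar> \<le> (\<Sum>i\<le>l. ennreal \<bar>fd l i\<bar> * ennreal \<bar>\<psi> (x + real i *\<^sub>R h)\<bar>)" for x
  proof -
    have "\<bar>fin_diff l h \<psi> x\<bar> \<le> (\<Sum>i\<le>l. \<bar>fd l i\<bar> * \<bar>\<psi> (x + real i *\<^sub>R h)\<bar>)"
      unfolding fin_diff_fd abs_mult[symmetric] by (rule sum_abs)
    then show ?thesis
      by (simp add: ennreal_mult[symmetric] sum_ennreal ennreal_leI)
  qed
  then have "L1n Q (fin_diff l h \<psi>) \<le> (\<integral>\<^sup>+x. (\<Sum>i\<le>l. ennreal \<bar>fd l i\<bar> * (ennreal \<bar>\<psi> (x + real i *\<^sub>R h)\<bar> * indicator Q x)) \<partial>lborel)"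
    unfolding L1n_def by (intro nn_integral_mono) (auto simp: indicator_def)
  also have "\<dots> = (\<Sum>i\<le>l. ennreal \<bar>fd l i\<bar> * (\<integral>\<^sup>+x\<in>Q. ennreal \<bar>\<psi> (x + real i *\<^sub>R h)\<bar> \<partial>lborel))"
    by (subst nn_integral_sum) (auto simp: nn_integral_cmult)
  also have "\<dots> \<le> (\<Sum>i\<le>l. ennreal \<bar>fd l i\<bar> * L1n N \<psi>)"
    using N by (intro sum_mono mult_left_mono nn_integral_shift_le) auto
  also have "\<dots> = ennreal (2 ^ l) * L1n N \<psi>"
    unfolding sum_distrib_right[symmetric] by (subst sum_ennreal) (auto simp: sum_abs_fd)
  finally show ?thesis .
qed

lemma fin_diff_borel:
  assumes [measurable]: "borel_fun \<psi>"
  shows "borel_fun (fin_diff l h \<psi>)"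
  unfolding fin_diff_def[abs_def] by measurable

lemma fin_diff_diff: "fin_diff l h \<phi> x - fin_diff l h \<psi> x = fin_diff l h (\<lambda>x. \<phi> x - \<psi> x) x"
  by (simp add: fin_diff_def sum_subtractf right_diff_distrib)

lemma snd_borel: "borel_fun (snd :: 'a::euclidean_space \<times> 'b::euclidean_space \<Rightarrow> 'b)"
  by (rule borel_measurable_continuous_onI) (rule continuous_on_snd[OF continuous_on_id])

text \<open>The smooth estimate applied to mollifications of \<open>f\<close>. Both sides pass to the limit because the
  trace formula is continuous in local \<open>L\<^sub>1\<close>.\<close>

lemma local_estimate:
  fixes f :: "'a::euclidean_space \<times> real \<Rightarrow> real"
  assumes g: "\<And>w. w \<in> words (Suc l) \<Longrightarrow> wderiv w f (g w)" and g1: "wderiv [et] f g1"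
    and h: "\<And>b. b \<in> Basis \<Longrightarrow> \<bar>h \<bullet> b\<bar> \<le> r" and r: "r > 0"
    and Qm [measurable]: "Q \<in> sets borel" and Nm [measurable]: "N \<in> sets borel" and Nb: "bounded N"
    and N: "\<And>x s. x \<in> Q \<Longrightarrow> 0 \<le> s \<Longrightarrow> s \<le> real (Suc l) \<Longrightarrow> x + s *\<^sub>R h \<in> N"
  shows "L1n Q (fin_diff (Suc l) h (trc f g1)) \<le> ennreal (2 ^ Suc l + 2 ^ Suc l * real (Suc l) ^ Suc l) *
    (\<Sum>w\<in>words (Suc l). L1n (N \<times> {0<..<2 * real (Suc l) * r}) (\<lambda>z. snd z ^ l * g w z))"
proof -
  let ?R = "2 * real (Suc l) * r"
  let ?C = "ennreal (2 ^ Suc l + 2 ^ Suc l * real (Suc l) ^ Suc l)"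
  let ?S = "N \<times> {0<..<?R}"
  have R: "?R > 0" using r by simp
  have l: "locint f" "locint g1" using g1 by (auto simp: wderiv_def)
  have lg: "locint (g w)" if "w \<in> words (Suc l)" for w using g[OF that] by (simp add: wderiv_def)
  define F where "F j = conv f (dil j moll)" for j
  define G where "G j = conv g1 (dil j moll)" for j
  define H where "H w j = conv (g w) (dil j moll)" for w j
  note mt = tfun_dil[OF moll_facts(1)[where 'a="'a \<times> real"]]
  note fb = locint_borel[OF l(1)] locint_borel[OF l(2)]
  have sF: "smooth (F j)" for j unfolding F_def by (rule smooth_conv[OF l(1) mt])
  have dG: "pderiv_dir et (F j) = G j" for j
    unfolding F_def G_def using wderiv_conv[OF g1 _ mt] et_Basis by simp
  have dH: "pderivs w (F j) = H w j" if "w \<in> words (Suc l)" for w j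
    unfolding F_def H_def using wderiv_conv[OF g[OF that] _ mt] that by (auto simp: words_def)
  have lF: "locint (F j)" "locint (G j)" for j
    unfolding F_def G_def by (intro locint_conv l tfun_kern mt)+
  have lH: "locint (H w j)" if "w \<in> words (Suc l)" for w j
    unfolding H_def by (intro locint_conv lg that tfun_kern mt)
  have F0: "(\<lambda>x. F j (x, 0)) = trc (F j) (G j)" for j
    using trc_smooth(1)[OF sF, of j] dG by auto
  have conv: "(\<lambda>j. L1n A (\<lambda>z. F j z - f z)) \<longlonglongrightarrow> 0" "(\<lambda>j. L1n A (\<lambda>z. G j z - g1 z)) \<longlonglongrightarrow> 0" if "bounded A" for A
    unfolding F_def G_def
    by (intro tendsto_L1n_subset[OF _ that] mollify_tendsto l moll_facts)+
  have convH: "(\<lambda>j. L1n A (\<lambda>z. H w j z - g w z)) \<longlonglongrightarrow> 0" if "bounded A" "w \<in> words (Suc l)" for A w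
    unfolding H_def by (intro tendsto_L1n_subset[OF _ that(1)] mollify_tendsto lg that moll_facts)
  note [measurable] = snd_borel[where 'a='a and 'b=real]
  define a where "a j = L1n (N \<times> {0<..<1}) (\<lambda>z. F j z - f z) + L1n (N \<times> {0<..<1}) (\<lambda>z. G j z - g1 z)" for j
  define b where "b j = (\<Sum>w\<in>words (Suc l). ennreal (?R ^ l) * L1n ?S (\<lambda>z. H w j z - g w z))" for j
  define K where "K = (\<Sum>w\<in>words (Suc l). L1n ?S (\<lambda>z. snd z ^ l * g w z))"
  have bd: "L1n Q (fin_diff (Suc l) h (trc f g1)) \<le> ennreal (2 ^ Suc l) * a j + ?C * (b j + K)" for j
  proof -
    have tm: "borel_fun (trc f g1)" "borel_fun (trc (F j) (G j))"
      by (intro trc_borel fb locint_borel lF)+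
    have "L1n Q (fin_diff (Suc l) h (trc f g1)) \<le> L1n Q (\<lambda>x. fin_diff (Suc l) h (trc (F j) (G j)) x - fin_diff (Suc l) h (trc f g1) x)
        + L1n Q (fin_diff (Suc l) h (trc (F j) (G j)))"
      using L1n_diff_triangle[OF fin_diff_borel[OF tm(1)] fin_diff_borel[OF tm(2)], of "\<lambda>_. 0" Q "Suc l" h "Suc l" h]
      by (simp add: L1n_minus_commute[of Q "fin_diff (Suc l) h (trc f g1)"])
    also have "L1n Q (\<lambda>x. fin_diff (Suc l) h (trc (F j) (G j)) x - fin_diff (Suc l) h (trc f g1) x) \<le> ennreal (2 ^ Suc l) * a j"
    proof -
      have "L1n Q (\<lambda>x. fin_diff (Suc l) h (trc (F j) (G j)) x - fin_diff (Suc l) h (trc f g1) x)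
        \<le> ennreal (2 ^ Suc l) * L1n N (\<lambda>x. trc (F j) (G j) x - trc f g1 x)"
        unfolding fin_diff_diff
        by (rule L1n_fin_diff_le) (use tm N in \<open>auto intro!: borel_measurable_diff\<close>)
      also have "L1n N (\<lambda>x. trc (F j) (G j) x - trc f g1 x) = L1n N (trc (\<lambda>z. F j z - f z) (\<lambda>z. G j z - g1 z))"
        using trc_diff_AE[OF lF l, of j j] by (intro L1n_cong_AE) (auto elim!: eventually_mono)
      also have "\<dots> \<le> a j"
        unfolding a_def by (intro L1n_trc borel_measurable_diff fb locint_borel lF Nm)
      finally show ?thesis by (simp add: mult_left_mono)
    qed
    also have "L1n Q (fin_diff (Suc l) h (trc (F j) (G j))) \<le> ?C * (\<Sum>w\<in>words (Suc l). L1n ?S (\<lambda>z. snd z ^ l * pderivs w (F j) z))"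
      unfolding F0[symmetric] by (rule local_estimate_smooth[OF sF h r Qm Nm N])
    also have "(\<Sum>w\<in>words (Suc l). L1n ?S (\<lambda>z. snd z ^ l * pderivs w (F j) z)) \<le> b j + K"
      unfolding b_def K_def sum.distrib[symmetric]
    proof (rule sum_mono)
      fix w :: "('a \<times> real) list" assume w: "w \<in> words (Suc l)"
      have [measurable]: "borel_fun (g w)" "borel_fun (H w j)"
        using lg[OF w] lH[OF w] by (auto intro: locint_borel)
      have "L1n ?S (\<lambda>z. snd z ^ l * pderivs w (F j) z) = L1n ?S (\<lambda>z. snd z ^ l * (H w j z - g w z) + snd z ^ l * g w z)"
        unfolding dH[OF w] by (simp add: algebra_simps)
      also have "\<dots> \<le> L1n ?S (\<lambda>z. snd z ^ l * (H w j z - g w z)) + L1n ?S (\<lambda>z. snd z ^ l * g w z)"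
        by (rule L1n_triangle) auto
      also have "L1n ?S (\<lambda>z. snd z ^ l * (H w j z - g w z)) \<le> L1n ?S (\<lambda>z. ?R ^ l * (H w j z - g w z))"
        unfolding L1n_def
      proof (rule nn_integral_mono)
        fix z :: "'a \<times> real"
        show "ennreal \<bar>snd z ^ l * (H w j z - g w z)\<bar> * indicator ?S z \<le> ennreal \<bar>?R ^ l * (H w j z - g w z)\<bar> * indicator ?S z"
        proof (cases "z \<in> ?S")
          case True
          then have "\<bar>snd z\<bar> ^ l \<le> \<bar>?R\<bar> ^ l" by (intro power_mono) auto
          then have "\<bar>snd z\<bar> ^ l * \<bar>H w j z - g w z\<bar> \<le> \<bar>?R\<bar> ^ l * \<bar>H w j z - g w z\<bar>" by (rule mult_right_mono) simp
          then have "\<bar>snd z ^ l * (H w j z - g w z)\<bar> \<le> \<bar>?R ^ l * (H w j z - g w z)\<bar>"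
            by (simp only: abs_mult power_abs)
          then show ?thesis using True by (simp add: ennreal_leI del: of_nat_Suc)
        qed simp
      qed
      also have "\<dots> = ennreal (?R ^ l) * L1n ?S (\<lambda>z. H w j z - g w z)"
        using R by (subst L1n_cmult) (auto simp del: of_nat_Suc)
      finally show "L1n ?S (\<lambda>z. snd z ^ l * pderivs w (F j) z)
        \<le> ennreal (?R ^ l) * L1n ?S (\<lambda>z. H w j z - g w z) + L1n ?S (\<lambda>z. snd z ^ l * g w z)"
        by (simp add: add_right_mono)
    qed
    finally show ?thesis by (simp add: add_mono mult_left_mono del: of_nat_Suc power_Suc)
  qed
  have "a \<longlonglongrightarrow> 0 + 0"
    unfolding a_def by (intro tendsto_add conv bounded_Times Nb) auto
  moreover have "b \<longlonglongrightarrow> (\<Sum>w\<in>(words (Suc l) :: ('a \<times> real) list set). ennreal (?R ^ l) * 0)"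
    unfolding b_def by (intro tendsto_sum ennreal_tendsto_cmult convH bounded_Times Nb) auto
  ultimately have "(\<lambda>j. ennreal (2 ^ Suc l) * a j + ?C * (b j + K)) \<longlonglongrightarrow> ennreal (2 ^ Suc l) * 0 + ?C * (0 + K)"
    by (intro tendsto_add ennreal_tendsto_cmult tendsto_const) simp_all
  then have "(\<lambda>j. ennreal (2 ^ Suc l) * a j + ?C * (b j + K)) \<longlonglongrightarrow> ?C * K" by simp
  then have "L1n Q (fin_diff (Suc l) h (trc f g1)) \<le> ?C * K"
    by (rule tendsto_lowerbound) (rule always_eventually, rule allI, rule bd, rule sequentially_bot)
  then show ?thesis unfolding K_def .
qed

section \<open>Boundedness of the trace operator\<close>

definition sbox :: "real \<Rightarrow> 'a::euclidean_space set"
  where "sbox r = {h. \<forall>b\<in>Basis. \<bar>h \<bullet> b\<bar> < r}"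

lemma sbox_eq: "(sbox r :: 'a::euclidean_space set) = cube (- r *\<^sub>R One) (2 * r)"
proof -
  have "(- r *\<^sub>R One) \<bullet> b = - r" if "b \<in> Basis" for b :: 'a using that by simp
  then show ?thesis
    unfolding set_eq_iff sbox_def mem_cube mem_Collect_eq abs_less_iff
    by (auto simp del: inner_minus_left inner_scaleR_left)
qed

lemma scaleR_unit_I: "r > 0 \<Longrightarrow> (*\<^sub>R) r ` unit_I = (sbox r :: 'a::euclidean_space set)"
proof
  assume r: "r > 0"
  show "(*\<^sub>R) r ` unit_I \<subseteq> (sbox r :: 'a set)"
  proof
    fix x :: 'a assume "x \<in> (*\<^sub>R) r ` unit_I"
    then obtain y where y: "x = r *\<^sub>R y" "y \<in> unit_I" by auto
    have "\<bar>x \<bullet> b\<bar> < r" if "b \<in> Basis" for b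
    proof -
      have "\<bar>y \<bullet> b\<bar> < 1" using y(2) that by (auto simp: unit_I_def mem_box abs_less_iff)
      then have "r * \<bar>y \<bullet> b\<bar> < r * 1" using r by (intro mult_strict_left_mono) auto
      then show ?thesis using r by (simp add: y(1) abs_mult)
    qed
    then show "x \<in> sbox r" by (simp add: sbox_def)
  qed
  show "(sbox r :: 'a set) \<subseteq> (*\<^sub>R) r ` unit_I"
  proof
    fix x :: 'a assume x: "x \<in> sbox r"
    have "(1 / r) *\<^sub>R x \<in> unit_I"
      using x r by (auto simp: sbox_def unit_I_def mem_box abs_less_iff field_simps)
    moreover have "x = r *\<^sub>R ((1 / r) *\<^sub>R x)" using r by simp
    ultimately show "x \<in> (*\<^sub>R) r ` unit_I" by blast
  qed
qed

lemma sbox_sets [measurable]: "sbox r \<in> sets borel"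
  unfolding sbox_eq by simp

lemma emeasure_sbox: "r > 0 \<Longrightarrow> emeasure lborel (sbox r :: 'a::euclidean_space set) = ennreal ((2 * r) ^ DIM('a))"
  unfolding sbox_eq by (rule emeasure_cube) simp

lemma oscillation_eq:
  fixes \<phi> :: "real^'n \<Rightarrow> real"
  shows "oscillation l (dyadic_cube k m) \<phi> = ennreal (2 ^ (2 * k * CARD('n))) *
    (\<integral>\<^sup>+h\<in>sbox (1 / 2 ^ k). L1n (dyadic_cube k m) (fin_diff l h \<phi>) \<partial>lborel)"
proof -
  have s: "side_length (dyadic_cube k m) = 1 / 2 ^ k"
    unfolding dyadic_cube_eq by (rule side_length_cube) simp
  have e: "measure lebesgue (dyadic_cube k m) = (1 / 2 ^ k) ^ CARD('n)"
    unfolding dyadic_cube_eq by (subst measure_cube) auto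
  have p: "1 / ((1 / 2 ^ k) ^ CARD('n))\<^sup>2 = (2::real) ^ (2 * k * CARD('n))"
    by (simp add: power_divide power_mult[symmetric] mult_ac)
  have "(*\<^sub>R) (1 / 2 ^ k) ` unit_I = (sbox (1 / 2 ^ k) :: (real^'n) set)"
    by (rule scaleR_unit_I) simp
  then show ?thesis
    unfolding oscillation_def s e p set_nn_integral_lebesgue by (simp add: nn_integral_completion)
qed

lemma oscillation_cong_AE:
  fixes \<phi> \<psi> :: "real^'n \<Rightarrow> real"
  assumes "AE x in lborel. \<phi> x = \<psi> x"
  shows "oscillation l (dyadic_cube k m) \<phi> = oscillation l (dyadic_cube k m) \<psi>"
proof -
  have "L1n (dyadic_cube k m) (fin_diff l h \<phi>) = L1n (dyadic_cube k m) (fin_diff l h \<psi>)" for h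
    using fin_diff_cong_AE[OF assms, of l h] by (intro L1n_cong_AE) (auto elim!: eventually_mono)
  then show ?thesis unfolding oscillation_eq by simp
qed

lemma B_norm_eq:
  fixes \<phi> :: "real^'n \<Rightarrow> real"
  shows "B_norm l w \<phi> =
    (\<integral>\<^sup>+k. (\<integral>\<^sup>+m. ennreal (w k m) * oscillation l (dyadic_cube k m) \<phi> \<partial>count_space UNIV) \<partial>count_space {1..})
    + (\<integral>\<^sup>+m. ennreal (w 0 m) * L1n (dyadic_cube 0 m) \<phi> \<partial>count_space UNIV)"
  unfolding B_norm_def set_nn_integral_lebesgue
  by (simp add: infsum_eq_nn_integral)

lemma B_norm_cong_AE:
  fixes \<phi> \<psi> :: "real^'n \<Rightarrow> real"
  assumes "AE x in lborel. \<phi> x = \<psi> x"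
  shows "B_norm l w \<phi> = B_norm l w \<psi>"
proof -
  have "L1n Q \<phi> = L1n Q \<psi>" for Q
    using assms by (intro L1n_cong_AE) (auto elim!: eventually_mono)
  then show ?thesis unfolding B_norm_eq oscillation_cong_AE[OF assms] by simp
qed

lemma dyadic_geometric:
  assumes "s > 0" "A > 0"
  shows "(\<Sum>k<n. if 2 ^ k * s < A then 2 ^ k * s else (0::real)) \<le> 2 * A"
proof -
  have le: "(\<Sum>k<n. if 2 ^ k * s < A then 2 ^ k * s else 0) \<le> 2 ^ n * s" for n
  proof (induction n)
    case (Suc n)
    have "(if 2 ^ n * s < A then 2 ^ n * s else 0) \<le> 2 ^ n * s" using assms by simp
    then show ?case using Suc by simp
  qed (use assms in simp)
  show ?thesis
  proof (induction n)
    case (Suc n)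
    show ?case
    proof (cases "2 ^ n * s < A")
      case True then show ?thesis using le[of n] by simp
    qed (use Suc in simp)
  qed (use assms in simp)
qed

lemma dyadic_scales_bound:
  assumes "l \<ge> 1" "A > 0"
  shows "(\<integral>\<^sup>+k. ennreal ((2 ^ k * s) ^ l) * indicator {0<..<A} (2 ^ k * s) \<partial>count_space {1..}) \<le> ennreal (2 * A ^ l)"
proof (cases "s > 0")
  case False
  have "ennreal ((2 ^ k * s) ^ l) * indicator {0<..<A} (2 ^ k * s) = 0" for k :: nat
    using False by (auto simp: indicator_def zero_less_mult_iff)
  then show ?thesis by (simp only: nn_integral_const mult_zero_left zero_le)
next
  case True
  let ?f = "\<lambda>k::nat. ennreal ((2 ^ k * s) ^ l) * indicator {0<..<A} (2 ^ k * s)"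
  have "(\<integral>\<^sup>+k. ?f k \<partial>count_space {1..}) = (\<integral>\<^sup>+k. ?f k * indicator {1..} k \<partial>count_space UNIV)"
    by (rule nn_integral_count_space_indicator) simp
  also have "\<dots> \<le> (\<integral>\<^sup>+k. ?f k \<partial>count_space UNIV)"
    by (intro nn_integral_mono) (auto simp: indicator_def)
  also have "\<dots> = (\<Sum>k. ?f k)" by (rule nn_integral_count_space_nat)
  also have "\<dots> = (SUP n. \<Sum>k<n. ?f k)" by (rule suminf_eq_SUP)
  also have "\<dots> \<le> ennreal (2 * A ^ l)"
  proof (rule SUP_least)
    fix n :: nat
    have "(\<Sum>k<n. ?f k) \<le> (\<Sum>k<n. ennreal (A ^ (l - 1) * (if 2 ^ k * s < A then 2 ^ k * s else 0)))"
    proof (rule sum_mono)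
      fix k :: nat
      show "?f k \<le> ennreal (A ^ (l - 1) * (if 2 ^ k * s < A then 2 ^ k * s else 0))"
      proof (cases "2 ^ k * s < A")
        case lt: True
        have "(2 ^ k * s) ^ l = (2 ^ k * s) ^ (l - 1) * (2 ^ k * s)"
          using assms(1) by (metis One_nat_def Suc_pred less_le_trans power_Suc2 zero_less_one)
        also have "\<dots> \<le> A ^ (l - 1) * (2 ^ k * s)"
          using True lt by (intro mult_right_mono power_mono) auto
        finally show ?thesis using lt True by (simp add: ennreal_leI)
      qed simp
    qed
    also have "\<dots> = ennreal (A ^ (l - 1) * (\<Sum>k<n. if 2 ^ k * s < A then 2 ^ k * s else 0))"
      unfolding sum_distrib_left using True assms by (intro sum_ennreal) auto
    also have "\<dots> \<le> ennreal (A ^ (l - 1) * (2 * A))"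
      using dyadic_geometric[OF True assms(2), of n] assms by (intro ennreal_leI mult_left_mono) auto
    also have "A ^ (l - 1) * (2 * A) = 2 * A ^ l"
      using assms(1) by (cases l) auto
    finally show "(\<Sum>k<n. ?f k) \<le> ennreal (2 * A ^ l)" .
  qed
  finally show ?thesis .
qed

lemma AE_near_cells:
  fixes m :: "int^'n"
  shows "AE z in lborel. z \<in> cube (corner k m - (real L / 2 ^ k) *\<^sub>R One) ((2 * real L + 1) / 2 ^ k) \<times> {0<..<2 * real L / 2 ^ k}
    \<longrightarrow> (\<exists>q\<in>nbrs L \<times> {0..<2 * int L}. z \<in> cell k (m + fst q) (snd q))"
proof -
  let ?c = "corner k m - (real L / 2 ^ k) *\<^sub>R One"
  have "AE z in (lborel :: ((real^'n) \<times> real) measure). \<forall>c::int. snd z \<noteq> real_of_int c / 2 ^ k"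
    unfolding AE_all_countable by (intro allI AE_snd_neq)
  with AE_fst_dyadic_cube[of k] show ?thesis
  proof eventually_elim
    case (elim z)
    show ?case
    proof
      assume z: "z \<in> cube ?c ((2 * real L + 1) / 2 ^ k) \<times> {0<..<2 * real L / 2 ^ k}"
      define p where "p = idx k (fst z) - m"
      define j where "j = \<lfloor>2 ^ k * snd z\<rfloor>"
      have pn: "p \<in> nbrs L"
        unfolding nbrs_def mem_Collect_eq
      proof
        fix i :: 'n
        have "axis i (1::real) \<in> Basis" by (simp add: axis_in_Basis_iff)
        moreover have "fst z \<in> cube ?c ((2 * real L + 1) / 2 ^ k)" using z by auto
        ultimately have "?c \<bullet> axis i 1 < fst z \<bullet> axis i 1 \<and>
          fst z \<bullet> axis i 1 < ?c \<bullet> axis i 1 + (2 * real L + 1) / 2 ^ k"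
          unfolding mem_cube by blast
        moreover have "?c \<bullet> axis i 1 = (real_of_int (m $ i) - real L) / 2 ^ k"
          by (simp add: inner_axis corner_def One_cart' diff_divide_distrib)
        ultimately have "(real_of_int (m $ i) - real L) / 2 ^ k < fst z $ i"
          "fst z $ i < (real_of_int (m $ i) - real L) / 2 ^ k + (2 * real L + 1) / 2 ^ k"
          by (simp_all add: inner_axis)
        then have "real_of_int (m $ i) - real L < 2 ^ k * fst z $ i" "2 ^ k * fst z $ i < real_of_int (m $ i) + real L + 1"
          by (simp_all add: add_divide_distrib[symmetric] field_simps)
        then show "\<bar>p $ i\<bar> \<le> int L" unfolding p_def idx_def by simp linarith
      qed
      have s: "0 < snd z" "snd z < 2 * real L / 2 ^ k" using z by auto
      have jj: "real_of_int j \<le> 2 ^ k * snd z" "2 ^ k * snd z < real_of_int j + 1"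
        unfolding j_def by linarith+
      have "real_of_int j \<noteq> 2 ^ k * snd z" using elim(2)[rule_format, of j] by (auto simp: field_simps)
      then have j1: "real_of_int j < 2 ^ k * snd z" using jj(1) by simp
      have "0 \<le> 2 ^ k * snd z" "2 ^ k * snd z < 2 * real L" using s by (simp_all add: field_simps)
      then have j2: "0 \<le> j" "j < 2 * int L" unfolding j_def by (simp, linarith)
      have "z \<in> cell k (m + p) j"
        using elim(1) j1 jj(2) unfolding cell_def p_def by (cases z) (simp add: field_simps)
      then show "\<exists>q\<in>nbrs L \<times> {0..<2 * int L}. z \<in> cell k (m + fst q) (snd q)"
        using pn j2 by (intro bexI[of _ "(p, j)"]) auto
    qed
  qed
qed

text \<open>By \<open>cell_AE\<close>, a multiple of the weight on one cell dominates the mean of the weight over the other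
  one, which may therefore be replaced by the weight inside the integral.\<close>

lemma weight_into_cell:
  fixes \<gamma> :: "(real^'n) \<times> real \<Rightarrow> real"
  assumes "\<gamma> \<in> A1_loc"
  shows "\<exists>C\<ge>1. \<forall>k m p j u. p \<in> nbrs L \<and> \<bar>j\<bar> \<le> int L \<and> u \<in> borel_measurable borel \<longrightarrow>
    L1n (cell k m 0) (wrep \<gamma>) * L1n (cell k (m + p) j) u
      \<le> ennreal (C / 2 ^ (k * (CARD('n) + 1))) * L1n (cell k (m + p) j) (\<lambda>z. wrep \<gamma> z * u z)"
proof -
  obtain C where C: "C \<ge> 1" "\<And>k m p j. \<forall>a. \<bar>p $ a\<bar> \<le> int L \<Longrightarrow> \<bar>j\<bar> \<le> int L \<Longrightarrow>
    AE z in lborel. z \<in> cell k (m + p) j \<longrightarrow>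
      L1n (cell k m 0) (wrep \<gamma>) \<le> ennreal (C / 2 ^ (k * (CARD('n) + 1))) * ennreal (wrep \<gamma> z)"
    using cell_AE[OF assms, of L] by blast
  note W = wrep[OF assms]
  have "L1n (cell k m 0) (wrep \<gamma>) * L1n (cell k (m + p) j) u
      \<le> ennreal (C / 2 ^ (k * (CARD('n) + 1))) * L1n (cell k (m + p) j) (\<lambda>z. wrep \<gamma> z * u z)"
    if p: "p \<in> nbrs L" "\<bar>j\<bar> \<le> int L" and [measurable]: "borel_fun u" for k m p j u
  proof -
    have [measurable]: "borel_fun (wrep \<gamma>)" by (rule W(5))
    let ?c = "ennreal (C / 2 ^ (k * (CARD('n) + 1)))"
    have "L1n (cell k m 0) (wrep \<gamma>) * L1n (cell k (m + p) j) u
      = (\<integral>\<^sup>+z. L1n (cell k m 0) (wrep \<gamma>) * (ennreal \<bar>u z\<bar> * indicator (cell k (m + p) j) z) \<partial>lborel)"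
      unfolding L1n_def[of "cell k (m + p) j"] by (rule nn_integral_cmult[symmetric]) measurable
    also have "\<dots> \<le> (\<integral>\<^sup>+z. ?c * (ennreal \<bar>wrep \<gamma> z * u z\<bar> * indicator (cell k (m + p) j) z) \<partial>lborel)"
    proof (rule nn_integral_mono_AE)
      have "AE z in lborel. z \<in> cell k (m + p) j \<longrightarrow>
        L1n (cell k m 0) (wrep \<gamma>) \<le> ?c * ennreal (wrep \<gamma> z)"
        using p by (intro C(2)) (auto simp: nbrs_def)
      then show "AE z in lborel. L1n (cell k m 0) (wrep \<gamma>) * (ennreal \<bar>u z\<bar> * indicator (cell k (m + p) j) z)
        \<le> ?c * (ennreal \<bar>wrep \<gamma> z * u z\<bar> * indicator (cell k (m + p) j) z)"
      proof eventually_elim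
        case (elim z)
        show ?case
        proof (cases "z \<in> cell k (m + p) j")
          case True
          then have "L1n (cell k m 0) (wrep \<gamma>) * ennreal \<bar>u z\<bar> \<le> ?c * ennreal (wrep \<gamma> z) * ennreal \<bar>u z\<bar>"
            using elim by (intro mult_right_mono) auto
          then show ?thesis using True W(3)[of z] by (simp add: abs_mult ennreal_mult mult.assoc)
        qed simp
      qed
    qed
    also have "\<dots> = ?c * L1n (cell k (m + p) j) (\<lambda>z. wrep \<gamma> z * u z)"
      unfolding L1n_def by (rule nn_integral_cmult) measurable
    finally show ?thesis .
  qed
  then show ?thesis using C(1) by blast
qed

lemma nn_integral_cells_le:
  fixes u :: "(real^'n) \<times> real \<Rightarrow> real"
  assumes [measurable]: "borel_fun u" and j: "0 \<le> j" "j < 2 * int L"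
  shows "(\<integral>\<^sup>+m. L1n (cell k (m + p) j) u \<partial>count_space UNIV) \<le> L1n (UNIV \<times> {0<..<2 * real L / 2 ^ k}) u"
proof -
  have "(\<integral>\<^sup>+m. L1n (cell k (m + p) j) u \<partial>count_space UNIV) = (\<integral>\<^sup>+m. L1n (cell k m j) u \<partial>count_space UNIV)"
    by (rule nn_integral_count_space_shift)
  also have "\<dots> = L1n (UNIV \<times> {real_of_int j / 2 ^ k <..< (real_of_int j + 1) / 2 ^ k}) u"
    unfolding L1n_def by (rule nn_integral_cells) measurable
  also have "\<dots> \<le> L1n (UNIV \<times> {0<..<2 * real L / 2 ^ k}) u"
  proof (intro L1n_mono_set Sigma_mono subsetI)
    fix s assume s: "s \<in> {real_of_int j / 2 ^ k <..< (real_of_int j + 1) / 2 ^ k}"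
    have "0 \<le> real_of_int j / 2 ^ k" using j by simp
    moreover have "(real_of_int j + 1) / 2 ^ k \<le> 2 * real L / 2 ^ k"
    proof -
      have "real_of_int (j + 1) \<le> real_of_int (2 * int L)" using j(2) by (subst of_int_le_iff) simp
      then show ?thesis by (intro divide_right_mono) auto
    qed
    ultimately show "s \<in> {0<..<2 * real L / 2 ^ k}" using s by auto
  qed auto
  finally show ?thesis .
qed

lemma nn_integral_weight_eq:
  fixes \<gamma> :: "'a::euclidean_space \<Rightarrow> real"
  assumes "\<gamma> \<in> A1_loc"
  shows "wnorm (wrep \<gamma>) u = wnorm \<gamma> u"
  using wrep(2)[OF assms] unfolding ae_eq_def AE_lebesgue_iff
  by (intro nn_integral_cong_AE) (auto elim!: eventually_mono)

text \<open>The cells of scale \<open>k\<close> that enter the estimate of the differences over the cube \<open>m\<close>.\<close>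

definition near_sum :: "nat \<Rightarrow> nat \<Rightarrow> int^'n \<Rightarrow> ((real^'n) \<times> real \<Rightarrow> real) \<Rightarrow> ennreal"
  where "near_sum L k m u = (\<Sum>q\<in>nbrs L \<times> {0..<2 * int L}. L1n (cell k (m + fst q) (snd q)) u)"

text \<open>The points that the differences involve stay in a neighbourhood of the cube that is covered by
  finitely many dyadic cubes of the same scale.\<close>

lemma oscillation_trc_le:
  fixes f g1 :: "(real^'n) \<times> real \<Rightarrow> real"
  assumes g: "\<forall>w\<in>words (Suc l). wderiv w f (g w)" and g1: "wderiv [et] f g1"
  defines "C0 \<equiv> 2 ^ Suc l + 2 ^ Suc l * real (Suc l) ^ Suc l"
  shows "oscillation (Suc l) (dyadic_cube k m) (trc f g1) \<le> ennreal (C0 * 2 ^ CARD('n) * 2 ^ (k * CARD('n))) *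
    (\<Sum>w\<in>words (Suc l). near_sum (Suc l) k m (\<lambda>z. snd z ^ l * g w z))"
proof -
  let ?L = "Suc l"
  let ?n = "CARD('n)"
  let ?c = "corner k m - (real ?L / 2 ^ k) *\<^sub>R One"
  let ?v = "\<lambda>w. \<lambda>z. snd z ^ l * g w z"
  note [measurable] = snd_borel[where 'a="real^'n" and 'b=real]
  have C0: "C0 \<ge> 0" by (simp add: C0_def)
  let ?Q = "dyadic_cube k m"
  define N where "N = cube ?c ((2 * real ?L + 1) / 2 ^ k)"
  have Nb: "bounded N" "N \<in> sets borel" unfolding N_def by (auto simp: bounded_box)
  define S where "S = (\<Sum>w\<in>words ?L. near_sum ?L k m (?v w))"
  have one: "L1n ?Q (fin_diff ?L h (trc f g1)) \<le> ennreal C0 * S" if h: "h \<in> sbox (1 / 2 ^ k)" for h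
  proof -
    have "L1n ?Q (fin_diff ?L h (trc f g1)) \<le> ennreal C0 *
      (\<Sum>w\<in>words ?L. L1n (N \<times> {0<..<2 * real ?L * (1 / 2 ^ k)}) (?v w))"
      unfolding C0_def
    proof (rule local_estimate[OF _ g1 _ _ _ Nb(2) Nb(1)])
      fix x s assume x: "x \<in> ?Q" and s: "0 \<le> s" "s \<le> real ?L"
      show "x + s *\<^sub>R h \<in> N"
        unfolding N_def mem_cube
      proof
        fix b :: "real^'n" assume b: "b \<in> Basis"
        have xb: "corner k m \<bullet> b < x \<bullet> b" "x \<bullet> b < corner k m \<bullet> b + 1 / 2 ^ k"
          using x b unfolding dyadic_cube_eq mem_cube by auto
        have hb: "\<bar>h \<bullet> b\<bar> \<le> 1 / 2 ^ k" using h b by (simp add: sbox_def less_imp_le)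
        have "\<bar>s * (h \<bullet> b)\<bar> \<le> real ?L * (1 / 2 ^ k)"
          unfolding abs_mult using s hb by (intro mult_mono) auto
        then have sh: "- (real ?L / 2 ^ k) \<le> s * (h \<bullet> b)" "s * (h \<bullet> b) \<le> real ?L / 2 ^ k"
          by (auto simp: abs_le_iff)
        have c: "?c \<bullet> b = corner k m \<bullet> b - real ?L / 2 ^ k"
          using b by (simp add: inner_diff_left del: of_nat_Suc)
        have d: "(2 * real ?L + 1) / 2 ^ k = 2 * (real ?L / 2 ^ k) + 1 / 2 ^ k"
          by (simp add: add_divide_distrib)
        show "?c \<bullet> b < (x + s *\<^sub>R h) \<bullet> b \<and>
          (x + s *\<^sub>R h) \<bullet> b < ?c \<bullet> b + (2 * real ?L + 1) / 2 ^ k"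
          unfolding c d inner_add_left inner_scaleR_left using xb sh by linarith
      qed
    qed (use g h in \<open>auto simp: sbox_def less_imp_le\<close>)
    also have "(\<Sum>w\<in>words ?L. L1n (N \<times> {0<..<2 * real ?L * (1 / 2 ^ k)}) (?v w)) \<le> S"
      unfolding S_def
    proof (rule sum_mono)
      fix w :: "((real^'n) \<times> real) list" assume "w \<in> words ?L"
      then have [measurable]: "borel_fun (g w)" using g by (auto simp: wderiv_def locint_borel)
      have "L1n (N \<times> {0<..<2 * real ?L / 2 ^ k}) (?v w) \<le> near_sum ?L k m (?v w)"
        unfolding L1n_def near_sum_def
        by (rule nn_integral_cover) (use AE_near_cells[of k m ?L] in \<open>auto simp: N_def finite_nbrs\<close>)
      then show "L1n (N \<times> {0<..<2 * real ?L * (1 / 2 ^ k)}) (?v w)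
        \<le> near_sum ?L k m (?v w)"
        by (simp del: of_nat_Suc)
    qed
    finally show ?thesis by (simp add: mult_left_mono)
  qed
  have "oscillation ?L ?Q (trc f g1) \<le> ennreal (2 ^ (2 * k * ?n)) *
      (\<integral>\<^sup>+h. ennreal C0 * S * indicator (sbox (1 / 2 ^ k)) (h :: real^'n) \<partial>lborel)"
    unfolding oscillation_eq using one
    by (intro mult_left_mono nn_integral_mono) (auto simp: indicator_def)
  also have "\<dots> = ennreal (2 ^ (2 * k * ?n)) * (ennreal C0 * S * ennreal ((2 * (1 / 2 ^ k)) ^ ?n))"
    by (subst nn_integral_cmult_indicator) (auto simp: emeasure_sbox)
  also have "\<dots> = (ennreal (2 ^ (2 * k * ?n)) * ennreal C0 * ennreal ((2 * (1 / 2 ^ k)) ^ ?n)) * S"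
    by (simp only: mult_ac)
  also have "ennreal (2 ^ (2 * k * ?n)) * ennreal C0 * ennreal ((2 * (1 / 2 ^ k)) ^ ?n)
      = ennreal (2 ^ (2 * k * ?n) * C0 * (2 * (1 / 2 ^ k)) ^ ?n)"
    using C0 by (simp add: ennreal_mult)
  also have "2 ^ (2 * k * ?n) * C0 * (2 * (1 / 2 ^ k)) ^ ?n = C0 * 2 ^ ?n * 2 ^ (k * ?n)"
  proof -
    have "(2::real) ^ (2 * k * ?n) = 2 ^ (k * ?n) * 2 ^ (k * ?n)"
      by (simp add: power_add[symmetric])
    moreover have "(2 * (1 / 2 ^ k)) ^ ?n = 2 ^ ?n / (2::real) ^ (k * ?n)"
      by (simp add: power_divide power_mult)
    ultimately show ?thesis by (simp add: field_simps)
  qed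
  finally show ?thesis unfolding S_def .
qed

lemma near_sum_weight:
  fixes \<gamma> :: "(real^'n) \<times> real \<Rightarrow> real"
  assumes "\<gamma> \<in> A1_loc"
  shows "\<exists>C\<ge>1. \<forall>k m. \<forall>u\<in>borel_measurable borel. L1n (cell k m 0) (wrep \<gamma>) * near_sum L k m u
    \<le> ennreal (C / 2 ^ (k * (CARD('n) + 1))) * near_sum L k m (\<lambda>z. wrep \<gamma> z * u z)"
proof -
  obtain C where C: "C \<ge> 1" "\<And>k m p j u. p \<in> nbrs (2 * L) \<Longrightarrow> \<bar>j\<bar> \<le> int (2 * L) \<Longrightarrow> u \<in> borel_measurable borel \<Longrightarrow>
    L1n (cell k m 0) (wrep \<gamma>) * L1n (cell k (m + p) j) u
      \<le> ennreal (C / 2 ^ (k * (CARD('n) + 1))) * L1n (cell k (m + p) j) (\<lambda>z. wrep \<gamma> z * u z)"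
    using weight_into_cell[OF assms, of "2 * L"] by blast
  have "fst q \<in> nbrs (2 * L) \<and> \<bar>snd q\<bar> \<le> int (2 * L)" if q: "q \<in> (nbrs L :: (int^'n) set) \<times> {0..<2 * int L}" for q
  proof -
    have "fst q \<in> nbrs L" using q by auto
    then have "fst q \<in> nbrs (2 * L)" unfolding nbrs_def mem_Collect_eq by (force intro: order_trans)
    then show ?thesis using q by auto
  qed
  then show ?thesis
    unfolding near_sum_def sum_distrib_left by (intro exI[of _ C] conjI allI ballI sum_mono C) auto
qed

lemma nn_integral_near_sum_le:
  fixes u :: "(real^'n) \<times> real \<Rightarrow> real"
  assumes "borel_fun u"
  shows "(\<integral>\<^sup>+m. near_sum L k m u \<partial>count_space UNIV)
    \<le> ennreal (real (card ((nbrs L :: (int^'n) set) \<times> {0..<2 * int L}))) * L1n (UNIV \<times> {0<..<2 * real L / 2 ^ k}) u"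
proof -
  have "(\<integral>\<^sup>+m. near_sum L k m u \<partial>count_space UNIV)
    = (\<Sum>q\<in>nbrs L \<times> {0..<2 * int L}. \<integral>\<^sup>+m. L1n (cell k (m + fst q) (snd q)) u \<partial>count_space UNIV)"
    unfolding near_sum_def by (rule nn_integral_sum) simp
  also have "\<dots> \<le> (\<Sum>q\<in>(nbrs L :: (int^'n) set) \<times> {0..<2 * int L}. L1n (UNIV \<times> {0<..<2 * real L / 2 ^ k}) u)"
    by (intro sum_mono nn_integral_cells_le assms) auto
  finally show ?thesis by (simp add: ennreal_of_nat_eq_real_of_nat)
qed

text \<open>A point at height \<open>t\<close> is counted at the scales with \<open>2\<^sup>k t < A\<close> only, with weights
  \<open>(2\<^sup>k t)\<^sup>l\<close> that form a geometric progression; this is where \<open>l \<ge> 1\<close> enters.\<close>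

lemma nn_integral_scales_le:
  fixes v :: "'a::euclidean_space \<times> real \<Rightarrow> real"
  assumes v [measurable]: "borel_fun v" and l: "l \<ge> 1" "A > 0"
  shows "(\<integral>\<^sup>+k. ennreal ((2 ^ k) ^ l) * L1n (UNIV \<times> {0<..<A / 2 ^ k}) (\<lambda>z. v z * snd z ^ l) \<partial>count_space {1..})
    \<le> ennreal (2 * A ^ l) * (\<integral>\<^sup>+z. ennreal \<bar>v z\<bar> \<partial>lborel)"
proof -
  note [measurable] = snd_borel[where 'a='a and 'b=real]
  let ?h = "\<lambda>k z. ennreal \<bar>v z\<bar> * (ennreal ((2 ^ k * snd z) ^ l) * indicator {0<..<A} (2 ^ k * snd z))"
  have e: "ennreal ((2 ^ k) ^ l) * L1n (UNIV \<times> {0<..<A / 2 ^ k}) (\<lambda>z. v z * snd z ^ l) = (\<integral>\<^sup>+z. ?h k z \<partial>lborel)" for k :: nat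
  proof -
    have "ennreal ((2 ^ k) ^ l) * L1n (UNIV \<times> {0<..<A / 2 ^ k}) (\<lambda>z. v z * snd z ^ l)
      = (\<integral>\<^sup>+z. ennreal ((2 ^ k) ^ l) * (ennreal \<bar>v z * snd z ^ l\<bar> * indicator (UNIV \<times> {0<..<A / 2 ^ k}) z) \<partial>lborel)"
      unfolding L1n_def by (rule nn_integral_cmult[symmetric]) measurable
    also have "\<dots> = (\<integral>\<^sup>+z. ?h k z \<partial>lborel)"
    proof (intro nn_integral_cong)
      fix z :: "'a \<times> real"
      have i: "2 ^ k * snd z \<in> {0<..<A} \<longleftrightarrow> z \<in> UNIV \<times> {0<..<A / 2 ^ k}"
        by (cases z) (simp add: pos_less_divide_eq mult.commute[of "2 ^ k"] zero_less_mult_iff)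
      show "ennreal ((2 ^ k) ^ l) * (ennreal \<bar>v z * snd z ^ l\<bar> * indicator (UNIV \<times> {0<..<A / 2 ^ k}) z) = ?h k z"
      proof (cases "z \<in> UNIV \<times> {0<..<A / 2 ^ k}")
        case True
        then have z: "snd z > 0" by auto
        then have "(2 ^ k) ^ l * \<bar>v z * snd z ^ l\<bar> = \<bar>v z\<bar> * (2 ^ k * snd z) ^ l"
          by (simp add: abs_mult power_mult_distrib)
        then show ?thesis using z True i by (simp add: ennreal_mult[symmetric])
      next
        case False then show ?thesis using i by simp
      qed
    qed
    finally show ?thesis .
  qed
  have "(\<integral>\<^sup>+k. ennreal ((2 ^ k) ^ l) * L1n (UNIV \<times> {0<..<A / 2 ^ k}) (\<lambda>z. v z * snd z ^ l) \<partial>count_space {1..})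
    = (\<integral>\<^sup>+z. (\<integral>\<^sup>+k. ?h k z \<partial>count_space {1..}) \<partial>lborel)"
    unfolding e by (rule nn_integral_count_space_nn_integral[symmetric]) auto
  also have "\<dots> \<le> (\<integral>\<^sup>+z. ennreal \<bar>v z\<bar> * ennreal (2 * A ^ l) \<partial>lborel)"
  proof (rule nn_integral_mono)
    fix z :: "'a \<times> real"
    have "(\<integral>\<^sup>+k. ?h k z \<partial>count_space {1..})
      = ennreal \<bar>v z\<bar> * (\<integral>\<^sup>+k. ennreal ((2 ^ k * snd z) ^ l) * indicator {0<..<A} (2 ^ k * snd z) \<partial>count_space {1..})"
      by (rule nn_integral_cmult) simp
    also have "\<dots> \<le> ennreal \<bar>v z\<bar> * ennreal (2 * A ^ l)"
      by (intro mult_left_mono dyadic_scales_bound l) auto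
    finally show "(\<integral>\<^sup>+k. ?h k z \<partial>count_space {1..}) \<le> ennreal \<bar>v z\<bar> * ennreal (2 * A ^ l)" .
  qed
  also have "\<dots> = (\<integral>\<^sup>+z. ennreal \<bar>v z\<bar> \<partial>lborel) * ennreal (2 * A ^ l)"
    by (rule nn_integral_multc) measurable
  finally show ?thesis by (simp only: mult.commute)
qed

text \<open>At scale \<open>0\<close> the norm of the trace is bounded directly by the formula that defines the trace.\<close>

lemma first_scale_bound:
  fixes \<gamma> :: "(real^'n) \<times> real \<Rightarrow> real"
  assumes \<gamma>: "\<gamma> \<in> A1_loc"
  shows "\<exists>A\<ge>1. \<forall>f\<in>borel_measurable borel. \<forall>g\<in>borel_measurable borel.
    (\<integral>\<^sup>+m. ennreal (weight_seq l \<gamma> 0 m) * L1n (dyadic_cube 0 m) (trc f g) \<partial>count_space UNIV)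
      \<le> ennreal A * (wnorm \<gamma> f + wnorm \<gamma> g)"
proof -
  obtain A where A: "A \<ge> 1" "\<And>k m p j u. p \<in> nbrs 0 \<Longrightarrow> \<bar>j\<bar> \<le> int 0 \<Longrightarrow> u \<in> borel_measurable borel \<Longrightarrow>
    L1n (cell k m 0) (wrep \<gamma>) * L1n (cell k (m + p) j) u
      \<le> ennreal (A / 2 ^ (k * (CARD('n) + 1))) * L1n (cell k (m + p) j) (\<lambda>z. wrep \<gamma> z * u z)"
    using weight_into_cell[OF \<gamma>, of 0] by blast
  have [measurable]: "borel_fun (wrep \<gamma>)" by (rule wrep(5)[OF \<gamma>])
  have u: "(\<integral>\<^sup>+m. ennreal A * L1n (cell 0 m 0) (\<lambda>z. wrep \<gamma> z * u z) \<partial>count_space UNIV)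
      \<le> ennreal A * wnorm \<gamma> u"
    if [measurable]: "borel_fun u" for u
  proof -
    have "(\<integral>\<^sup>+m. L1n (cell 0 (m + 0) 0) (\<lambda>z. wrep \<gamma> z * u z) \<partial>count_space UNIV) \<le> L1n (UNIV \<times> {0<..<2 * real 1 / 2 ^ 0}) (\<lambda>z. wrep \<gamma> z * u z)"
      by (rule nn_integral_cells_le) auto
    also have "\<dots> \<le> L1n UNIV (\<lambda>z. wrep \<gamma> z * u z)" by (rule L1n_mono_set) simp
    also have "\<dots> = wnorm \<gamma> u"
      unfolding nn_integral_weight_eq[OF \<gamma>, symmetric] by (simp add: L1n_def)
    finally show ?thesis by (simp add: nn_integral_cmult mult_left_mono)
  qed
  have "(\<integral>\<^sup>+m. ennreal (weight_seq l \<gamma> 0 m) * L1n (dyadic_cube 0 m) (trc f g) \<partial>count_space UNIV)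
      \<le> ennreal A * (wnorm \<gamma> f + wnorm \<gamma> g)"
    if fg [measurable]: "borel_fun f" "borel_fun g" for f g
  proof -
    have mv: "ennreal (weight_seq l \<gamma> 0 m) * L1n (dyadic_cube 0 m) (trc f g)
      \<le> ennreal A * L1n (cell 0 m 0) (\<lambda>z. wrep \<gamma> z * f z) + ennreal A * L1n (cell 0 m 0) (\<lambda>z. wrep \<gamma> z * g z)" for m
    proof -
      have c: "dyadic_cube 0 m \<times> {0<..<1} = cell 0 m 0" by (simp add: cell_def)
      have z: "(0 :: int^'n) \<in> nbrs 0" by (simp add: nbrs_def)
      have "L1n (dyadic_cube 0 m) (trc f g) \<le> L1n (cell 0 m 0) f + L1n (cell 0 m 0) g"
        unfolding c[symmetric] by (rule L1n_trc) auto
      then have "ennreal (weight_seq l \<gamma> 0 m) * L1n (dyadic_cube 0 m) (trc f g)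
        \<le> L1n (cell 0 m 0) (wrep \<gamma>) * (L1n (cell 0 m 0) f + L1n (cell 0 m 0) g)"
        unfolding ennreal_weight_seq[OF \<gamma>] by (simp add: mult_left_mono)
      also have "\<dots> = L1n (cell 0 m 0) (wrep \<gamma>) * L1n (cell 0 m 0) f + L1n (cell 0 m 0) (wrep \<gamma>) * L1n (cell 0 m 0) g"
        by (rule distrib_left)
      also have "\<dots> \<le> ennreal A * L1n (cell 0 m 0) (\<lambda>z. wrep \<gamma> z * f z) + ennreal A * L1n (cell 0 m 0) (\<lambda>z. wrep \<gamma> z * g z)"
        using A(2)[OF z, of 0 f 0 m] A(2)[OF z, of 0 g 0 m] by (intro add_mono) auto
      finally show ?thesis .
    qed
    have "(\<integral>\<^sup>+m. ennreal (weight_seq l \<gamma> 0 m) * L1n (dyadic_cube 0 m) (trc f g) \<partial>count_space UNIV)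
      \<le> (\<integral>\<^sup>+m. ennreal A * L1n (cell 0 m 0) (\<lambda>z. wrep \<gamma> z * f z) \<partial>count_space UNIV)
        + (\<integral>\<^sup>+m. ennreal A * L1n (cell 0 m 0) (\<lambda>z. wrep \<gamma> z * g z) \<partial>count_space UNIV)"
      using nn_integral_mono[OF mv, of "count_space UNIV" "\<lambda>m. m"] by (simp add: nn_integral_add)
    also have "\<dots> \<le> ennreal A * wnorm \<gamma> f + ennreal A * wnorm \<gamma> g"
      by (intro add_mono u fg)
    finally show ?thesis by (simp only: distrib_left)
  qed
  then show ?thesis using A(1) by blast
qed

text \<open>Level by level: the differences over a cube are bounded by integrals over nearby cells, the weight
  is moved into these integrals, and the sums over cubes and over scales are carried out.\<close>

lemma trace_bounded:
  fixes \<gamma> :: "(real^'n) \<times> real \<Rightarrow> real"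
  assumes \<gamma>: "\<gamma> \<in> A1_loc" and l: "l \<ge> 1"
  shows "\<exists>C. \<forall>f g g1 B. locint f \<longrightarrow> (\<forall>w\<in>words (Suc l). wderiv w f (g w)) \<longrightarrow> wderiv [et] f g1 \<longrightarrow>
    wnorm \<gamma> f \<le> B \<longrightarrow> wnorm \<gamma> g1 \<le> B \<longrightarrow>
    (\<forall>w\<in>words (Suc l). wnorm \<gamma> (g w) \<le> B) \<longrightarrow>
    B_norm (Suc l) (weight_seq (Suc l) \<gamma>) (trc f g1) \<le> ennreal C * B"
proof -
  let ?L = "Suc l"
  let ?n = "CARD('n)"
  let ?W = "words ?L :: ((real^'n) \<times> real) list set"
  obtain A where A: "A \<ge> 1" "\<And>k m u. u \<in> borel_measurable borel \<Longrightarrow> L1n (cell k m 0) (wrep \<gamma>) * near_sum ?L k m u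
    \<le> ennreal (A / 2 ^ (k * (?n + 1))) * near_sum ?L k m (\<lambda>z. wrep \<gamma> z * u z)"
    using near_sum_weight[OF \<gamma>, of ?L] by blast
  obtain A' where A': "A' \<ge> 1" "\<And>f g. f \<in> borel_measurable borel \<Longrightarrow> g \<in> borel_measurable borel \<Longrightarrow>
    (\<integral>\<^sup>+m. ennreal (weight_seq ?L \<gamma> 0 m) * L1n (dyadic_cube 0 m) (trc f g) \<partial>count_space UNIV)
      \<le> ennreal A' * (wnorm \<gamma> f + wnorm \<gamma> g)"
    using first_scale_bound[OF \<gamma>, of ?L] by blast
  have [measurable]: "borel_fun (wrep \<gamma>)" by (rule wrep(5)[OF \<gamma>])
  note [measurable] = snd_borel[where 'a="real^'n" and 'b=real]
  define C0 where "C0 = (2::real) ^ ?L + 2 ^ ?L * real ?L ^ ?L"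
  define C1 where "C1 = C0 * 2 ^ ?n * A"
  define K where "K = real (card ((nbrs ?L :: (int^'n) set) \<times> {0..<2 * int ?L}))"
  define C2 where "C2 = C1 * K * (2 * (2 * real ?L) ^ l) * real (card ?W)"
  have C0: "C0 \<ge> 0" by (simp add: C0_def)
  have C1: "C1 \<ge> 0" using C0 A(1) by (simp add: C1_def)
  have K: "K \<ge> 0" by (simp add: K_def)
  have C2: "C2 \<ge> 0" using C1 K by (simp add: C2_def)
  show ?thesis
  proof (intro exI[of _ "C2 + 2 * A'"] allI impI)
    fix f g1 :: "(real^'n) \<times> real \<Rightarrow> real" and g :: "((real^'n) \<times> real) list \<Rightarrow> (real^'n) \<times> real \<Rightarrow> real" and B :: ennreal
    assume f: "locint f" and g: "\<forall>w\<in>words ?L. wderiv w f (g w)" and g1: "wderiv [et] f g1"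
      and Bf: "wnorm \<gamma> f \<le> B" and Bg1: "wnorm \<gamma> g1 \<le> B"
      and Bg: "\<forall>w\<in>words ?L. wnorm \<gamma> (g w) \<le> B"
    have gm: "borel_fun (g w)" if "w \<in> words ?L" for w
      using g that by (auto simp: wderiv_def locint_borel)
    have fm: "borel_fun f" "borel_fun g1"
      using f g1 by (auto simp: wderiv_def locint_borel)
    define \<phi> where "\<phi> = trc f g1"
    let ?E = "\<lambda>k. \<integral>\<^sup>+m. ennreal (weight_seq ?L \<gamma> k m) * oscillation ?L (dyadic_cube k m) \<phi> \<partial>count_space UNIV"
    define V where "V w z = (wrep \<gamma> z * g w z) * snd z ^ l" for w z
    have Vm: "borel_fun (V w)" if "w \<in> words ?L" for w
      using gm[OF that] unfolding V_def[abs_def] by measurable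
    have osc: "ennreal (weight_seq ?L \<gamma> k m) * oscillation ?L (dyadic_cube k m) \<phi>
        \<le> (\<Sum>w\<in>?W. ennreal (C1 * (2 ^ k) ^ l) * near_sum ?L k m (V w))" for k m
    proof -
      let ?c = "ennreal (2 ^ (k * ?L) * (C0 * 2 ^ ?n * 2 ^ (k * ?n)))"
      let ?v = "\<lambda>w z. snd z ^ l * g w z"
      have "ennreal (weight_seq ?L \<gamma> k m) * oscillation ?L (dyadic_cube k m) \<phi>
        \<le> ennreal (2 ^ (k * ?L)) * L1n (cell k m 0) (wrep \<gamma>) *
          (ennreal (C0 * 2 ^ ?n * 2 ^ (k * ?n)) * (\<Sum>w\<in>?W. near_sum ?L k m (?v w)))"
        unfolding ennreal_weight_seq[OF \<gamma>] \<phi>_def C0_def by (intro mult_left_mono oscillation_trc_le g g1) simp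
      also have "\<dots> = ennreal (2 ^ (k * ?L)) * ennreal (C0 * 2 ^ ?n * 2 ^ (k * ?n)) *
          (L1n (cell k m 0) (wrep \<gamma>) * (\<Sum>w\<in>?W. near_sum ?L k m (?v w)))"
        by (simp only: mult_ac)
      also have "ennreal (2 ^ (k * ?L)) * ennreal (C0 * 2 ^ ?n * 2 ^ (k * ?n)) = ?c"
        by (rule ennreal_mult[symmetric]) (use C0 in simp_all)
      also have "?c * (L1n (cell k m 0) (wrep \<gamma>) * (\<Sum>w\<in>?W. near_sum ?L k m (?v w)))
          = (\<Sum>w\<in>?W. ?c * (L1n (cell k m 0) (wrep \<gamma>) * near_sum ?L k m (?v w)))"
        by (simp only: sum_distrib_left)
      also have "\<dots> \<le> (\<Sum>w\<in>?W. ennreal (C1 * (2 ^ k) ^ l) * near_sum ?L k m (V w))"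
      proof (intro sum_mono)
        fix w assume w: "w \<in> ?W"
        note [measurable] = gm[OF w]
        have "?c * (L1n (cell k m 0) (wrep \<gamma>) * near_sum ?L k m (?v w))
          \<le> ?c * (ennreal (A / 2 ^ (k * (?n + 1))) * near_sum ?L k m (\<lambda>z. wrep \<gamma> z * ?v w z))"
          by (intro mult_left_mono A(2)) auto
        also have "(\<lambda>z. wrep \<gamma> z * ?v w z) = V w" by (simp add: V_def fun_eq_iff mult_ac)
        also have "?c * (ennreal (A / 2 ^ (k * (?n + 1))) * near_sum ?L k m (V w))
          = ?c * ennreal (A / 2 ^ (k * (?n + 1))) * near_sum ?L k m (V w)"
          by (simp only: mult.assoc)
        also have "?c * ennreal (A / 2 ^ (k * (?n + 1))) = ennreal (2 ^ (k * ?L) * (C0 * 2 ^ ?n * 2 ^ (k * ?n)) * (A / 2 ^ (k * (?n + 1))))"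
          by (rule ennreal_mult[symmetric]) (use C0 A(1) in simp_all)
        also have "2 ^ (k * ?L) * (C0 * 2 ^ ?n * 2 ^ (k * ?n)) * (A / 2 ^ (k * (?n + 1))) = C1 * (2 ^ k) ^ l"
        proof -
          have "(2::real) ^ (k * ?L) = 2 ^ k * (2 ^ k) ^ l" by (simp add: power_mult power_add)
          moreover have "(2::real) ^ (k * (?n + 1)) = 2 ^ k * 2 ^ (k * ?n)" by (simp add: power_add)
          ultimately show ?thesis unfolding C1_def by simp
        qed
        finally show "?c * (L1n (cell k m 0) (wrep \<gamma>) * near_sum ?L k m (?v w))
          \<le> ennreal (C1 * (2 ^ k) ^ l) * near_sum ?L k m (V w)" .
      qed
      finally show ?thesis .
    qed
    let ?N = "\<lambda>k w. L1n (UNIV \<times> {0<..<2 * real ?L / 2 ^ k}) (V w)"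
    have scale: "(?E k)
        \<le> (\<Sum>w\<in>?W. ennreal (C1 * K) * (ennreal ((2 ^ k) ^ l) * ?N k w))" for k
    proof -
      have "(?E k)
        \<le> (\<integral>\<^sup>+m. (\<Sum>w\<in>?W. ennreal (C1 * (2 ^ k) ^ l) * near_sum ?L k m (V w)) \<partial>count_space UNIV)"
        by (intro nn_integral_mono osc)
      also have "\<dots> = (\<Sum>w\<in>?W. ennreal (C1 * (2 ^ k) ^ l) * (\<integral>\<^sup>+m. near_sum ?L k m (V w) \<partial>count_space UNIV))"
        by (simp add: nn_integral_sum nn_integral_cmult)
      also have "\<dots> \<le> (\<Sum>w\<in>?W. ennreal (C1 * (2 ^ k) ^ l) * (ennreal K * ?N k w))"
        unfolding K_def by (intro sum_mono mult_left_mono nn_integral_near_sum_le Vm) auto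
      also have "\<dots> = (\<Sum>w\<in>?W. ennreal (C1 * K) * (ennreal ((2 ^ k) ^ l) * ?N k w))"
      proof (intro sum.cong refl)
        fix w
        have c: "ennreal (C1 * (2 ^ k) ^ l) = ennreal C1 * ennreal ((2 ^ k) ^ l)" "ennreal (C1 * K) = ennreal C1 * ennreal K"
          using C1 K by (auto intro: ennreal_mult)
        show "ennreal (C1 * (2 ^ k) ^ l) * (ennreal K * ?N k w) = ennreal (C1 * K) * (ennreal ((2 ^ k) ^ l) * ?N k w)"
          unfolding c by (simp only: mult_ac)
      qed
      finally show ?thesis .
    qed
    have kk: "(\<integral>\<^sup>+k. ennreal ((2 ^ k) ^ l) * ?N k w \<partial>count_space {1..}) \<le> ennreal (2 * (2 * real ?L) ^ l) * B"
      if w: "w \<in> words ?L" for w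
    proof -
      have "(\<integral>\<^sup>+k. ennreal ((2 ^ k) ^ l) * ?N k w \<partial>count_space {1..})
        \<le> ennreal (2 * (2 * real ?L) ^ l) * wnorm (wrep \<gamma>) (g w)"
        unfolding V_def by (rule nn_integral_scales_le) (use gm[OF w] l in auto)
      also have "\<dots> \<le> ennreal (2 * (2 * real ?L) ^ l) * B"
        unfolding nn_integral_weight_eq[OF \<gamma>] using Bg w by (intro mult_left_mono) auto
      finally show ?thesis .
    qed
    have first: "(\<integral>\<^sup>+k. (?E k) \<partial>count_space {1..})
        \<le> ennreal C2 * B"
    proof -
      have "(\<integral>\<^sup>+k. (?E k) \<partial>count_space {1..})
        \<le> (\<integral>\<^sup>+k. (\<Sum>w\<in>?W. ennreal (C1 * K) * (ennreal ((2 ^ k) ^ l) * ?N k w)) \<partial>count_space {1..})"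
        by (intro nn_integral_mono scale)
      also have "\<dots> = (\<Sum>w\<in>?W. ennreal (C1 * K) * (\<integral>\<^sup>+k. ennreal ((2 ^ k) ^ l) * ?N k w \<partial>count_space {1..}))"
        by (simp add: nn_integral_sum nn_integral_cmult)
      also have "\<dots> \<le> (\<Sum>w\<in>?W. ennreal (C1 * K) * (ennreal (2 * (2 * real ?L) ^ l) * B))"
        by (intro sum_mono mult_left_mono kk) auto
      also have "\<dots> = (ennreal (C1 * K) * ennreal (2 * (2 * real ?L) ^ l) * ennreal (real (card ?W))) * B"
        by (simp only: sum_constant ennreal_of_nat_eq_real_of_nat mult_ac)
      also have "ennreal (C1 * K) * ennreal (2 * (2 * real ?L) ^ l) * ennreal (real (card ?W)) = ennreal C2"
        unfolding C2_def using C1 K by (simp only: ennreal_mult[symmetric] mult_nonneg_nonneg of_nat_0_le_iff zero_le_power zero_le_numeral)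
      finally show ?thesis .
    qed
    have "(\<integral>\<^sup>+m. ennreal (weight_seq ?L \<gamma> 0 m) * L1n (dyadic_cube 0 m) \<phi> \<partial>count_space UNIV) \<le> ennreal A' * (B + B)"
      unfolding \<phi>_def by (rule order_trans[OF A'(2)[OF fm]]) (intro mult_left_mono add_mono Bf Bg1 zero_le)
    with first have "B_norm ?L (weight_seq ?L \<gamma>) \<phi> \<le> ennreal C2 * B + ennreal A' * (B + B)"
      unfolding B_norm_eq by (rule add_mono)
    also have "\<dots> = ennreal (C2 + 2 * A') * B"
    proof -
      have "ennreal (C2 + 2 * A') = ennreal C2 + (ennreal A' + ennreal A')"
        using C2 A'(1) by (simp add: ennreal_plus[symmetric] del: ennreal_plus)
      then show ?thesis by (simp only: distrib_right distrib_left)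
    qed
    finally show "B_norm ?L (weight_seq ?L \<gamma>) (trc f g1) \<le> ennreal (C2 + 2 * A') * B" unfolding \<phi>_def .
  qed
qed

section \<open>Smoothing operators that reproduce differences\<close>

text \<open>A mollifier whose support is so small that the kernel below, which involves its dilations by up to
  \<open>L\<close>, is supported in the ball of radius \<open>1/2\<close>.\<close>

definition om :: "nat \<Rightarrow> 'a::euclidean_space \<Rightarrow> real"
  where "om L x = (2 * real L) ^ DIM('a) * moll ((2 * real L) *\<^sub>R x)"

text \<open>Substituting \<open>y = - i h\<close> in the \<open>i\<close>-th term turns convolution with this kernel into an average of
  \<open>- \<Sum>\<^sub>i\<^sub>\<ge>\<^sub>1 (-1)\<^sup>i (L choose i) \<phi>(x + i h)\<close>, which is \<open>\<phi>(x) - \<Delta>\<^sup>L(h) \<phi>(x)\<close>.\<close>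

definition Om :: "nat \<Rightarrow> 'a::euclidean_space \<Rightarrow> real"
  where "Om L y = (\<Sum>i\<in>{1..L}. (- fd L i / real i ^ DIM('a)) * om L ((- 1 / real i) *\<^sub>R y))"

lemma sum_fd: "L \<ge> 1 \<Longrightarrow> (\<Sum>i\<in>{1..L}. fd L i) = -1"
proof -
  assume L: "L \<ge> 1"
  have "(\<Sum>i\<le>L. fd L i) = 0"
    unfolding fd_def using choose_alternating_sum[of L, where 'a=real] L by (simp add: mult.commute)
  moreover have "{..L} = insert 0 {1..L}" by auto
  ultimately show ?thesis by simp
qed

lemma om_facts:
  assumes L: "L \<ge> 1"
  shows "tfun (om L :: 'a::euclidean_space \<Rightarrow> real)" "(LINT x|lborel. om L (x::'a)) = 1"
    "om L (x::'a) \<ge> 0" "norm (x::'a) \<ge> 1 / (2 * real L) \<Longrightarrow> om L x = 0"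
proof -
  have z: "norm (x::'a) \<ge> 1 / (2 * real L) \<Longrightarrow> om L x = 0" for x
    unfolding om_def using L by (subst moll_facts(5)) (auto simp: field_simps)
  then show "norm (x::'a) \<ge> 1 / (2 * real L) \<Longrightarrow> om L x = 0" .
  have s: "smooth (moll :: 'a \<Rightarrow> real)" using moll_facts(1)[where 'a='a] by (simp add: tfun_def)
  have "smooth (om L :: 'a \<Rightarrow> real)"
    unfolding om_def[abs_def] using smooth_affine[OF s, of 0 "2 * real L"] by (intro smooth_cmult) simp
  then show "tfun (om L :: 'a \<Rightarrow> real)" unfolding tfun_def using z by (meson less_imp_le)
  have [measurable]: "borel_fun (moll :: 'a \<Rightarrow> real)" by (rule smooth_borel[OF s])
  show "(LINT x|lborel. om L (x::'a)) = 1"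
    unfolding om_def using integral_affine[of "moll :: 'a \<Rightarrow> real" "2 * real L" 0] L moll_facts(3)[where 'a='a]
    by simp
  show "om L (x::'a) \<ge> 0" unfolding om_def using moll_facts(4)[where 'a='a] by simp
qed

lemma Om_facts:
  assumes L: "L \<ge> 1"
  shows "tfun (Om L :: 'a::euclidean_space \<Rightarrow> real)" "norm (x::'a) > 1 / 2 \<Longrightarrow> Om L x = 0"
    "(LINT x|lborel. Om L (x::'a)) = 1"
proof -
  note o = om_facts[OF L, where 'a='a]
  have so: "smooth (om L :: 'a \<Rightarrow> real)" using o(1) by (simp add: tfun_def)
  have [measurable]: "borel_fun (om L :: 'a \<Rightarrow> real)" by (rule smooth_borel[OF so])
  have z: "norm (x::'a) > 1 / 2 \<Longrightarrow> Om L x = 0" for x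
  proof -
    assume x: "norm x > 1 / 2"
    have "om L ((- 1 / real i) *\<^sub>R x) = 0" if i: "i \<in> {1..L}" for i
    proof (rule o(4))
      have "1 / (2 * real L) \<le> 1 / (2 * real i)" using i by (intro divide_left_mono) auto
      also have "\<dots> = (1 / real i) * (1 / 2)" by simp
      also have "\<dots> \<le> (1 / real i) * norm x" using x by (intro mult_left_mono) auto
      also have "\<dots> = norm ((- 1 / real i) *\<^sub>R x)" by simp
      finally show "1 / (2 * real L) \<le> norm ((- 1 / real i) *\<^sub>R x)" .
    qed
    then show "Om L x = 0" by (simp add: Om_def)
  qed
  then show "norm (x::'a) > 1 / 2 \<Longrightarrow> Om L x = 0" .
  have s1: "smooth (\<lambda>y. om L ((- 1 / real i) *\<^sub>R (y::'a)))" for i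
    using smooth_affine[OF so, of 0 "- 1 / real i"] by simp
  have "smooth (Om L :: 'a \<Rightarrow> real)"
    unfolding Om_def[abs_def] by (intro smooth_sum smooth_cmult s1)
  then show "tfun (Om L :: 'a \<Rightarrow> real)" unfolding tfun_def using z by blast
  have ii: "integrable lborel (\<lambda>y. om L ((- 1 / real i) *\<^sub>R (y::'a)))" "(LINT y|lborel. om L ((- 1 / real i) *\<^sub>R (y::'a))) = real i ^ DIM('a)"
    if i: "i \<in> {1..L}" for i
  proof -
    have "integrable lborel (om L :: 'a \<Rightarrow> real)" by (rule kern_integrable[OF tfun_kern[OF o(1)]])
    then show "integrable lborel (\<lambda>y. om L ((- 1 / real i) *\<^sub>R (y::'a)))"
      using integrable_affine[of "om L :: 'a \<Rightarrow> real" "- 1 / real i" 0] i by simp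
    have "1 = \<bar>- 1 / real i\<bar> ^ DIM('a) * (LINT y|lborel. om L ((- 1 / real i) *\<^sub>R (y::'a)))"
      using integral_affine[of "om L :: 'a \<Rightarrow> real" "- 1 / real i" 0] i o(2) by simp
    then show "(LINT y|lborel. om L ((- 1 / real i) *\<^sub>R (y::'a))) = real i ^ DIM('a)"
      using i by (simp add: power_divide field_simps)
  qed
  have "(LINT x|lborel. Om L (x::'a)) = (\<Sum>i\<in>{1..L}. (- fd L i / real i ^ DIM('a)) * (LINT y|lborel. om L ((- 1 / real i) *\<^sub>R (y::'a))))"
    unfolding Om_def
    by (subst Bochner_Integration.integral_sum) (intro integrable_mult_right ii(1) impI, assumption, simp)
  also have "\<dots> = (\<Sum>i\<in>{1..L}. - fd L i)" by (intro sum.cong refl) (subst ii(2), auto)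
  also have "\<dots> = 1" using sum_fd[OF L] by (simp add: sum_negf)
  finally show "(LINT x|lborel. Om L (x::'a)) = 1" .
qed

text \<open>The reason for the choice of the kernel: the error of the smoothing operator is an average of
  differences of order \<open>L\<close>.\<close>

lemma conv_Om:
  fixes \<phi> :: "'a::euclidean_space \<Rightarrow> real"
  assumes L: "L \<ge> 1" and \<phi>: "locint \<phi>"
  shows "conv \<phi> (dil j (Om L)) x = \<phi> x - (LINT h|lborel. dil j (om L) h * fin_diff L h \<phi> x)"
proof -
  let ?n = "DIM('a)"
  note o = om_facts[OF L, where 'a='a]
  define q where "q = (dil j (om L) :: 'a \<Rightarrow> real)"
  have qk: "kern q" unfolding q_def by (intro kern_dil tfun_kern o(1))
  have [measurable]: "borel_fun q" by (rule kern_borel[OF qk])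
  have [measurable]: "borel_fun \<phi>" using \<phi> by (rule locint_borel)
  let ?I = "\<lambda>i. LINT h|lborel. \<phi> (x + real i *\<^sub>R h) * q h"
  have q1: "(LINT h|lborel. q h) = 1"
    unfolding q_def using integral_dil[of "om L :: 'a \<Rightarrow> real" j] o(1,2) kern_borel[OF tfun_kern[OF o(1)]] by simp
  have dO: "dil j (Om L) y = (\<Sum>i\<in>{1..L}. (- fd L i / real i ^ ?n) * q ((- 1 / real i) *\<^sub>R y))" for y :: 'a
    unfolding dil_def Om_def q_def sum_distrib_left by (intro sum.cong refl) (simp add: mult_ac)
  have kq: "kern (\<lambda>y. q ((- 1 / real i) *\<^sub>R y))" if i: "i \<in> {1..L}" for i
  proof -
    obtain R where R: "\<And>x. norm x > R \<Longrightarrow> q x = 0" using qk by (auto simp: kern_def)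
    have "continuous_on UNIV (\<lambda>y. q ((- 1 / real i) *\<^sub>R y))"
      by (rule continuous_on_compose2[where g=q and t=UNIV])
        (use qk in \<open>auto simp: kern_def intro!: continuous_intros\<close>)
    moreover have "q ((- 1 / real i) *\<^sub>R y) = 0" if "norm y > real i * R" for y
      using that i by (intro R) (simp add: field_simps)
    ultimately show ?thesis unfolding kern_def by blast
  qed
  have sub: "(LINT y|lborel. \<phi> (x - y) * q ((- 1 / real i) *\<^sub>R y)) = real i ^ ?n * ?I i"
    and int: "integrable lborel (\<lambda>h. \<phi> (x + real i *\<^sub>R h) * q h)" if i: "i \<in> {1..L}" for i
  proof -
    let ?f = "\<lambda>y. \<phi> (x - y) * q ((- 1 / real i) *\<^sub>R y)"
    have e: "?f (0 + (- real i) *\<^sub>R h) = \<phi> (x + real i *\<^sub>R h) * q h" for h using i by simp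
    have m: "borel_fun ?f" by measurable
    show "(LINT y|lborel. ?f y) = real i ^ ?n * ?I i"
      using integral_affine[OF m, of "- real i" 0] i unfolding e by simp
    show "integrable lborel (\<lambda>h. \<phi> (x + real i *\<^sub>R h) * q h)"
      using integrable_affine[OF m, of "- real i" 0] i kern_integrable_left[OF \<phi> kq[OF i], of x] unfolding e by simp
  qed
  have "conv \<phi> (dil j (Om L)) x = (LINT y|lborel. (\<Sum>i\<in>{1..L}. (- fd L i / real i ^ ?n) * (\<phi> (x - y) * q ((- 1 / real i) *\<^sub>R y))))"
    unfolding conv_def dO sum_distrib_left by (intro Bochner_Integration.integral_cong sum.cong refl) (simp add: mult_ac)
  also have "\<dots> = (\<Sum>i\<in>{1..L}. (- fd L i / real i ^ ?n) * (LINT y|lborel. \<phi> (x - y) * q ((- 1 / real i) *\<^sub>R y)))"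
    by (subst Bochner_Integration.integral_sum)
      (intro integrable_mult_right kern_integrable_left[OF \<phi> kq] impI, assumption, simp)
  also have "\<dots> = (\<Sum>i\<in>{1..L}. - (fd L i * ?I i))"
    by (intro sum.cong refl) (subst sub, auto)
  also have "\<dots> = - (\<Sum>i\<in>{1..L}. fd L i * ?I i)" by (rule sum_negf)
  finally have c: "conv \<phi> (dil j (Om L)) x = - (\<Sum>i\<in>{1..L}. fd L i * ?I i)" .
  have s: "{..L} = insert 0 {1..L}" by auto
  have "(LINT h|lborel. q h * fin_diff L h \<phi> x) = (LINT h|lborel. \<phi> x * q h + (\<Sum>i\<in>{1..L}. fd L i * (\<phi> (x + real i *\<^sub>R h) * q h)))"
    unfolding fin_diff_fd s by (intro Bochner_Integration.integral_cong refl) (simp add: algebra_simps sum_distrib_left)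
  also have "\<dots> = \<phi> x + (\<Sum>i\<in>{1..L}. fd L i * ?I i)"
    using q1 kern_integrable[OF qk] int
    by (subst Bochner_Integration.integral_add) (auto intro!: Bochner_Integration.integrable_sum simp: Bochner_Integration.integral_sum)
  finally show ?thesis unfolding c q_def by simp
qed

lemma sbox_ball:
  assumes "norm (h::'a::euclidean_space) < r" shows "h \<in> sbox r"
  using assms Basis_le_norm[of _ h] unfolding sbox_def by (auto intro: order_le_less_trans)

lemma conv_Om_error:
  fixes \<phi> :: "'a::euclidean_space \<Rightarrow> real"
  assumes L: "L \<ge> 1" and \<phi>: "locint \<phi>" and M: "\<And>h::'a. om L h \<le> M" and r: "1 / 2 ^ Suc j \<le> r"
  shows "ennreal \<bar>\<phi> x - conv \<phi> (dil j (Om L)) x\<bar>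
    \<le> ennreal (2 ^ (j * DIM('a)) * M) * (\<integral>\<^sup>+h\<in>sbox r. ennreal \<bar>fin_diff L h \<phi> x\<bar> \<partial>lborel)"
proof -
  note o = om_facts[OF L, where 'a='a]
  have [measurable]: "borel_fun \<phi>" using \<phi> by (rule locint_borel)
  have "borel_fun (\<lambda>h. fin_diff L h \<phi> x)" unfolding fin_diff_def by measurable
  note [measurable] = this
  have "ennreal \<bar>\<phi> x - conv \<phi> (dil j (Om L)) x\<bar> \<le> (\<integral>\<^sup>+h. ennreal \<bar>dil j (om L) h * fin_diff L h \<phi> x\<bar> \<partial>lborel)"
    unfolding conv_Om[OF L \<phi>] using norm_integral_le_nn[of lborel "\<lambda>h. dil j (om L) h * fin_diff L h \<phi> x"] by simp
  also have "\<dots> \<le> (\<integral>\<^sup>+h. ennreal (2 ^ (j * DIM('a)) * M) * (ennreal \<bar>fin_diff L h \<phi> x\<bar> * indicator (sbox r) h) \<partial>lborel)"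
  proof (rule nn_integral_mono)
    fix h :: 'a
    show "ennreal \<bar>dil j (om L) h * fin_diff L h \<phi> x\<bar>
      \<le> ennreal (2 ^ (j * DIM('a)) * M) * (ennreal \<bar>fin_diff L h \<phi> x\<bar> * indicator (sbox r) h)"
    proof (cases "norm h < 1 / 2 ^ Suc j")
      case True
      then have "h \<in> sbox r" using r by (intro sbox_ball) simp
      moreover have "\<bar>dil j (om L) h\<bar> \<le> 2 ^ (j * DIM('a)) * M"
        unfolding dil_def using o(3)[of "2 ^ j *\<^sub>R h"] M[of "2 ^ j *\<^sub>R h"] by (simp add: abs_mult mult_left_mono)
      then have "\<bar>dil j (om L) h\<bar> * \<bar>fin_diff L h \<phi> x\<bar> \<le> 2 ^ (j * DIM('a)) * M * \<bar>fin_diff L h \<phi> x\<bar>"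
        by (rule mult_right_mono) simp
      ultimately show ?thesis using order_trans[OF o(3) M]
        by (simp add: abs_mult ennreal_mult[symmetric] ennreal_leI)
    next
      case False
      have "1 / (2 * real L) \<le> norm (2 ^ j *\<^sub>R h)"
      proof -
        have "1 / (2 * real L) \<le> 1 / 2" using L by simp
        also have "1 / 2 \<le> 2 ^ j * norm h" using False by (simp add: field_simps)
        finally show ?thesis by simp
      qed
      then have "dil j (om L) h = 0" unfolding dil_def by (simp add: o(4))
      then show ?thesis by simp
    qed
  qed
  also have "\<dots> = ennreal (2 ^ (j * DIM('a)) * M) * (\<integral>\<^sup>+h\<in>sbox r. ennreal \<bar>fin_diff L h \<phi> x\<bar> \<partial>lborel)"
    by (rule nn_integral_cmult) measurable
  finally show ?thesis .
qed

text \<open>A convolution at scale \<open>2\<^sup>-\<^sup>j\<close> only sees the neighbouring dyadic cubes of that scale.\<close>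

lemma conv_dil_bound:
  fixes g :: "real^'n \<Rightarrow> real"
  assumes g: "locint g" and k: "kern k" and z: "\<And>y. norm y > 1 / 2 \<Longrightarrow> k y = 0" and M: "\<And>y. \<bar>k y\<bar> \<le> M"
    and x: "x \<in> dyadic_cube j m"
  shows "ennreal \<bar>conv g (dil j k) x\<bar> \<le> ennreal (2 ^ (j * CARD('n)) * M) * (\<Sum>p\<in>nbrs 1. L1n (dyadic_cube j (m + p)) g)"
proof -
  have gm [measurable]: "borel_fun g" using g by (rule locint_borel)
  have km [measurable]: "borel_fun (dil j k)" by (rule kern_borel[OF kern_dil[OF k]])
  let ?c = "2 ^ (j * CARD('n)) * M"
  have M0: "M \<ge> 0" using M[of 0] by simp
  have c: "?c \<ge> 0" using M0 by simp
  let ?S = "{y. norm (x - y) \<le> 1 / 2 / 2 ^ j}"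
  have "?S = cball x (1 / 2 / 2 ^ j)" by (auto simp: cball_def dist_norm)
  then have [measurable]: "?S \<in> sets borel" by simp
  have "ennreal \<bar>conv g (dil j k) x\<bar> \<le> (\<integral>\<^sup>+y. ennreal \<bar>g y * dil j k (x - y)\<bar> \<partial>lborel)"
    unfolding conv_alt[OF gm km] by (rule norm_integral_le_nn)
  also have "\<dots> \<le> (\<integral>\<^sup>+y. ennreal ?c * (ennreal \<bar>g y\<bar> * indicator ?S y) \<partial>lborel)"
  proof (rule nn_integral_mono)
    fix y
    show "ennreal \<bar>g y * dil j k (x - y)\<bar> \<le> ennreal ?c * (ennreal \<bar>g y\<bar> * indicator ?S y)"
    proof (cases "y \<in> ?S")
      case True
      have "\<bar>dil j k (x - y)\<bar> \<le> ?c" unfolding dil_def using M by (simp add: abs_mult mult_left_mono)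
      then have "\<bar>g y\<bar> * \<bar>dil j k (x - y)\<bar> \<le> \<bar>g y\<bar> * ?c" by (rule mult_left_mono) simp
      then show ?thesis using True c by (simp add: abs_mult ennreal_mult[symmetric] ennreal_leI mult.commute)
    next
      case False
      then have "dil j k (x - y) = 0" using dil_zero_outside[of "1/2" k j "x - y"] z by auto
      then show ?thesis by simp
    qed
  qed
  also have "\<dots> = ennreal ?c * (\<integral>\<^sup>+y\<in>?S. ennreal \<bar>g y\<bar> \<partial>lborel)"
    by (rule nn_integral_cmult) measurable
  also have "(\<integral>\<^sup>+y\<in>?S. ennreal \<bar>g y\<bar> \<partial>lborel) \<le> (\<Sum>p\<in>nbrs 1. \<integral>\<^sup>+y\<in>dyadic_cube j (m + p). ennreal \<bar>g y\<bar> \<partial>lborel)"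
  proof (rule nn_integral_cover)
    show "AE y in lborel. y \<in> ?S \<longrightarrow> (\<exists>p\<in>nbrs 1. y \<in> dyadic_cube j (m + p))"
      using AE_dyadic_cube[of j]
    proof eventually_elim
      case (elim y)
      show ?case
      proof
        assume y: "y \<in> ?S"
        have "\<bar>y $ i - x $ i\<bar> < real 1 / 2 ^ j" for i
        proof -
          have "\<bar>y $ i - x $ i\<bar> \<le> norm (x - y)"
            using component_le_norm_cart[of "x - y" i] by (simp add: abs_minus_commute)
          also have "\<dots> \<le> 1 / 2 / 2 ^ j" using y by simp
          also have "\<dots> < real 1 / 2 ^ j" by (simp add: field_simps)
          finally show ?thesis .
        qed
        from nbr_dyadic[OF x this] have "idx j y - m \<in> nbrs 1" by simp
        then show "\<exists>p\<in>nbrs 1. y \<in> dyadic_cube j (m + p)" using elim by (intro bexI[of _ "idx j y - m"]) auto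
      qed
    qed
  qed (auto simp: finite_nbrs)
  finally show ?thesis unfolding L1n_def by (simp add: mult_left_mono)
qed

section \<open>The pieces of the extension\<close>

text \<open>The outer convolution makes the piece smooth; the inner differences are small by the
  approximation property of the kernel. The indices are arranged so that the sum telescopes.\<close>

definition piece :: "nat \<Rightarrow> (real^'n \<Rightarrow> real) \<Rightarrow> nat \<Rightarrow> real^'n \<Rightarrow> real"
  where "piece L \<phi> j = (case j of
      0 \<Rightarrow> conv (conv \<phi> (dil 1 (Om L))) (dil 0 (Om L))
    | Suc i \<Rightarrow> conv (\<lambda>x. conv \<phi> (dil (i + 2) (Om L)) x - conv \<phi> (dil i (Om L)) x) (dil (Suc i) (Om L)))"

lemma kern_dil_Om: "L \<ge> 1 \<Longrightarrow> kern (dil j (Om L))"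
  by (intro kern_dil tfun_kern Om_facts)

lemma tfun_dil_Om: "L \<ge> 1 \<Longrightarrow> tfun (dil j (Om L))"
  by (intro tfun_dil Om_facts)

text \<open>Convolutions commute, so \<open>\<phi> * \<Omega>\<^sub>N * \<Omega>\<^sub>N\<^sub>+\<^sub>1\<close> occurs in consecutive pieces with opposite signs.\<close>

lemma sum_piece:
  assumes L: "L \<ge> 1" and \<phi>: "locint \<phi>"
  shows "(\<Sum>j<Suc N. piece L \<phi> j x) = conv (conv \<phi> (dil (Suc N) (Om L))) (dil N (Om L)) x"
proof (induction N)
  case 0 then show ?case by (simp add: piece_def)
next
  case (Suc N)
  note k = kern_dil_Om[OF L]
  have "piece L \<phi> (Suc N) x = conv (conv \<phi> (dil (N + 2) (Om L))) (dil (Suc N) (Om L)) x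
      - conv (conv \<phi> (dil N (Om L))) (dil (Suc N) (Om L)) x"
    unfolding piece_def by (simp add: conv_diff locint_conv \<phi> k)
  also have "conv (conv \<phi> (dil N (Om L))) (dil (Suc N) (Om L)) = conv (conv \<phi> (dil (Suc N) (Om L))) (dil N (Om L))"
    by (rule conv_commute[OF \<phi> k k])
  finally show ?case using Suc by simp
qed

lemma smooth_piece:
  assumes L: "L \<ge> 1" and \<phi>: "locint \<phi>"
  shows "smooth (piece L \<phi> j)"
  unfolding piece_def
  by (cases j) (auto intro!: smooth_conv locint_conv locint_diff \<phi> kern_dil_Om tfun_dil_Om L)

lemma piece_add:
  assumes L: "L \<ge> 1" and "locint \<phi>" "locint \<psi>"
  shows "piece L (\<lambda>x. \<phi> x + \<psi> x) j x = piece L \<phi> j x + piece L \<psi> j x"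
proof -
  note k = kern_dil_Om[OF L]
  have e: "conv (\<lambda>x. \<phi> x + \<psi> x) (dil i (Om L)) = (\<lambda>x. conv \<phi> (dil i (Om L)) x + conv \<psi> (dil i (Om L)) x)" for i
    by (rule ext) (rule conv_add[OF assms(2,3) k])
  have l: "locint (conv \<phi> (dil i (Om L)))" "locint (conv \<psi> (dil i (Om L)))" for i
    by (intro locint_conv assms k)+
  show ?thesis
  proof (cases j)
    case 0 then show ?thesis unfolding piece_def e by (simp add: conv_add l k)
  next
    case (Suc i)
    have "(\<lambda>x. (conv \<phi> (dil (i + 2) (Om L)) x + conv \<psi> (dil (i + 2) (Om L)) x) - (conv \<phi> (dil i (Om L)) x + conv \<psi> (dil i (Om L)) x))
      = (\<lambda>x. (conv \<phi> (dil (i + 2) (Om L)) x - conv \<phi> (dil i (Om L)) x) + (conv \<psi> (dil (i + 2) (Om L)) x - conv \<psi> (dil i (Om L)) x))"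
      by auto
    then show ?thesis unfolding piece_def e Suc by (simp add: conv_add locint_diff l k)
  qed
qed

lemma piece_cmult: "piece L (\<lambda>x. c * \<phi> x) j x = c * piece L \<phi> j x"
proof -
  have e: "conv (\<lambda>x. c * \<phi> x) (dil i (Om L)) = (\<lambda>x. c * conv \<phi> (dil i (Om L)) x)" for i
    by (rule ext) (rule conv_cmult)
  show ?thesis
    unfolding piece_def e by (cases j) (simp_all add: conv_cmult right_diff_distrib[symmetric])
qed

lemma piece_cong_AE:
  assumes L: "L \<ge> 1" and "locint \<phi>" "locint \<psi>" "AE x in lborel. \<phi> x = \<psi> x"
  shows "piece L \<phi> = piece L \<psi>"
proof -
  have "conv \<phi> (dil i (Om L)) = conv \<psi> (dil i (Om L))" for i
    by (rule conv_cong_AE) (auto intro: assms locint_borel kern_borel[OF kern_dil_Om])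
  then show ?thesis unfolding piece_def by presburger
qed

text \<open>At scale \<open>0\<close> both convolutions spread the \<open>L\<^sub>1\<close> norm to neighbouring cubes, hence the double sum.\<close>

definition psize :: "nat \<Rightarrow> (real^'n \<Rightarrow> real) \<Rightarrow> nat \<Rightarrow> int^'n \<Rightarrow> ennreal"
  where "psize L \<phi> j m = (if j = 0
    then (\<Sum>p\<in>nbrs 1. \<Sum>q\<in>nbrs 1. L1n (dyadic_cube 0 (m + p + q)) \<phi>)
    else (\<Sum>p\<in>nbrs 1. oscillation L (dyadic_cube j (m + p)) \<phi>))"

lemma conv_cmult_right: "conv g (\<lambda>y. c * k y) x = c * conv g k x"
proof -
  have "conv g (\<lambda>y. c * k y) x = (LINT y|lborel. c * (g (x - y) * k y))"
    unfolding conv_def by (simp only: mult.left_commute)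
  then show ?thesis unfolding conv_def by simp
qed

lemma ennreal_mult3:
  "a \<ge> 0 \<Longrightarrow> b \<ge> 0 \<Longrightarrow> c \<ge> 0 \<Longrightarrow> ennreal a * ennreal b * ennreal c = ennreal (a * b * c)"
  by (simp add: ennreal_mult)

text \<open>The derivatives fall on the outer kernel and cost a factor \<open>2\<^sup>j\<close> each. What remains is the mean of
  the inner difference over the neighbouring cubes, which for \<open>j \<ge> 1\<close> is bounded by oscillations. For
  \<open>j = 0\<close> there is no difference to exploit, and both convolutions spread the \<open>L\<^sub>1\<close> norm of \<open>\<phi>\<close> to
  neighbouring cubes.\<close>

lemma piece_bound:
  assumes L: "L \<ge> 1" and v: "set v \<subseteq> Basis"
  shows "\<exists>C\<ge>0. \<forall>\<phi> j m x. locint \<phi> \<longrightarrow> x \<in> dyadic_cube j m \<longrightarrow>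
    ennreal \<bar>pderivs v (piece L \<phi> j) (x :: real^'n)\<bar> \<le> ennreal (C * 2 ^ (j * length v)) * psize L \<phi> j m"
proof -
  let ?n = "CARD('n)"
  note O = Om_facts[OF L, where 'a="real^'n"]
  define K where "K = (pderivs v (Om L) :: real^'n \<Rightarrow> real)"
  have sO: "smooth (Om L :: real^'n \<Rightarrow> real)" using O(1) by (simp add: tfun_def)
  have tK: "tfun K" unfolding K_def by (rule tfun_pderivs[OF O(1) v])
  have kK: "kern K" by (rule tfun_kern[OF tK])
  have zK: "norm y > 1 / 2 \<Longrightarrow> K y = 0" for y unfolding K_def using pderivs_zero_outside[of "1/2" "Om L"] O(2) by blast
  obtain M1 where M1: "M1 > 0" "\<And>y. \<bar>K y\<bar> \<le> M1" using kernE[OF kK] by metis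
  obtain M2 where M2: "M2 > 0" "\<And>y::real^'n. \<bar>Om L y\<bar> \<le> M2" using kernE[OF tfun_kern[OF O(1)]] by metis
  obtain M3 where M3: "M3 > 0" "\<And>y::real^'n. \<bar>om L y\<bar> \<le> M3"
    using kernE[OF tfun_kern[OF om_facts(1)[OF L, where 'a="real^'n"]]] by metis
  have M3': "om L y \<le> M3" for y :: "real^'n" using M3(2)[of y] by linarith
  note k = kern_dil_Om[OF L, where 'a="real^'n"]
  have dK: "pderivs v (conv g (dil j (Om L))) x = 2 ^ (j * length v) * conv g (dil j K) x" if g: "locint g" for g :: "real^'n \<Rightarrow> real" and j x
  proof -
    have "pderivs v (conv g (dil j (Om L))) x = conv g (pderivs v (dil j (Om L))) x"
      by (simp add: pderivs_conv[OF g tfun_dil_Om[OF L] v])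
    also have "pderivs v (dil j (Om L)) = (\<lambda>y. 2 ^ (j * length v) * dil j K y)"
      unfolding K_def by (rule ext) (rule pderivs_dil[OF sO v])
    also have "conv g (\<lambda>y. 2 ^ (j * length v) * dil j K y) x = 2 ^ (j * length v) * conv g (dil j K) x"
      by (rule conv_cmult_right)
    finally show ?thesis .
  qed
  have dbound: "ennreal \<bar>pderivs v (conv g (dil j (Om L))) x\<bar>
      \<le> ennreal (2 ^ (j * length v)) * (ennreal (2 ^ (j * ?n) * M1) * (\<Sum>p\<in>nbrs 1. L1n (dyadic_cube j (m + p)) g))"
    if g: "locint g" and x: "x \<in> dyadic_cube j m" for g :: "real^'n \<Rightarrow> real" and j m x
    unfolding dK[OF g] abs_mult
    using conv_dil_bound[OF g kK zK M1(2) x] by (simp add: ennreal_mult mult_left_mono)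
  define D where "D = 2 * 2 ^ ?n * M3"
  have osc: "L1n (dyadic_cube (Suc i) m) (\<lambda>x. conv \<phi> (dil (i + 2) (Om L)) x - conv \<phi> (dil i (Om L)) x)
      \<le> ennreal (D / 2 ^ (Suc i * ?n)) * oscillation L (dyadic_cube (Suc i) m) \<phi>"
    if \<phi>: "locint \<phi>" for \<phi> :: "real^'n \<Rightarrow> real" and i m
  proof -
    let ?Q = "dyadic_cube (Suc i) m"
    let ?B = "sbox (1 / 2 ^ Suc i) :: (real^'n) set"
    have [measurable]: "borel_fun \<phi>" using \<phi> by (rule locint_borel)
    define I where "I x = (\<integral>\<^sup>+h\<in>?B. ennreal \<bar>fin_diff L h \<phi> x\<bar> \<partial>lborel)" for x
    define c where "c = 2 * (2 ^ ((i + 2) * ?n) * M3)"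
    have c0: "c \<ge> 0" unfolding c_def using M3(1) by simp
    have fm: "(\<lambda>(x, h). ennreal \<bar>fin_diff L h \<phi> x\<bar>) \<in> borel_measurable (lborel \<Otimes>\<^sub>M lborel)"
      unfolding fin_diff_def by measurable
    have bm: "(\<lambda>(x, h). indicator ?B h * indicator ?Q x :: ennreal) \<in> borel_measurable (lborel \<Otimes>\<^sub>M lborel)"
      by measurable
    have Im [measurable]: "borel_fun I"
    proof -
      have "(\<lambda>(x, h). ennreal \<bar>fin_diff L h \<phi> x\<bar> * indicator ?B h) \<in> borel_measurable (borel \<Otimes>\<^sub>M lborel)"
        unfolding fin_diff_def by measurable
      from lborel.borel_measurable_nn_integral[OF this] show ?thesis unfolding I_def[abs_def] by simp
    qed
    have pt: "ennreal \<bar>conv \<phi> (dil (i + 2) (Om L)) x - conv \<phi> (dil i (Om L)) x\<bar> \<le> ennreal c * I x" for x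
    proof -
      have "\<bar>conv \<phi> (dil (i + 2) (Om L)) x - conv \<phi> (dil i (Om L)) x\<bar>
        \<le> \<bar>\<phi> x - conv \<phi> (dil (i + 2) (Om L)) x\<bar> + \<bar>\<phi> x - conv \<phi> (dil i (Om L)) x\<bar>" by linarith
      then have "ennreal \<bar>conv \<phi> (dil (i + 2) (Om L)) x - conv \<phi> (dil i (Om L)) x\<bar>
        \<le> ennreal \<bar>\<phi> x - conv \<phi> (dil (i + 2) (Om L)) x\<bar> + ennreal \<bar>\<phi> x - conv \<phi> (dil i (Om L)) x\<bar>"
        by (simp add: ennreal_plus[symmetric] ennreal_leI del: ennreal_plus)
      also have "\<dots> \<le> ennreal (2 ^ ((i + 2) * ?n) * M3) * I x + ennreal (2 ^ (i * ?n) * M3) * I x"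
        unfolding I_def
      proof (intro add_mono)
        show "ennreal \<bar>\<phi> x - conv \<phi> (dil (i + 2) (Om L)) x\<bar> \<le> ennreal (2 ^ ((i + 2) * ?n) * M3) * (\<integral>\<^sup>+h\<in>?B. ennreal \<bar>fin_diff L h \<phi> x\<bar> \<partial>lborel)"
          using conv_Om_error[OF L \<phi> M3', of "i + 2" "1 / 2 ^ Suc i" x] by (simp add: field_simps)
        show "ennreal \<bar>\<phi> x - conv \<phi> (dil i (Om L)) x\<bar> \<le> ennreal (2 ^ (i * ?n) * M3) * (\<integral>\<^sup>+h\<in>?B. ennreal \<bar>fin_diff L h \<phi> x\<bar> \<partial>lborel)"
          using conv_Om_error[OF L \<phi> M3', of i "1 / 2 ^ Suc i" x] by simp
      qed
      also have "\<dots> \<le> ennreal (2 ^ ((i + 2) * ?n) * M3) * I x + ennreal (2 ^ ((i + 2) * ?n) * M3) * I x"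
        using M3(1) by (intro add_left_mono mult_right_mono ennreal_leI power_increasing) auto
      also have "\<dots> = ennreal c * I x"
        unfolding c_def using M3(1) by (simp add: distrib_right[symmetric] ennreal_plus[symmetric] mult.assoc del: ennreal_plus)
      finally show ?thesis .
    qed
    have "L1n ?Q (\<lambda>x. conv \<phi> (dil (i + 2) (Om L)) x - conv \<phi> (dil i (Om L)) x) \<le> (\<integral>\<^sup>+x. ennreal c * (I x * indicator ?Q x) \<partial>lborel)"
      unfolding L1n_def using pt by (intro nn_integral_mono) (auto simp: indicator_def)
    also have "\<dots> = ennreal c * (\<integral>\<^sup>+x\<in>?Q. I x \<partial>lborel)"
      by (rule nn_integral_cmult) measurable
    also have "(\<integral>\<^sup>+x\<in>?Q. I x \<partial>lborel) = (\<integral>\<^sup>+x. (\<integral>\<^sup>+h. ennreal \<bar>fin_diff L h \<phi> x\<bar> * (indicator ?B h * indicator ?Q x) \<partial>lborel) \<partial>lborel)"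
      unfolding I_def by (intro nn_integral_cong) (auto simp: indicator_def)
    also have "\<dots> = (\<integral>\<^sup>+h. (\<integral>\<^sup>+x. ennreal \<bar>fin_diff L h \<phi> x\<bar> * (indicator ?B h * indicator ?Q x) \<partial>lborel) \<partial>lborel)"
      using borel_measurable_times_ennreal[OF fm bm]
      by (intro lborel_pair.Fubini'[symmetric]) (simp add: split_beta')
    also have "\<dots> = (\<integral>\<^sup>+h\<in>?B. L1n ?Q (fin_diff L h \<phi>) \<partial>lborel)"
      unfolding L1n_def by (intro nn_integral_cong) (auto simp: indicator_def)
    also have "ennreal c * \<dots> = ennreal (D / 2 ^ (Suc i * ?n)) * oscillation L ?Q \<phi>"
    proof -
      have "ennreal (D / 2 ^ (Suc i * ?n)) * oscillation L ?Q \<phi>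
        = ennreal (D / 2 ^ (Suc i * ?n)) * ennreal (2 ^ (2 * Suc i * ?n)) * (\<integral>\<^sup>+h\<in>?B. L1n ?Q (fin_diff L h \<phi>) \<partial>lborel)"
        unfolding oscillation_eq by (simp only: mult.assoc)
      also have "ennreal (D / 2 ^ (Suc i * ?n)) * ennreal (2 ^ (2 * Suc i * ?n)) = ennreal (D / 2 ^ (Suc i * ?n) * 2 ^ (2 * Suc i * ?n))"
        using M3(1) by (intro ennreal_mult[symmetric]) (auto simp: D_def)
      also have "D / 2 ^ (Suc i * ?n) * 2 ^ (2 * Suc i * ?n) = c"
      proof -
        have "(2::real) ^ (2 * Suc i * ?n) = 2 ^ (Suc i * ?n) * 2 ^ (Suc i * ?n)"
          by (subst power_add[symmetric]) (simp add: algebra_simps)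
        moreover have "(2::real) ^ ((i + 2) * ?n) = 2 ^ ?n * 2 ^ (Suc i * ?n)"
          by (subst power_add[symmetric]) (simp add: algebra_simps)
        ultimately show ?thesis unfolding D_def c_def by simp
      qed
      finally show ?thesis by simp
    qed
    finally show ?thesis .
  qed
  define C where "C = M1 * D + M1 * (2 ^ ?n * M2)"
  have D0: "D \<ge> 0" unfolding D_def using M3(1) by simp
  have C0: "C \<ge> 0" unfolding C_def using M1(1) M2(1) D0 by simp
  have "ennreal \<bar>pderivs v (piece L \<phi> j) x\<bar> \<le> ennreal (C * 2 ^ (j * length v)) * psize L \<phi> j m"
    if \<phi>: "locint \<phi>" and x: "x \<in> dyadic_cube j m" for \<phi> :: "real^'n \<Rightarrow> real" and j m x
  proof (cases j)
    case 0
    let ?g = "conv \<phi> (dil 1 (Om L))"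
    have [measurable]: "borel_fun \<phi>" using \<phi> by (rule locint_borel)
    have one: "L1n (dyadic_cube 0 q) ?g \<le> ennreal (2 ^ ?n * M2) * (\<Sum>p\<in>nbrs 1. L1n (dyadic_cube 0 (q + p)) \<phi>)" for q
    proof -
      define k1 where "k1 = (dil 1 (Om L) :: real^'n \<Rightarrow> real)"
      have "dil 0 k1 = k1" by (auto simp: dil_def)
      moreover have "\<bar>k1 y\<bar> \<le> 2 ^ ?n * M2" for y unfolding k1_def dil_def using M2 by (simp add: abs_mult)
      moreover have "norm y > 1 / 2 \<Longrightarrow> k1 y = 0" for y
        unfolding k1_def using dil_zero_outside[of "1/2" "Om L" 1 y] O(2) by auto
      ultimately have b: "ennreal \<bar>?g y\<bar> \<le> ennreal (2 ^ ?n * M2) * (\<Sum>p\<in>nbrs 1. L1n (dyadic_cube 0 (q + p)) \<phi>)" if "y \<in> dyadic_cube 0 q" for y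
        using conv_dil_bound[OF \<phi>, of k1 "2 ^ ?n * M2" y 0 q] k[of 1] that by (simp add: k1_def)
      have "L1n (dyadic_cube 0 q) ?g \<le> (\<integral>\<^sup>+y. ennreal (2 ^ ?n * M2) * (\<Sum>p\<in>nbrs 1. L1n (dyadic_cube 0 (q + p)) \<phi>) * indicator (dyadic_cube 0 q) y \<partial>lborel)"
        unfolding L1n_def[of "dyadic_cube 0 q"] using b by (intro nn_integral_mono) (auto simp: indicator_def)
      also have "\<dots> = ennreal (2 ^ ?n * M2) * (\<Sum>p\<in>nbrs 1. L1n (dyadic_cube 0 (q + p)) \<phi>) * emeasure lborel (dyadic_cube 0 q)"
        by (rule nn_integral_cmult_indicator) simp
      also have "emeasure lborel (dyadic_cube 0 q) = 1"
        unfolding dyadic_cube_eq by (subst emeasure_cube) auto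
      finally show ?thesis by simp
    qed
    have "ennreal \<bar>pderivs v (piece L \<phi> j) x\<bar>
      \<le> ennreal (2 ^ (0 * length v)) * (ennreal (2 ^ (0 * ?n) * M1) * (\<Sum>p\<in>nbrs 1. L1n (dyadic_cube 0 (m + p)) ?g))"
      using dbound[of ?g x 0 m] x locint_conv[OF \<phi> k] unfolding 0 piece_def by simp
    also have "\<dots> \<le> ennreal M1 * (\<Sum>p\<in>nbrs 1. ennreal (2 ^ ?n * M2) * (\<Sum>q\<in>nbrs 1. L1n (dyadic_cube 0 (m + p + q)) \<phi>))"
      using one by (simp add: mult_left_mono sum_mono)
    also have "\<dots> = ennreal (M1 * (2 ^ ?n * M2)) * psize L \<phi> 0 m"
      using M1(1) M2(1) by (simp add: psize_def sum_distrib_left[symmetric] ennreal_mult mult.assoc)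
    also have "\<dots> \<le> ennreal (C * 2 ^ (j * length v)) * psize L \<phi> j m"
      unfolding 0 C_def using M1(1) D0 by (intro mult_right_mono ennreal_leI) auto
    finally show ?thesis .
  next
    case (Suc i)
    let ?g = "\<lambda>x. conv \<phi> (dil (i + 2) (Om L)) x - conv \<phi> (dil i (Om L)) x"
    have g: "locint ?g" by (intro locint_diff locint_conv \<phi> k)
    have "ennreal \<bar>pderivs v (piece L \<phi> j) x\<bar>
      \<le> ennreal (2 ^ (j * length v)) * (ennreal (2 ^ (j * ?n) * M1) * (\<Sum>p\<in>nbrs 1. L1n (dyadic_cube j (m + p)) ?g))"
      using dbound[OF g, of x j m] x unfolding Suc piece_def by simp
    also have "\<dots> \<le> ennreal (2 ^ (j * length v)) * (ennreal (2 ^ (j * ?n) * M1) * (\<Sum>p\<in>nbrs 1. ennreal (D / 2 ^ (j * ?n)) * oscillation L (dyadic_cube j (m + p)) \<phi>))"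
      unfolding Suc by (intro mult_left_mono sum_mono osc \<phi>) auto
    also have "\<dots> = (ennreal (2 ^ (j * length v)) * ennreal (2 ^ (j * ?n) * M1) * ennreal (D / 2 ^ (j * ?n))) * psize L \<phi> j m"
      unfolding psize_def using Suc by (simp add: sum_distrib_left[symmetric] mult.assoc)
    also have "ennreal (2 ^ (j * length v)) * ennreal (2 ^ (j * ?n) * M1) * ennreal (D / 2 ^ (j * ?n))
        = ennreal (2 ^ (j * length v) * (2 ^ (j * ?n) * M1) * (D / 2 ^ (j * ?n)))"
      using M1(1) D0 by (intro ennreal_mult3) auto
    also have "2 ^ (j * length v) * (2 ^ (j * ?n) * M1) * (D / 2 ^ (j * ?n)) = M1 * D * 2 ^ (j * length v)" by simp
    also have "ennreal (M1 * D * 2 ^ (j * length v)) * psize L \<phi> j m \<le> ennreal (C * 2 ^ (j * length v)) * psize L \<phi> j m"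
      unfolding C_def using M1(1) M2(1) by (intro mult_right_mono ennreal_leI) auto
    finally show ?thesis .
  qed
  then show ?thesis using C0 by blast
qed

section \<open>Series of smooth functions in the weighted space\<close>

lemma pderivs_sum_lessThan:
  assumes "\<And>j. smooth (u j)" "set w \<subseteq> Basis"
  shows "pderivs w (\<lambda>z. \<Sum>j<N. u j z) = (\<lambda>z. \<Sum>j<N::nat. pderivs w (u j) z)"
proof (induction N)
  case 0
  have "pderivs w (\<lambda>z. 0 * u 0 z) = (\<lambda>z. 0 * pderivs w (u 0) z)" by (rule pderivs_cmult[OF assms])
  then show ?case by simp
next
  case (Suc N)
  then show ?case using assms by (simp add: pderivs_add smooth_sum)
qed

lemma ennreal_tendsto_squeeze:
  fixes a b :: "nat \<Rightarrow> ennreal"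
  assumes "\<And>N. a N \<le> b N" "b \<longlonglongrightarrow> 0"
  shows "a \<longlonglongrightarrow> 0"
  by (rule tendsto_sandwich[OF _ _ tendsto_const assms(2)]) (use assms(1) in auto)

lemma ennreal_suminf_tail:
  fixes a :: "nat \<Rightarrow> ennreal"
  assumes "(\<Sum>j. a j) < \<infinity>"
  shows "(\<lambda>N. \<Sum>j. a (j + N)) \<longlonglongrightarrow> 0"
proof -
  have fin: "(\<Sum>j<N. a j) < \<infinity>" for N
    by (rule le_less_trans[OF sum_le_suminf[of a "{..<N}"] assms]) auto
  have "(\<Sum>j. a (j + N)) = (\<Sum>j. a j) - (\<Sum>j<N. a j)" for N
    using suminf_offset[of a N] fin[of N] by (simp add: ennreal_add_diff_cancel_right top_unique less_top)
  moreover have "(\<lambda>N. (\<Sum>j. a j) - (\<Sum>j<N. a j)) \<longlonglongrightarrow> (\<Sum>j. a j) - (\<Sum>j. a j)"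
    using assms by (intro tendsto_diff_ennreal tendsto_const summable_LIMSEQ) auto
  ultimately show ?thesis using assms by simp
qed

lemma abs_suminf_finite_le:
  fixes r :: "nat \<Rightarrow> real"
  assumes "finite {j. r j \<noteq> 0}"
  shows "ennreal \<bar>\<Sum>j. r j\<bar> \<le> (\<Sum>j. ennreal \<bar>r j\<bar>)"
proof -
  have "(\<Sum>j. r j) = (\<Sum>j\<in>{j. r j \<noteq> 0}. r j)" by (rule suminf_finite[OF assms]) simp
  then have "ennreal \<bar>\<Sum>j. r j\<bar> \<le> ennreal (\<Sum>j\<in>{j. r j \<noteq> 0}. \<bar>r j\<bar>)"
    by (simp add: ennreal_leI)
  also have "\<dots> = (\<Sum>j\<in>{j. r j \<noteq> 0}. ennreal \<bar>r j\<bar>)" by (simp add: sum_ennreal)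
  also have "\<dots> \<le> (\<Sum>j. ennreal \<bar>r j\<bar>)" using assms by (intro sum_le_suminf) auto
  finally show ?thesis .
qed

lemma nn_integral_series_le:
  fixes p :: "nat \<Rightarrow> 'a::euclidean_space \<Rightarrow> real"
  assumes [measurable]: "\<And>j. borel_fun (p j)" "borel_fun \<omega>"
    and fin: "AE z in lborel. finite {j. p j z \<noteq> 0}"
  shows "(\<integral>\<^sup>+z. ennreal \<bar>\<omega> z * (\<Sum>j. p j z)\<bar> \<partial>lborel) \<le> (\<Sum>j. wnorm \<omega> (p j))"
proof -
  have "(\<integral>\<^sup>+z. ennreal \<bar>\<omega> z * (\<Sum>j. p j z)\<bar> \<partial>lborel) \<le> (\<integral>\<^sup>+z. (\<Sum>j. ennreal \<bar>\<omega> z * p j z\<bar>) \<partial>lborel)"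
  proof (rule nn_integral_mono_AE, use fin in eventually_elim)
    case (elim z)
    have "ennreal \<bar>\<omega> z * (\<Sum>j. p j z)\<bar> = ennreal \<bar>\<omega> z\<bar> * ennreal \<bar>\<Sum>j. p j z\<bar>"
      by (simp add: abs_mult ennreal_mult)
    also have "\<dots> \<le> ennreal \<bar>\<omega> z\<bar> * (\<Sum>j. ennreal \<bar>p j z\<bar>)"
      by (intro mult_left_mono abs_suminf_finite_le elim) simp
    also have "\<dots> = (\<Sum>j. ennreal \<bar>\<omega> z * p j z\<bar>)"
      unfolding ennreal_suminf_cmult[symmetric] by (simp only: abs_mult ennreal_mult abs_ge_zero)
    finally show ?case .
  qed
  also have "\<dots> = (\<Sum>j. wnorm \<omega> (p j))"
    by (rule nn_integral_suminf) measurable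
  finally show ?thesis .
qed

text \<open>Because the weight is in \<open>A\<^sub>1\<close>, weighted convergence of the series and of its derivatives forces local
  convergence in \<open>L\<^sub>1\<close>, which is enough to differentiate termwise. Local finiteness off a null set
  identifies the limits with the pointwise sums.\<close>

lemma smooth_series:
  fixes \<gamma> :: "'a::euclidean_space \<Rightarrow> real" and u :: "nat \<Rightarrow> 'a \<Rightarrow> real"
  assumes \<gamma>: "\<gamma> \<in> A1_loc" and u: "\<And>j. smooth (u j)" and w: "set w \<subseteq> Basis"
    and fin: "\<And>w. set w \<subseteq> Basis \<Longrightarrow> AE z in lborel. finite {j. pderivs w (u j) z \<noteq> 0}"
    and b: "\<And>v. v \<in> {[], w} \<Longrightarrow> (\<Sum>j. wnorm (wrep \<gamma>) (pderivs v (u j))) < \<infinity>"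
  shows "(\<lambda>N. L1n (cball 0 R) (\<lambda>z. (\<Sum>j<N. pderivs w (u j) z) - (\<Sum>j. pderivs w (u j) z))) \<longlonglongrightarrow> 0"
    and "wderiv w (\<lambda>z. \<Sum>j. u j z) (\<lambda>z. \<Sum>j. pderivs w (u j) z)"
proof -
  have [measurable]: "borel_fun (wrep \<gamma>)" by (rule wrep(5)[OF \<gamma>])
  have conv: "(\<lambda>N. L1n (cball 0 R) (\<lambda>z. (\<Sum>j<N. pderivs v (u j) z) - (\<Sum>j. pderivs v (u j) z))) \<longlonglongrightarrow> 0"
    and loc: "locint (\<lambda>z. \<Sum>j. pderivs v (u j) z)" if v: "v \<in> {[], w}" for v R
  proof -
    have vB: "set v \<subseteq> Basis" using v w by auto
    have pm [measurable]: "borel_fun (pderivs v (u j))" for j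
      by (intro smooth_borel smooth_pderivs u vB)
    have fv: "AE z in lborel. finite {j. pderivs v (u j) z \<noteq> 0}" by (rule fin[OF vB])
    let ?a = "\<lambda>j. \<integral>\<^sup>+z. ennreal \<bar>wrep \<gamma> z * pderivs v (u j) z\<bar> \<partial>lborel"
    have tail: "L1n (cball 0 R) (\<lambda>z. \<Sum>j. pderivs v (u (j + N)) z) \<le> ennreal C * (\<Sum>j. ?a (j + N))"
      if C: "\<forall>h\<in>borel_measurable borel. L1n (cball 0 R) h \<le> ennreal C * wnorm (wrep \<gamma>) h" for N C R
    proof -
      have "borel_fun (\<lambda>z. \<Sum>j. pderivs v (u (j + N)) z)" by measurable
      then have "L1n (cball 0 R) (\<lambda>z. \<Sum>j. pderivs v (u (j + N)) z)
        \<le> ennreal C * (\<integral>\<^sup>+z. ennreal \<bar>wrep \<gamma> z * (\<Sum>j. pderivs v (u (j + N)) z)\<bar> \<partial>lborel)"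
        using C by blast
      also have "\<dots> \<le> ennreal C * (\<Sum>j. ?a (j + N))"
      proof (intro mult_left_mono nn_integral_series_le)
        show "AE z in lborel. finite {j. pderivs v (u (j + N)) z \<noteq> 0}"
          using fv
        proof eventually_elim
          case (elim z)
          have "{j. pderivs v (u (j + N)) z \<noteq> 0} = (\<lambda>j. j + N) -` {j. pderivs v (u j) z \<noteq> 0}" by auto
          then show ?case using finite_vimageI[OF elim, of "\<lambda>j. j + N"] by (simp only:) (simp add: inj_def)
        qed
      qed auto
      finally show ?thesis .
    qed
    show "locint (\<lambda>z. \<Sum>j. pderivs v (u j) z)"
      unfolding locint_def
    proof (intro conjI allI)
      show "borel_fun (\<lambda>z. \<Sum>j. pderivs v (u j) z)" by measurable
      fix R
      obtain C where C: "\<forall>h\<in>borel_measurable borel. L1n (cball 0 R) h \<le> ennreal C * wnorm (wrep \<gamma>) h"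
        using weighted_locint[OF \<gamma>, of R] by blast
      show "L1n (cball 0 R) (\<lambda>z. \<Sum>j. pderivs v (u j) z) < \<infinity>"
        using tail[OF C, of 0] b[OF v] by (auto simp: ennreal_mult_less_top intro: le_less_trans)
    qed
    obtain C where C: "\<forall>h\<in>borel_measurable borel. L1n (cball 0 R) h \<le> ennreal C * wnorm (wrep \<gamma>) h"
      using weighted_locint[OF \<gamma>, of R] by blast
    have le: "L1n (cball 0 R) (\<lambda>z. (\<Sum>j<N. pderivs v (u j) z) - (\<Sum>j. pderivs v (u j) z)) \<le> ennreal C * (\<Sum>j. ?a (j + N))" for N
    proof -
      have "L1n (cball 0 R) (\<lambda>z. (\<Sum>j<N. pderivs v (u j) z) - (\<Sum>j. pderivs v (u j) z))
        = L1n (cball 0 R) (\<lambda>z. (\<Sum>j. pderivs v (u j) z) - (\<Sum>j<N. pderivs v (u j) z))"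
        by (rule L1n_minus_commute)
      also have "\<dots> = L1n (cball 0 R) (\<lambda>z. \<Sum>j. pderivs v (u (j + N)) z)"
      proof (rule L1n_cong_AE, use fv in eventually_elim)
        case (elim z)
        have "summable (\<lambda>j. pderivs v (u j) z)" by (rule summable_finite[OF elim]) simp
        then show ?case using suminf_minus_initial_segment[of "\<lambda>j. pderivs v (u j) z" N] by simp
      qed
      also have "\<dots> \<le> ennreal C * (\<Sum>j. ?a (j + N))" by (rule tail[OF C])
      finally show ?thesis .
    qed
    have "(\<lambda>N. ennreal C * (\<Sum>j. ?a (j + N))) \<longlonglongrightarrow> ennreal C * 0"
      by (rule ennreal_tendsto_cmult[OF _ ennreal_suminf_tail[OF b[OF v]]]) simp
    then have lim: "(\<lambda>N. ennreal C * (\<Sum>j. ?a (j + N))) \<longlonglongrightarrow> 0" by (simp only: mult_zero_right)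
    show "(\<lambda>N. L1n (cball 0 R) (\<lambda>z. (\<Sum>j<N. pderivs v (u j) z) - (\<Sum>j. pderivs v (u j) z))) \<longlonglongrightarrow> 0"
      by (rule ennreal_tendsto_squeeze[OF le lim])
  qed
  show "(\<lambda>N. L1n (cball 0 R) (\<lambda>z. (\<Sum>j<N. pderivs w (u j) z) - (\<Sum>j. pderivs w (u j) z))) \<longlonglongrightarrow> 0"
    by (rule conv) simp
  show "wderiv w (\<lambda>z. \<Sum>j. u j z) (\<lambda>z. \<Sum>j. pderivs w (u j) z)"
  proof (rule wderiv_limit[where u="\<lambda>N z. \<Sum>j<N. u j z" and v="\<lambda>N z. \<Sum>j<N. pderivs w (u j) z"])
    show "wderiv w (\<lambda>z. \<Sum>j<N. u j z) (\<lambda>z. \<Sum>j<N. pderivs w (u j) z)" for N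
      using wderiv_smooth[OF smooth_sum[of "{..<N}" u] w] u unfolding pderivs_sum_lessThan[OF u w] by simp
  qed (use conv[of "[]"] loc[of "[]"] conv[of w] loc[of w] w in auto)
qed

section \<open>The extension operator\<close>

definition cutoff :: "real \<Rightarrow> real"
  where "cutoff t = exp 1 * bump t"

lemma cutoff_facts: "tfun cutoff" "cutoff 0 = 1" "norm t > 1 \<Longrightarrow> cutoff t = 0"
proof -
  show "cutoff 0 = 1" by (simp add: cutoff_def bump_0 exp_add[symmetric])
  show "norm t > 1 \<Longrightarrow> cutoff t = 0" by (simp add: cutoff_def bump_eq_0_iff)
  show "tfun cutoff"
    using bump_facts(1)[where 'a=real] unfolding tfun_def cutoff_def[abs_def] by (auto intro: smooth_cmult)
qed

definition layer :: "nat \<Rightarrow> (real^'n \<Rightarrow> real) \<Rightarrow> nat \<Rightarrow> (real^'n) \<times> real \<Rightarrow> real"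
  where "layer L \<phi> j z = piece L \<phi> j (fst z) * cutoff (2 ^ j * snd z)"

lemma smooth_cutoff_scaled: "smooth (\<lambda>t. cutoff (2 ^ j * t))"
  using smooth_affine[of cutoff 0 "2 ^ j"] cutoff_facts(1) by (simp add: tfun_def)

lemma smooth_layer:
  assumes "L \<ge> 1" "locint \<phi>"
  shows "smooth (layer L \<phi> j)"
  unfolding layer_def[abs_def] by (intro smooth_tensor smooth_piece assms smooth_cutoff_scaled)

lemma pderivs_layer:
  assumes "L \<ge> 1" "locint \<phi>" "set w \<subseteq> Basis"
  shows "pderivs w (layer L \<phi> j) z = pderivs (fst_part w) (piece L \<phi> j) (fst z) *
    ((2 ^ j) ^ length (snd_part w) * pderivs (snd_part w) cutoff (2 ^ j * snd z))"
proof -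
  have s: "smooth cutoff" using cutoff_facts(1) by (simp add: tfun_def)
  have "pderivs (snd_part w) (\<lambda>t. cutoff (0 + 2 ^ j *\<^sub>R t)) = (\<lambda>t. (2 ^ j) ^ length (snd_part w) * pderivs (snd_part w) cutoff (0 + 2 ^ j *\<^sub>R t))"
    by (rule pderivs_affine[OF s]) (rule fst_snd_part_Basis[OF assms(3)])
  then show ?thesis
    unfolding layer_def[abs_def] pderivs_tensor[OF smooth_piece[OF assms(1,2)] smooth_cutoff_scaled assms(3)] by simp
qed

lemma pderivs_layer_zero:
  assumes "L \<ge> 1" "locint \<phi>" "set w \<subseteq> Basis" "\<bar>2 ^ j * snd z\<bar> > 1"
  shows "pderivs w (layer L \<phi> j) z = 0"
proof -
  have "pderivs (snd_part w) cutoff (2 ^ j * snd z) = 0"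
    by (rule pderivs_zero_outside[of 1]) (use assms(4) cutoff_facts(3) in auto)
  then show ?thesis by (simp add: pderivs_layer[OF assms(1-3)])
qed

lemma finite_layers:
  assumes "L \<ge> 1" "locint \<phi>" "set w \<subseteq> Basis" "snd z \<noteq> 0"
  shows "finite {j. pderivs w (layer L \<phi> j) z \<noteq> 0}"
proof -
  obtain N where N: "1 / \<bar>snd z\<bar> < 2 ^ N"
    using real_arch_pow[of 2 "1 / \<bar>snd z\<bar>"] by auto
  have "pderivs w (layer L \<phi> j) z = 0" if "j \<ge> N" for j
  proof (rule pderivs_layer_zero[OF assms(1-3)])
    have "1 < 2 ^ N * \<bar>snd z\<bar>" using N assms(4) by (simp add: field_simps)
    also have "\<dots> \<le> 2 ^ j * \<bar>snd z\<bar>" using that by (intro mult_right_mono power_increasing) auto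
    finally show "\<bar>2 ^ j * snd z\<bar> > 1" by (simp add: abs_mult)
  qed
  then have "{j. pderivs w (layer L \<phi> j) z \<noteq> 0} \<subseteq> {..<N}" by (auto simp: not_le[symmetric])
  then show ?thesis by (rule finite_subset) simp
qed

text \<open>The quantity that the Besov norm attaches to the cube \<open>m\<close> of scale \<open>j\<close>; it puts the scale \<open>0\<close>, where
  the norm of \<open>\<phi>\<close> itself is used, on the same footing as the others.\<close>

definition lsize :: "nat \<Rightarrow> (real^'n \<Rightarrow> real) \<Rightarrow> nat \<Rightarrow> int^'n \<Rightarrow> ennreal"
  where "lsize L \<phi> j m = (if j = 0 then L1n (dyadic_cube 0 m) \<phi> else oscillation L (dyadic_cube j m) \<phi>)"

lemma psize_le: "psize L \<phi> j m \<le> (\<Sum>p\<in>nbrs 1. \<Sum>q\<in>nbrs 1. lsize L \<phi> j (m + p + q))"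
proof (cases "j = 0")
  case False
  have "oscillation L (dyadic_cube j (m + p)) \<phi> \<le> (\<Sum>q\<in>nbrs 1. lsize L \<phi> j (m + p + q))" for p
  proof -
    have "(0::int^'n) \<in> nbrs 1" by (simp add: nbrs_def)
    then have "lsize L \<phi> j (m + p + 0) \<le> (\<Sum>q\<in>nbrs 1. lsize L \<phi> j (m + p + q))"
      by (intro member_le_sum[of 0 "nbrs 1" "\<lambda>q. lsize L \<phi> j (m + p + q)"]) (auto simp: finite_nbrs)
    then show ?thesis using False by (simp add: lsize_def)
  qed
  then show ?thesis using False by (simp add: psize_def sum_mono)
qed (simp add: psize_def lsize_def)

lemma B_norm_suminf:
  "B_norm L \<omega> \<phi> = (\<Sum>j. \<integral>\<^sup>+m. ennreal (\<omega> j m) * lsize L \<phi> j m \<partial>count_space UNIV)"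
proof -
  let ?b = "\<lambda>j. \<integral>\<^sup>+m. ennreal (\<omega> j m) * lsize L \<phi> j m \<partial>count_space UNIV"
  have "(\<Sum>j. ?b j) = (\<integral>\<^sup>+j. ?b j \<partial>count_space UNIV)" by (rule nn_integral_count_space_nat[symmetric])
  also have "\<dots> = (\<integral>\<^sup>+j. ?b j * indicator {1..} j + ?b j * indicator {0} j \<partial>count_space UNIV)"
    by (intro nn_integral_cong) (auto simp: indicator_def)
  also have "\<dots> = (\<integral>\<^sup>+j. ?b j * indicator {1..} j \<partial>count_space UNIV) + (\<integral>\<^sup>+j. ?b j * indicator {0} j \<partial>count_space UNIV)"
    by (rule nn_integral_add) auto
  also have "(\<integral>\<^sup>+j. ?b j * indicator {1..} j \<partial>count_space UNIV) = (\<integral>\<^sup>+j. ?b j \<partial>count_space {1..})"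
    by (rule nn_integral_count_space_indicator[symmetric]) simp
  also have "\<dots> = (\<integral>\<^sup>+k. (\<integral>\<^sup>+m. ennreal (\<omega> k m) * oscillation L (dyadic_cube k m) \<phi> \<partial>count_space UNIV) \<partial>count_space {1..})"
    by (intro nn_integral_cong) (auto simp: lsize_def)
  also have "(\<integral>\<^sup>+j. ?b j * indicator {0} j \<partial>count_space UNIV) = ?b 0"
    unfolding nn_integral_count_space_nat by (subst suminf_finite[of "{0}"]) auto
  also have "\<dots> = (\<integral>\<^sup>+m. ennreal (\<omega> 0 m) * L1n (dyadic_cube 0 m) \<phi> \<partial>count_space UNIV)" by (simp add: lsize_def)
  finally show ?thesis unfolding B_norm_eq by simp
qed

text \<open>A layer lives on the cells on both sides of the hyperplane \<open>t = 0\<close>. Its derivatives are at most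
  \<open>2\<^sup>j\<^sup>L\<close> times the size of the piece, and \<open>2\<^sup>j\<^sup>L\<close> times the weight of a cell is the weight \<open>\<gamma>\<^sub>j\<^sub>,\<^sub>m\<close> up to
  comparability of neighbouring cells.\<close>

lemma layer_bound:
  fixes \<gamma> :: "(real^'n) \<times> real \<Rightarrow> real"
  assumes L: "L \<ge> 1" and \<gamma>: "\<gamma> \<in> A1_loc" and w: "set w \<subseteq> Basis" "length w \<le> L"
  shows "\<exists>C\<ge>0. \<forall>\<phi> j. locint \<phi> \<longrightarrow> wnorm (wrep \<gamma>) (pderivs w (layer L \<phi> j))
    \<le> ennreal C * (\<integral>\<^sup>+m. ennreal (weight_seq L \<gamma> j m) * lsize L \<phi> j m \<partial>count_space UNIV)"
proof -
  have [measurable]: "borel_fun (wrep \<gamma>)" by (rule wrep(5)[OF \<gamma>])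
  note wB = fst_snd_part_Basis[OF w(1)]
  obtain C1 where C1: "C1 \<ge> 0" "\<And>\<phi> j m x. locint \<phi> \<Longrightarrow> x \<in> dyadic_cube j m \<Longrightarrow>
    ennreal \<bar>pderivs (fst_part w) (piece L \<phi> j) (x :: real^'n)\<bar> \<le> ennreal (C1 * 2 ^ (j * length (fst_part w))) * psize L \<phi> j m"
    using piece_bound[OF L wB(1)] by blast
  obtain M where M: "M > 0" "\<And>t. \<bar>pderivs (snd_part w) cutoff t\<bar> \<le> M"
    using kernE[OF tfun_kern[OF tfun_pderivs[OF cutoff_facts(1) wB(2)]]] by metis
  obtain A where A: "A \<ge> 1" "\<And>k m (p::int^'n) i j. \<forall>a. \<bar>p $ a\<bar> \<le> int 2 \<Longrightarrow> \<bar>i\<bar> \<le> int 2 \<Longrightarrow> \<bar>j\<bar> \<le> int 2 \<Longrightarrow>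
    L1n (cell k m i) (wrep \<gamma>) \<le> ennreal A * L1n (cell k (m + p) j) (wrep \<gamma>)"
    using cell_compare[OF \<gamma>, of 2] by blast
  define K where "K = real (card (nbrs 1 :: (int^'n) set))"
  \<comment> \<open>The factor \<open>2\<close> counts the cells above and below \<open>t = 0\<close>; the factors \<open>K\<close> count neighbours.\<close>
  define C where "C = 2 * (C1 * M * (A * K * K))"
  have C0: "C \<ge> 0" unfolding C_def K_def using C1(1) M(1) A(1) by simp
  have "wnorm (wrep \<gamma>) (pderivs w (layer L \<phi> j))
    \<le> ennreal C * (\<integral>\<^sup>+m. ennreal (weight_seq L \<gamma> j m) * lsize L \<phi> j m \<partial>count_space UNIV)"
    if \<phi>: "locint \<phi>" for \<phi> :: "real^'n \<Rightarrow> real" and j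
  proof -
    let ?D = "pderivs w (layer L \<phi> j)"
    have [measurable]: "borel_fun ?D" by (intro smooth_borel smooth_pderivs smooth_layer L \<phi> w)
    let ?h = "\<lambda>z. ennreal \<bar>wrep \<gamma> z * ?D z\<bar>"
    let ?S = "\<lambda>i::int. (UNIV :: (real^'n) set) \<times> {real_of_int i / 2 ^ j <..< (real_of_int i + 1) / 2 ^ j}"
    let ?b = "\<integral>\<^sup>+m. ennreal (weight_seq L \<gamma> j m) * lsize L \<phi> j m \<partial>count_space UNIV"
    have pt: "ennreal \<bar>?D z\<bar> \<le> ennreal (C1 * M * 2 ^ (j * L)) * psize L \<phi> j m" if z: "fst z \<in> dyadic_cube j m" for z m
    proof -
      have "ennreal \<bar>?D z\<bar> = ennreal \<bar>pderivs (fst_part w) (piece L \<phi> j) (fst z)\<bar> *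
          ennreal ((2 ^ j) ^ length (snd_part w) * \<bar>pderivs (snd_part w) cutoff (2 ^ j * snd z)\<bar>)"
        unfolding pderivs_layer[OF L \<phi> w(1)] by (simp add: abs_mult ennreal_mult)
      also have "\<dots> \<le> (ennreal (C1 * 2 ^ (j * length (fst_part w))) * psize L \<phi> j m) * ennreal ((2 ^ j) ^ length (snd_part w) * M)"
        using C1(2)[OF \<phi> z] M by (intro mult_mono ennreal_leI mult_left_mono) auto
      also have "\<dots> = (ennreal (C1 * 2 ^ (j * length (fst_part w))) * ennreal ((2 ^ j) ^ length (snd_part w) * M)) * psize L \<phi> j m"
        by (simp only: mult_ac)
      also have "ennreal (C1 * 2 ^ (j * length (fst_part w))) * ennreal ((2 ^ j) ^ length (snd_part w) * M)
        = ennreal (C1 * 2 ^ (j * length (fst_part w)) * ((2 ^ j) ^ length (snd_part w) * M))"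
        using C1(1) M(1) by (intro ennreal_mult[symmetric]) auto
      also have "C1 * 2 ^ (j * length (fst_part w)) * ((2 ^ j) ^ length (snd_part w) * M) = C1 * M * 2 ^ (j * length w)"
        unfolding wB(3)[symmetric] by (simp add: power_mult[symmetric] power_add distrib_left)
      also have "ennreal (C1 * M * 2 ^ (j * length w)) * psize L \<phi> j m \<le> ennreal (C1 * M * 2 ^ (j * L)) * psize L \<phi> j m"
        using w(2) C1(1) M(1) by (intro mult_right_mono ennreal_leI mult_left_mono power_increasing) auto
      finally show ?thesis .
    qed
    have cellb: "(\<integral>\<^sup>+z\<in>cell j m i. ?h z \<partial>lborel) \<le> ennreal (C1 * M * A) *
        (\<Sum>p\<in>nbrs 1. \<Sum>q\<in>nbrs 1. ennreal (weight_seq L \<gamma> j (m + p + q)) * lsize L \<phi> j (m + p + q))" if i: "i \<in> {-1, 0}" for m i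
    proof -
      have "(\<integral>\<^sup>+z\<in>cell j m i. ?h z \<partial>lborel)
        \<le> (\<integral>\<^sup>+z. (ennreal (C1 * M * 2 ^ (j * L)) * psize L \<phi> j m) * (ennreal \<bar>wrep \<gamma> z\<bar> * indicator (cell j m i) z) \<partial>lborel)"
      proof (rule nn_integral_mono)
        fix z
        show "?h z * indicator (cell j m i) z
          \<le> (ennreal (C1 * M * 2 ^ (j * L)) * psize L \<phi> j m) * (ennreal \<bar>wrep \<gamma> z\<bar> * indicator (cell j m i) z)"
        proof (cases "z \<in> cell j m i")
          case True
          then have "fst z \<in> dyadic_cube j m" by (auto simp: cell_def)
          from mult_right_mono[OF pt[OF this], of "ennreal \<bar>wrep \<gamma> z\<bar>"] show ?thesis
            using True by (simp add: abs_mult ennreal_mult mult.commute)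
        qed simp
      qed
      also have "\<dots> = (ennreal (C1 * M * 2 ^ (j * L)) * psize L \<phi> j m) * L1n (cell j m i) (wrep \<gamma>)"
        unfolding L1n_def by (rule nn_integral_cmult) measurable
      also have "\<dots> \<le> (ennreal (C1 * M * 2 ^ (j * L)) * (\<Sum>p\<in>nbrs 1. \<Sum>q\<in>nbrs 1. lsize L \<phi> j (m + p + q))) * L1n (cell j m i) (wrep \<gamma>)"
        by (intro mult_mono psize_le) auto
      also have "\<dots> = ennreal (C1 * M) * (\<Sum>p\<in>nbrs 1. \<Sum>q\<in>nbrs 1. ennreal (2 ^ (j * L)) * L1n (cell j m i) (wrep \<gamma>) * lsize L \<phi> j (m + p + q))"
        using C1(1) M(1) by (simp add: ennreal_mult sum_distrib_left[symmetric] mult_ac)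
      also have "\<dots> \<le> ennreal (C1 * M) * (\<Sum>p\<in>nbrs 1. \<Sum>q\<in>nbrs 1. ennreal A * (ennreal (weight_seq L \<gamma> j (m + p + q)) * lsize L \<phi> j (m + p + q)))"
      proof (intro mult_left_mono sum_mono)
        fix p q :: "int^'n" assume pq: "p \<in> nbrs 1" "q \<in> nbrs 1"
        have "\<bar>(p + q) $ a\<bar> \<le> int 2" for a
        proof -
          have "\<bar>p $ a\<bar> \<le> 1" "\<bar>q $ a\<bar> \<le> 1" using pq by (auto simp: nbrs_def)
          then show ?thesis by simp
        qed
        then have "L1n (cell j m i) (wrep \<gamma>) \<le> ennreal A * L1n (cell j (m + (p + q)) 0) (wrep \<gamma>)"
          using i by (intro A(2)) auto
        then have "ennreal (2 ^ (j * L)) * L1n (cell j m i) (wrep \<gamma>) * lsize L \<phi> j (m + p + q)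
          \<le> ennreal (2 ^ (j * L)) * (ennreal A * L1n (cell j (m + (p + q)) 0) (wrep \<gamma>)) * lsize L \<phi> j (m + p + q)"
          by (intro mult_right_mono mult_left_mono) auto
        also have "\<dots> = ennreal A * (ennreal (weight_seq L \<gamma> j (m + p + q)) * lsize L \<phi> j (m + p + q))"
          unfolding ennreal_weight_seq[OF \<gamma>] by (simp only: mult_ac add.assoc)
        finally show "ennreal (2 ^ (j * L)) * L1n (cell j m i) (wrep \<gamma>) * lsize L \<phi> j (m + p + q)
          \<le> ennreal A * (ennreal (weight_seq L \<gamma> j (m + p + q)) * lsize L \<phi> j (m + p + q))" .
      qed auto
      also have "\<dots> = ennreal (C1 * M * A) *
        (\<Sum>p\<in>nbrs 1. \<Sum>q\<in>nbrs 1. ennreal (weight_seq L \<gamma> j (m + p + q)) * lsize L \<phi> j (m + p + q))"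
        using C1(1) M(1) A(1) by (simp only: ennreal_mult sum_distrib_left[symmetric] mult.assoc) (simp add: ennreal_mult mult.assoc)
      finally show ?thesis .
    qed
    have strip: "(\<integral>\<^sup>+z\<in>?S i. ?h z \<partial>lborel) \<le> ennreal (C1 * M * (A * K * K)) * ?b" if i: "i \<in> {-1, 0}" for i
    proof -
      let ?f = "\<lambda>m. ennreal (weight_seq L \<gamma> j m) * lsize L \<phi> j m"
      have "(\<integral>\<^sup>+z\<in>?S i. ?h z \<partial>lborel) = (\<integral>\<^sup>+m. (\<integral>\<^sup>+z\<in>cell j m i. ?h z \<partial>lborel) \<partial>count_space UNIV)"
        by (rule nn_integral_cells[symmetric]) measurable
      also have "\<dots> \<le> (\<integral>\<^sup>+m. ennreal (C1 * M * A) * (\<Sum>p\<in>nbrs 1. \<Sum>q\<in>nbrs 1. ?f (m + p + q)) \<partial>count_space UNIV)"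
        by (intro nn_integral_mono cellb i)
      also have "\<dots> = ennreal (C1 * M * A) * (\<integral>\<^sup>+m. (\<Sum>p\<in>nbrs 1. \<Sum>q\<in>nbrs 1. ?f (m + p + q)) \<partial>count_space UNIV)"
        by (rule nn_integral_cmult) simp
      also have "(\<integral>\<^sup>+m. (\<Sum>p\<in>nbrs 1. \<Sum>q\<in>nbrs 1. ?f (m + p + q)) \<partial>count_space UNIV)
        = (\<Sum>p\<in>nbrs 1. \<Sum>q\<in>nbrs 1. (\<integral>\<^sup>+m. ?f (m + p + q) \<partial>count_space UNIV))"
        by (simp add: nn_integral_sum)
      also have "\<dots> = (\<Sum>p\<in>(nbrs 1 :: (int^'n) set). \<Sum>q\<in>(nbrs 1 :: (int^'n) set). ?b)"
      proof (intro sum.cong refl)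
        fix p q :: "int^'n"
        have "(\<integral>\<^sup>+m. ?f (m + p + q) \<partial>count_space UNIV) = (\<integral>\<^sup>+m. ?f (m + (p + q)) \<partial>count_space UNIV)" by (simp only: add.assoc)
        also have "\<dots> = ?b" by (rule nn_integral_count_space_shift)
        finally show "(\<integral>\<^sup>+m. ?f (m + p + q) \<partial>count_space UNIV) = ?b" .
      qed
      also have "\<dots> = ennreal (K * K) * ?b"
        unfolding K_def by (simp add: ennreal_of_nat_eq_real_of_nat ennreal_mult mult.assoc)
      also have "ennreal (C1 * M * A) * (ennreal (K * K) * ?b) = ennreal (C1 * M * (A * K * K)) * ?b"
        using C1(1) M(1) A(1) unfolding K_def by (simp add: ennreal_mult[symmetric] mult.assoc[symmetric])
      finally show ?thesis .
    qed
    have "(\<integral>\<^sup>+z. ?h z \<partial>lborel) = (\<integral>\<^sup>+z\<in>{z. \<bar>2 ^ j * snd z\<bar> \<le> 1}. ?h z \<partial>lborel)"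
      by (intro nn_integral_cong) (auto simp: indicator_def pderivs_layer_zero[OF L \<phi> w(1)])
    also have "\<dots> \<le> (\<Sum>i\<in>{-1, 0}. \<integral>\<^sup>+z\<in>?S i. ?h z \<partial>lborel)"
    proof (rule nn_integral_cover)
      have "AE z in (lborel :: ((real^'n) \<times> real) measure). snd z \<noteq> 0 \<and> snd z \<noteq> 1 / 2 ^ j \<and> snd z \<noteq> - (1 / 2 ^ j)"
        by (intro AE_conjI AE_snd_neq)
      then show "AE z in lborel. z \<in> {z. \<bar>2 ^ j * snd z\<bar> \<le> 1} \<longrightarrow> (\<exists>i\<in>{-1, 0}. z \<in> ?S i)"
      proof eventually_elim
        case (elim z)
        show ?case
        proof
          assume "z \<in> {z. \<bar>2 ^ j * snd z\<bar> \<le> 1}"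
          then have "\<bar>snd z\<bar> \<le> 1 / 2 ^ j" by (simp add: abs_mult field_simps)
          then have "snd z \<le> 1 / 2 ^ j" "- (1 / 2 ^ j) \<le> snd z" by linarith+
          then have "(0 < snd z \<and> snd z < 1 / 2 ^ j) \<or> (- (1 / 2 ^ j) < snd z \<and> snd z < 0)" using elim by linarith
          then show "\<exists>i\<in>{-1, 0}. z \<in> ?S i" by (cases z) auto
        qed
      qed
    qed auto
    also have "\<dots> \<le> (\<Sum>i\<in>{-1, 0::int}. ennreal (C1 * M * (A * K * K)) * ?b)"
      by (intro sum_mono strip)
    also have "\<dots> = ennreal C * ?b"
    proof -
      have "ennreal C = ennreal 2 * ennreal (C1 * M * (A * K * K))"
        unfolding C_def K_def using C1(1) M(1) A(1) by (intro ennreal_mult) auto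
      then show ?thesis by (simp add: mult.assoc)
    qed
    finally show ?thesis .
  qed
  then show ?thesis using C0 by blast
qed

text \<open>Off the hyperplane \<open>t = 0\<close> the sum is finite; on it the value is irrelevant.\<close>

definition extension :: "nat \<Rightarrow> (real^'n \<Rightarrow> real) \<Rightarrow> (real^'n) \<times> real \<Rightarrow> real"
  where "extension L \<phi> z = (\<Sum>j. layer L \<phi> j z)"

text \<open>The outer convolution is bounded on local \<open>L\<^sub>1\<close> uniformly in the scale, so its effect on the error of
  the inner one is harmless.\<close>

lemma double_mollify_tendsto:
  fixes \<phi> :: "real^'n \<Rightarrow> real"
  assumes L: "L \<ge> 1" and \<phi>: "locint \<phi>"
  shows "(\<lambda>N. L1n (cball 0 R) (\<lambda>x. conv (conv \<phi> (dil (Suc N) (Om L))) (dil N (Om L)) x - \<phi> x)) \<longlonglongrightarrow> 0"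
proof -
  note O = Om_facts[OF L, where 'a="real^'n"]
  note k = kern_dil_Om[OF L, where 'a="real^'n"]
  have kO: "kern (Om L :: real^'n \<Rightarrow> real)" by (rule tfun_kern[OF O(1)])
  have Om: "borel_fun (Om L :: real^'n \<Rightarrow> real)" by (rule kern_borel[OF kO])
  have [measurable]: "borel_fun \<phi>" using \<phi> by (rule locint_borel)
  have cl: "locint (conv \<phi> (dil j (Om L)))" for j by (rule locint_conv[OF \<phi> k])
  have [measurable]: "borel_fun (conv \<phi> (dil j (Om L)))" for j by (rule locint_borel[OF cl])
  define I where "I = (LINT y|lborel. \<bar>Om L (y :: real^'n)\<bar>)"
  define a where "a j = L1n (cball 0 (R + 1)) (\<lambda>x. conv \<phi> (dil j (Om L)) x - \<phi> x)" for j
  define b where "b j = L1n (cball 0 R) (\<lambda>x. conv \<phi> (dil j (Om L)) x - \<phi> x)" for j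
  have ab: "a \<longlonglongrightarrow> 0" "b \<longlonglongrightarrow> 0"
    unfolding a_def[abs_def] b_def[abs_def] by (intro mollify_tendsto \<phi> kO O(3))+
  have le: "L1n (cball 0 R) (\<lambda>x. conv (conv \<phi> (dil (Suc N) (Om L))) (dil N (Om L)) x - \<phi> x) \<le> ennreal I * a (Suc N) + b N" for N
  proof -
    have z: "norm y > 1 \<Longrightarrow> dil N (Om L) y = 0" for y :: "real^'n"
    proof (rule dil_zero_outside[where r="1/2"])
      assume "norm y > 1"
      moreover have "1 / 2 / 2 ^ N \<le> (1::real)"
      proof -
        have "1 * 1 \<le> (2::real) * 2 ^ N" by (intro mult_mono one_le_power) auto
        then show ?thesis by (simp add: divide_le_eq)
      qed
      ultimately show "1 / 2 / 2 ^ N < norm y" by linarith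
    qed (rule O(2))
    have [measurable]: "borel_fun (conv (conv \<phi> (dil (Suc N) (Om L))) (dil N (Om L)))"
      by (intro locint_borel locint_conv cl k)
    have "L1n (cball 0 R) (\<lambda>x. conv (conv \<phi> (dil (Suc N) (Om L))) (dil N (Om L)) x - \<phi> x)
      \<le> L1n (cball 0 R) (\<lambda>x. conv (conv \<phi> (dil (Suc N) (Om L))) (dil N (Om L)) x - conv \<phi> (dil N (Om L)) x) + b N"
      unfolding b_def by (rule L1n_diff_triangle) auto
    also have "(\<lambda>x. conv (conv \<phi> (dil (Suc N) (Om L))) (dil N (Om L)) x - conv \<phi> (dil N (Om L)) x)
      = conv (\<lambda>x. conv \<phi> (dil (Suc N) (Om L)) x - \<phi> x) (dil N (Om L))"
      by (rule ext) (rule conv_diff[OF cl \<phi> k, symmetric])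
    also have "L1n (cball 0 R) \<dots> \<le> ennreal I * a (Suc N)"
      unfolding a_def I_def integral_abs_dil[OF Om, of N, symmetric]
      by (rule L1n_conv_le[OF locint_diff[OF cl \<phi>] k z])
    finally show ?thesis by simp
  qed
  have "(\<lambda>N. ennreal I * a (Suc N) + b N) \<longlonglongrightarrow> ennreal I * 0 + 0"
    using ab LIMSEQ_Suc[OF ab(1)] by (intro tendsto_add ennreal_tendsto_cmult) auto
  then have l: "(\<lambda>N. ennreal I * a (Suc N) + b N) \<longlonglongrightarrow> 0" by simp
  show ?thesis
    by (rule ennreal_tendsto_squeeze[OF le l])
qed

text \<open>The trace is identified through the smooth partial sums, whose traces are the sums of the pieces:
  these converge to \<open>\<phi>\<close>, and by continuity of the trace formula also to the trace of the extension.\<close>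

lemma extension_bounded:
  fixes \<gamma> :: "(real^'n) \<times> real \<Rightarrow> real"
  assumes L: "L \<ge> 1" and \<gamma>: "\<gamma> \<in> A1_loc"
  shows "\<exists>C\<ge>0. \<forall>\<phi>. locint \<phi> \<and> B_norm L (weight_seq L \<gamma>) \<phi> < \<infinity> \<longrightarrow>
    extension L \<phi> \<in> W_space L \<gamma> \<and> W_norm L \<gamma> (extension L \<phi>) \<le> ennreal C * B_norm L (weight_seq L \<gamma>) \<phi> \<and>
    (\<exists>\<psi>. is_trace (extension L \<phi>) \<psi> \<and> \<psi> =\<^sub>a \<phi>)"
proof -
  have [measurable]: "borel_fun (wrep \<gamma>)" by (rule wrep(5)[OF \<gamma>])
  let ?b = "\<lambda>\<phi> j. \<integral>\<^sup>+m. ennreal (weight_seq L \<gamma> j m) * lsize L \<phi> j m \<partial>count_space UNIV"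
  have "\<forall>w. \<exists>C\<ge>0. set w \<subseteq> Basis \<and> length w \<le> L \<longrightarrow> (\<forall>\<phi> j. locint \<phi> \<longrightarrow>
      wnorm (wrep \<gamma>) (pderivs w (layer L \<phi> j)) \<le> ennreal C * ?b \<phi> j)"
    using layer_bound[OF L \<gamma>] by blast
  from choice[OF this] obtain A where A0: "\<forall>w. A w \<ge> 0 \<and> (set w \<subseteq> Basis \<and> length w \<le> L \<longrightarrow> (\<forall>\<phi> j. locint \<phi> \<longrightarrow>
      wnorm (wrep \<gamma>) (pderivs w (layer L \<phi> j)) \<le> ennreal (A w) * ?b \<phi> j))" ..
  have A: "\<And>w. A w \<ge> 0"
    "\<And>w \<phi> j. set w \<subseteq> Basis \<Longrightarrow> length w \<le> L \<Longrightarrow> locint \<phi> \<Longrightarrow>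
      wnorm (wrep \<gamma>) (pderivs w (layer L \<phi> j)) \<le> ennreal (A w) * ?b \<phi> j"
    using A0 by simp_all
  let ?I = "multi_indices L :: ((real^'n) \<times> real \<Rightarrow> nat) set"
  define K where "K = (\<Sum>\<alpha>\<in>?I. A (word_of \<alpha>))"
  define C where "C = real (card ?I) * K"
  have K0: "K \<ge> 0" unfolding K_def using A(1) by (simp add: sum_nonneg)
  have "extension L \<phi> \<in> W_space L \<gamma> \<and> W_norm L \<gamma> (extension L \<phi>) \<le> ennreal C * B_norm L (weight_seq L \<gamma>) \<phi> \<and>
    (\<exists>\<psi>. is_trace (extension L \<phi>) \<psi> \<and> \<psi> =\<^sub>a \<phi>)"
    if \<phi>: "locint \<phi>" and B: "B_norm L (weight_seq L \<gamma>) \<phi> < \<infinity>" for \<phi> :: "real^'n \<Rightarrow> real"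
  proof -
    define B where "B = B_norm L (weight_seq L \<gamma>) \<phi>"
    have Bf: "B < \<infinity>" using B by (simp add: B_def)
    define u where "u = layer L \<phi>"
    define G where "G w z = (\<Sum>j. pderivs w (u j) z)" for w z
    have us: "smooth (u j)" for j unfolding u_def by (rule smooth_layer[OF L \<phi>])
    have fin: "AE z in lborel. finite {j. pderivs w (u j) z \<noteq> 0}" if "set w \<subseteq> Basis" for w
      using AE_snd_neq[of 0] unfolding u_def by eventually_elim (rule finite_layers[OF L \<phi> that])
    have sb: "(\<Sum>j. wnorm (wrep \<gamma>) (pderivs w (u j))) \<le> ennreal (A w) * B"
      if "set w \<subseteq> Basis" "length w \<le> L" for w
    proof -
      have "(\<Sum>j. wnorm (wrep \<gamma>) (pderivs w (u j))) \<le> (\<Sum>j. ennreal (A w) * ?b \<phi> j)"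
        unfolding u_def using A(2)[OF that \<phi>] by (intro suminf_le summableI) auto
      then show ?thesis unfolding B_def B_norm_suminf ennreal_suminf_cmult .
    qed
    have sbf: "(\<Sum>j. wnorm (wrep \<gamma>) (pderivs w (u j))) < \<infinity>"
      if "set w \<subseteq> Basis" "length w \<le> L" for w
      using sb[OF that] Bf by (auto simp: ennreal_mult_less_top intro: le_less_trans)
    have ext_eq: "extension L \<phi> = (\<lambda>z. \<Sum>j. u j z)" by (rule HOL.ext) (simp add: extension_def u_def)
    have wd: "wderiv w (extension L \<phi>) (G w)" if "set w \<subseteq> Basis" "length w \<le> L" for w
      unfolding ext_eq G_def[abs_def]
      by (rule smooth_series(2)[OF \<gamma> us that(1) fin]) (use sbf[of w] sbf[of "[]"] that in auto)
    have conv: "(\<lambda>N. L1n (cball 0 R) (\<lambda>z. (\<Sum>j<N. pderivs w (u j) z) - G w z)) \<longlonglongrightarrow> 0"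
      if "set w \<subseteq> Basis" "length w \<le> L" for w R
      unfolding G_def
      by (rule smooth_series(1)[OF \<gamma> us that(1) fin]) (use sbf[of w] sbf[of "[]"] that in auto)
    have nb: "wnorm \<gamma> (G w) \<le> ennreal (A w) * B"
      if w: "set w \<subseteq> Basis" "length w \<le> L" for w
    proof -
      have "wnorm \<gamma> (G w) = wnorm (wrep \<gamma>) (G w)"
        by (rule nn_integral_weight_eq[OF \<gamma>, symmetric])
      also have "\<dots> \<le> (\<Sum>j. wnorm (wrep \<gamma>) (pderivs w (u j)))"
        unfolding G_def
        by (rule nn_integral_series_le) (use us w fin in \<open>auto intro: smooth_borel smooth_pderivs\<close>)
      also have "\<dots> \<le> ennreal (A w) * B" by (rule sb[OF w])
      finally show ?thesis .
    qed
    have wo: "set (word_of \<alpha>) \<subseteq> Basis" "length (word_of \<alpha>) \<le> L" if "\<alpha> \<in> ?I" for \<alpha>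
      using that by (auto simp: set_word_of[THEN subsetD] length_word_of multi_indices_def)
    have nb': "wnorm \<gamma> (G (word_of \<alpha>)) \<le> ennreal K * B" if "\<alpha> \<in> ?I" for \<alpha>
    proof -
      have "A (word_of \<alpha>) \<le> K"
        unfolding K_def using that A(1) by (intro member_le_sum[of \<alpha> ?I "\<lambda>\<alpha>. A (word_of \<alpha>)"] finite_multi_indices) auto
      then have "ennreal (A (word_of \<alpha>)) * B \<le> ennreal K * B" by (intro mult_right_mono ennreal_leI) auto
      then show ?thesis using nb[OF wo[OF that]] by (rule order_trans[rotated])
    qed
    have KB: "ennreal K * B < \<infinity>" using Bf by (simp add: ennreal_mult_less_top)
    have wda: "wderiv (word_of \<alpha>) (extension L \<phi>) (G (word_of \<alpha>))" if "\<alpha> \<in> ?I" for \<alpha> by (rule wd[OF wo[OF that]])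
    have W: "extension L \<phi> \<in> W_space L \<gamma>"
      by (rule W_spaceI(1)[where G="\<lambda>\<alpha>. G (word_of \<alpha>)", OF wda nb' KB])
    have "W_norm L \<gamma> (extension L \<phi>) \<le> of_nat (card ?I) * (ennreal K * B)"
      by (rule W_spaceI(2)[where G="\<lambda>\<alpha>. G (word_of \<alpha>)", OF wda nb' KB])
    also have "\<dots> = ennreal C * B"
      unfolding C_def using K0 by (simp add: ennreal_of_nat_eq_real_of_nat ennreal_mult mult.assoc)
    finally have N: "W_norm L \<gamma> (extension L \<phi>) \<le> ennreal C * B" .
    have et: "set [et :: (real^'n) \<times> real] \<subseteq> Basis" "length [et :: (real^'n) \<times> real] \<le> L"
      using et_Basis L by auto
    have w0: "set ([] :: ((real^'n) \<times> real) list) \<subseteq> Basis" "length ([] :: ((real^'n) \<times> real) list) \<le> L" by auto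
    let ?t = "trc (extension L \<phi>) (G [et])"
    have le: "locint (extension L \<phi>)" "locint (G [et])" using wd[OF et] by (auto simp: wderiv_def)
    have tr: "is_trace (extension L \<phi>) ?t"
      by (rule is_traceI[OF wd[OF et] locint_imp_L1_loc[OF le(1)] ae_eq_refl])
    have [measurable]: "borel_fun \<phi>" "borel_fun (extension L \<phi>)" "borel_fun (G [et])"
      using \<phi> le by (auto intro: locint_borel)
    have tm [measurable]: "borel_fun ?t" by (rule trc_borel) auto
    define v where "v N x = conv (conv \<phi> (dil (Suc N) (Om L))) (dil N (Om L)) x" for N x
    have vm [measurable]: "borel_fun (v N)" for N
      unfolding v_def[abs_def] by (intro locint_borel locint_conv kern_dil_Om L \<phi>)
    have "L1n (cball 0 R) (\<lambda>x. ?t x - \<phi> x) = 0" for R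
    proof (rule L1_limit_unique[where u=v])
      show "(\<lambda>N. L1n (cball 0 R) (\<lambda>x. v N x - \<phi> x)) \<longlonglongrightarrow> 0"
        unfolding v_def by (rule double_mollify_tendsto[OF L \<phi>])
      define F where "F N z = (\<Sum>j<N. u j z)" for N z
      define F1 where "F1 N z = (\<Sum>j<N. pderivs [et] (u j) z)" for N z
      have Fs: "smooth (F N)" for N unfolding F_def[abs_def] by (intro smooth_sum us)
      have F1: "pderiv_dir et (F N) = F1 N" for N
        using pderivs_sum_lessThan[OF us et(1), where N=N] by (simp add: F_def[abs_def] F1_def[abs_def])
      have F1s: "smooth (F1 N)" for N using smooth_pderivs[OF Fs et(1), of N] F1 by simp
      have Fl: "locint (F N)" "locint (F1 N)" for N
        by (intro locint_continuous smooth_continuous Fs F1s)+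
      have [measurable]: "borel_fun (F N)" "borel_fun (F1 N)" for N
        using Fl by (auto intro: locint_borel)
      have tv: "trc (F (Suc N)) (F1 (Suc N)) x = v N x" for N x
        using trc_smooth(1)[OF Fs, of "Suc N" x] sum_piece[OF L \<phi>, where N=N and x=x] cutoff_facts(2)
        unfolding F1 by (simp add: F_def u_def layer_def v_def)
      define e where "e N = L1n (cball 0 (R + 1)) (\<lambda>z. F N z - extension L \<phi> z) + L1n (cball 0 (R + 1)) (\<lambda>z. F1 N z - G [et] z)" for N
      have "e \<longlonglongrightarrow> 0 + 0"
        unfolding e_def[abs_def]
      proof (intro tendsto_add)
        show "(\<lambda>N. L1n (cball 0 (R + 1)) (\<lambda>z. F1 N z - G [et] z)) \<longlonglongrightarrow> 0"
          unfolding F1_def by (rule conv[OF et])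
        show "(\<lambda>N. L1n (cball 0 (R + 1)) (\<lambda>z. F N z - extension L \<phi> z)) \<longlonglongrightarrow> 0"
          using conv[OF w0, of "R + 1"] by (simp add: F_def ext_eq G_def)
      qed
      then have e0: "(\<lambda>N. e (Suc N)) \<longlonglongrightarrow> 0" using LIMSEQ_Suc by fastforce
      have "L1n (cball 0 R) (\<lambda>x. v N x - ?t x) \<le> e (Suc N)" for N
      proof -
        have "L1n (cball 0 R) (\<lambda>x. v N x - ?t x)
          = L1n (cball 0 R) (trc (\<lambda>z. F (Suc N) z - extension L \<phi> z) (\<lambda>z. F1 (Suc N) z - G [et] z))"
          using trc_diff_AE[OF Fl(1)[of "Suc N"] Fl(2)[of "Suc N"] le]
          by (intro L1n_cong_AE) (auto simp: tv elim: eventually_mono)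
        also have "\<dots> \<le> L1n (cball 0 R \<times> {0<..<1}) (\<lambda>z. F (Suc N) z - extension L \<phi> z)
            + L1n (cball 0 R \<times> {0<..<1}) (\<lambda>z. F1 (Suc N) z - G [et] z)"
          by (rule L1n_trc) auto
        also have "\<dots> \<le> e (Suc N)"
        proof -
          have "cball 0 R \<times> {0<..<1} \<subseteq> (cball 0 (R + 1) :: ((real^'n) \<times> real) set)"
          proof
            fix z :: "(real^'n) \<times> real" assume "z \<in> cball 0 R \<times> {0<..<1}"
            then have "norm (fst z) \<le> R" "norm (snd z) \<le> 1" by auto
            then show "z \<in> cball 0 (R + 1)"
              using norm_Pair_le[of "fst z" "snd z"] by simp
          qed
          then show ?thesis unfolding e_def by (intro add_mono L1n_mono_set)
        qed
        finally show ?thesis .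
      qed
      then show "(\<lambda>N. L1n (cball 0 R) (\<lambda>x. v N x - ?t x)) \<longlonglongrightarrow> 0"
        by (rule ennreal_tendsto_squeeze[OF _ e0])
    qed auto
    then have "?t =\<^sub>a \<phi>"
      unfolding ae_eq_def AE_lebesgue_iff by (intro L1n_zero_imp_AE) auto
    then show ?thesis using W N tr unfolding B_def by blast
  qed
  then show ?thesis using K0 by (intro exI[of _ C]) (auto simp: C_def)
qed

lemma extension_add:
  fixes \<phi> \<psi> :: "real^'n \<Rightarrow> real"
  assumes L: "L \<ge> 1" and l: "locint \<phi>" "locint \<psi>"
  shows "extension L (\<lambda>x. \<phi> x + \<psi> x) =\<^sub>a (\<lambda>z. extension L \<phi> z + extension L \<psi> z)"
  unfolding ae_eq_def AE_lebesgue_iff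
proof (rule AE_mp[OF AE_snd_neq[of 0]], intro AE_I2 impI)
  fix z :: "(real^'n) \<times> real" assume z: "snd z \<noteq> 0"
  have s: "summable (\<lambda>j. layer L \<eta> j z)" if "locint \<eta>" for \<eta> :: "real^'n \<Rightarrow> real"
    using finite_layers[OF L that, of "[]" z] z by (intro summable_finite) auto
  have "layer L (\<lambda>x. \<phi> x + \<psi> x) j z = layer L \<phi> j z + layer L \<psi> j z" for j
    by (simp add: layer_def piece_add[OF L l] distrib_right)
  then show "extension L (\<lambda>x. \<phi> x + \<psi> x) z = extension L \<phi> z + extension L \<psi> z"
    unfolding extension_def using suminf_add[OF s[OF l(1)] s[OF l(2)]] by simp
qed

lemma extension_cmult:
  fixes \<phi> :: "real^'n \<Rightarrow> real"
  assumes L: "L \<ge> 1" and l: "locint \<phi>"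
  shows "extension L (\<lambda>x. c * \<phi> x) =\<^sub>a (\<lambda>z. c * extension L \<phi> z)"
  unfolding ae_eq_def AE_lebesgue_iff
proof (rule AE_mp[OF AE_snd_neq[of 0]], intro AE_I2 impI)
  fix z :: "(real^'n) \<times> real" assume z: "snd z \<noteq> 0"
  have s: "summable (\<lambda>j. layer L \<phi> j z)"
    using finite_layers[OF L l, of "[]" z] z by (intro summable_finite) auto
  have "layer L (\<lambda>x. c * \<phi> x) j z = c * layer L \<phi> j z" for j
    by (simp add: layer_def piece_cmult)
  then show "extension L (\<lambda>x. c * \<phi> x) z = c * extension L \<phi> z"
    unfolding extension_def using suminf_mult[OF s, of c] by simp
qed

lemma extension_cong_AE:
  assumes "L \<ge> 1" "locint \<phi>" "locint \<psi>" "\<phi> =\<^sub>a \<psi>"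
  shows "extension L \<phi> = extension L \<psi>"
  using piece_cong_AE[OF assms(1-3)] assms(4)
  by (auto simp: fun_eq_iff extension_def layer_def ae_eq_def AE_lebesgue_iff)

section \<open>The trace theorem\<close>

lemma Tr_bounded_linear_op:
  fixes \<gamma> :: "(real^'n) \<times> real \<Rightarrow> real"
  assumes l: "l > 1" and \<gamma>: "\<gamma> \<in> A1_loc"
  shows "W_space l \<gamma> \<subseteq> Tr_domain"
    and "bounded_linear_op (W_space l \<gamma>) (W_norm l \<gamma>) (B_space l (weight_seq l \<gamma>)) (B_norm l (weight_seq l \<gamma>)) Tr"
proof -
  obtain l' where l': "l = Suc l'" "l' \<ge> 1" using l by (cases l) auto
  have et: "set [et :: (real^'n) \<times> real] \<subseteq> Basis" "length [et :: (real^'n) \<times> real] \<le> l"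
    using et_Basis l by auto
  have w0: "set ([] :: ((real^'n) \<times> real) list) \<subseteq> Basis" "length ([] :: ((real^'n) \<times> real) list) \<le> l" by auto
  obtain C where C: "\<And>f g g1 B. locint f \<Longrightarrow> \<forall>w\<in>words l. wderiv w f (g w) \<Longrightarrow> wderiv [et] f g1 \<Longrightarrow>
    wnorm \<gamma> f \<le> B \<Longrightarrow> wnorm \<gamma> g1 \<le> B \<Longrightarrow>
    \<forall>w\<in>words l. wnorm \<gamma> (g w) \<le> B \<Longrightarrow>
    B_norm l (weight_seq l \<gamma>) (trc f g1) \<le> ennreal C * B"
    using trace_bounded[OF \<gamma> l'(2)] unfolding l'(1) by blast
  have fL: "f \<in> L1_loc" if "f \<in> W_space l \<gamma>" for f using that by (simp add: W_space_def)
  let ?t = "\<lambda>f. trc (rep f) (Dw [et] f)"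
  have tr: "is_trace f (?t f)" if f: "f \<in> W_space l \<gamma>" for f
    by (rule is_traceI[OF W_space_wderiv(1)[OF f et] fL[OF f] rep(2)[OF fL[OF f]]])
  have lin: "Tr h =\<^sub>a (\<lambda>x. a * Tr f x + b * Tr g x)"
    if f: "f \<in> W_space l \<gamma>" and g: "g \<in> W_space l \<gamma>" and h: "h \<in> L1_loc" "(\<lambda>z. a * f z + b * g z) =\<^sub>a h" for a b f g h
  proof -
    have w: "wderiv [et] (\<lambda>z. a * rep f z + b * rep g z) (\<lambda>z. a * Dw [et] f z + b * Dw [et] g z)"
      by (rule wderiv_lincomb[OF W_space_wderiv(1)[OF f et] W_space_wderiv(1)[OF g et] et(1)])
    have "(\<lambda>z. a * rep f z + b * rep g z) =\<^sub>a (\<lambda>z. a * f z + b * g z)"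
      using rep(2)[OF fL[OF f]] rep(2)[OF fL[OF g]] unfolding ae_eq_def by eventually_elim simp
    from ae_eq_trans[OF this h(2)] have "(\<lambda>z. a * rep f z + b * rep g z) =\<^sub>a h" .
    from Tr_eq(1)[OF is_traceI[OF w h(1) this]]
    have "Tr h =\<^sub>a trc (\<lambda>z. a * rep f z + b * rep g z) (\<lambda>z. a * Dw [et] f z + b * Dw [et] g z)" .
    moreover have "locint (rep f)" "locint (Dw [et] f)" "locint (rep g)" "locint (Dw [et] g)"
      using W_space_wderiv(1)[OF f et] W_space_wderiv(1)[OF g et] by (auto simp: wderiv_def)
    note trc_lincomb_AE[OF this, of a b]
    ultimately show ?thesis
      using Tr_eq(1)[OF tr[OF f]] Tr_eq(1)[OF tr[OF g]] unfolding ae_eq_def AE_lebesgue_iff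
      by eventually_elim simp
  qed
  have main: "is_trace f (Tr f) \<and> B_norm l (weight_seq l \<gamma>) (Tr f) \<le> ennreal C * W_norm l \<gamma> f \<and> Tr f \<in> L1_loc"
    if f: "f \<in> W_space l \<gamma>" for f
  proof -
    note fL = fL[OF f]
    note D = W_space_wderiv[OF f]
    let ?t = "trc (rep f) (Dw [et] f)"
    note T = Tr_eq[OF tr[OF f]]
    have lr: "locint (rep f)" by (rule rep(1)[OF fL])
    have "wderiv [] (rep f) (rep f)" using lr by (simp add: wderiv_def)
    then have "AE z in lborel. rep f z = Dw [] f z" using D(1)[OF w0] by (rule wderiv_unique) simp
    then have "wnorm \<gamma> (rep f) = wnorm \<gamma> (Dw [] f)"
      by (intro nn_integral_cong_AE) (auto elim!: eventually_mono)
    then have n0: "wnorm \<gamma> (rep f) \<le> W_norm l \<gamma> f" using D(2)[OF w0] by simp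
    have "B_norm l (weight_seq l \<gamma>) ?t \<le> ennreal C * W_norm l \<gamma> f"
    proof (rule C[OF lr _ D(1)[OF et] n0 D(2)[OF et], where g="\<lambda>w. Dw w f"]; intro ballI)
      fix w :: "((real^'n) \<times> real) list" assume "w \<in> words l"
      then have w: "set w \<subseteq> Basis" "length w \<le> l" by (auto simp: words_def)
      show "wderiv w (rep f) (Dw w f)" by (rule D(1)[OF w])
      show "wnorm \<gamma> (Dw w f) \<le> W_norm l \<gamma> f" by (rule D(2)[OF w])
    qed
    moreover have "B_norm l (weight_seq l \<gamma>) (Tr f) = B_norm l (weight_seq l \<gamma>) ?t"
      by (rule B_norm_cong_AE) (use T(1) in \<open>simp add: ae_eq_def AE_lebesgue_iff\<close>)
    ultimately show ?thesis using T(2) by (simp add: is_trace_def)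
  qed
  show "W_space l \<gamma> \<subseteq> Tr_domain" using main unfolding Tr_domain_def by blast
  show "bounded_linear_op (W_space l \<gamma>) (W_norm l \<gamma>) (B_space l (weight_seq l \<gamma>)) (B_norm l (weight_seq l \<gamma>)) Tr"
    unfolding bounded_linear_op_def
  proof (intro conjI ballI allI impI)
    show "Tr ` W_space l \<gamma> \<subseteq> B_space l (weight_seq l \<gamma>)"
    proof
      fix \<phi> assume "\<phi> \<in> Tr ` W_space l \<gamma>"
      then obtain f where f: "f \<in> W_space l \<gamma>" "\<phi> = Tr f" by blast
      have "ennreal C * W_norm l \<gamma> f < \<infinity>" using f(1) by (simp add: W_space_def ennreal_mult_less_top)
      then show "\<phi> \<in> B_space l (weight_seq l \<gamma>)"
        using main[OF f(1)] f(2) by (auto simp: B_space_def intro: le_less_trans)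
    qed
    show "Tr f =\<^sub>a Tr g" if "f \<in> W_space l \<gamma>" "g \<in> W_space l \<gamma>" "f =\<^sub>a g" for f g
      using lin[OF that(1,1) fL[OF that(2)], of 1 0] that(3) by (simp add: ae_eq_sym)
    show "Tr (\<lambda>z. f z + g z) =\<^sub>a (\<lambda>x. Tr f x + Tr g x)" if "f \<in> W_space l \<gamma>" "g \<in> W_space l \<gamma>" for f g
      using lin[OF that L1_loc_add[OF fL fL], of f g 1 1] that by (simp add: ae_eq_refl)
    show "Tr (\<lambda>z. c * f z) =\<^sub>a (\<lambda>x. c * Tr f x)" if "f \<in> W_space l \<gamma>" for c f
      using lin[OF that that L1_loc_cmult[OF fL[OF that]], of c 0] by (simp add: ae_eq_refl)
    show "\<exists>C. \<forall>f\<in>W_space l \<gamma>. B_norm l (weight_seq l \<gamma>) (Tr f) \<le> ennreal C * W_norm l \<gamma> f"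
      using main by blast
  qed
qed

text \<open>The Borel representative is chosen first; equality almost everywhere is enough for linearity
  because convolutions do not see null sets.\<close>

lemma extension_bounded_linear_op:
  fixes \<gamma> :: "(real^'n) \<times> real \<Rightarrow> real"
  assumes L: "L \<ge> 1" and \<gamma>: "\<gamma> \<in> A1_loc"
  defines "E \<equiv> \<lambda>\<phi>. extension L (rep \<phi>)"
  shows "bounded_linear_op (B_space L (weight_seq L \<gamma>)) (B_norm L (weight_seq L \<gamma>)) (W_space L \<gamma>) (W_norm L \<gamma>) E"
    and "\<forall>\<phi>\<in>B_space L (weight_seq L \<gamma>). Tr (E \<phi>) =\<^sub>a \<phi>"
proof -
  let ?B = "B_space L (weight_seq L \<gamma>)"
  obtain C where C: "\<And>\<phi>. locint \<phi> \<Longrightarrow> B_norm L (weight_seq L \<gamma>) \<phi> < \<infinity> \<Longrightarrow>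
    extension L \<phi> \<in> W_space L \<gamma> \<and> W_norm L \<gamma> (extension L \<phi>) \<le> ennreal C * B_norm L (weight_seq L \<gamma>) \<phi> \<and>
    (\<exists>\<psi>. is_trace (extension L \<phi>) \<psi> \<and> \<psi> =\<^sub>a \<phi>)"
    using extension_bounded[OF L \<gamma>] by blast
  have L1: "\<phi> \<in> L1_loc" if "\<phi> \<in> ?B" for \<phi> using that by (simp add: B_space_def)
  have loc: "locint (rep \<phi>)" "rep \<phi> =\<^sub>a \<phi>" if "\<phi> \<in> ?B" for \<phi> using rep[OF L1[OF that]] by auto
  have main: "E \<phi> \<in> W_space L \<gamma> \<and> W_norm L \<gamma> (E \<phi>) \<le> ennreal C * B_norm L (weight_seq L \<gamma>) \<phi> \<and>
    (\<exists>\<psi>. is_trace (E \<phi>) \<psi> \<and> \<psi> =\<^sub>a \<phi>)" if \<phi>: "\<phi> \<in> ?B" for \<phi>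
  proof -
    have e: "B_norm L (weight_seq L \<gamma>) (rep \<phi>) = B_norm L (weight_seq L \<gamma>) \<phi>"
      by (rule B_norm_cong_AE) (use loc(2)[OF \<phi>] in \<open>simp add: ae_eq_def AE_lebesgue_iff\<close>)
    have "B_norm L (weight_seq L \<gamma>) (rep \<phi>) < \<infinity>" using \<phi> e by (simp add: B_space_def)
    from C[OF loc(1)[OF \<phi>] this] show ?thesis
      unfolding e E_def using ae_eq_trans[OF _ loc(2)[OF \<phi>]] by blast
  qed
  show "\<forall>\<phi>\<in>?B. Tr (E \<phi>) =\<^sub>a \<phi>" using main Tr_eq(1) ae_eq_trans by blast
  show "bounded_linear_op ?B (B_norm L (weight_seq L \<gamma>)) (W_space L \<gamma>) (W_norm L \<gamma>) E"
    unfolding bounded_linear_op_def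
  proof (intro conjI ballI allI impI)
    show "E ` ?B \<subseteq> W_space L \<gamma>" using main by blast
    show "\<exists>C. \<forall>\<phi>\<in>?B. W_norm L \<gamma> (E \<phi>) \<le> ennreal C * B_norm L (weight_seq L \<gamma>) \<phi>" using main by blast
    show "E \<phi> =\<^sub>a E \<psi>" if "\<phi> \<in> ?B" "\<psi> \<in> ?B" "\<phi> =\<^sub>a \<psi>" for \<phi> \<psi>
    proof -
      have "rep \<phi> =\<^sub>a rep \<psi>"
        by (rule ae_eq_trans[OF ae_eq_trans[OF loc(2)[OF that(1)] that(3)] ae_eq_sym[OF loc(2)[OF that(2)]]])
      then have "E \<phi> = E \<psi>" unfolding E_def using that loc L by (intro extension_cong_AE) auto
      then show ?thesis by (simp add: ae_eq_refl)
    qed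
    show "E (\<lambda>x. \<phi> x + \<psi> x) =\<^sub>a (\<lambda>z. E \<phi> z + E \<psi> z)" if \<phi>: "\<phi> \<in> ?B" and \<psi>: "\<psi> \<in> ?B" for \<phi> \<psi>
    proof -
      have s: "(\<lambda>x. \<phi> x + \<psi> x) \<in> L1_loc" by (intro L1_loc_add L1 \<phi> \<psi>)
      have "(\<lambda>x. rep \<phi> x + rep \<psi> x) =\<^sub>a (\<lambda>x. \<phi> x + \<psi> x)"
        using loc(2)[OF \<phi>] loc(2)[OF \<psi>] unfolding ae_eq_def by eventually_elim simp
      then have "rep (\<lambda>x. \<phi> x + \<psi> x) =\<^sub>a (\<lambda>x. rep \<phi> x + rep \<psi> x)"
        using ae_eq_trans[OF rep(2)[OF s]] ae_eq_sym by blast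
      then have "E (\<lambda>x. \<phi> x + \<psi> x) = extension L (\<lambda>x. rep \<phi> x + rep \<psi> x)"
        unfolding E_def by (intro extension_cong_AE L rep(1) s locint_add loc \<phi> \<psi>)
      then show ?thesis using extension_add[OF L loc(1)[OF \<phi>] loc(1)[OF \<psi>]] by (simp add: E_def)
    qed
    show "E (\<lambda>x. c * \<phi> x) =\<^sub>a (\<lambda>z. c * E \<phi> z)" if \<phi>: "\<phi> \<in> ?B" for c \<phi>
    proof -
      have s: "(\<lambda>x. c * \<phi> x) \<in> L1_loc" by (intro L1_loc_cmult L1 \<phi>)
      have "(\<lambda>x. c * rep \<phi> x) =\<^sub>a (\<lambda>x. c * \<phi> x)"
        using loc(2)[OF \<phi>] unfolding ae_eq_def by eventually_elim simp
      then have "rep (\<lambda>x. c * \<phi> x) =\<^sub>a (\<lambda>x. c * rep \<phi> x)"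
        using ae_eq_trans[OF rep(2)[OF s]] ae_eq_sym by blast
      then have "E (\<lambda>x. c * \<phi> x) = extension L (\<lambda>x. c * rep \<phi> x)"
        unfolding E_def by (intro extension_cong_AE L rep(1) s locint_cmult loc \<phi>)
      then show ?thesis using extension_cmult[OF L loc(1)[OF \<phi>]] by (simp add: E_def)
    qed
  qed
qed

theorem theorem3p1:
  fixes \<gamma> :: "(real^'n) \<times> real \<Rightarrow> real" and l :: nat
  assumes "l > 1" and "\<gamma> \<in> A1_loc"
  defines "W \<equiv> W_space l \<gamma>" and "B \<equiv> B_space l (weight_seq l \<gamma>)"
    and "normW \<equiv> W_norm l \<gamma>" and "normB \<equiv> B_norm l (weight_seq l \<gamma>)"
  shows "W \<subseteq> Tr_domain \<and> bounded_linear_op W normW B normB Tr \<and>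
    (\<exists>Ext. bounded_linear_op B normB W normW Ext \<and> (\<forall>\<phi>\<in>B. Tr (Ext \<phi>) =\<^sub>a \<phi>))"
  unfolding W_def B_def normW_def normB_def
  using Tr_bounded_linear_op[OF assms(1,2)] extension_bounded_linear_op[OF _ assms(2), of l] assms(1) by auto

end
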